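(* Let $(\mathbf u,\theta)$ be a solution of system (S) in the sense defined in the context, and let $\boldsymbol\gamma:=H\mathbf u$ be the divergence-free part of $\mathbf u$. Then $$\boldsymbol\gamma(t,\cdot)\to0\ \text{ in }L^2(\Omega)\ \text{ as }t\to\infty$$ if and only if $\boldsymbol\gamma$ is equal to $0$ (identically on $(0,\infty)\times\Omega$).
   Context: Setting. Let $d\in\{2,3\}$ and let $\Omega\subset\mathbb R^d$ be open, bounded and convex with smooth boundary $\partial\Omega$ and outward unit normal $\mathbf n$. Constants $\nu,\mu,\lambda\in\mathbb R$ are fixed with $\mu>0$ and $2\mu+d\lambda>0$. For $d=3$, $\operatorname{curl}$ is the usual curl. For $d=2$, $\operatorname{curl}\mathbf w=\partial_{x_1}w^2-\partial_{x_2}w^1$ for a vector field $\mathbf w=(w^1,w^2)$ and $\operatorname{curl}g=(\partial_{x_2}g,-\partial_{x_1}g)$ for a scalar $g$. Put $\mathcal N\mathbf u=\operatorname{curl}\mathbf u$ if $d=2$ and $\mathcal N\mathbf u=\operatorname{curl}\mathbf u\times\mathbf n$ if $d=3$. System (S), for unknowns $\mathbf u:[0,\infty)\times\Omega\to\mathbb R^d$ and $\theta:[0,\infty)\times\Omega\to\mathbb R$: $$\mathbf u_{tt}-(2\mu+\lambda)\nabla\operatorname{div}\mathbf u+\mu\operatorname{curl}\operatorname{curl}\mathbf u=-\nu\nabla\theta,\qquad \theta_t-\Delta\theta=-\nu\theta\operatorname{div}\mathbf u_t\quad\text{in }(0,\infty)\times\Omega,$$ $$\mathbf u\cdot\mathbf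 n=0,\quad \mathcal N\mathbf u=0,\quad \nabla\theta\cdot\mathbf n=0\quad\text{on }(0,\infty)\times\partial\Omega,$$ $$\mathbf u(0,\cdot)=\mathbf u_0,\quad \mathbf u_t(0,\cdot)=\mathbf v_0,\quad \theta(0,\cdot)=\theta_0>0.$$ Function space. $\mathcal H=\{\mathbf w\in H^1(\Omega)\ (\mathbb R^d\text{-valued}):\mathbf w\cdot\mathbf n=0\text{ on }\partial\Omega\}$ with norm $\|\mathbf w\|_{\mathcal H}=(\|\operatorname{div}\mathbf w\|_{L^2(\Omega)}^2+\|\operatorname{curl}\mathbf w\|_{L^2(\Omega)}^2)^{1/2}$. Definition of solution. The initial data satisfy $\mathbf u_0\in H^2(\Omega)\cap\mathcal H$, $\mathbf v_0\in\mathcal H$, $\theta_0\in H^1(\Omega)\cap L^\infty(\Omega)$, $\theta_0\ge\tilde\theta$ in $\Omega$ for some constant $\tilde\theta>0$. Then $(\mathbf u,\theta)$ is a solution of (S) if: (1) $\mathbf u\in L^\infty(0,\infty;H^2(\Omega)\cap\mathcal H)\cap W^{1,\infty}(0,\infty;\mathcal H)\cap W^{2,\infty}(0,\infty;L^2(\Omega))$ and $\theta\in L^\infty(0,\infty;H^1(\Omega))\cap L^2_{\mathrm{loc}}(0,\infty;H^2(\Omega))\cap H^1_{\mathrm{loc}}(0,\infty;L^2(\Omega))$, where "loc" means on $(0,T)$ for every $T>0$; (2) for almost all $t\in(0,\infty)$ and all $\boldsymbol\phi\in\mathcal H$, $\int_\Omega\mathbf u_{tt}\cdot\boldsymbol\phi\,dx+(2\mu+\lambda)\int_\Omega\operatorname{div}\mathbf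 u\operatorname{div}\boldsymbol\phi\,dx+\mu\int_\Omega\operatorname{curl}\mathbf u\cdot\operatorname{curl}\boldsymbol\phi\,dx=-\nu\int_\Omega\nabla\theta\cdot\boldsymbol\phi\,dx$; (3) for almost all $t\in(0,\infty)$ and all $\psi\in H^1(\Omega)$, $\int_\Omega\theta_t\psi\,dx+\int_\Omega\nabla\theta\cdot\nabla\psi\,dx=-\nu\int_\Omega\theta\operatorname{div}\mathbf u_t\,\psi\,dx$; (4) the initial conditions are attained in the sense that $\theta\in C([0,\infty);H^1(\Omega))$, $\mathbf u\in C([0,\infty);\mathcal H)$, $\mathbf u_t\in C([0,\infty);L^2(\Omega))$, with $\mathbf u(0)=\mathbf u_0$, $\mathbf u_t(0)=\mathbf v_0$, $\theta(0)=\theta_0$. Helmholtz decomposition. Every $\mathbf v\in L^2(\Omega;\mathbb R^d)$ decomposes uniquely as $\mathbf v=H\mathbf v+H^\perp\mathbf v$, orthogonally in $L^2(\Omega)$, with $\operatorname{div}H\mathbf v=0$ in $\Omega$, $H\mathbf v\cdot\mathbf n=0$ on $\partial\Omega$, and $H^\perp\mathbf v=\nabla\phi$ for some $\phi\in H^1(\Omega)$ with $\int_\Omega\phi\,dx=0$. *)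

theory Defs
  imports "HOL-Analysis.Analysis"
begin

section \<open>Smooth functions and domains with smooth boundary\<close>

primrec Ck_on :: "nat \<Rightarrow> 'a::euclidean_space set \<Rightarrow> ('a \<Rightarrow> 'b::real_normed_vector) \<Rightarrow> bool" where
  "Ck_on 0 U f \<longleftrightarrow> continuous_on U f"
| "Ck_on (Suc k) U f \<longleftrightarrow> (\<forall>x\<in>U. f differentiable (at x)) \<and>
     (\<forall>b\<in>Basis. Ck_on k U (\<lambda>x. frechet_derivative f (at x) b))"

text \<open>Only used for open \<open>U\<close>.\<close>

definition smooth_on :: "'a::euclidean_space set \<Rightarrow> ('a \<Rightarrow> 'b::real_normed_vector) \<Rightarrow> bool" where
  "smooth_on U f \<longleftrightarrow> (\<forall>k. Ck_on k U f)"

definition pderiv_at :: "'n \<Rightarrow> (real^'n \<Rightarrow> 'b::real_normed_vector) \<Rightarrow> real^'n \<Rightarrow> 'b" where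
  "pderiv_at i f x = frechet_derivative f (at x) (axis i 1)"

definition gradient :: "(real^'n \<Rightarrow> real) \<Rightarrow> real^'n \<Rightarrow> real^'n" where
  "gradient f x = (\<chi> i. pderiv_at i f x)"

definition boundary_defining :: "(real^'n) set \<Rightarrow> real^'n \<Rightarrow> (real^'n) set \<Rightarrow> (real^'n \<Rightarrow> real) \<Rightarrow> bool" where
  "boundary_defining \<Omega> p U \<rho> \<longleftrightarrow> open U \<and> p \<in> U \<and> smooth_on U \<rho> \<and>
     (\<forall>x\<in>U. gradient \<rho> x \<noteq> 0) \<and>
     \<Omega> \<inter> U = {x\<in>U. \<rho> x < 0} \<and> frontier \<Omega> \<inter> U = {x\<in>U. \<rho> x = 0}"

definition smooth_boundary :: "(real^'n) set \<Rightarrow> bool" where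
  "smooth_boundary \<Omega> \<longleftrightarrow> (\<forall>p\<in>frontier \<Omega>. \<exists>U \<rho>. boundary_defining \<Omega> p U \<rho>)"

text \<open>The gradients at \<open>p\<close> of any two local defining functions are positive multiples of each
  other, so the following does not depend on the choice of \<open>\<rho>\<close>.\<close>

definition outward_normal :: "(real^'n) set \<Rightarrow> real^'n \<Rightarrow> real^'n" where
  "outward_normal \<Omega> p = (THE n. \<exists>U \<rho>. boundary_defining \<Omega> p U \<rho> \<and> n = sgn (gradient \<rho> p))"

section \<open>Lebesgue and Sobolev spaces\<close>

text \<open>Elements of all function spaces are represented by functions; two representatives
  of the same element agree almost everywhere on \<open>\<Omega>\<close>. All properties and (semi)norms below are
  insensitive to the choice of representative.\<close>

definition test_function :: "'a::euclidean_space set \<Rightarrow> ('a \<Rightarrow> real) \<Rightarrow> bool" where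
  "test_function U \<phi> \<longleftrightarrow> smooth_on UNIV \<phi> \<and> compact (closure {x. \<phi> x \<noteq> 0}) \<and>
     closure {x. \<phi> x \<noteq> 0} \<subseteq> U"

definition L2_on :: "'a::euclidean_space set \<Rightarrow> ('a \<Rightarrow> 'b::euclidean_space) \<Rightarrow> bool" where
  "L2_on \<Omega> f \<longleftrightarrow> f \<in> borel_measurable (lebesgue_on \<Omega>) \<and>
     integrable (lebesgue_on \<Omega>) (\<lambda>x. (norm (f x))\<^sup>2)"

definition L2_norm_on :: "'a::euclidean_space set \<Rightarrow> ('a \<Rightarrow> 'b::euclidean_space) \<Rightarrow> real" where
  "L2_norm_on \<Omega> f = sqrt (LINT x|lebesgue_on \<Omega>. (norm (f x))\<^sup>2)"

definition loc_integrable_on :: "'a::euclidean_space set \<Rightarrow> ('a \<Rightarrow> 'b::euclidean_space) \<Rightarrow> bool" where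
  "loc_integrable_on \<Omega> f \<longleftrightarrow> (\<forall>K. compact K \<and> K \<subseteq> \<Omega> \<longrightarrow> integrable (lebesgue_on K) f)"

definition is_weak_pderiv ::
  "(real^'n) set \<Rightarrow> 'n \<Rightarrow> (real^'n \<Rightarrow> 'b::euclidean_space) \<Rightarrow> (real^'n \<Rightarrow> 'b) \<Rightarrow> bool" where
  "is_weak_pderiv \<Omega> i f g \<longleftrightarrow> loc_integrable_on \<Omega> f \<and> loc_integrable_on \<Omega> g \<and>
     (\<forall>\<phi>. test_function \<Omega> \<phi> \<longrightarrow>
        (LINT x|lebesgue_on \<Omega>. pderiv_at i \<phi> x *\<^sub>R f x) = - (LINT x|lebesgue_on \<Omega>. \<phi> x *\<^sub>R g x))"

text \<open>Some representative of the weak partial derivative (unique up to null sets), arbitrary if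
  there is no weak derivative.\<close>

definition weak_pderiv :: "(real^'n) set \<Rightarrow> 'n \<Rightarrow> (real^'n \<Rightarrow> 'b::euclidean_space) \<Rightarrow> real^'n \<Rightarrow> 'b" where
  "weak_pderiv \<Omega> i f = (SOME g. is_weak_pderiv \<Omega> i f g)"

definition weak_grad :: "(real^'n) set \<Rightarrow> (real^'n \<Rightarrow> real) \<Rightarrow> real^'n \<Rightarrow> real^'n" where
  "weak_grad \<Omega> f x = (\<chi> i. weak_pderiv \<Omega> i f x)"

definition weak_div :: "(real^'n) set \<Rightarrow> (real^'n \<Rightarrow> real^'n) \<Rightarrow> real^'n \<Rightarrow> real" where
  "weak_div \<Omega> w x = (\<Sum>i\<in>UNIV. weak_pderiv \<Omega> i w x $ i)"

definition weak_curl2 :: "(real^2) set \<Rightarrow> (real^2 \<Rightarrow> real^2) \<Rightarrow> real^2 \<Rightarrow> real" where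
  "weak_curl2 \<Omega> w x = weak_pderiv \<Omega> 1 w x $ 2 - weak_pderiv \<Omega> 2 w x $ 1"

definition weak_curl3 :: "(real^3) set \<Rightarrow> (real^3 \<Rightarrow> real^3) \<Rightarrow> real^3 \<Rightarrow> real^3" where
  "weak_curl3 \<Omega> w x = vector
     [weak_pderiv \<Omega> 2 w x $ 3 - weak_pderiv \<Omega> 3 w x $ 2,
      weak_pderiv \<Omega> 3 w x $ 1 - weak_pderiv \<Omega> 1 w x $ 3,
      weak_pderiv \<Omega> 1 w x $ 2 - weak_pderiv \<Omega> 2 w x $ 1]"

primrec Hk_on :: "nat \<Rightarrow> (real^'n) set \<Rightarrow> (real^'n \<Rightarrow> 'b::euclidean_space) \<Rightarrow> bool" where
  "Hk_on 0 \<Omega> f \<longleftrightarrow> L2_on \<Omega> f"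
| "Hk_on (Suc k) \<Omega> f \<longleftrightarrow> L2_on \<Omega> f \<and> (\<forall>i. \<exists>g. is_weak_pderiv \<Omega> i f g \<and> Hk_on k \<Omega> g)"

primrec Hk_norm_sq :: "nat \<Rightarrow> (real^'n) set \<Rightarrow> (real^'n \<Rightarrow> 'b::euclidean_space) \<Rightarrow> real" where
  "Hk_norm_sq 0 \<Omega> f = (L2_norm_on \<Omega> f)\<^sup>2"
| "Hk_norm_sq (Suc k) \<Omega> f =
     (L2_norm_on \<Omega> f)\<^sup>2 + (\<Sum>i\<in>UNIV. Hk_norm_sq k \<Omega> (weak_pderiv \<Omega> i f))"

definition Hk_norm :: "nat \<Rightarrow> (real^'n) set \<Rightarrow> (real^'n \<Rightarrow> 'b::euclidean_space) \<Rightarrow> real" where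
  "Hk_norm k \<Omega> f = sqrt (Hk_norm_sq k \<Omega> f)"

section \<open>Surface measure and boundary traces\<close>

text \<open>Boundedness is required because \<^const>\<open>diameter\<close> is junk on unbounded sets.\<close>

definition hausdorff_covers :: "real \<Rightarrow> 'a::metric_space set \<Rightarrow> (nat \<Rightarrow> 'a set) set" where
  "hausdorff_covers \<delta> A = {C. A \<subseteq> (\<Union>i. C i) \<and> (\<forall>i. bounded (C i) \<and> diameter (C i) \<le> \<delta>)}"

definition hausdorff_pre :: "nat \<Rightarrow> real \<Rightarrow> 'a::metric_space set \<Rightarrow> ennreal" where
  "hausdorff_pre k \<delta> A = (INF C\<in>hausdorff_covers \<delta> A.
     \<Sum>i. ennreal (unit_ball_vol (real k) * (diameter (C i) / 2) ^ k))"

definition hausdorff_outer :: "nat \<Rightarrow> 'a::metric_space set \<Rightarrow> ennreal" where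
  "hausdorff_outer k A = (SUP \<delta>\<in>{0<..}. hausdorff_pre k \<delta> A)"

text \<open>Since the value of \<^const>\<open>measure_of\<close> is the zero measure unless the given set function
  is a measure, it is shown below that this is the case for \<open>k > 0\<close>.\<close>

definition hausdorff_measure :: "nat \<Rightarrow> 'a::metric_space measure" where
  "hausdorff_measure k = measure_of UNIV (sets borel) (hausdorff_outer k)"

lemma hausdorff_pre_mono: "A \<subseteq> B \<Longrightarrow> hausdorff_pre k \<delta> A \<le> hausdorff_pre k \<delta> B"
  unfolding hausdorff_pre_def by (intro INF_superset_mono) (auto simp: hausdorff_covers_def)

lemma hausdorff_pre_antimono: "\<delta> \<le> \<delta>' \<Longrightarrow> hausdorff_pre k \<delta>' A \<le> hausdorff_pre k \<delta> A"
  unfolding hausdorff_pre_def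
  by (intro INF_superset_mono) (fastforce simp: hausdorff_covers_def intro: order_trans)+

lemma hausdorff_pre_empty: "k > 0 \<Longrightarrow> \<delta> > 0 \<Longrightarrow> hausdorff_pre k \<delta> {} = 0"
proof -
  assume k: "k > 0" "\<delta> > 0"
  have "hausdorff_pre k \<delta> {} \<le> (\<Sum>i::nat. ennreal (unit_ball_vol (real k) * (diameter {} / 2) ^ k))"
    unfolding hausdorff_pre_def using k
    by (intro INF_lower2[of "\<lambda>_. {}"]) (auto simp: hausdorff_covers_def)
  then show ?thesis using k by (simp add: power_0_left)
qed

lemma hausdorff_pre_subadd: "hausdorff_pre k \<delta> (\<Union>n. A n) \<le> (\<Sum>n::nat. hausdorff_pre k \<delta> (A n))"
proof (rule ennreal_le_epsilon)
  define w where "w D = ennreal (unit_ball_vol (real k) * (diameter D / 2) ^ k)" for D :: "'a set"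
  fix e :: real assume "0 < e" "(\<Sum>n. hausdorff_pre k \<delta> (A n)) < top"
  then have *: "\<And>n. hausdorff_pre k \<delta> (A n) < hausdorff_pre k \<delta> (A n) + e * (1/2)^Suc n"
    by (auto simp add: less_top dest!: ennreal_suminf_lessD)
  have "\<exists>B. \<forall>n. B n \<in> hausdorff_covers \<delta> (A n) \<and>
      (\<Sum>i. w (B n i)) < hausdorff_pre k \<delta> (A n) + e * (1/2)^Suc n"
  proof (intro choice allI)
    fix n
    show "\<exists>C. C \<in> hausdorff_covers \<delta> (A n) \<and>
        (\<Sum>i. w (C i)) < hausdorff_pre k \<delta> (A n) + e * (1/2)^Suc n"
      using *[of n] by (subst (asm) (1) hausdorff_pre_def) (auto simp: INF_less_iff w_def)
  qed
  then obtain B where B: "\<And>n. B n \<in> hausdorff_covers \<delta> (A n)"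
    "\<And>n. (\<Sum>i. w (B n i)) < hausdorff_pre k \<delta> (A n) + e * (1/2)^Suc n"
    by blast
  define C where "C = case_prod B \<circ> prod_decode"
  have "(\<Union>n. A n) \<subseteq> (\<Union>i. C i)"
  proof
    fix x assume "x \<in> (\<Union>n. A n)"
    then obtain n where "x \<in> A n" by blast
    then obtain i where "x \<in> B n i" using B(1)[of n] by (auto simp: hausdorff_covers_def)
    then have "x \<in> C (prod_encode (n, i))" by (simp add: C_def)
    then show "x \<in> (\<Union>i. C i)" by blast
  qed
  then have C: "C \<in> hausdorff_covers \<delta> (\<Union>n. A n)"
    using B(1) by (auto simp: hausdorff_covers_def C_def split: prod.split)
  have "hausdorff_pre k \<delta> (\<Union>n. A n) \<le> (\<Sum>i. w (C i))"
    unfolding hausdorff_pre_def w_def by (rule INF_lower[OF C])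
  also have "\<dots> = (\<Sum>n. \<Sum>i. w (B n i))"
    unfolding C_def comp_def by (intro suminf_ennreal_2dimen) auto
  also have "\<dots> \<le> (\<Sum>n. hausdorff_pre k \<delta> (A n) + e * (1/2) ^ Suc n)"
    by (intro suminf_le less_imp_le B(2)) auto
  also have "\<dots> = (\<Sum>n. hausdorff_pre k \<delta> (A n)) + (\<Sum>n. ennreal e * ennreal ((1/2) ^ Suc n))"
    using \<open>0 < e\<close> by (subst suminf_add[symmetric])
      (auto simp del: ennreal_suminf_cmult simp add: ennreal_mult[symmetric])
  also have "\<dots> = (\<Sum>n. hausdorff_pre k \<delta> (A n)) + e"
    unfolding ennreal_suminf_cmult
    by (subst suminf_ennreal_eq[OF zero_le_power power_half_series]) auto
  finally show "hausdorff_pre k \<delta> (\<Union>n. A n) \<le> (\<Sum>n. hausdorff_pre k \<delta> (A n)) + e" .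
qed

lemma hausdorff_outer_mono: "A \<subseteq> B \<Longrightarrow> hausdorff_outer k A \<le> hausdorff_outer k B"
  unfolding hausdorff_outer_def by (intro SUP_mono) (blast intro: hausdorff_pre_mono)

lemma hausdorff_outer_empty: "k > 0 \<Longrightarrow> hausdorff_outer k {} = 0"
  unfolding hausdorff_outer_def by (auto simp: hausdorff_pre_empty intro!: antisym SUP_least)

lemma hausdorff_outer_subadd: "hausdorff_outer k (\<Union>n. A n) \<le> (\<Sum>n::nat. hausdorff_outer k (A n))"
  unfolding hausdorff_outer_def
proof (rule SUP_least)
  fix \<delta> :: real assume d: "\<delta> \<in> {0<..}"
  have "hausdorff_pre k \<delta> (\<Union>n. A n) \<le> (\<Sum>n. hausdorff_pre k \<delta> (A n))"
    by (rule hausdorff_pre_subadd)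
  also have "\<dots> \<le> (\<Sum>n. SUP \<delta>\<in>{0<..}. hausdorff_pre k \<delta> (A n))"
    by (intro suminf_le SUP_upper d) auto
  finally show "hausdorff_pre k \<delta> (\<Union>n. A n) \<le> (\<Sum>n. SUP \<delta>\<in>{0<..}. hausdorff_pre k \<delta> (A n))" .
qed

lemma hausdorff_outer_Un: 
  assumes "k > 0" shows "hausdorff_outer k (A \<union> B) \<le> hausdorff_outer k A + hausdorff_outer k B"
proof -
  define D where "D n = (if n = 0 then A else if n = 1 then B else {})" for n :: nat
  have "A \<union> B = (\<Union>n. D n)"
    unfolding D_def by (auto split: if_splits) 
  moreover have "(\<Sum>n. hausdorff_outer k (D n)) = (\<Sum>n\<in>{0,1}. hausdorff_outer k (D n))"
    by (rule suminf_finite) (auto simp: D_def hausdorff_outer_empty[OF assms])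
  ultimately show ?thesis
    using hausdorff_outer_subadd[of k D] by (simp add: D_def)
qed

lemma hausdorff_pre_separated:
  assumes k: "k > 0" and sep: "\<And>a b. a \<in> A \<Longrightarrow> b \<in> B \<Longrightarrow> \<delta> < dist a b" and "\<delta> > 0"
  shows "hausdorff_pre k \<delta> A + hausdorff_pre k \<delta> B \<le> hausdorff_pre k \<delta> (A \<union> B)"
  unfolding hausdorff_pre_def[of k \<delta> "A \<union> B"]
proof (rule INF_greatest)
  define w where "w D = ennreal (unit_ball_vol (real k) * (diameter D / 2) ^ k)" for D :: "'a set"
  have w0: "w {} = 0" using k by (simp add: w_def)
  fix C assume C: "C \<in> hausdorff_covers \<delta> (A \<union> B)"
  define C1 where "C1 i = (if C i \<inter> A \<noteq> {} then C i else {})" for i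
  define C2 where "C2 i = (if C i \<inter> B \<noteq> {} then C i else {})" for i
  have not_both: "C i \<inter> A = {} \<or> C i \<inter> B = {}" for i
  proof (rule ccontr)
    assume "\<not> ?thesis"
    then obtain a b where "a \<in> C i" "a \<in> A" "b \<in> C i" "b \<in> B" by blast
    moreover have "bounded (C i)" "diameter (C i) \<le> \<delta>" using C by (auto simp: hausdorff_covers_def)
    ultimately have "dist a b \<le> \<delta>" using diameter_bounded_bound[of "C i" a b] by linarith
    then show False using sep[OF \<open>a \<in> A\<close> \<open>b \<in> B\<close>] by linarith
  qed
  have "C1 \<in> hausdorff_covers \<delta> A" "C2 \<in> hausdorff_covers \<delta> B"
    using C \<open>\<delta> > 0\<close> by (fastforce simp: hausdorff_covers_def C1_def C2_def)+
  then have "hausdorff_pre k \<delta> A + hausdorff_pre k \<delta> B \<le> (\<Sum>i. w (C1 i)) + (\<Sum>i. w (C2 i))"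
    unfolding hausdorff_pre_def w_def by (intro add_mono INF_lower)
  also have "\<dots> = (\<Sum>i. w (C1 i) + w (C2 i))"
    by (rule suminf_add) auto
  also have "\<dots> \<le> (\<Sum>i. w (C i))"
  proof (rule suminf_le)
    show "w (C1 i) + w (C2 i) \<le> w (C i)" for i
      using not_both[of i] by (auto simp: C1_def C2_def w0)
  qed auto
  finally show "hausdorff_pre k \<delta> A + hausdorff_pre k \<delta> B \<le>
     (\<Sum>i. ennreal (unit_ball_vol (real k) * (diameter (C i) / 2) ^ k))" by (simp add: w_def)
qed

lemma hausdorff_outer_separated:
  assumes k: "k > 0" and sep: "\<And>a b. a \<in> A \<Longrightarrow> b \<in> B \<Longrightarrow> d \<le> dist a b" and "d > 0"
  shows "hausdorff_outer k A + hausdorff_outer k B \<le> hausdorff_outer k (A \<union> B)"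
proof -
  have "hausdorff_outer k A + hausdorff_outer k B =
     (SUP \<delta>\<in>{0<..}. hausdorff_pre k \<delta> A + hausdorff_pre k \<delta> B)"
    unfolding hausdorff_outer_def
  proof (rule SUP_add_directed_ennreal[symmetric])
    fix i j :: real assume ij: "i \<in> {0<..}" "j \<in> {0<..}"
    have "hausdorff_pre k i A + hausdorff_pre k j B
        \<le> hausdorff_pre k (min i j) A + hausdorff_pre k (min i j) B"
      by (intro add_mono hausdorff_pre_antimono) auto
    then show "\<exists>l\<in>{0<..}. hausdorff_pre k i A + hausdorff_pre k j B
        \<le> hausdorff_pre k l A + hausdorff_pre k l B"
      using ij by (intro bexI[of _ "min i j"]) auto
  qed
  also have "\<dots> \<le> hausdorff_outer k (A \<union> B)"
  proof (rule SUP_least)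
    fix \<delta> :: real assume "\<delta> \<in> {0<..}"
    define \<eta> where "\<eta> = min \<delta> (d / 2)"
    have \<eta>: "\<eta> > 0" "\<eta> \<le> \<delta>" "\<eta> < d" using \<open>d > 0\<close> \<open>\<delta> \<in> _\<close> by (auto simp: \<eta>_def)
    have "hausdorff_pre k \<delta> A + hausdorff_pre k \<delta> B \<le> hausdorff_pre k \<eta> A + hausdorff_pre k \<eta> B"
      by (intro add_mono hausdorff_pre_antimono \<eta>)
    also have "\<dots> \<le> hausdorff_pre k \<eta> (A \<union> B)"
      using sep \<eta> by (intro hausdorff_pre_separated k) (auto intro: less_le_trans)
    also have "\<dots> \<le> hausdorff_outer k (A \<union> B)"
      unfolding hausdorff_outer_def using \<eta> by (intro SUP_upper) auto
    finally show "hausdorff_pre k \<delta> A + hausdorff_pre k \<delta> B \<le> hausdorff_outer k (A \<union> B)" .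
  qed
  finally show ?thesis .
qed

lemma hausdorff_outer_levels:
  assumes k: "k > 0" and "b < a"
    and "\<And>x. x \<in> A \<Longrightarrow> a \<le> infdist x F" "\<And>x. x \<in> B \<Longrightarrow> infdist x F \<le> b"
  shows "hausdorff_outer k A + hausdorff_outer k B \<le> hausdorff_outer k (A \<union> B)"
proof (rule hausdorff_outer_separated[OF k, where d = "a - b"])
  fix x y assume "x \<in> A" "y \<in> B"
  then show "a - b \<le> dist x y"
    using assms(3,4) infdist_triangle_abs[of x F y] by fastforce
qed (use \<open>b < a\<close> in simp)

lemma hausdorff_outer_closed_split:
  assumes k: "k > 0" and "closed F" and "F \<noteq> {}"
  shows "hausdorff_outer k (F \<inter> A) + hausdorff_outer k (A - F) \<le> hausdorff_outer k A"
proof (cases "hausdorff_outer k A = \<infinity>")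
  case fin: False
  define g where "g x = infdist x F" for x
  define B where "B n = {x\<in>A. g x > 1 / (real n + 1)}" for n
  define R where "R n = {x\<in>A. 1 / (real n + 2) < g x \<and> g x \<le> 1 / (real n + 1)}" for n
  let ?h = "hausdorff_outer k"
  have step: "?h (\<Union>i\<in>{..<N}. R (2 * i + c)) + ?h (R (2 * N + c)) \<le> ?h (\<Union>i\<in>{..<Suc N}. R (2 * i + c))"
    for N c
  proof -
    have "?h (\<Union>i\<in>{..<N}. R (2 * i + c)) + ?h (R (2 * N + c))
        \<le> ?h ((\<Union>i\<in>{..<N}. R (2 * i + c)) \<union> R (2 * N + c))"
    proof (cases "N = 0")
      case False
      show ?thesis
      proof (rule hausdorff_outer_levels[OF k, where F = F])
        show "1 / (real (2 * N + c) + 1) < 1 / real (2 * N + c)"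
          using False by (simp add: field_simps)
        show "infdist x F \<le> 1 / (real (2 * N + c) + 1)" if "x \<in> R (2 * N + c)" for x
          using that by (simp add: R_def g_def)
        show "1 / real (2 * N + c) \<le> infdist x F" if "x \<in> (\<Union>i\<in>{..<N}. R (2 * i + c))" for x
        proof -
          from that obtain i where i: "i < N" "x \<in> R (2 * i + c)" by blast
          have "1 / real (2 * N + c) \<le> 1 / (real (2 * i + c) + 2)"
            using i(1) by (intro divide_left_mono) auto
          also have "\<dots> \<le> infdist x F" using i(2) by (simp add: R_def g_def)
          finally show ?thesis .
        qed
      qed
    qed (simp add: hausdorff_outer_empty[OF k])
    also have "(\<Union>i\<in>{..<N}. R (2 * i + c)) \<union> R (2 * N + c) = (\<Union>i\<in>{..<Suc N}. R (2 * i + c))"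
      by (auto simp: lessThan_Suc)
    finally show ?thesis .
  qed
  have part: "(\<Sum>i<N. ?h (R (2 * i + c))) \<le> ?h A" for N c
  proof -
    have "(\<Sum>i<N. ?h (R (2 * i + c))) \<le> ?h (\<Union>i\<in>{..<N}. R (2 * i + c))"
    proof (induction N)
      case (Suc N)
      have "(\<Sum>i<Suc N. ?h (R (2 * i + c))) \<le> ?h (\<Union>i\<in>{..<N}. R (2 * i + c)) + ?h (R (2 * N + c))"
        using Suc by (simp add: add_right_mono)
      also note step
      finally show ?case .
    qed simp
    also have "\<dots> \<le> ?h A" by (intro hausdorff_outer_mono) (auto simp: R_def)
    finally show ?thesis .
  qed
  have sum_fin: "(\<Sum>i. ?h (R i)) \<noteq> \<infinity>"
  proof -
    have "(\<Sum>i<n. ?h (R i)) \<le> ?h A + ?h A" for n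
    proof -
      have "(\<Sum>i<n. ?h (R i)) \<le> (\<Sum>i<2 * n. ?h (R i))"
        by (rule sum_mono2) auto
      also have "\<dots> = (\<Sum>i<n. ?h (R (2 * i + 0))) + (\<Sum>i<n. ?h (R (2 * i + 1)))"
        by (induction n) (auto simp: algebra_simps)
      also have "\<dots> \<le> ?h A + ?h A" by (intro add_mono part)
      finally show ?thesis .
    qed
    then have "(\<Sum>i. ?h (R i)) \<le> ?h A + ?h A"
      by (intro suminf_le_const) auto
    moreover have "?h A + ?h A < \<infinity>" using fin by (simp add: less_top)
    ultimately show ?thesis by (metis leD)
  qed
  have "?h (F \<inter> A) + ?h (A - F) \<le> ?h A + (\<Sum>i. ?h (R (i + n)))" for n
  proof -
    have "A - F \<subseteq> B n \<union> (\<Union>i. R (i + n))"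
    proof
      fix x assume x: "x \<in> A - F"
      then have "g x > 0"
        unfolding g_def using in_closed_iff_infdist_zero[OF assms(2,3), of x] infdist_nonneg[of x F]
        by auto
      then obtain m where "inverse (real (Suc m)) < g x" using reals_Archimedean by blast
      then have ex: "\<exists>m. 1 / (real m + 1) < g x" by (auto simp: field_simps)
      define l where "l = (LEAST m. 1 / (real m + 1) < g x)"
      have l: "1 / (real l + 1) < g x" unfolding l_def by (rule LeastI_ex[OF ex])
      show "x \<in> B n \<union> (\<Union>i. R (i + n))"
      proof (cases "l \<le> n")
        case True
        have "1 / (real n + 1) \<le> 1 / (real l + 1)" using True by (intro divide_left_mono) auto
        then show ?thesis using l x by (auto simp: B_def)
      next
        case False
        then have "\<not> 1 / (real (l - 1) + 1) < g x"
          unfolding l_def by (intro not_less_Least) auto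
        moreover have "1 / (real (l - 1) + 2) < g x"
          using l False by (simp add: of_nat_diff add.commute)
        ultimately have "x \<in> R (l - 1 - n + n)" using x False by (auto simp: R_def)
        then show ?thesis by blast
      qed
    qed
    then have "?h (A - F) \<le> ?h (B n \<union> (\<Union>i. R (i + n)))" by (rule hausdorff_outer_mono)
    also have "\<dots> \<le> ?h (B n) + (\<Sum>i. ?h (R (i + n)))"
      using hausdorff_outer_Un[OF k] hausdorff_outer_subadd by (blast intro: order_trans add_left_mono)
    finally have "?h (F \<inter> A) + ?h (A - F) \<le> (?h (B n) + ?h (F \<inter> A)) + (\<Sum>i. ?h (R (i + n)))"
      by (metis add.assoc add.commute add_left_mono)
    also have "?h (B n) + ?h (F \<inter> A) \<le> ?h (B n \<union> F \<inter> A)"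
      by (rule hausdorff_outer_levels[OF k, where F = F and a = "1 / (real n + 1)" and b = 0])
        (auto simp: B_def g_def)
    also have "\<dots> \<le> ?h A" by (intro hausdorff_outer_mono) (auto simp: B_def)
    finally show ?thesis by (simp add: add_right_mono)
  qed
  moreover have "(\<lambda>n. \<Sum>i. ?h (R (i + n))) \<longlonglongrightarrow> 0"
  proof -
    have r: "?h (R i) < \<infinity>" for i
      using sum_fin by (metis ennreal_suminf_lessD infinity_ennreal_def less_top)
    define r where "r i = enn2real (?h (R i))" for i
    have eq: "?h (R i) = ennreal (r i)" for i using r[of i] by (simp add: r_def less_top)
    have s: "summable r"
      using sum_fin unfolding eq by (intro summable_suminf_not_top) (auto simp: r_def)
    have "(\<Sum>i. ?h (R (i + n))) = ennreal (\<Sum>i. r (i + n))" for n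
      unfolding eq using summable_ignore_initial_segment[OF s, of n]
      by (intro suminf_ennreal2) (simp_all add: r_def)
    moreover have "(\<lambda>n. \<Sum>i. r (i + n)) \<longlonglongrightarrow> 0"
    proof -
      have "(\<lambda>n. suminf r - (\<Sum>i<n. r i)) \<longlonglongrightarrow> suminf r - suminf r"
        by (intro tendsto_diff tendsto_const summable_LIMSEQ s)
      then show ?thesis using suminf_minus_initial_segment[OF s] by simp
    qed
    ultimately show ?thesis using tendsto_ennrealI by fastforce
  qed
  then have "(\<lambda>n. ?h A + (\<Sum>i. ?h (R (i + n)))) \<longlonglongrightarrow> ?h A + 0"
    by (intro tendsto_add tendsto_const)
  ultimately show ?thesis by (intro LIMSEQ_le_const) auto
qed simp

lemma hausdorff_measure_space:
  assumes k: "k > 0"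
  shows "measure_space UNIV (sets borel) (hausdorff_outer k :: 'a::metric_space set \<Rightarrow> ennreal)"
proof -
  let ?h = "hausdorff_outer k :: 'a set \<Rightarrow> ennreal"
  define L where "L = lambda_system UNIV (Pow UNIV) ?h"
  have "outer_measure_space (Pow UNIV) ?h"
    using hausdorff_outer_empty[OF k] hausdorff_outer_mono hausdorff_outer_subadd
    by (auto simp: outer_measure_space_def positive_def increasing_def countably_subadditive_def)
  then have ms: "measure_space UNIV L ?h"
    unfolding L_def by (intro sigma_algebra.caratheodory_lemma sigma_algebra_Pow)
  have "F \<in> L" if "closed F" for F :: "'a set"
  proof -
    have "?h (F \<inter> A) + ?h (A - F) = ?h A" for A
    proof (cases "F = {}")
      case False
      have "?h A = ?h ((F \<inter> A) \<union> (A - F))" by (rule arg_cong[where f = ?h]) auto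
      also have "\<dots> \<le> ?h (F \<inter> A) + ?h (A - F)" by (rule hausdorff_outer_Un[OF k])
      finally show ?thesis using hausdorff_outer_closed_split[OF k that False] by (intro antisym)
    qed (simp add: hausdorff_outer_empty[OF k])
    then show ?thesis by (auto simp: L_def lambda_system_def Diff_eq Int_commute)
  qed
  then have "sigma_sets UNIV (Collect closed) \<subseteq> L"
    using ms by (intro sigma_algebra.sigma_sets_subset) (auto simp: measure_space_def)
  then have "sets borel \<subseteq> L" by (simp add: borel_eq_closed)
  then show ?thesis
    using sets.sigma_algebra_axioms[of "borel :: 'a measure"] by (intro measure_down[OF ms]) auto
qed

lemma space_hausdorff_measure [simp]: "space (hausdorff_measure k) = UNIV"
  by (simp add: hausdorff_measure_def space_measure_of_conv)

lemma sets_hausdorff_measure [simp]: "sets (hausdorff_measure k) = sets borel"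
  using sets.sigma_sets_eq[of borel] by (simp add: hausdorff_measure_def sets_measure_of_conv)

lemma emeasure_hausdorff_measure:
  assumes "k > 0" and "A \<in> sets borel"
  shows "emeasure (hausdorff_measure k) A = hausdorff_outer k A"
proof (rule emeasure_measure_of[OF hausdorff_measure_def])
  show "positive (sets (hausdorff_measure k)) (hausdorff_outer k)"
    "countably_additive (sets (hausdorff_measure k)) (hausdorff_outer k)"
    using hausdorff_measure_space[OF assms(1)] by (auto simp: measure_space_def)
qed (use assms in auto)

definition surface_measure :: "(real^'n) set \<Rightarrow> (real^'n) measure" where
  "surface_measure \<Omega> = restrict_space (hausdorff_measure (CARD('n) - 1)) (frontier \<Omega>)"

text \<open>\<open>g\<close> is the trace of \<open>w \<in> H\<^sup>1(\<Omega>)\<close>: the trace operator is the continuous extension to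
  \<open>H\<^sup>1(\<Omega>) \<rightarrow> L\<^sup>2(\<partial>\<Omega>)\<close> of the restriction map on functions that are smooth up to the boundary.\<close>

definition is_trace :: "(real^'n) set \<Rightarrow> (real^'n \<Rightarrow> 'b::euclidean_space) \<Rightarrow> (real^'n \<Rightarrow> 'b) \<Rightarrow> bool" where
  "is_trace \<Omega> w g \<longleftrightarrow> g \<in> borel_measurable (surface_measure \<Omega>) \<and>
     (\<exists>W :: nat \<Rightarrow> real^'n \<Rightarrow> 'b. (\<forall>k. smooth_on UNIV (W k)) \<and>
        (\<lambda>k. Hk_norm 1 \<Omega> (\<lambda>x. W k x - w x)) \<longlonglongrightarrow> 0 \<and>
        (\<lambda>k. \<integral>\<^sup>+ x. ennreal ((norm (W k x - g x))\<^sup>2) \<partial>surface_measure \<Omega>) \<longlonglongrightarrow> 0)"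

definition tangential_trace :: "(real^'n) set \<Rightarrow> (real^'n \<Rightarrow> real^'n) \<Rightarrow> bool" where
  "tangential_trace \<Omega> w \<longleftrightarrow>
     (\<exists>g. is_trace \<Omega> w g \<and> (AE x in surface_measure \<Omega>. g x \<bullet> outward_normal \<Omega> x = 0))"

section \<open>Spaces of vector-valued functions of time\<close>

record ('a, 'b) fspace =
  fcarrier :: "('a \<Rightarrow> 'b) set"
  fnorm :: "('a \<Rightarrow> 'b) \<Rightarrow> real"

definition L2_space :: "(real^'n) set \<Rightarrow> (real^'n, 'b::euclidean_space) fspace" where
  "L2_space \<Omega> = \<lparr>fcarrier = {f. L2_on \<Omega> f}, fnorm = L2_norm_on \<Omega>\<rparr>"

definition Hk_space :: "nat \<Rightarrow> (real^'n) set \<Rightarrow> (real^'n, 'b::euclidean_space) fspace" where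
  "Hk_space k \<Omega> = \<lparr>fcarrier = {f. Hk_on k \<Omega> f}, fnorm = Hk_norm k \<Omega>\<rparr>"

text \<open>The space of \<open>H\<^sup>1\<close> fields tangential to the boundary. The parameter \<open>crl\<close> is
  \<^const>\<open>weak_curl2\<close> or \<^const>\<open>weak_curl3\<close>, depending on the dimension.\<close>

type_synonym ('n, 'c) curl_op = "(real^'n) set \<Rightarrow> (real^'n \<Rightarrow> real^'n) \<Rightarrow> real^'n \<Rightarrow> 'c"

definition Htan_space :: "('n, 'c::euclidean_space) curl_op \<Rightarrow> (real^'n) set \<Rightarrow> (real^'n, real^'n) fspace" where
  "Htan_space crl \<Omega> = \<lparr>fcarrier = {w. Hk_on 1 \<Omega> w \<and> tangential_trace \<Omega> w},
     fnorm = (\<lambda>w. sqrt ((L2_norm_on \<Omega> (weak_div \<Omega> w))\<^sup>2 + (L2_norm_on \<Omega> (crl \<Omega> w))\<^sup>2))\<rparr>"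

text \<open>A closed subspace of \<open>H\<^sup>2\<close>, hence carries the \<open>H\<^sup>2\<close> norm.\<close>

definition H2_Htan_space :: "('n, 'c::euclidean_space) curl_op \<Rightarrow> (real^'n) set \<Rightarrow> (real^'n, real^'n) fspace" where
  "H2_Htan_space crl \<Omega> = \<lparr>fcarrier = fcarrier (Hk_space 2 \<Omega>) \<inter> fcarrier (Htan_space crl \<Omega>),
     fnorm = fnorm (Hk_space 2 \<Omega>)\<rparr>"

text \<open>A list of pairs \<open>(E, w)\<close> stands for the simple function with value
  \<open>\<Sum> indicator E t *\<^sub>R w\<close> at time \<open>t\<close>.\<close>

definition simple_on :: "real set \<Rightarrow> ('a, 'b) fspace \<Rightarrow> (real set \<times> ('a \<Rightarrow> 'b)) list \<Rightarrow> bool" where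
  "simple_on I X s \<longleftrightarrow> (\<forall>(E, w)\<in>set s. E \<in> lmeasurable \<and> E \<subseteq> I \<and> w \<in> fcarrier X)"

definition simple_val :: "(real set \<times> ('a \<Rightarrow> 'b::real_vector)) list \<Rightarrow> real \<Rightarrow> 'a \<Rightarrow> 'b" where
  "simple_val s t x = (\<Sum>(E, w)\<leftarrow>s. indicator E t *\<^sub>R w x)"

definition simple_int :: "(real set \<times> ('a \<Rightarrow> 'b::real_vector)) list \<Rightarrow> 'a \<Rightarrow> 'b" where
  "simple_int s x = (\<Sum>(E, w)\<leftarrow>s. measure lebesgue E *\<^sub>R w x)"

definition strongly_measurable_on ::
  "real set \<Rightarrow> ('a, 'b::real_vector) fspace \<Rightarrow> (real \<Rightarrow> 'a \<Rightarrow> 'b) \<Rightarrow> bool" where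
  "strongly_measurable_on I X f \<longleftrightarrow> (AE t in lebesgue_on I. f t \<in> fcarrier X) \<and>
     (\<exists>s. (\<forall>k. simple_on I X (s k)) \<and>
       (AE t in lebesgue_on I. (\<lambda>k::nat. fnorm X (\<lambda>x. f t x - simple_val (s k) t x)) \<longlonglongrightarrow> 0))"

text \<open>\<open>y\<close> is the Bochner integral over \<open>I\<close> of the \<open>X\<close>-valued function \<open>f\<close>.\<close>

definition has_Bochner_integral_on ::
  "real set \<Rightarrow> ('a, 'b::real_vector) fspace \<Rightarrow> (real \<Rightarrow> 'a \<Rightarrow> 'b) \<Rightarrow> ('a \<Rightarrow> 'b) \<Rightarrow> bool" where
  "has_Bochner_integral_on I X f y \<longleftrightarrow> strongly_measurable_on I X f \<and> y \<in> fcarrier X \<and>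
     (\<exists>s. (\<forall>k. simple_on I X (s k)) \<and>
       (\<lambda>k::nat. \<integral>\<^sup>+ t. ennreal (fnorm X (\<lambda>x. f t x - simple_val (s k) t x)) \<partial>lebesgue_on I) \<longlonglongrightarrow> 0 \<and>
       (\<lambda>k. fnorm X (\<lambda>x. simple_int (s k) x - y x)) \<longlonglongrightarrow> 0)"

definition Linf_time :: "real set \<Rightarrow> ('a, 'b::real_vector) fspace \<Rightarrow> (real \<Rightarrow> 'a \<Rightarrow> 'b) \<Rightarrow> bool" where
  "Linf_time I X f \<longleftrightarrow> strongly_measurable_on I X f \<and>
     (\<exists>C. AE t in lebesgue_on I. fnorm X (f t) \<le> C)"

definition L2_time :: "real set \<Rightarrow> ('a, 'b::real_vector) fspace \<Rightarrow> (real \<Rightarrow> 'a \<Rightarrow> 'b) \<Rightarrow> bool" where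
  "L2_time I X f \<longleftrightarrow> strongly_measurable_on I X f \<and>
     (\<integral>\<^sup>+ t. ennreal ((fnorm X (f t))\<^sup>2) \<partial>lebesgue_on I) < \<infinity>"

text \<open>\<open>g\<close> is the weak time derivative of \<open>f\<close>, both being \<open>X\<close>-valued; the integrals are Bochner
  integrals in \<open>X\<close>.\<close>

definition is_weak_tderiv ::
  "real set \<Rightarrow> ('a, 'b::real_vector) fspace \<Rightarrow> (real \<Rightarrow> 'a \<Rightarrow> 'b) \<Rightarrow> (real \<Rightarrow> 'a \<Rightarrow> 'b) \<Rightarrow> bool" where
  "is_weak_tderiv I X f g \<longleftrightarrow> (\<forall>\<phi>. test_function I \<phi> \<longrightarrow>
     (\<exists>y. has_Bochner_integral_on I X (\<lambda>t x. deriv \<phi> t *\<^sub>R f t x) y \<and>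
          has_Bochner_integral_on I X (\<lambda>t x. \<phi> t *\<^sub>R g t x) (\<lambda>x. - y x)))"

definition C_time :: "real set \<Rightarrow> ('a, 'b::real_vector) fspace \<Rightarrow> (real \<Rightarrow> 'a \<Rightarrow> 'b) \<Rightarrow> bool" where
  "C_time I X f \<longleftrightarrow> (\<forall>t\<in>I. f t \<in> fcarrier X \<and>
     ((\<lambda>s. fnorm X (\<lambda>x. f s x - f t x)) \<longlongrightarrow> 0) (at t within I))"

section \<open>Solutions of the system\<close>

definition admissible_data ::
  "('n, 'c::euclidean_space) curl_op \<Rightarrow> (real^'n) set \<Rightarrow>
   (real^'n \<Rightarrow> real^'n) \<Rightarrow> (real^'n \<Rightarrow> real^'n) \<Rightarrow> (real^'n \<Rightarrow> real) \<Rightarrow> bool" where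
  "admissible_data crl \<Omega> u0 v0 \<theta>0 \<longleftrightarrow>
     u0 \<in> fcarrier (H2_Htan_space crl \<Omega>) \<and> v0 \<in> fcarrier (Htan_space crl \<Omega>) \<and>
     Hk_on 1 \<Omega> \<theta>0 \<and> (\<exists>C. AE x in lebesgue_on \<Omega>. \<bar>\<theta>0 x\<bar> \<le> C) \<and>
     (\<exists>c>0. AE x in lebesgue_on \<Omega>. c \<le> \<theta>0 x)"

text \<open>Below \<open>ut\<close>, \<open>utt\<close> and \<open>\<theta>t\<close> stand for the weak time derivatives \<open>u\<^sub>t\<close>, \<open>u\<^sub>t\<^sub>t\<close> and \<open>\<theta>\<^sub>t\<close>;
  \<open>u\<close>, \<open>ut\<close> and \<open>\<theta>\<close> are the representatives that are continuous in time.\<close>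

definition momentum_eq ::
  "('n, 'c::euclidean_space) curl_op \<Rightarrow> (real^'n) set \<Rightarrow> real \<Rightarrow> real \<Rightarrow> real \<Rightarrow>
   (real \<Rightarrow> real^'n \<Rightarrow> real^'n) \<Rightarrow> (real \<Rightarrow> real^'n \<Rightarrow> real^'n) \<Rightarrow> (real \<Rightarrow> real^'n \<Rightarrow> real) \<Rightarrow> bool" where
  "momentum_eq crl \<Omega> \<nu> \<mu> lam u utt \<theta> \<longleftrightarrow>
     (AE t in lebesgue_on {0<..}. \<forall>\<phi>\<in>fcarrier (Htan_space crl \<Omega>).
        (LINT x|lebesgue_on \<Omega>. utt t x \<bullet> \<phi> x)
        + (2 * \<mu> + lam) * (LINT x|lebesgue_on \<Omega>. weak_div \<Omega> (u t) x * weak_div \<Omega> \<phi> x)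
        + \<mu> * (LINT x|lebesgue_on \<Omega>. crl \<Omega> (u t) x \<bullet> crl \<Omega> \<phi> x)
        = - \<nu> * (LINT x|lebesgue_on \<Omega>. weak_grad \<Omega> (\<theta> t) x \<bullet> \<phi> x))"

definition heat_eq ::
  "(real^'n) set \<Rightarrow> real \<Rightarrow> (real \<Rightarrow> real^'n \<Rightarrow> real^'n) \<Rightarrow>
   (real \<Rightarrow> real^'n \<Rightarrow> real) \<Rightarrow> (real \<Rightarrow> real^'n \<Rightarrow> real) \<Rightarrow> bool" where
  "heat_eq \<Omega> \<nu> ut \<theta> \<theta>t \<longleftrightarrow>
     (AE t in lebesgue_on {0<..}. \<forall>\<psi>. Hk_on 1 \<Omega> \<psi> \<longrightarrow>
        (LINT x|lebesgue_on \<Omega>. \<theta>t t x * \<psi> x)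
        + (LINT x|lebesgue_on \<Omega>. weak_grad \<Omega> (\<theta> t) x \<bullet> weak_grad \<Omega> \<psi> x)
        = - \<nu> * (LINT x|lebesgue_on \<Omega>. \<theta> t x * weak_div \<Omega> (ut t) x * \<psi> x))"

definition is_solution ::
  "('n, 'c::euclidean_space) curl_op \<Rightarrow> (real^'n) set \<Rightarrow> real \<Rightarrow> real \<Rightarrow> real \<Rightarrow>
   (real^'n \<Rightarrow> real^'n) \<Rightarrow> (real^'n \<Rightarrow> real^'n) \<Rightarrow> (real^'n \<Rightarrow> real) \<Rightarrow>
   (real \<Rightarrow> real^'n \<Rightarrow> real^'n) \<Rightarrow> (real \<Rightarrow> real^'n \<Rightarrow> real) \<Rightarrow> bool" where
  "is_solution crl \<Omega> \<nu> \<mu> lam u0 v0 \<theta>0 u \<theta> \<longleftrightarrow>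
     admissible_data crl \<Omega> u0 v0 \<theta>0 \<and>
     (\<exists>ut utt \<theta>t.
       Linf_time {0<..} (H2_Htan_space crl \<Omega>) u \<and>
       Linf_time {0<..} (Htan_space crl \<Omega>) u \<and> Linf_time {0<..} (Htan_space crl \<Omega>) ut \<and>
       is_weak_tderiv {0<..} (Htan_space crl \<Omega>) u ut \<and>
       Linf_time {0<..} (L2_space \<Omega>) u \<and> Linf_time {0<..} (L2_space \<Omega>) ut \<and>
       Linf_time {0<..} (L2_space \<Omega>) utt \<and>
       is_weak_tderiv {0<..} (L2_space \<Omega>) u ut \<and> is_weak_tderiv {0<..} (L2_space \<Omega>) ut utt \<and>
       Linf_time {0<..} (Hk_space 1 \<Omega>) \<theta> \<and>
       (\<forall>T>0. L2_time {0<..<T} (Hk_space 2 \<Omega>) \<theta> \<and>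
              L2_time {0<..<T} (L2_space \<Omega>) \<theta> \<and> L2_time {0<..<T} (L2_space \<Omega>) \<theta>t \<and>
              is_weak_tderiv {0<..<T} (L2_space \<Omega>) \<theta> \<theta>t) \<and>
       momentum_eq crl \<Omega> \<nu> \<mu> lam u utt \<theta> \<and>
       heat_eq \<Omega> \<nu> ut \<theta> \<theta>t \<and>
       C_time {0..} (Hk_space 1 \<Omega>) \<theta> \<and> C_time {0..} (Htan_space crl \<Omega>) u \<and>
       C_time {0..} (L2_space \<Omega>) ut \<and>
       (AE x in lebesgue_on \<Omega>. u 0 x = u0 x) \<and>
       (AE x in lebesgue_on \<Omega>. ut 0 x = v0 x) \<and>
       (AE x in lebesgue_on \<Omega>. \<theta> 0 x = \<theta>0 x))"

section \<open>The Helmholtz decomposition\<close>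

definition is_distr_div :: "(real^'n) set \<Rightarrow> (real^'n \<Rightarrow> real^'n) \<Rightarrow> (real^'n \<Rightarrow> real) \<Rightarrow> bool" where
  "is_distr_div \<Omega> w g \<longleftrightarrow> loc_integrable_on \<Omega> w \<and> loc_integrable_on \<Omega> g \<and>
     (\<forall>\<phi>. test_function \<Omega> \<phi> \<longrightarrow>
        (LINT x|lebesgue_on \<Omega>. w x \<bullet> gradient \<phi> x) = - (LINT x|lebesgue_on \<Omega>. g x * \<phi> x))"

text \<open>For an \<open>L\<^sup>2\<close> field \<open>w\<close> with \<open>div w = g \<in> L\<^sup>2\<close> the normal trace \<open>w \<cdot> n\<close> only exists as an element
  of the dual of \<open>H\<^sup>1\<^sup>/\<^sup>2(\<partial>\<Omega>)\<close>, defined through its pairing with the trace of \<open>\<psi> \<in> H\<^sup>1(\<Omega>)\<close>.\<close>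

definition normal_trace_pairing ::
  "(real^'n) set \<Rightarrow> (real^'n \<Rightarrow> real^'n) \<Rightarrow> (real^'n \<Rightarrow> real) \<Rightarrow> (real^'n \<Rightarrow> real) \<Rightarrow> real" where
  "normal_trace_pairing \<Omega> w g \<psi> =
     (LINT x|lebesgue_on \<Omega>. w x \<bullet> weak_grad \<Omega> \<psi> x) + (LINT x|lebesgue_on \<Omega>. g x * \<psi> x)"

text \<open>\<open>w\<close> is (a representative of) the divergence-free part \<open>H v\<close>. It is unique up to null sets.\<close>

definition divfree_part :: "(real^'n) set \<Rightarrow> (real^'n \<Rightarrow> real^'n) \<Rightarrow> (real^'n \<Rightarrow> real^'n) \<Rightarrow> bool" where
  "divfree_part \<Omega> v w \<longleftrightarrow> L2_on \<Omega> v \<and> L2_on \<Omega> w \<and>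
     is_distr_div \<Omega> w (\<lambda>x. 0) \<and>
     (\<forall>\<psi>. Hk_on 1 \<Omega> \<psi> \<longrightarrow> normal_trace_pairing \<Omega> w (\<lambda>x. 0) \<psi> = 0) \<and>
     (\<exists>\<phi>. Hk_on 1 \<Omega> \<phi> \<and> (LINT x|lebesgue_on \<Omega>. \<phi> x) = 0 \<and>
        (AE x in lebesgue_on \<Omega>. v x = w x + weak_grad \<Omega> \<phi> x) \<and>
        (LINT x|lebesgue_on \<Omega>. w x \<bullet> weak_grad \<Omega> \<phi> x) = 0)"

end

theory Submission
  imports Defs
begin

text \<open>Only the implication from decay to vanishing needs an argument. Formally the divergence-free part
  \<open>\<gamma>\<close> of \<open>u\<close> solves a conservative linear wave equation \<open>\<gamma>\<^sub>t\<^sub>t = - \<mu> curl curl \<gamma>\<close>, because the right hand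
  side \<open>- \<nu> \<nabla>\<theta>\<close> and the term with \<open>\<nabla> div u\<close> are gradients. A solution and its translate in time
  have a constant Wronskian
  \<open>\<langle>\<gamma>\<^sub>t(t), \<gamma>(t + s)\<rangle> - \<langle>\<gamma>\<^sub>t(t + s), \<gamma>(t)\<rangle>\<close>,
  and since \<open>\<gamma>\<^sub>t\<close> is bounded and \<open>\<gamma>\<close> tends to zero, this constant is zero. Dividing by \<open>s\<close> and letting \<open>s\<close>
  tend to zero gives \<open>\<parallel>\<gamma>\<^sub>t\<parallel>\<^sup>2 + \<mu> \<parallel>curl \<gamma>\<parallel>\<^sup>2 = 0\<close>. Hence \<open>curl u = curl \<gamma> = 0\<close>, and a field in \<open>L\<^sup>2\<close> whose curl
  vanishes on a convex domain is a gradient, so \<open>\<gamma> = 0\<close>.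

  Since \<open>\<gamma>\<close> is only known to be square integrable in space, the equation for \<open>\<gamma>\<close> cannot be used as it stands.
  It is replaced by three scalar kernels in two times,
  \<open>k t s = \<langle>\<gamma> t, \<gamma> s\<rangle>\<close>, \<open>K t s = \<langle>u\<^sub>t t, \<gamma> s\<rangle>\<close> and \<open>c t s = \<langle>rot u t, rot u s\<rangle>\<close>, where \<open>rot w\<close> is the
  matrix of the differences \<open>\<partial>\<^sub>i w\<^sub>j - \<partial>\<^sub>j w\<^sub>i\<close>. Here \<open>K\<close> is the derivative of \<open>k\<close> in the first time and \<open>- (\<mu> / 2) c\<close>
  that of \<open>K\<close>, and lemma \<open>Wronskian_argument\<close> carries out the argument for such kernels.

  Three facts about the domain are needed for this.

  \<^item> The momentum equation may be tested with \<open>\<gamma> s\<close>, lemma \<open>momentum_divfree_part\<close>. It holds for tangential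
    test fields, and a smooth field becomes tangential by subtracting a gradient that is small in \<open>L\<^sup>2\<close>
    (lemma \<open>tangential_approximation\<close>). This changes neither the rotation nor, in the limit, the pairings, so
    that the equation holds for all smooth fields, in particular for the smooth fields approximating \<open>u s\<close>.

  \<^item> A square integrable field that is orthogonal to the gradients of smooth functions is orthogonal to all
    weak gradients, lemma \<open>orthogonal_to_weak_grad\<close>. This is the density of smooth functions in \<open>H\<^sup>1\<close>,
    which on a convex domain follows by dilation and mollification.

  \<^item> The pairing of a field with a divergence-free one is bounded by the rotation of the field, lemma
    \<open>Poincare_rotation\<close>. It yields the continuity of \<open>\<gamma>\<close> in time and the last step of the argument.\<close>

section \<open>Calculus of smooth functions\<close>

lemma Ck_on_SucI:
  fixes f :: "'a::euclidean_space \<Rightarrow> 'b::real_normed_vector"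
  assumes "open U" and d: "\<And>x. x \<in> U \<Longrightarrow> (f has_derivative f' x) (at x)"
    and c: "\<And>b. b \<in> Basis \<Longrightarrow> Ck_on k U (\<lambda>x. f' x b)"
    and cong: "\<And>g h :: 'a \<Rightarrow> 'b. (\<And>x. x \<in> U \<Longrightarrow> g x = h x) \<Longrightarrow> Ck_on k U g \<Longrightarrow> Ck_on k U h"
  shows "Ck_on (Suc k) U f"
proof -
  have eq: "frechet_derivative f (at x) = f' x" if "x \<in> U" for x
    using frechet_derivative_at[OF d[OF that]] by simp
  have "Ck_on k U (\<lambda>x. frechet_derivative f (at x) b)" if "b \<in> Basis" for b
  proof (rule cong[of "\<lambda>x. f' x b"])
    show "f' x b = frechet_derivative f (at x) b" if "x \<in> U" for x using eq[OF that] by simp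
  qed (rule c[OF that])
  then show ?thesis using d by (auto simp: differentiable_def)
qed

lemma Ck_on_cong:
  assumes "open U" "\<And>x. x \<in> U \<Longrightarrow> f x = g x" "Ck_on k U f"
  shows "Ck_on k U g"
  using assms(2,3)
proof (induction k arbitrary: f g)
  case 0
  then show ?case by (auto intro: continuous_on_eq)
next
  case (Suc k)
  have "(g has_derivative frechet_derivative f (at x)) (at x)" if "x \<in> U" for x
    using has_derivative_transform_within_open[OF _ assms(1) that Suc.prems(1)] Suc.prems(2) that
    by (auto simp: frechet_derivative_works)
  then show ?case
  proof (rule Ck_on_SucI[OF assms(1)])
    show "Ck_on k U h'" if "\<And>x. x \<in> U \<Longrightarrow> h x = h' x" "Ck_on k U h" for h h' :: "'a \<Rightarrow> 'b"
      using Suc.IH[OF that] .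
  qed (use Suc.prems(2) in auto)
qed

lemma Ck_on_derivI:
  assumes "open U" and "\<And>x. x \<in> U \<Longrightarrow> (f has_derivative f' x) (at x)"
    and "\<And>b. b \<in> Basis \<Longrightarrow> Ck_on k U (\<lambda>x. f' x b)"
  shows "Ck_on (Suc k) U f"
proof (rule Ck_on_SucI[OF assms])
  show "Ck_on k U h" if "\<And>x. x \<in> U \<Longrightarrow> g x = h x" "Ck_on k U g" for g h :: "'a \<Rightarrow> 'b"
    using Ck_on_cong[OF assms(1) that] .
qed auto

lemma Ck_on_Suc_derivative:
  assumes "Ck_on (Suc k) U f"
  shows "\<And>x. x \<in> U \<Longrightarrow> (f has_derivative frechet_derivative f (at x)) (at x)"
    and "\<And>b. b \<in> Basis \<Longrightarrow> Ck_on k U (\<lambda>x. frechet_derivative f (at x) b)"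
  using assms by (auto simp: frechet_derivative_works)

lemma Ck_on_SucD: "Ck_on (Suc k) U f \<Longrightarrow> Ck_on k U f"
proof (induction k arbitrary: f)
  case 0
  then show ?case
    by (auto intro!: continuous_at_imp_continuous_on differentiable_imp_continuous_within)
next
  case (Suc k)
  from Suc.prems have "\<forall>b\<in>Basis. Ck_on k U (\<lambda>x. frechet_derivative f (at x) b)"
    using Suc.IH by auto
  with Suc.prems show ?case by auto
qed

lemma Ck_on_subset: "Ck_on k U f \<Longrightarrow> V \<subseteq> U \<Longrightarrow> Ck_on k V f"
  by (induction k arbitrary: f) (auto intro: continuous_on_subset)

lemma Ck_on_Un:
  assumes "open U" "open V"
  shows "Ck_on k U f \<Longrightarrow> Ck_on k V f \<Longrightarrow> Ck_on k (U \<union> V) f"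
proof (induction k arbitrary: f)
  case 0
  then show ?case using continuous_on_open_Un[OF assms] by auto
qed auto

lemma Ck_on_continuous: "Ck_on k U f \<Longrightarrow> continuous_on U f"
  by (induction k) (auto dest: Ck_on_SucD simp del: Ck_on.simps(2))

lemma Ck_on_const [simp]: "open U \<Longrightarrow> Ck_on k U (\<lambda>x. c)"
proof (induction k arbitrary: c)
  case (Suc k)
  then show ?case by (intro Ck_on_derivI[where f' = "\<lambda>x h. 0"]) simp_all
qed auto

lemma Ck_on_linear:
  assumes "open U" "bounded_linear f"
  shows "Ck_on k U f"
proof (cases k)
  case 0
  then show ?thesis using assms by (auto intro: linear_continuous_on)
next
  case (Suc m)
  show ?thesis unfolding Suc
    using assms by (intro Ck_on_derivI[where f' = "\<lambda>_. f"] bounded_linear_imp_has_derivative) auto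
qed

lemma Ck_on_bounded_linear:
  assumes "open U" and g: "bounded_linear g"
  shows "Ck_on k U f \<Longrightarrow> Ck_on k U (\<lambda>x. g (f x))"
proof (induction k arbitrary: f)
  case 0
  then show ?case using bounded_linear.continuous_on[OF g] by auto
next
  case (Suc k)
  note d = Ck_on_Suc_derivative[OF Suc.prems]
  show ?case
    using d assms(1)
    by (intro Ck_on_derivI[where f' = "\<lambda>x h. g (frechet_derivative f (at x) h)"] Suc.IH
        bounded_linear.has_derivative[OF g]) auto
qed

lemma Ck_on_add:
  assumes "open U"
  shows "Ck_on k U f \<Longrightarrow> Ck_on k U g \<Longrightarrow> Ck_on k U (\<lambda>x. f x + g x)"
proof (induction k arbitrary: f g)
  case 0
  then show ?case by (auto intro: continuous_on_add)
next
  case (Suc k)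
  note d = Ck_on_Suc_derivative[OF Suc.prems(1)] Ck_on_Suc_derivative[OF Suc.prems(2)]
  show ?case
    using d assms
    by (intro Ck_on_derivI[where f' = "\<lambda>x h. frechet_derivative f (at x) h + frechet_derivative g (at x) h"]
        Suc.IH has_derivative_add) auto
qed

lemma Ck_on_sum:
  assumes "open U"
  shows "(\<And>i. i \<in> I \<Longrightarrow> Ck_on k U (f i)) \<Longrightarrow> Ck_on k U (\<lambda>x. \<Sum>i\<in>I. f i x)"
  using assms by (induction I rule: infinite_finite_induct) (auto intro: Ck_on_add)

lemma Ck_on_bilinear:
  assumes "open U" and b: "bounded_bilinear bil"
  shows "Ck_on k U f \<Longrightarrow> Ck_on k U g \<Longrightarrow> Ck_on k U (\<lambda>x. bil (f x) (g x))"
proof (induction k arbitrary: f g)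
  case 0
  then show ?case using bounded_bilinear.continuous_on[OF b] by auto
next
  case (Suc k)
  note d = Ck_on_Suc_derivative[OF Suc.prems(1)] Ck_on_Suc_derivative[OF Suc.prems(2)]
    Suc.prems[THEN Ck_on_SucD]
  show ?case
    using d assms(1)
    by (intro Ck_on_derivI[where f' = "\<lambda>x h. bil (f x) (frechet_derivative g (at x) h)
         + bil (frechet_derivative f (at x) h) (g x)"]
        Suc.IH Ck_on_add bounded_bilinear.FDERIV[OF b]) auto
qed

lemmas Ck_on_mult = Ck_on_bilinear[OF _ bounded_bilinear_mult]
  and Ck_on_scaleR = Ck_on_bilinear[OF _ bounded_bilinear_scaleR]
  and Ck_on_inner = Ck_on_bilinear[OF _ bounded_bilinear_inner]

lemma Ck_on_minus: "open U \<Longrightarrow> Ck_on k U f \<Longrightarrow> Ck_on k U (\<lambda>x. - f x)"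
  by (rule Ck_on_bounded_linear[where g = uminus]) (auto intro: bounded_linear_minus bounded_linear_ident)

lemma Ck_on_diff: "open U \<Longrightarrow> Ck_on k U f \<Longrightarrow> Ck_on k U g \<Longrightarrow> Ck_on k U (\<lambda>x. f x - g x)"
  using Ck_on_add[of U k f "\<lambda>x. - g x"] Ck_on_minus[of U k g] by simp

lemma Ck_on_prod:
  fixes f :: "'i \<Rightarrow> 'a::euclidean_space \<Rightarrow> real"
  assumes "open U"
  shows "(\<And>i. i \<in> I \<Longrightarrow> Ck_on k U (f i)) \<Longrightarrow> Ck_on k U (\<lambda>x. \<Prod>i\<in>I. f i x)"
  using assms by (induction I rule: infinite_finite_induct) (auto intro: Ck_on_mult)

lemma Ck_on_compose_real:
  fixes f :: "'a::euclidean_space \<Rightarrow> real" and h :: "real \<Rightarrow> 'b::real_normed_vector"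
  assumes "open U" and V: "f ` U \<subseteq> V"
  shows "Ck_on k V h \<Longrightarrow> Ck_on k U f \<Longrightarrow> Ck_on k U (\<lambda>x. h (f x))"
proof (induction k arbitrary: h)
  case 0
  then show ?case using V by (auto intro: continuous_on_compose2)
next
  case (Suc k)
  note d = Ck_on_Suc_derivative[OF Suc.prems(1)] Ck_on_Suc_derivative[OF Suc.prems(2)]
    Suc.prems(2)[THEN Ck_on_SucD]
  have lin: "frechet_derivative h (at y) r = r *\<^sub>R frechet_derivative h (at y) 1" if "y \<in> V" for y r
    using linear_scale[OF has_derivative_linear[OF d(1)[OF that]], of r 1] by simp
  show ?case
  proof (rule Ck_on_derivI[OF assms(1)])
    fix x assume x: "x \<in> U"
    then have "((\<lambda>x. h (f x)) has_derivative
        (\<lambda>v. frechet_derivative h (at (f x)) (frechet_derivative f (at x) v))) (at x)"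
      using V d by (intro has_derivative_compose[where f = f and g = h]) auto
    then show "((\<lambda>x. h (f x)) has_derivative
        (\<lambda>v. frechet_derivative f (at x) v *\<^sub>R frechet_derivative h (at (f x)) 1)) (at x)"
      using lin V x by (metis (no_types, lifting) ext imageI subsetD)
  next
    fix b :: 'a assume "b \<in> Basis"
    then show "Ck_on k U (\<lambda>x. frechet_derivative f (at x) b *\<^sub>R frechet_derivative h (at (f x)) 1)"
      using d assms(1) by (intro Ck_on_scaleR Suc.IH) auto
  qed
qed

lemma Ck_on_inverse:
  fixes f :: "'a::euclidean_space \<Rightarrow> real"
  assumes "open U" "\<And>x. x \<in> U \<Longrightarrow> f x \<noteq> 0"
  shows "Ck_on k U f \<Longrightarrow> Ck_on k U (\<lambda>x. inverse (f x))"
proof (induction k)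
  case 0
  then show ?case using assms by (auto intro: continuous_on_inverse)
next
  case (Suc k)
  note d = Ck_on_Suc_derivative[OF Suc.prems]
  show ?case
    using d assms Suc.IH[OF Ck_on_SucD[OF Suc.prems]]
    by (intro Ck_on_derivI[where f' = "\<lambda>x h. - (inverse (f x) * frechet_derivative f (at x) h * inverse (f x))"]
        Ck_on_minus Ck_on_mult) (auto intro!: has_derivative_inverse)
qed

lemma smooth_on_simps:
  shows smooth_on_const [simp]: "open U \<Longrightarrow> smooth_on U (\<lambda>x. c)"
    and smooth_on_add: "open U \<Longrightarrow> smooth_on U f \<Longrightarrow> smooth_on U g \<Longrightarrow> smooth_on U (\<lambda>x. f x + g x)"
    and smooth_on_diff: "open U \<Longrightarrow> smooth_on U f \<Longrightarrow> smooth_on U g \<Longrightarrow> smooth_on U (\<lambda>x. f x - g x)"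
    and smooth_on_minus: "open U \<Longrightarrow> smooth_on U f \<Longrightarrow> smooth_on U (\<lambda>x. - f x)"
    and smooth_on_scaleR: "open U \<Longrightarrow> smooth_on U a \<Longrightarrow> smooth_on U f \<Longrightarrow> smooth_on U (\<lambda>x. a x *\<^sub>R f x)"
    and smooth_on_subset: "smooth_on U f \<Longrightarrow> V \<subseteq> U \<Longrightarrow> smooth_on V f"
    and smooth_on_Un: "open U \<Longrightarrow> open V \<Longrightarrow> smooth_on U f \<Longrightarrow> smooth_on V f \<Longrightarrow> smooth_on (U \<union> V) f"
    and smooth_on_cong: "open U \<Longrightarrow> (\<And>x. x \<in> U \<Longrightarrow> f x = g x) \<Longrightarrow> smooth_on U f \<Longrightarrow> smooth_on U g"
    and smooth_on_continuous: "smooth_on U f \<Longrightarrow> continuous_on U f"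
  unfolding smooth_on_def
  subgoal by (simp)
  subgoal by (simp add: Ck_on_add)
  subgoal by (simp add: Ck_on_diff)
  subgoal by (simp add: Ck_on_minus)
  subgoal by (simp add: Ck_on_scaleR)
  subgoal using Ck_on_subset by blast
  subgoal using Ck_on_Un by blast
  subgoal using Ck_on_cong by metis
  subgoal using Ck_on_continuous by blast
  done

lemma smooth_on_linear: "open U \<Longrightarrow> bounded_linear l \<Longrightarrow> smooth_on U l"
  unfolding smooth_on_def by (simp add: Ck_on_linear)

lemma smooth_on_bounded_linear:
  "open U \<Longrightarrow> bounded_linear l \<Longrightarrow> smooth_on U f \<Longrightarrow> smooth_on U (\<lambda>x. l (f x))"
  unfolding smooth_on_def by (simp add: Ck_on_bounded_linear)

lemma smooth_on_inner:
  fixes f g :: "'a::euclidean_space \<Rightarrow> 'b::real_inner"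
  shows "open U \<Longrightarrow> smooth_on U f \<Longrightarrow> smooth_on U g \<Longrightarrow> smooth_on U (\<lambda>x. f x \<bullet> g x)"
  unfolding smooth_on_def by (simp add: Ck_on_inner)

lemma smooth_on_mult:
  fixes f g :: "'a::euclidean_space \<Rightarrow> real"
  shows "open U \<Longrightarrow> smooth_on U f \<Longrightarrow> smooth_on U g \<Longrightarrow> smooth_on U (\<lambda>x. f x * g x)"
  unfolding smooth_on_def by (simp add: Ck_on_mult)

lemma smooth_on_inverse:
  fixes f :: "'a::euclidean_space \<Rightarrow> real"
  shows "open U \<Longrightarrow> (\<And>x. x \<in> U \<Longrightarrow> f x \<noteq> 0) \<Longrightarrow> smooth_on U f \<Longrightarrow> smooth_on U (\<lambda>x. inverse (f x))"
  unfolding smooth_on_def by (simp add: Ck_on_inverse)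

lemma smooth_on_sum:
  "open U \<Longrightarrow> (\<And>i. i \<in> I \<Longrightarrow> smooth_on U (f i)) \<Longrightarrow> smooth_on U (\<lambda>x. \<Sum>i\<in>I. f i x)"
  unfolding smooth_on_def by (simp add: Ck_on_sum)

lemma smooth_on_prod:
  fixes f :: "'i \<Rightarrow> 'a::euclidean_space \<Rightarrow> real"
  shows "open U \<Longrightarrow> (\<And>i. i \<in> I \<Longrightarrow> smooth_on U (f i)) \<Longrightarrow> smooth_on U (\<lambda>x. \<Prod>i\<in>I. f i x)"
  unfolding smooth_on_def by (simp add: Ck_on_prod)

lemma smooth_on_compose_real:
  fixes f :: "'a::euclidean_space \<Rightarrow> real" and h :: "real \<Rightarrow> 'b::real_normed_vector"
  shows "open U \<Longrightarrow> smooth_on UNIV h \<Longrightarrow> smooth_on U f \<Longrightarrow> smooth_on U (\<lambda>x. h (f x))"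
  unfolding smooth_on_def by (blast intro: Ck_on_compose_real[where V = UNIV])

lemma smooth_on_ident: "open U \<Longrightarrow> smooth_on U (\<lambda>x. x)"
  by (rule smooth_on_linear) (auto intro: bounded_linear_ident)

lemma smooth_on_has_derivative:
  "smooth_on U f \<Longrightarrow> x \<in> U \<Longrightarrow> (f has_derivative frechet_derivative f (at x)) (at x)"
  unfolding smooth_on_def by (metis Ck_on_Suc_derivative(1))

lemma smooth_on_frechet_derivative:
  assumes "open U" "smooth_on U f" shows "smooth_on U (\<lambda>x. frechet_derivative f (at x) v)"
proof -
  have sb: "smooth_on U (\<lambda>x. frechet_derivative f (at x) b)" if "b \<in> Basis" for b
    using assms(2) that unfolding smooth_on_def by (metis Ck_on.simps(2))
  have "smooth_on U (\<lambda>x. \<Sum>b\<in>Basis. (v \<bullet> b) *\<^sub>R frechet_derivative f (at x) b)"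
  proof (rule smooth_on_sum[OF assms(1)])
    fix b :: 'a assume b: "b \<in> Basis"
    show "smooth_on U (\<lambda>x. (v \<bullet> b) *\<^sub>R frechet_derivative f (at x) b)"
      using smooth_on_bounded_linear[OF assms(1) bounded_linear_scaleR_right sb[OF b]] .
  qed
  moreover have "(\<Sum>b\<in>Basis. (v \<bullet> b) *\<^sub>R frechet_derivative f (at x) b) = frechet_derivative f (at x) v"
    if "x \<in> U" for x
  proof -
    have l: "linear (frechet_derivative f (at x))"
      using smooth_on_has_derivative[OF assms(2) that] by (rule has_derivative_linear)
    have "frechet_derivative f (at x) (\<Sum>b\<in>Basis. (v \<bullet> b) *\<^sub>R b)
        = (\<Sum>b\<in>Basis. (v \<bullet> b) *\<^sub>R frechet_derivative f (at x) b)"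
      by (simp add: linear_sum[OF l] linear_scale[OF l])
    then show ?thesis by (simp add: euclidean_representation)
  qed
  ultimately show ?thesis using smooth_on_cong[OF assms(1)] by (metis (no_types, lifting))
qed

text \<open>The functions \<open>t\<^sup>-\<^sup>m exp (-1/t)\<close>, extended by zero: the family is closed under differentiation,
  which makes all of its members smooth.\<close>

definition flat_pow :: "nat \<Rightarrow> real \<Rightarrow> real" where
  "flat_pow m t = (if t > 0 then inverse t ^ m * exp (- inverse t) else 0)"

definition flat :: "real \<Rightarrow> real" where
  "flat t = (if t > 0 then exp (- inverse t) else 0)"

lemma flat_pow_tendsto_0: "(flat_pow m \<longlongrightarrow> 0) (at_right 0)"
proof -
  have "((\<lambda>x::real. x ^ m / exp x) \<longlongrightarrow> 0) at_top" by (rule tendsto_power_div_exp_0)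
  then have "((\<lambda>t::real. inverse t ^ m / exp (inverse t)) \<longlongrightarrow> 0) (at_right 0)"
    by (rule filterlim_compose) (rule filterlim_inverse_at_top_right)
  then show ?thesis
    by (rule Lim_transform_eventually)
      (auto simp: flat_pow_def exp_minus divide_inverse eventually_at_right_less intro!: eventually_mono[OF eventually_at_right_less])
qed

lemma flat_pow_has_derivative:
  "(flat_pow m has_real_derivative flat_pow (m + 2) t - real m * flat_pow (m + 1) t) (at t)"
proof -
  consider "t > 0" | "t < 0" | "t = 0" by linarith
  then show ?thesis
  proof cases
    case 1
    have "((\<lambda>t. inverse t ^ m * exp (- inverse t)) has_real_derivative
        flat_pow (m + 2) t - real m * flat_pow (m + 1) t) (at t)"
    proof (cases m)
      case 0
      then show ?thesis using 1
        by (auto intro!: derivative_eq_intros simp: flat_pow_def power2_eq_square)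
    next
      case (Suc n)
      have h1: "((\<lambda>t. inverse t ^ Suc n) has_real_derivative - real (Suc n) * inverse t ^ (n + 2)) (at t)"
        using 1 DERIV_power[OF DERIV_inverse', of "\<lambda>t. t" 1 t UNIV "Suc n"] 
        by (simp add: algebra_simps power2_eq_square)
      have h2: "((\<lambda>t. exp (- inverse t)) has_real_derivative exp (- inverse t) * (inverse t)\<^sup>2) (at t)"
        using 1 by (auto intro!: derivative_eq_intros simp: power2_eq_square)
      have "((\<lambda>t. inverse t ^ m * exp (- inverse t)) has_real_derivative
          - real (Suc n) * inverse t ^ (n + 2) * exp (- inverse t)
          + exp (- inverse t) * (inverse t)\<^sup>2 * inverse t ^ Suc n) (at t)"
        using DERIV_mult[OF h1 h2] unfolding Suc .
      then show ?thesis
        by (rule DERIV_cong) (use 1 Suc in \<open>simp add: flat_pow_def algebra_simps power2_eq_square\<close>)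
    qed
    then show ?thesis
      by (rule DERIV_cong_ev[THEN iffD1, rotated -1])
        (use 1 in \<open>auto simp: flat_pow_def intro!: eventually_mono[OF eventually_nhds_in_open[of "{0<..}"]]\<close>)
  next
    case 2
    have "((\<lambda>t. 0) has_real_derivative flat_pow (m + 2) t - real m * flat_pow (m + 1) t) (at t)"
      using 2 by (simp add: flat_pow_def)
    then show ?thesis
      by (rule DERIV_cong_ev[THEN iffD1, rotated -1])
        (use 2 in \<open>auto simp: flat_pow_def intro!: eventually_mono[OF eventually_nhds_in_open[of "{..<0}"]]\<close>)
  next
    case 3
    have "((\<lambda>y. flat_pow m y / y) \<longlongrightarrow> 0) (at_right 0)"
      using flat_pow_tendsto_0[of "m + 1"]
      by (rule Lim_transform_eventually)
        (auto simp: flat_pow_def divide_inverse intro!: eventually_mono[OF eventually_at_right_less])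
    moreover have "((\<lambda>y. flat_pow m y / y) \<longlongrightarrow> 0) (at_left 0)"
      by (rule Lim_transform_eventually[where f = "\<lambda>y. 0"])
        (auto simp: flat_pow_def eventually_at_filter)
    ultimately have "((\<lambda>y. flat_pow m y / y) \<longlongrightarrow> 0) (at 0)"
      by (simp add: filterlim_at_split)
    then show ?thesis using 3 by (simp add: has_field_derivative_iff flat_pow_def)
  qed
qed

lemma Ck_on_flat_pow: "Ck_on k UNIV (flat_pow m)"
proof (induction k arbitrary: m)
  case 0
  have "isCont (flat_pow m) t" for t using flat_pow_has_derivative by (rule DERIV_isCont)
  then show ?case by (auto intro: continuous_at_imp_continuous_on)
next
  case (Suc k)
  have "(flat_pow m has_derivative (\<lambda>h. h * (flat_pow (m + 2) t - real m * flat_pow (m + 1) t))) (at t)" for t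
    using flat_pow_has_derivative[of m t] by (simp add: has_field_derivative_def mult_commute_abs)
  then show ?case
    using Suc by (intro Ck_on_derivI[where f' = "\<lambda>t h. h * (flat_pow (m + 2) t - real m * flat_pow (m + 1) t)"]
        Ck_on_mult Ck_on_diff) auto
qed

lemma flat_eq_flat_pow: "flat = flat_pow 0"
  by (auto simp: flat_def flat_pow_def)

lemma smooth_on_flat: "smooth_on UNIV flat"
  by (simp add: smooth_on_def flat_eq_flat_pow Ck_on_flat_pow)

lemma flat_has_derivative: "(flat has_real_derivative flat_pow 2 t) (at t)"
  using flat_pow_has_derivative[of 0 t] by (simp add: flat_eq_flat_pow numeral_2_eq_2)

lemma flat_nonneg [simp]: "0 \<le> flat t" and flat_le_1 [simp]: "flat t \<le> 1"
  and flat_pos_iff [simp]: "0 < flat t \<longleftrightarrow> 0 < t" and flat_eq_0_iff [simp]: "flat t = 0 \<longleftrightarrow> t \<le> 0"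
  by (auto simp: flat_def)

lemma flat_tendsto_1: "(flat \<longlongrightarrow> 1) at_top"
proof -
  have "((\<lambda>t::real. exp (- inverse t)) \<longlongrightarrow> exp (- 0)) at_top"
    by (intro tendsto_intros tendsto_inverse_0_at_top filterlim_ident)
  then show ?thesis
    by (rule Lim_transform_eventually[where f = "\<lambda>t. exp (- inverse t)", THEN tendsto_eq_rhs])
      (auto simp: flat_def eventually_at_top_dense intro!: exI[of _ 0])
qed

lemma smooth_on_flat_compose:
  fixes f :: "'a::euclidean_space \<Rightarrow> real"
  shows "open U \<Longrightarrow> smooth_on U f \<Longrightarrow> smooth_on U (\<lambda>x. flat (f x))"
  by (rule smooth_on_compose_real[OF _ smooth_on_flat])

section \<open>Integration over measurable sets\<close>

lemma AE_lebesgue_on_iff: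
  "S \<in> sets lebesgue \<Longrightarrow> (AE x in lebesgue_on S. P x) \<longleftrightarrow> (AE x in lebesgue. x \<in> S \<longrightarrow> P x)"
  by (rule AE_restrict_space_iff) simp

lemma integrable_lebesgue_on_iff:
  fixes f :: "'a::euclidean_space \<Rightarrow> 'b::euclidean_space"
  shows "S \<in> sets lebesgue \<Longrightarrow> integrable (lebesgue_on S) f \<longleftrightarrow> integrable lebesgue (\<lambda>x. indicator S x *\<^sub>R f x)"
  by (rule integrable_restrict_space) simp

lemma integral_lebesgue_on_eq:
  fixes f :: "'a::euclidean_space \<Rightarrow> 'b::euclidean_space"
  shows "S \<in> sets lebesgue \<Longrightarrow> integral\<^sup>L (lebesgue_on S) f = integral\<^sup>L lebesgue (\<lambda>x. indicator S x *\<^sub>R f x)"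
  by (rule integral_restrict_space) simp

lemma AE_measurable_lebesgue:
  fixes f g :: "'a::euclidean_space \<Rightarrow> 'b::euclidean_space"
  assumes f: "f \<in> borel_measurable lebesgue" and ae: "AE x in lebesgue. f x = g x"
  shows "g \<in> borel_measurable lebesgue"
proof (rule measurableI)
  fix A :: "'b set" assume "A \<in> sets borel"
  then have fA: "f -` A \<in> sets lebesgue" using measurable_sets[OF f, of A] by simp
  obtain N where N: "N \<in> null_sets lebesgue" "{x. f x \<noteq> g x} \<subseteq> N"
    using ae by (auto simp: eventually_ae_filter)
  have "g -` A \<inter> N \<in> sets lebesgue"
    using N(1) null_sets_completion_subset[of "g -` A \<inter> N" N lborel] by auto
  moreover have "g -` A = (f -` A - N) \<union> (g -` A \<inter> N)" using N(2) by force
  ultimately show "g -` A \<inter> space lebesgue \<in> sets lebesgue"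
    using fA N(1) by (metis null_setsD2 sets.Diff sets.Int_space_eq2 sets.Un)
qed simp

lemma AE_measurable_lebesgue_on:
  fixes f g :: "'a::euclidean_space \<Rightarrow> 'b::euclidean_space"
  assumes S: "S \<in> sets lebesgue" and f: "f \<in> borel_measurable (lebesgue_on S)"
    and ae: "AE x in lebesgue_on S. f x = g x"
  shows "g \<in> borel_measurable (lebesgue_on S)"
proof -
  have "(\<lambda>x. if x \<in> S then f x else 0) \<in> borel_measurable lebesgue"
    using f borel_measurable_if[OF S, of f] by simp
  then have "(\<lambda>x. if x \<in> S then g x else 0) \<in> borel_measurable lebesgue"
    by (rule AE_measurable_lebesgue) (use ae in \<open>auto simp: AE_lebesgue_on_iff[OF S] elim!: eventually_mono\<close>)
  then show ?thesis using borel_measurable_if[OF S, of g] by simp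
qed

lemma integral_cong_AE_lebesgue_on:
  fixes f g :: "'a::euclidean_space \<Rightarrow> 'b::euclidean_space"
  assumes S: "S \<in> sets lebesgue" and ae: "AE x in lebesgue_on S. f x = g x"
  shows "integral\<^sup>L (lebesgue_on S) f = integral\<^sup>L (lebesgue_on S) g"
proof (cases "f \<in> borel_measurable (lebesgue_on S)")
  case True
  then show ?thesis
    using AE_measurable_lebesgue_on[OF S True ae] ae by (intro integral_cong_AE) auto
next
  case False
  have "g \<notin> borel_measurable (lebesgue_on S)"
    using AE_measurable_lebesgue_on[OF S, of g f] ae False by (auto simp: eq_commute)
  then show ?thesis using False by (metis integrable_iff_bounded not_integrable_integral_eq)
qed

lemma continuous_measurable_lebesgue_on:
  fixes f :: "'a::euclidean_space \<Rightarrow> 'b::euclidean_space"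
  assumes "continuous_on UNIV f" shows "f \<in> borel_measurable (lebesgue_on S)"
proof -
  have "f \<in> borel_measurable lborel" using borel_measurable_continuous_onI[OF assms] by simp
  then show ?thesis by (intro measurable_restrict_space1 measurable_completion)
qed

lemma integrable_continuous_lebesgue_on:
  fixes f :: "'a::euclidean_space \<Rightarrow> 'b::euclidean_space"
  assumes "bounded S" "S \<in> sets lebesgue" "continuous_on UNIV f"
  shows "integrable (lebesgue_on S) f"
proof -
  obtain M where M: "\<And>x. x \<in> closure S \<Longrightarrow> norm (f x) \<le> M"
    using compact_imp_bounded[OF compact_continuous_image[OF continuous_on_subset[OF assms(3)]], of "closure S"]
      assms(1) by (auto simp: bounded_iff compact_closure)
  have "integrable (lebesgue_on S) (\<lambda>x. M)"
  proof -
    have "S \<in> lmeasurable" using assms(1,2) by (rule bounded_set_imp_lmeasurable)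
    then have "integrable lebesgue (indicator S :: 'a \<Rightarrow> real)"
      using integrable_real_indicator[of S lebesgue] by (auto simp: fmeasurable_def)
    then show ?thesis
      using integrable_scaleR_left[of M lebesgue "indicator S :: 'a \<Rightarrow> real"]
      by (simp add: integrable_lebesgue_on_iff[OF assms(2)])
  qed
  then show ?thesis
  proof (rule Bochner_Integration.integrable_bound)
    show "AE x in lebesgue_on S. norm (f x) \<le> norm M"
      using M closure_subset[of S] by (auto simp: AE_lebesgue_on_iff[OF assms(2)] intro!: AE_I2 order_trans[OF M])
  qed (use assms in \<open>auto intro: continuous_measurable_lebesgue_on\<close>)
qed

section \<open>The space L2\<close>

definition L2_inner :: "'a::euclidean_space set \<Rightarrow> ('a \<Rightarrow> 'b::euclidean_space) \<Rightarrow> ('a \<Rightarrow> 'b) \<Rightarrow> real" where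
  "L2_inner \<Omega> f g = (LINT x|lebesgue_on \<Omega>. f x \<bullet> g x)"

lemma L2_onD: "L2_on \<Omega> f \<Longrightarrow> f \<in> borel_measurable (lebesgue_on \<Omega>)"
  by (simp add: L2_on_def)

lemma L2_on_dominated:
  assumes g: "L2_on \<Omega> g" and f: "f \<in> borel_measurable (lebesgue_on \<Omega>)"
    and le: "AE x in lebesgue_on \<Omega>. norm (f x) \<le> C * norm (g x)"
  shows "L2_on \<Omega> f"
  unfolding L2_on_def
proof
  have "integrable (lebesgue_on \<Omega>) (\<lambda>x. C\<^sup>2 * (norm (g x))\<^sup>2)"
    using g by (auto simp: L2_on_def)
  then show "integrable (lebesgue_on \<Omega>) (\<lambda>x. (norm (f x))\<^sup>2)"
  proof (rule Bochner_Integration.integrable_bound)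
    show "AE x in lebesgue_on \<Omega>. norm ((norm (f x))\<^sup>2) \<le> norm (C\<^sup>2 * (norm (g x))\<^sup>2)"
      using le
    proof eventually_elim
      case (elim x)
      have "(norm (f x))\<^sup>2 \<le> (C * norm (g x))\<^sup>2" by (rule power_mono[OF elim]) simp
      then show ?case by (simp add: power_mult_distrib)
    qed
  qed (use f in simp)
qed (rule f)

lemma L2_inner_integrable:
  assumes "L2_on \<Omega> f" "L2_on \<Omega> g"
  shows "integrable (lebesgue_on \<Omega>) (\<lambda>x. f x \<bullet> g x)"
proof (rule Bochner_Integration.integrable_bound)
  show "integrable (lebesgue_on \<Omega>) (\<lambda>x. (norm (f x))\<^sup>2 + (norm (g x))\<^sup>2)"
    using assms by (auto simp: L2_on_def)
  show "AE x in lebesgue_on \<Omega>. norm (f x \<bullet> g x) \<le> norm ((norm (f x))\<^sup>2 + (norm (g x))\<^sup>2)"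
  proof (rule AE_I2)
    fix x
    have "\<bar>f x \<bullet> g x\<bar> \<le> norm (f x) * norm (g x)" by (rule Cauchy_Schwarz_ineq2)
    also have "\<dots> \<le> (norm (f x))\<^sup>2 + (norm (g x))\<^sup>2"
      using sum_squares_bound[of "norm (f x)" "norm (g x)"]
        mult_nonneg_nonneg[OF norm_ge_zero[of "f x"] norm_ge_zero[of "g x"]] by linarith
    finally show "norm (f x \<bullet> g x) \<le> norm ((norm (f x))\<^sup>2 + (norm (g x))\<^sup>2)" by simp
  qed
qed (use assms in \<open>auto dest!: L2_onD\<close>)

lemma L2_on_zero [simp]: "L2_on \<Omega> (\<lambda>x. 0)"
  by (simp add: L2_on_def)

lemma L2_on_scaleR:
  assumes "L2_on \<Omega> f" shows "L2_on \<Omega> (\<lambda>x. c *\<^sub>R f x)"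
  by (rule L2_on_dominated[OF assms, where C = "\<bar>c\<bar>"]) (use L2_onD[OF assms] in auto)

lemma L2_on_add:
  assumes "L2_on \<Omega> f" "L2_on \<Omega> g" shows "L2_on \<Omega> (\<lambda>x. f x + g x)"
proof -
  have "integrable (lebesgue_on \<Omega>) (\<lambda>x. (norm (f x))\<^sup>2 + (norm (g x))\<^sup>2 + 2 * (f x \<bullet> g x))"
    using assms L2_inner_integrable[OF assms] by (auto simp: L2_on_def)
  moreover have "(norm (f x))\<^sup>2 + (norm (g x))\<^sup>2 + 2 * (f x \<bullet> g x) = (norm (f x + g x))\<^sup>2" for x
    by (simp add: power2_norm_eq_inner inner_simps inner_commute)
  ultimately show ?thesis using assms by (auto simp: L2_on_def)
qed

lemma L2_on_minus: "L2_on \<Omega> f \<Longrightarrow> L2_on \<Omega> (\<lambda>x. - f x)"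
  using L2_on_scaleR[of \<Omega> f "-1"] by simp

lemma L2_on_diff: "L2_on \<Omega> f \<Longrightarrow> L2_on \<Omega> g \<Longrightarrow> L2_on \<Omega> (\<lambda>x. f x - g x)"
  using L2_on_add[OF _ L2_on_minus, of \<Omega> f g] by simp

lemma L2_on_sum: "(\<And>i. i \<in> I \<Longrightarrow> L2_on \<Omega> (f i)) \<Longrightarrow> L2_on \<Omega> (\<lambda>x. \<Sum>i\<in>I. f i x)"
  by (induction I rule: infinite_finite_induct) (auto intro: L2_on_add)

lemma L2_on_bounded_linear:
  fixes l :: "'b::euclidean_space \<Rightarrow> 'c::euclidean_space"
  assumes "L2_on \<Omega> f" "bounded_linear l" shows "L2_on \<Omega> (\<lambda>x. l (f x))"
proof (rule L2_on_dominated[OF assms(1), where C = "onorm l"])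
  have "l \<in> borel_measurable borel"
    using assms(2) by (intro borel_measurable_continuous_onI linear_continuous_on)
  then show "(\<lambda>x. l (f x)) \<in> borel_measurable (lebesgue_on \<Omega>)"
    using L2_onD[OF assms(1)] by (rule measurable_compose[rotated])
qed (use onorm[OF assms(2)] in simp)

lemma L2_on_AE_cong:
  assumes "\<Omega> \<in> sets lebesgue" "L2_on \<Omega> f" "AE x in lebesgue_on \<Omega>. f x = g x"
  shows "L2_on \<Omega> g"
proof (rule L2_on_dominated[OF assms(2), where C = 1])
  show "g \<in> borel_measurable (lebesgue_on \<Omega>)"
    by (rule AE_measurable_lebesgue_on[OF assms(1) L2_onD[OF assms(2)] assms(3)])
qed (use assms(3) in \<open>auto elim!: eventually_mono\<close>)

lemma L2_on_continuous:
  fixes f :: "'a::euclidean_space \<Rightarrow> 'b::euclidean_space"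
  assumes "bounded \<Omega>" "\<Omega> \<in> sets lebesgue" "continuous_on UNIV f"
  shows "L2_on \<Omega> f"
  unfolding L2_on_def using assms
  by (auto intro!: continuous_measurable_lebesgue_on integrable_continuous_lebesgue_on continuous_intros)

lemma L2_on_integrable:
  fixes f :: "'a::euclidean_space \<Rightarrow> 'b::euclidean_space"
  assumes "bounded \<Omega>" "\<Omega> \<in> sets lebesgue" "L2_on \<Omega> f"
  shows "integrable (lebesgue_on \<Omega>) f"
proof (rule Bochner_Integration.integrable_bound)
  show "integrable (lebesgue_on \<Omega>) (\<lambda>x. 1 + (norm (f x))\<^sup>2)"
    using assms integrable_continuous_lebesgue_on[OF assms(1,2), of "\<lambda>x. 1::real"] by (auto simp: L2_on_def)
  show "AE x in lebesgue_on \<Omega>. norm (f x) \<le> norm (1 + (norm (f x))\<^sup>2)"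
  proof (rule AE_I2)
    fix x
    have "0 \<le> (norm (f x) - 1)\<^sup>2 + norm (f x)" by simp
    then show "norm (f x) \<le> norm (1 + (norm (f x))\<^sup>2)" by (simp add: power2_eq_square algebra_simps)
  qed
qed (use assms in \<open>auto dest: L2_onD\<close>)

lemma L2_inner_commute: "L2_inner \<Omega> f g = L2_inner \<Omega> g f"
  by (simp add: L2_inner_def inner_commute)

lemma L2_inner_cong_AE:
  assumes "\<Omega> \<in> sets lebesgue" "AE x in lebesgue_on \<Omega>. f x = f' x" "AE x in lebesgue_on \<Omega>. g x = g' x"
  shows "L2_inner \<Omega> f g = L2_inner \<Omega> f' g'"
  unfolding L2_inner_def
  by (rule integral_cong_AE_lebesgue_on[OF assms(1)]) (use assms(2,3) in eventually_elim, simp)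

lemma L2_inner_add_left:
  assumes "L2_on \<Omega> f" "L2_on \<Omega> g" "L2_on \<Omega> h"
  shows "L2_inner \<Omega> (\<lambda>x. f x + g x) h = L2_inner \<Omega> f h + L2_inner \<Omega> g h"
  using assms by (simp add: L2_inner_def inner_add_left L2_inner_integrable)

lemma L2_inner_diff_left:
  assumes "L2_on \<Omega> f" "L2_on \<Omega> g" "L2_on \<Omega> h"
  shows "L2_inner \<Omega> (\<lambda>x. f x - g x) h = L2_inner \<Omega> f h - L2_inner \<Omega> g h"
  using assms by (simp add: L2_inner_def inner_diff_left L2_inner_integrable)

lemma L2_inner_scaleR_left: "L2_inner \<Omega> (\<lambda>x. c *\<^sub>R f x) h = c * L2_inner \<Omega> f h"
  by (simp add: L2_inner_def)

lemma L2_inner_add_right: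
  assumes "L2_on \<Omega> f" "L2_on \<Omega> g" "L2_on \<Omega> h"
  shows "L2_inner \<Omega> h (\<lambda>x. f x + g x) = L2_inner \<Omega> h f + L2_inner \<Omega> h g"
  using L2_inner_add_left[OF assms] by (simp add: L2_inner_commute)

lemma L2_inner_diff_right:
  assumes "L2_on \<Omega> f" "L2_on \<Omega> g" "L2_on \<Omega> h"
  shows "L2_inner \<Omega> h (\<lambda>x. f x - g x) = L2_inner \<Omega> h f - L2_inner \<Omega> h g"
  using L2_inner_diff_left[OF assms] by (simp add: L2_inner_commute)

lemma L2_inner_scaleR_right: "L2_inner \<Omega> h (\<lambda>x. c *\<^sub>R f x) = c * L2_inner \<Omega> h f"
  by (simp add: L2_inner_def)

lemma L2_inner_self_nonneg: "0 \<le> L2_inner \<Omega> f f"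
  by (simp add: L2_inner_def)

lemma L2_norm_on_nonneg [simp]: "0 \<le> L2_norm_on \<Omega> f"
  by (simp add: L2_norm_on_def)

lemma L2_norm_on_square: "(L2_norm_on \<Omega> f)\<^sup>2 = L2_inner \<Omega> f f"
  by (simp add: L2_norm_on_def L2_inner_def power2_norm_eq_inner)

lemma L2_Cauchy_Schwarz:
  assumes "L2_on \<Omega> f" "L2_on \<Omega> g"
  shows "\<bar>L2_inner \<Omega> f g\<bar> \<le> L2_norm_on \<Omega> f * L2_norm_on \<Omega> g"
proof -
  let ?i = "L2_inner \<Omega>"
  have q: "0 \<le> ?i f f - 2 * t * ?i f g + t\<^sup>2 * ?i g g" for t
  proof -
    have "0 \<le> ?i (\<lambda>x. f x - t *\<^sub>R g x) (\<lambda>x. f x - t *\<^sub>R g x)" by (rule L2_inner_self_nonneg)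
    also have "\<dots> = ?i f f - 2 * t * ?i f g + t\<^sup>2 * ?i g g"
      using assms by (simp add: L2_inner_diff_left L2_inner_diff_right L2_inner_scaleR_left
          L2_inner_scaleR_right L2_on_scaleR L2_on_diff L2_inner_commute[of \<Omega> g f] power2_eq_square algebra_simps)
    finally show ?thesis .
  qed
  have "(?i f g)\<^sup>2 \<le> ?i f f * ?i g g"
  proof (cases "?i g g = 0")
    case True
    have "?i f g = 0"
    proof (rule ccontr)
      assume "?i f g \<noteq> 0"
      then show False using q[of "(?i f f + 1) / (2 * ?i f g)"] True by (simp add: field_simps)
    qed
    then show ?thesis using True by simp
  next
    case False
    then have "0 < ?i g g" using L2_inner_self_nonneg[of \<Omega> g] by simp
    then show ?thesis using q[of "?i f g / ?i g g"] by (simp add: field_simps power2_eq_square)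
  qed
  then have "sqrt ((?i f g)\<^sup>2) \<le> sqrt (?i f f * ?i g g)" by (rule real_sqrt_le_mono)
  then show ?thesis
    by (simp add: real_sqrt_mult L2_norm_on_def L2_inner_def power2_norm_eq_inner)
qed

lemma L2_norm_triangle:
  assumes "L2_on \<Omega> f" "L2_on \<Omega> g"
  shows "L2_norm_on \<Omega> (\<lambda>x. f x + g x) \<le> L2_norm_on \<Omega> f + L2_norm_on \<Omega> g"
proof (rule power2_le_imp_le)
  show "(L2_norm_on \<Omega> (\<lambda>x. f x + g x))\<^sup>2 \<le> (L2_norm_on \<Omega> f + L2_norm_on \<Omega> g)\<^sup>2"
    unfolding power2_sum L2_norm_on_square
    using assms L2_Cauchy_Schwarz[OF assms]
    by (simp add: L2_inner_add_left L2_inner_add_right L2_on_add L2_inner_commute[of \<Omega> g f])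
qed simp

lemma L2_norm_minus: "L2_norm_on \<Omega> (\<lambda>x. - f x) = L2_norm_on \<Omega> f"
  by (simp add: L2_norm_on_def)

lemma L2_norm_diff_commute: "L2_norm_on \<Omega> (\<lambda>x. f x - g x) = L2_norm_on \<Omega> (\<lambda>x. g x - f x)"
  by (simp add: L2_norm_on_def norm_minus_commute)

lemma L2_norm_cong_AE:
  assumes "\<Omega> \<in> sets lebesgue" "AE x in lebesgue_on \<Omega>. f x = g x"
  shows "L2_norm_on \<Omega> f = L2_norm_on \<Omega> g"
proof -
  have "(L2_norm_on \<Omega> f)\<^sup>2 = (L2_norm_on \<Omega> g)\<^sup>2"
    unfolding L2_norm_on_square by (rule L2_inner_cong_AE[OF assms(1,2,2)])
  then show ?thesis by simp
qed

lemma L2_norm_eq_0_imp_AE: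
  assumes "L2_on \<Omega> f" "L2_norm_on \<Omega> f = 0"
  shows "AE x in lebesgue_on \<Omega>. f x = 0"
proof -
  have "integral\<^sup>L (lebesgue_on \<Omega>) (\<lambda>x. (norm (f x))\<^sup>2) = 0"
    using assms(2) by (simp add: L2_norm_on_def)
  then have "AE x in lebesgue_on \<Omega>. (norm (f x))\<^sup>2 = 0"
    using assms(1) integral_nonneg_eq_0_iff_AE[of "lebesgue_on \<Omega>" "\<lambda>x. (norm (f x))\<^sup>2"]
    by (simp add: L2_on_def)
  then show ?thesis by simp
qed

lemma L2_inner_tendsto:
  assumes "\<And>k. L2_on \<Omega> (f k)" "L2_on \<Omega> f'" "L2_on \<Omega> g"
    and lim: "((\<lambda>k. L2_norm_on \<Omega> (\<lambda>x. f k x - f' x)) \<longlongrightarrow> 0) F"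
  shows "((\<lambda>k. L2_inner \<Omega> (f k) g) \<longlongrightarrow> L2_inner \<Omega> f' g) F"
proof -
  have "((\<lambda>k. L2_norm_on \<Omega> (\<lambda>x. f k x - f' x) * L2_norm_on \<Omega> g) \<longlongrightarrow> 0) F"
    using tendsto_mult_right[OF lim, of "L2_norm_on \<Omega> g"] by simp
  then have "((\<lambda>k. L2_inner \<Omega> (\<lambda>x. f k x - f' x) g) \<longlongrightarrow> 0) F"
    by (rule Lim_null_comparison[rotated]) (use assms in \<open>auto intro!: always_eventually L2_Cauchy_Schwarz L2_on_diff\<close>)
  then have "((\<lambda>k. L2_inner \<Omega> (f k) g - L2_inner \<Omega> f' g) \<longlongrightarrow> 0) F"
    using assms by (simp add: L2_inner_diff_left)
  then show ?thesis by (simp add: LIM_zero_iff)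
qed

lemma L2_norm_tendsto:
  assumes "\<And>k. L2_on \<Omega> (f k)" "L2_on \<Omega> f'"
    and lim: "((\<lambda>k. L2_norm_on \<Omega> (\<lambda>x. f k x - f' x)) \<longlongrightarrow> 0) F"
  shows "((\<lambda>k. L2_norm_on \<Omega> (f k)) \<longlongrightarrow> L2_norm_on \<Omega> f') F"
proof -
  have "\<bar>L2_norm_on \<Omega> (f k) - L2_norm_on \<Omega> f'\<bar> \<le> L2_norm_on \<Omega> (\<lambda>x. f k x - f' x)" for k
    using L2_norm_triangle[OF L2_on_diff[OF assms(1)[of k] assms(2)] assms(2)]
      L2_norm_triangle[OF L2_on_diff[OF assms(2) assms(1)[of k]] assms(1)[of k]]
      L2_norm_diff_commute[of \<Omega> "f k" f'] by simp
  then have "((\<lambda>k. L2_norm_on \<Omega> (f k) - L2_norm_on \<Omega> f') \<longlongrightarrow> 0) F"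
    by (intro Lim_null_comparison[OF _ lim] always_eventually) simp
  then show ?thesis by (simp add: LIM_zero_iff)
qed

lemma L2_tendsto_dominated:
  fixes f :: "nat \<Rightarrow> 'a::euclidean_space \<Rightarrow> 'b::euclidean_space"
  assumes "\<And>k. f k \<in> borel_measurable (lebesgue_on \<Omega>)" "L2_on \<Omega> g"
    and "\<And>k. AE x in lebesgue_on \<Omega>. norm (f k x) \<le> norm (g x)"
    and "AE x in lebesgue_on \<Omega>. (\<lambda>k. f k x) \<longlonglongrightarrow> 0"
  shows "(\<lambda>k. L2_norm_on \<Omega> (f k)) \<longlonglongrightarrow> 0"
proof -
  have "(\<lambda>k. LINT x|lebesgue_on \<Omega>. (norm (f k x))\<^sup>2) \<longlonglongrightarrow> (LINT x|lebesgue_on \<Omega>. 0)"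
  proof (rule integral_dominated_convergence[where w = "\<lambda>x. (norm (g x))\<^sup>2"])
    show "AE x in lebesgue_on \<Omega>. (\<lambda>k. (norm (f k x))\<^sup>2) \<longlonglongrightarrow> 0"
      using assms(4) by eventually_elim (auto intro!: tendsto_eq_intros)
    show "AE x in lebesgue_on \<Omega>. norm ((norm (f k x))\<^sup>2) \<le> (norm (g x))\<^sup>2" for k
      using assms(3)[of k] by eventually_elim (auto intro!: power_mono)
  qed (use assms in \<open>auto simp: L2_on_def\<close>)
  then have "(\<lambda>k. sqrt (LINT x|lebesgue_on \<Omega>. (norm (f k x))\<^sup>2)) \<longlonglongrightarrow> sqrt 0"
    by (intro tendsto_real_sqrt) simp
  then show ?thesis by (simp add: L2_norm_on_def)
qed

section \<open>Weak derivatives\<close>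

text \<open>Schwarz's theorem: two applications of the mean value theorem express the mixed second difference, which is
  symmetric in the two directions, by a second derivative near the base point.\<close>

lemma mixed_second_difference:
  fixes f :: "'a::real_normed_vector \<Rightarrow> real"
  assumes d1: "\<And>x. (f has_derivative f' x) (at x)"
    and d2: "\<And>x. ((\<lambda>x. f' x u) has_derivative f'' x) (at x)" and "h > 0"
  shows "\<exists>r\<in>{0<..<h}. \<exists>s\<in>{0<..<h}.
    f (x + h *\<^sub>R u + h *\<^sub>R v) - f (x + h *\<^sub>R u) - f (x + h *\<^sub>R v) + f x = h\<^sup>2 * f'' (x + r *\<^sub>R u + s *\<^sub>R v) v"
proof -
  define \<phi> where "\<phi> r = f (x + r *\<^sub>R u + h *\<^sub>R v) - f (x + r *\<^sub>R u)" for r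
  have lin: "linear (f' y)" "linear (f'' y)" for y
    using has_derivative_linear d1 d2 by blast+
  have "(\<phi> has_real_derivative f' (x + r *\<^sub>R u + h *\<^sub>R v) u - f' (x + r *\<^sub>R u) u) (at r)" for r
    unfolding \<phi>_def has_field_derivative_def
    by (rule has_derivative_eq_rhs[OF has_derivative_diff[OF
          has_derivative_compose[where g = f, OF _ d1] has_derivative_compose[where g = f, OF _ d1]]])
      (auto intro!: derivative_eq_intros simp: fun_eq_iff linear_scale[OF lin(1)] algebra_simps)
  then obtain r where r: "0 < r" "r < h"
    and r_eq: "\<phi> h - \<phi> 0 = h * (f' (x + r *\<^sub>R u + h *\<^sub>R v) u - f' (x + r *\<^sub>R u) u)"
    using MVT2[OF \<open>h > 0\<close>, of \<phi> "\<lambda>r. f' (x + r *\<^sub>R u + h *\<^sub>R v) u - f' (x + r *\<^sub>R u) u"] by auto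
  have "((\<lambda>s. f' (x + r *\<^sub>R u + s *\<^sub>R v) u) has_real_derivative f'' (x + r *\<^sub>R u + s *\<^sub>R v) v) (at s)" for s
    unfolding has_field_derivative_def
    by (rule has_derivative_eq_rhs[OF has_derivative_compose[where g = "\<lambda>y. f' y u", OF _ d2]])
      (auto intro!: derivative_eq_intros simp: fun_eq_iff linear_scale[OF lin(2)] algebra_simps)
  then obtain s where s: "0 < s" "s < h"
    and "f' (x + r *\<^sub>R u + h *\<^sub>R v) u - f' (x + r *\<^sub>R u + 0 *\<^sub>R v) u = h * f'' (x + r *\<^sub>R u + s *\<^sub>R v) v"
    using MVT2[OF \<open>h > 0\<close>, of "\<lambda>s. f' (x + r *\<^sub>R u + s *\<^sub>R v) u" "\<lambda>s. f'' (x + r *\<^sub>R u + s *\<^sub>R v) v"] by auto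
  with r_eq have "\<phi> h - \<phi> 0 = h * (h * f'' (x + r *\<^sub>R u + s *\<^sub>R v) v)" by simp
  then show ?thesis
    using r s by (intro bexI[of _ r] bexI[of _ s]) (auto simp: \<phi>_def power2_eq_square)
qed

lemma mixed_derivatives_commute:
  fixes f :: "'a::real_normed_vector \<Rightarrow> real"
  assumes d1: "\<And>x. (f has_derivative f' x) (at x)"
    and du: "\<And>x. ((\<lambda>x. f' x u) has_derivative fu x) (at x)" and dv: "\<And>x. ((\<lambda>x. f' x v) has_derivative fv x) (at x)"
    and cu: "continuous_on UNIV (\<lambda>x. fu x v)" and cv: "continuous_on UNIV (\<lambda>x. fv x u)"
  shows "fu x v = fv x u"
proof -
  have "\<exists>z w. dist z x \<le> inverse (real (Suc n)) * (norm u + norm v) \<and>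
      dist w x \<le> inverse (real (Suc n)) * (norm u + norm v) \<and> fu z v = fv w u" for n
  proof -
    define h where "h = inverse (real (Suc n))"
    have h: "h > 0" by (simp add: h_def)
    have small: "dist (x + p *\<^sub>R a + r *\<^sub>R b) x \<le> h * (norm a + norm b)"
      if "p \<in> {0<..<h}" "r \<in> {0<..<h}" for p r and a b :: 'a
    proof -
      have "dist (x + p *\<^sub>R a + r *\<^sub>R b) x \<le> norm (p *\<^sub>R a) + norm (r *\<^sub>R b)"
        by (simp add: dist_norm add.assoc norm_triangle_ineq del: norm_scaleR)
      also have "\<dots> \<le> h * norm a + h * norm b"
        using that by (auto intro!: add_mono mult_right_mono)
      finally show ?thesis by (simp add: distrib_left)
    qed
    obtain p r where pr: "p \<in> {0<..<h}" "r \<in> {0<..<h}" and 1: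
      "f (x + h *\<^sub>R u + h *\<^sub>R v) - f (x + h *\<^sub>R u) - f (x + h *\<^sub>R v) + f x = h\<^sup>2 * fu (x + p *\<^sub>R u + r *\<^sub>R v) v"
      using mixed_second_difference[OF d1 du h, of x v] by blast
    obtain p' r' where pr': "p' \<in> {0<..<h}" "r' \<in> {0<..<h}" and 2:
      "f (x + h *\<^sub>R v + h *\<^sub>R u) - f (x + h *\<^sub>R v) - f (x + h *\<^sub>R u) + f x = h\<^sup>2 * fv (x + p' *\<^sub>R v + r' *\<^sub>R u) u"
      using mixed_second_difference[OF d1 dv h, of x u] by blast
    have "f (x + h *\<^sub>R u + h *\<^sub>R v) = f (x + h *\<^sub>R v + h *\<^sub>R u)" by (simp add: algebra_simps)
    then have "h\<^sup>2 * fu (x + p *\<^sub>R u + r *\<^sub>R v) v = h\<^sup>2 * fv (x + p' *\<^sub>R v + r' *\<^sub>R u) u"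
      using 1 2 by linarith
    then have "fu (x + p *\<^sub>R u + r *\<^sub>R v) v = fv (x + p' *\<^sub>R v + r' *\<^sub>R u) u" using h by simp
    then show ?thesis
      using small[OF pr, of u v] small[OF pr', of v u] unfolding h_def by (metis add.commute)
  qed
  then obtain z w where zw: "\<And>n. dist (z n) x \<le> inverse (real (Suc n)) * (norm u + norm v)"
      "\<And>n. dist (w n) x \<le> inverse (real (Suc n)) * (norm u + norm v)"
    and eq: "\<And>n. fu (z n) v = fv (w n) u"
    by metis
  have "(\<lambda>n. inverse (real (Suc n)) * (norm u + norm v)) \<longlonglongrightarrow> 0 * (norm u + norm v)"
    by (intro tendsto_mult_right LIMSEQ_inverse_real_of_nat)
  then have lim0: "(\<lambda>n. inverse (real (Suc n)) * (norm u + norm v)) \<longlonglongrightarrow> 0" by simp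
  have "z \<longlonglongrightarrow> x" "w \<longlonglongrightarrow> x"
    using zw by (auto simp: tendsto_dist_iff[of _ x] intro!: Lim_null_comparison[OF _ lim0] always_eventually
        simp del: of_nat_Suc)
  then have "(\<lambda>n. fu (z n) v) \<longlonglongrightarrow> fu x v" "(\<lambda>n. fv (w n) u) \<longlonglongrightarrow> fv x u"
    using isCont_tendsto_compose[of x "\<lambda>y. fu y v"] isCont_tendsto_compose[of x "\<lambda>y. fv y u"] cu cv
    by (auto simp: continuous_on_eq_continuous_at)
  then show ?thesis unfolding eq by (rule LIMSEQ_unique)
qed

lemma has_derivative_vanishing_outside:
  assumes d: "\<And>x. (F has_derivative F' x) (at x)" and "closed K" "\<And>x. x \<notin> K \<Longrightarrow> F x = 0" "x \<notin> K"
  shows "F' x e = 0"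
proof -
  have "((\<lambda>_. 0) has_derivative F' x) (at x)"
    using has_derivative_transform_within_open[OF d[of x], of "- K" "\<lambda>_. 0"] assms by auto
  then have "F' x = (\<lambda>_. 0)" using has_derivative_unique[OF _ has_derivative_const] by blast
  then show ?thesis by simp
qed

lemma difference_bound:
  fixes F :: "'a::real_normed_vector \<Rightarrow> 'b::real_normed_vector"
  assumes d: "\<And>x. (F has_derivative F' x) (at x)" and B: "\<And>x. norm (F' x e) \<le> B" and "h \<ge> 0"
  shows "norm (F (x + h *\<^sub>R e) - F x) \<le> h * B"
proof -
  have lin: "linear (F' y)" for y using has_derivative_linear d by blast
  have "((\<lambda>s. F (x + s *\<^sub>R e)) has_derivative (\<lambda>t. t *\<^sub>R F' (x + s *\<^sub>R e) e)) (at s within {0..h})" for s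
    by (rule has_derivative_eq_rhs[OF has_derivative_compose[where g = F, OF _ d]])
      (auto intro!: derivative_eq_intros simp: fun_eq_iff linear_scale[OF lin])
  moreover have "onorm (\<lambda>t. t *\<^sub>R F' (x + s *\<^sub>R e) e) \<le> B" for s
    by (rule onorm_le) (use B mult_right_mono[OF B, of "\<bar>_\<bar>"] in \<open>auto simp: mult.commute\<close>)
  ultimately have "norm (F (x + h *\<^sub>R e) - F (x + 0 *\<^sub>R e)) \<le> B * norm (h - 0)"
    using \<open>h \<ge> 0\<close> by (intro differentiable_bound[of "{0..h}"]) auto
  then show ?thesis using \<open>h \<ge> 0\<close> by (simp add: mult.commute)
qed

text \<open>The difference quotients of an integrable function integrate to zero by translation
  invariance, and for a compactly supported \<open>C\<^sup>1\<close> function they converge dominatedly.\<close>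

lemma integral_derivative_compact_support:
  fixes F :: "'a::euclidean_space \<Rightarrow> 'b::euclidean_space"
  assumes d: "\<And>x. (F has_derivative F' x) (at x)" and c: "continuous_on UNIV (\<lambda>x. F' x e)"
    and K: "compact K" "\<And>x. x \<notin> K \<Longrightarrow> F x = 0"
  shows "integral\<^sup>L lborel (\<lambda>x. F' x e) = 0"
proof -
  have z: "F' x e = 0" if "x \<notin> K" for x
    using has_derivative_vanishing_outside[OF d compact_imp_closed[OF K(1)] K(2) that] .
  obtain B where B: "B \<ge> 0" "\<And>x. norm (F' x e) \<le> B"
  proof -
    obtain B where "\<And>y. y \<in> (\<lambda>x. F' x e) ` K \<Longrightarrow> norm y \<le> B"
      using compact_imp_bounded[OF compact_continuous_image[OF continuous_on_subset[OF c] K(1)]]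
      by (auto simp: bounded_iff)
    then show ?thesis by (intro that[of "max B 0"]) (auto, use z in \<open>metis imageI max.coboundedI1 max.coboundedI2 norm_zero order_refl\<close>)
  qed
  define h where "h n = inverse (real (Suc n))" for n
  have h: "0 < h n" "h n \<le> 1" "h n \<noteq> 0" for n by (auto simp: h_def field_simps)
  define D where "D n x = inverse (h n) *\<^sub>R (F (x + h n *\<^sub>R e) - F x)" for n x
  obtain R where R: "\<And>x. x \<in> K \<Longrightarrow> norm x \<le> R" using compact_imp_bounded[OF K(1)] by (auto simp: bounded_iff)
  have Fc: "continuous_on UNIV F"
    using d by (auto intro!: continuous_at_imp_continuous_on has_derivative_continuous)
  have "F = (\<lambda>x. indicator K x *\<^sub>R F x)" using K(2) by (auto simp: indicator_def)
  then have Fi: "integrable lborel F"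
    using borel_integrable_compact[OF K(1) continuous_on_subset[OF Fc]] by simp
  have shift: "integrable lborel (\<lambda>x. F (x + a)) \<and> integral\<^sup>L lborel (\<lambda>x. F (x + a)) = integral\<^sup>L lborel F" for a
    using integrable_distr[of "(+) a" lborel borel F] integral_distr[of "(+) a" lborel borel F] Fi
      borel_measurable_continuous_onI[OF Fc]
    by (simp add: lborel_distr_plus add.commute)
  have D0: "integral\<^sup>L lborel (D n) = 0" for n
    unfolding D_def using shift[of "h n *\<^sub>R e"] Fi by simp
  have "(\<lambda>n. integral\<^sup>L lborel (D n)) \<longlonglongrightarrow> integral\<^sup>L lborel (\<lambda>x. F' x e)"
  proof (rule integral_dominated_convergence[where w = "\<lambda>x. indicator (cball 0 (R + norm e)) x *\<^sub>R B"])
    show "(\<lambda>x. F' x e) \<in> borel_measurable lborel" using borel_measurable_continuous_onI[OF c] by simp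
    show "D n \<in> borel_measurable lborel" for n
      unfolding D_def using shift[of "h n *\<^sub>R e"] Fi by (auto dest: borel_measurable_integrable)
    show "integrable lborel (\<lambda>x. indicator (cball 0 (R + norm e)) x *\<^sub>R B)"
      by (rule borel_integrable_compact) auto
    show "AE x in lborel. norm (D n x) \<le> indicator (cball 0 (R + norm e)) x *\<^sub>R B" for n
    proof (rule AE_I2)
      fix x :: 'a
      have "norm (D n x) \<le> B"
        using difference_bound[OF d B(2), of "h n" x] h[of n]
        by (simp add: D_def divide_simps mult.commute)
      moreover have "D n x = 0" if "x \<notin> cball 0 (R + norm e)"
      proof -
        have nx: "norm x > R + norm e" using that by auto
        have "h n * norm e \<le> norm e" using h[of n] by (simp add: mult_left_le_one_le)
        then have "norm (x + h n *\<^sub>R e) > R"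
          using nx norm_triangle_ineq4[of "x + h n *\<^sub>R e" "h n *\<^sub>R e"] h[of n] by simp
        moreover have "norm x > R" using nx by (smt (verit) norm_ge_zero)
        ultimately show ?thesis using K(2) R unfolding D_def by (metis diff_zero leD scaleR_zero_right)
      qed
      ultimately show "norm (D n x) \<le> indicator (cball 0 (R + norm e)) x *\<^sub>R B"
        by (auto simp: indicator_def)
    qed
    show "AE x in lborel. (\<lambda>n. D n x) \<longlonglongrightarrow> F' x e"
    proof (rule AE_I2)
      fix x :: 'a
      have lin: "linear (F' y)" for y using has_derivative_linear d by blast
      have "((\<lambda>s. F (x + s *\<^sub>R e)) has_derivative (\<lambda>t. t *\<^sub>R F' x e)) (at 0)"
        by (rule has_derivative_eq_rhs[OF has_derivative_compose[where g = F and g' = "F' x"]])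
          (auto intro!: derivative_eq_intros simp: fun_eq_iff linear_scale[OF lin] d)
      then have "((\<lambda>s. norm (F (x + s *\<^sub>R e) - F x - s *\<^sub>R F' x e) / \<bar>s\<bar>) \<longlongrightarrow> 0) (at 0)"
        by (simp add: has_derivative_iff_norm)
      then have "((\<lambda>s. norm (inverse s *\<^sub>R (F (x + s *\<^sub>R e) - F x) - F' x e)) \<longlongrightarrow> 0) (at 0)"
      proof (rule Lim_transform_eventually)
        show "\<forall>\<^sub>F s in at 0. norm (F (x + s *\<^sub>R e) - F x - s *\<^sub>R F' x e) / \<bar>s\<bar>
            = norm (inverse s *\<^sub>R (F (x + s *\<^sub>R e) - F x) - F' x e)"
          unfolding eventually_at_filter
        proof (intro always_eventually allI impI)
          fix s :: real assume "s \<noteq> 0"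
          then have "inverse s *\<^sub>R (F (x + s *\<^sub>R e) - F x) - F' x e = inverse s *\<^sub>R (F (x + s *\<^sub>R e) - F x - s *\<^sub>R F' x e)"
            by (simp add: scaleR_diff_right)
          then show "norm (F (x + s *\<^sub>R e) - F x - s *\<^sub>R F' x e) / \<bar>s\<bar>
            = norm (inverse s *\<^sub>R (F (x + s *\<^sub>R e) - F x) - F' x e)"
            by (simp add: divide_inverse mult.commute)
        qed
      qed
      then have l: "((\<lambda>s. inverse s *\<^sub>R (F (x + s *\<^sub>R e) - F x)) \<longlongrightarrow> F' x e) (at 0)"
        by (simp add: LIM_zero_iff tendsto_norm_zero_iff)
      have "filterlim h (at 0) sequentially"
        using LIMSEQ_inverse_real_of_nat h(3) by (auto simp: filterlim_at h_def[abs_def] simp del: of_nat_Suc)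
      from filterlim_compose[OF l this] show "(\<lambda>n. D n x) \<longlonglongrightarrow> F' x e"
        by (simp add: D_def)
    qed
  qed
  then show ?thesis by (simp add: D0 LIMSEQ_const_iff)
qed


lemma test_functionE:
  assumes "test_function U \<phi>"
  obtains K where "compact K" "K \<subseteq> U" "\<And>x. x \<notin> K \<Longrightarrow> \<phi> x = 0" "smooth_on UNIV \<phi>"
proof (rule that)
  show "\<phi> x = 0" if "x \<notin> closure {x. \<phi> x \<noteq> 0}" for x
    using that closure_subset[of "{x. \<phi> x \<noteq> 0}"] by (auto simp: subset_iff)
qed (use assms in \<open>auto simp: test_function_def\<close>)

lemma test_functionI:
  assumes "smooth_on UNIV \<phi>" "compact K" "K \<subseteq> U" "\<And>x. x \<notin> K \<Longrightarrow> \<phi> x = 0"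
  shows "test_function U \<phi>"
proof -
  have "closure {x. \<phi> x \<noteq> 0} \<subseteq> K"
    using assms by (intro closure_minimal compact_imp_closed) auto
  moreover from this have "compact (closure {x. \<phi> x \<noteq> 0})"
    using bounded_subset[OF compact_imp_bounded[OF assms(2)]] by (simp add: compact_eq_bounded_closed)
  ultimately show ?thesis using assms by (auto simp: test_function_def)
qed

lemma compact_sets_lebesgue: "compact K \<Longrightarrow> K \<in> sets lebesgue"
  by (intro sets_completionI_sets) (auto dest: borel_compact)

lemma open_sets_lebesgue: "open U \<Longrightarrow> U \<in> sets lebesgue"
  by (intro sets_completionI_sets) auto

lemma integrable_times_compact_support:
  fixes g :: "'a::euclidean_space \<Rightarrow> 'b::euclidean_space"
  assumes a: "continuous_on UNIV a" "\<And>x. x \<notin> K \<Longrightarrow> a x = 0" and K: "compact K" "K \<subseteq> U"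
    and U: "U \<in> sets lebesgue" and g: "integrable (lebesgue_on K) g"
  shows "integrable (lebesgue_on U) (\<lambda>x. a x *\<^sub>R g x)"
proof -
  note KS = compact_sets_lebesgue[OF K(1)]
  obtain B where B: "\<And>x. x \<in> K \<Longrightarrow> \<bar>a x\<bar> \<le> B"
    using compact_imp_bounded[OF compact_continuous_image[OF continuous_on_subset[OF a(1)] K(1)]]
    by (auto simp: bounded_iff)
  have gi: "integrable lebesgue (\<lambda>x. indicator K x *\<^sub>R g x)" using g by (simp add: integrable_lebesgue_on_iff[OF KS])
  have am: "a \<in> borel_measurable lebesgue"
    using continuous_measurable_lebesgue_on[OF a(1), of UNIV] by (simp add: lebesgue_on_UNIV_eq)
  have "integrable lebesgue (\<lambda>x. a x *\<^sub>R (indicator K x *\<^sub>R g x))"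
  proof (rule Bochner_Integration.integrable_bound)
    show "integrable lebesgue (\<lambda>x. B *\<^sub>R (indicator K x *\<^sub>R g x))"
      using gi by (rule integrable_scaleR_right)
    show "(\<lambda>x. a x *\<^sub>R (indicator K x *\<^sub>R g x)) \<in> borel_measurable lebesgue"
      using am borel_measurable_integrable[OF gi] by (rule borel_measurable_scaleR)
    show "AE x in lebesgue. norm (a x *\<^sub>R (indicator K x *\<^sub>R g x)) \<le> norm (B *\<^sub>R (indicator K x *\<^sub>R g x))"
      using B by (intro AE_I2) (auto simp: indicator_def intro!: mult_right_mono order_trans[OF B])
  qed
  also have "(\<lambda>x. a x *\<^sub>R (indicator K x *\<^sub>R g x)) = (\<lambda>x. indicator U x *\<^sub>R (a x *\<^sub>R g x))"
    using a(2) K(2) by (auto simp: indicator_def fun_eq_iff)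
  finally show ?thesis by (simp add: integrable_lebesgue_on_iff[OF U])
qed

lemma continuous_loc_integrable:
  "continuous_on UNIV f \<Longrightarrow> loc_integrable_on U f"
  by (auto simp: loc_integrable_on_def intro!: integrable_continuous_lebesgue_on compact_sets_lebesgue
      dest: compact_imp_bounded)

lemma integrable_loc_integrable:
  assumes "U \<in> sets lebesgue" "integrable (lebesgue_on U) f"
  shows "loc_integrable_on U f"
  unfolding loc_integrable_on_def
proof (intro allI impI, elim conjE)
  fix K assume K: "compact K" "K \<subseteq> U"
  have "integrable lebesgue (\<lambda>x. indicator K x *\<^sub>R (indicator U x *\<^sub>R f x))"
    using assms(2) unfolding integrable_lebesgue_on_iff[OF assms(1)]
    by (rule integrable_mult_indicator[OF compact_sets_lebesgue[OF K(1)]])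
  also have "(\<lambda>x. indicator K x *\<^sub>R (indicator U x *\<^sub>R f x)) = (\<lambda>x. indicator K x *\<^sub>R f x)"
    using K by (auto simp: indicator_def fun_eq_iff)
  finally show "integrable (lebesgue_on K) f"
    by (simp add: integrable_lebesgue_on_iff compact_sets_lebesgue[OF K(1)])
qed

lemma pderiv_at_eq: "(f has_derivative f') (at x) \<Longrightarrow> pderiv_at i f x = f' (axis i 1)"
  unfolding pderiv_at_def by (simp add: frechet_derivative_at[symmetric])

lemma smooth_on_pderiv_at: "open U \<Longrightarrow> smooth_on U f \<Longrightarrow> smooth_on U (pderiv_at i f)"
  unfolding pderiv_at_def[abs_def] by (rule smooth_on_frechet_derivative)

lemma is_weak_pderiv_C1:
  fixes f :: "real^'n \<Rightarrow> 'b::euclidean_space"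
  assumes U: "open U" and d: "\<And>x. (f has_derivative f' x) (at x)" and c: "continuous_on UNIV (\<lambda>x. f' x (axis i 1))"
  shows "is_weak_pderiv U i f (\<lambda>x. f' x (axis i 1))"
  unfolding is_weak_pderiv_def
proof (intro conjI allI impI)
  have fc: "continuous_on UNIV f"
    using d by (auto intro!: continuous_at_imp_continuous_on has_derivative_continuous)
  show "loc_integrable_on U f" "loc_integrable_on U (\<lambda>x. f' x (axis i 1))"
    using fc c by (auto intro: continuous_loc_integrable)
  fix \<phi> :: "real^'n \<Rightarrow> real" assume "test_function U \<phi>"
  then obtain K where K: "compact K" "K \<subseteq> U" "\<And>x. x \<notin> K \<Longrightarrow> \<phi> x = 0" and s: "smooth_on UNIV \<phi>"
    using test_functionE[of U \<phi> thesis] by blast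
  let ?e = "axis i 1 :: real^'n"
  let ?p = "\<lambda>x. frechet_derivative \<phi> (at x) ?e"
  have pd: "(\<phi> has_derivative frechet_derivative \<phi> (at x)) (at x)" for x
    using smooth_on_has_derivative[OF s] by simp
  have pc: "continuous_on UNIV ?p" "continuous_on UNIV \<phi>"
    using smooth_on_continuous[OF smooth_on_frechet_derivative[OF _ s]] smooth_on_continuous[OF s] by auto
  have pz: "?p x = 0" if "x \<notin> K" for x
    using has_derivative_vanishing_outside[OF pd compact_imp_closed[OF K(1)] K(3) that] .
  have prod_d: "((\<lambda>x. \<phi> x *\<^sub>R f x) has_derivative
      (\<lambda>h. \<phi> x *\<^sub>R f' x h + frechet_derivative \<phi> (at x) h *\<^sub>R f x)) (at x)" for x
    by (rule has_derivative_scaleR[OF pd d])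
  have cont: "continuous_on UNIV (\<lambda>x. \<phi> x *\<^sub>R f' x ?e + ?p x *\<^sub>R f x)"
    using pc c fc by (intro continuous_intros)
  have "integral\<^sup>L lborel (\<lambda>x. \<phi> x *\<^sub>R f' x ?e + ?p x *\<^sub>R f x) = 0"
    using integral_derivative_compact_support[OF prod_d cont K(1)] K(3) by simp
  then have "integral\<^sup>L lebesgue (\<lambda>x. \<phi> x *\<^sub>R f' x ?e + ?p x *\<^sub>R f x) = 0"
    using borel_measurable_continuous_onI[OF cont] by (simp add: integral_completion)
  also have "(\<lambda>x. \<phi> x *\<^sub>R f' x ?e + ?p x *\<^sub>R f x) = (\<lambda>x. indicator U x *\<^sub>R (\<phi> x *\<^sub>R f' x ?e + ?p x *\<^sub>R f x))"
  proof
    fix x show "\<phi> x *\<^sub>R f' x ?e + ?p x *\<^sub>R f x = indicator U x *\<^sub>R (\<phi> x *\<^sub>R f' x ?e + ?p x *\<^sub>R f x)"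
      using K(2) K(3)[of x] pz[of x] by (cases "x \<in> K") auto
  qed
  finally have "integral\<^sup>L (lebesgue_on U) (\<lambda>x. \<phi> x *\<^sub>R f' x ?e + ?p x *\<^sub>R f x) = 0"
    by (simp add: integral_lebesgue_on_eq[OF open_sets_lebesgue[OF U]])
  moreover have "integrable (lebesgue_on U) (\<lambda>x. a x *\<^sub>R g x)"
    if "continuous_on UNIV a" "\<And>x. x \<notin> K \<Longrightarrow> a x = 0" "continuous_on UNIV g" for a :: "real^'n \<Rightarrow> real" and g :: "real^'n \<Rightarrow> 'b"
    using integrable_times_compact_support[OF that(1,2) K(1,2) open_sets_lebesgue[OF U]
        integrable_continuous_lebesgue_on[OF compact_imp_bounded[OF K(1)] compact_sets_lebesgue[OF K(1)] that(3)]] .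
  then have "integrable (lebesgue_on U) (\<lambda>x. \<phi> x *\<^sub>R f' x ?e)" "integrable (lebesgue_on U) (\<lambda>x. ?p x *\<^sub>R f x)"
    using K(3) pz pc c fc by auto
  ultimately have "(LINT x|lebesgue_on U. ?p x *\<^sub>R f x) = - (LINT x|lebesgue_on U. \<phi> x *\<^sub>R f' x ?e)"
    by (simp add: eq_neg_iff_add_eq_0 add.commute)
  then show "(LINT x|lebesgue_on U. pderiv_at i \<phi> x *\<^sub>R f x) = - (LINT x|lebesgue_on U. \<phi> x *\<^sub>R f' x ?e)"
    by (simp add: pderiv_at_def)
qed

text \<open>Products of one-dimensional flat functions are test functions that increase to the indicator
  function of an open box.\<close>

definition box_test :: "'a::euclidean_space \<Rightarrow> 'a \<Rightarrow> nat \<Rightarrow> 'a \<Rightarrow> real" where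
  "box_test a b k x = (\<Prod>i\<in>Basis. flat (real k * (x \<bullet> i - a \<bullet> i)) * flat (real k * (b \<bullet> i - x \<bullet> i)))"

lemma smooth_box_test: "smooth_on UNIV (box_test a b k)"
proof -
  have l: "smooth_on UNIV (\<lambda>x. x \<bullet> i)" for i :: 'a
    by (intro smooth_on_linear bounded_linear_inner_left) auto
  show ?thesis
    unfolding box_test_def[abs_def]
    by (intro smooth_on_prod smooth_on_mult smooth_on_flat_compose smooth_on_diff l smooth_on_const) auto
qed

lemma box_test_zero: "x \<notin> box a b \<Longrightarrow> box_test a b k x = 0"
  unfolding box_test_def by (force simp: box_def not_less mult_nonneg_nonpos intro!: prod_zero)

lemma box_test_bounds: "0 \<le> box_test a b k x" "box_test a b k x \<le> 1"
  unfolding box_test_def by (auto intro!: prod_nonneg prod_le_1 mult_le_one)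

lemma box_test_tendsto: "(\<lambda>k. box_test a b k x) \<longlonglongrightarrow> indicator (box a b) x"
proof (cases "x \<in> box a b")
  case True
  have "(\<lambda>k. flat (real k * c)) \<longlonglongrightarrow> 1" if "c > 0" for c
    using that by (intro filterlim_compose[OF flat_tendsto_1]) (auto intro!: filterlim_tendsto_pos_mult_at_top filterlim_real_sequentially simp: mult.commute[of _ c])
  then have "(\<lambda>k. box_test a b k x) \<longlonglongrightarrow> (\<Prod>i\<in>(Basis::'a set). 1 * 1)"
    unfolding box_test_def using True by (intro tendsto_prod tendsto_mult) (auto simp: box_def)
  then show ?thesis using True by simp
qed (simp add: box_test_zero)

lemma test_function_box_test: "cbox a b \<subseteq> U \<Longrightarrow> test_function U (box_test a b k)"
  using box_subset_cbox[of a b] by (intro test_functionI[where K = "cbox a b"] smooth_box_test box_test_zero) auto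

lemma integral_cbox_zero:
  fixes g :: "'a::euclidean_space \<Rightarrow> 'b::euclidean_space"
  assumes U: "open U" and g: "loc_integrable_on U g" and "cbox a b \<subseteq> U"
    and z: "\<And>\<phi>. test_function U \<phi> \<Longrightarrow> (LINT x|lebesgue_on U. \<phi> x *\<^sub>R g x) = 0"
  shows "(g has_integral 0) (cbox a b)"
proof -
  note US = open_sets_lebesgue[OF U]
  have gi: "integrable (lebesgue_on (cbox a b)) g"
    using g assms(3) by (auto simp: loc_integrable_on_def)
  have gL: "integrable lebesgue (\<lambda>x. indicator (cbox a b) x *\<^sub>R g x)"
    using gi by (simp add: integrable_lebesgue_on_iff compact_sets_lebesgue)
  let ?f = "\<lambda>k x. box_test a b k x *\<^sub>R (indicator (cbox a b) x *\<^sub>R g x)"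
  have bm: "box_test a b k \<in> borel_measurable lebesgue" for k
    using continuous_measurable_lebesgue_on[OF smooth_on_continuous[OF smooth_box_test], of a b k UNIV]
    by (simp add: lebesgue_on_UNIV_eq)
  have im: "(\<lambda>x. indicator (box a b) x *\<^sub>R (indicator (cbox a b) x *\<^sub>R g x)) \<in> borel_measurable lebesgue"
    by (rule borel_measurable_scaleR[OF borel_measurable_indicator borel_measurable_integrable[OF gL]])
      (rule open_sets_lebesgue[OF open_box])
  have f0: "integral\<^sup>L lebesgue (?f k) = 0" for k
  proof -
    have "?f k = (\<lambda>x. indicator U x *\<^sub>R (box_test a b k x *\<^sub>R g x))"
    proof
      fix x show "?f k x = indicator U x *\<^sub>R (box_test a b k x *\<^sub>R g x)"
        using assms(3) box_subset_cbox[of a b] box_test_zero[of x a b k] 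
        by (cases "x \<in> box a b") (auto simp: indicator_def)
    qed
    then show ?thesis
      using z[OF test_function_box_test[OF assms(3)], of k] by (simp add: integral_lebesgue_on_eq[OF US])
  qed
  have "(\<lambda>k. integral\<^sup>L lebesgue (?f k)) \<longlonglongrightarrow> integral\<^sup>L lebesgue (\<lambda>x. indicator (box a b) x *\<^sub>R (indicator (cbox a b) x *\<^sub>R g x))"
  proof (rule integral_dominated_convergence[where w = "\<lambda>x. norm (indicator (cbox a b) x *\<^sub>R g x)"])
    show "(\<lambda>x. indicator (box a b) x *\<^sub>R (indicator (cbox a b) x *\<^sub>R g x)) \<in> borel_measurable lebesgue"
      by (rule im)
    show "?f k \<in> borel_measurable lebesgue" for k
      using borel_measurable_integrable[OF gL] bm by (rule borel_measurable_scaleR[rotated])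
    show "integrable lebesgue (\<lambda>x. norm (indicator (cbox a b) x *\<^sub>R g x))" using gL by (rule integrable_norm)
    show "AE x in lebesgue. (\<lambda>k. ?f k x) \<longlonglongrightarrow> indicator (box a b) x *\<^sub>R (indicator (cbox a b) x *\<^sub>R g x)"
      by (intro AE_I2 tendsto_scaleR box_test_tendsto tendsto_const)
    show "AE x in lebesgue. norm (?f k x) \<le> norm (indicator (cbox a b) x *\<^sub>R g x)" for k
      using box_test_bounds[of a b k] by (intro AE_I2) (auto simp: indicator_def intro: mult_left_le_one_le)
  qed
  then have "integral\<^sup>L lebesgue (\<lambda>x. indicator (box a b) x *\<^sub>R (indicator (cbox a b) x *\<^sub>R g x)) = 0"
    unfolding f0 by (simp only: LIMSEQ_const_iff)
  moreover have "integral\<^sup>L lebesgue (\<lambda>x. indicator (box a b) x *\<^sub>R (indicator (cbox a b) x *\<^sub>R g x))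
      = integral\<^sup>L lebesgue (\<lambda>x. indicator (cbox a b) x *\<^sub>R g x)"
  proof (rule integral_cong_AE)
    have "cbox a b - box a b \<in> null_sets lebesgue"
      using negligible_frontier_interval[of a b] by (simp add: negligible_iff_null_sets)
    then have "AE x in lebesgue. x \<notin> cbox a b - box a b" by (rule AE_not_in)
    then show "AE x in lebesgue. indicator (box a b) x *\<^sub>R (indicator (cbox a b) x *\<^sub>R g x) = indicator (cbox a b) x *\<^sub>R g x"
      by eventually_elim (auto simp: indicator_def)
  qed (rule im borel_measurable_integrable[OF gL])+
  ultimately have "integral\<^sup>L (lebesgue_on (cbox a b)) g = 0"
    by (simp add: integral_lebesgue_on_eq compact_sets_lebesgue)
  then show ?thesis
    using has_integral_integral_lebesgue_on[OF gi] by (simp add: compact_sets_lebesgue)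
qed

text \<open>The fundamental lemma of the calculus of variations. The integrals over all boxes vanish because their
  indicators are limits of test functions, and Lebesgue differentiation recovers the values of the function.\<close>

lemma AE_zero_if_test_integrals_zero:
  fixes g :: "'a::euclidean_space \<Rightarrow> 'b::euclidean_space"
  assumes U: "open U" and g: "loc_integrable_on U g"
    and z: "\<And>\<phi>. test_function U \<phi> \<Longrightarrow> (LINT x|lebesgue_on U. \<phi> x *\<^sub>R g x) = 0"
  shows "AE x in lebesgue_on U. g x = 0"
proof -
  have box: "AE x in lebesgue. x \<in> cbox c d \<longrightarrow> g x = 0" if cd: "cbox c d \<subseteq> U" for c d
  proof -
    define h where "h x = (if x \<in> cbox c d then g x else 0)" for x
    have hz: "(h has_integral 0) (cbox a b)" if "cbox a b \<subseteq> cbox c d" for a b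
    proof -
      have "(g has_integral 0) (cbox a b)" using integral_cbox_zero[OF U g _ z] that cd by blast
      then show ?thesis by (rule has_integral_eq[rotated]) (use that in \<open>auto simp: h_def\<close>)
    qed
    have "h integrable_on cbox a b" for a b
    proof -
      obtain a' b' where ab: "cbox a b \<inter> cbox c d = cbox a' b'" unfolding Int_interval by blast
      then have "cbox a' b' \<subseteq> cbox c d" by blast
      then have "(h has_integral 0) (cbox a b \<inter> cbox c d)" unfolding ab by (rule hz)
      then have "((\<lambda>x. if x \<in> cbox c d then h x else 0) has_integral 0) (cbox a b)"
        by (subst has_integral_restrict_Int) (simp add: Int_commute)
      moreover have "(\<lambda>x. if x \<in> cbox c d then h x else 0) = h" by (auto simp: h_def)
      ultimately show ?thesis by (auto simp: integrable_on_def)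
    qed
    from integrable_ccontinuous_explicit[OF this] obtain N where N: "negligible N"
      "\<And>x e. \<lbrakk>x \<notin> N; 0 < e\<rbrakk> \<Longrightarrow> \<exists>r>0. \<forall>s. 0 < s \<and> s < r \<longrightarrow>
          norm (integral (cbox x (x + s *\<^sub>R One)) h /\<^sub>R s ^ DIM('a) - h x) < e"
      by metis
    have gz: "g x = 0" if x: "x \<in> box c d" "x \<notin> N" for x
    proof -
      have "norm (h x) \<le> e" if e: "e > 0" for e
      proof -
        obtain r where r: "r > 0" "\<And>s. 0 < s \<and> s < r \<Longrightarrow>
            norm (integral (cbox x (x + s *\<^sub>R One)) h /\<^sub>R s ^ DIM('a) - h x) < e"
          using N(2)[OF x(2) e] by blast
        obtain q where q: "q > 0" "cball x q \<subseteq> box c d"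
          using open_contains_cball_eq[OF open_box] x(1) by blast
        define s where "s = min (r / 2) (q / real DIM('a))"
        have s: "0 < s" "s < r" using r q by (auto simp: s_def)
        have "cbox x (x + s *\<^sub>R One) \<subseteq> cball x q"
        proof
          fix y assume "y \<in> cbox x (x + s *\<^sub>R One)"
          then have "\<bar>(y - x) \<bullet> i\<bar> \<le> s" if "i \<in> Basis" for i
            using that by (auto simp: mem_box inner_simps)
          then have "norm (y - x) \<le> (\<Sum>i\<in>(Basis::'a set). s)"
            by (intro order_trans[OF norm_le_l1] sum_mono) auto
          also have "\<dots> \<le> q" unfolding s_def by (auto simp: min_def field_simps)
          finally show "y \<in> cball x q" by (simp add: dist_norm norm_minus_commute)
        qed
        then have "cbox x (x + s *\<^sub>R One) \<subseteq> cbox c d" using q box_subset_cbox by blast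
        then have "integral (cbox x (x + s *\<^sub>R One)) h = 0" using hz by blast
        then show ?thesis using r(2)[of s] s by simp
      qed
      then have "norm (h x) \<le> 0" by (meson dense_ge)
      then show ?thesis using x box_subset_cbox[of c d] by (auto simp: h_def)
    qed
    have "cbox c d - box c d \<in> null_sets lebesgue" "N \<in> null_sets lebesgue"
      using N(1) negligible_frontier_interval[of c d] by (auto simp: negligible_iff_null_sets)
    from this[THEN AE_not_in] show ?thesis
      by eventually_elim (use gz in auto)
  qed
  obtain \<D> where D: "countable \<D>" "\<And>X. X \<in> \<D> \<Longrightarrow> X \<subseteq> U" "\<And>X. X \<in> \<D> \<Longrightarrow> \<exists>a b. X = cbox a b" "\<Union>\<D> = U"
    using open_countable_Union_open_cbox[OF U, of thesis] by blast
  have "AE x in lebesgue. \<forall>X\<in>\<D>. x \<in> X \<longrightarrow> g x = 0"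
    unfolding AE_ball_countable[OF D(1)]
  proof
    fix X assume X: "X \<in> \<D>"
    then obtain a b where "X = cbox a b" using D(3) by blast
    then show "AE x in lebesgue. x \<in> X \<longrightarrow> g x = 0" using box[of a b] D(2)[OF X] by simp
  qed
  then show ?thesis
    using D(4) by (auto simp: AE_lebesgue_on_iff[OF open_sets_lebesgue[OF U]] elim!: eventually_mono)
qed

lemma weak_pderiv_unique:
  assumes U: "open U" and g: "is_weak_pderiv U i f g" and h: "is_weak_pderiv U i f h"
  shows "AE x in lebesgue_on U. g x = h x"
proof -
  have "AE x in lebesgue_on U. g x - h x = 0"
  proof (rule AE_zero_if_test_integrals_zero[OF U])
    show "loc_integrable_on U (\<lambda>x. g x - h x)"
      using g h by (auto simp: is_weak_pderiv_def loc_integrable_on_def)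
    fix \<phi> assume t: "test_function U \<phi>"
    obtain K where K: "compact K" "K \<subseteq> U" "\<And>x. x \<notin> K \<Longrightarrow> \<phi> x = 0" "smooth_on UNIV \<phi>"
      using test_functionE[OF t] by blast
    have "integrable (lebesgue_on U) (\<lambda>x. \<phi> x *\<^sub>R g x)" "integrable (lebesgue_on U) (\<lambda>x. \<phi> x *\<^sub>R h x)"
      using K smooth_on_continuous[OF K(4)] g h open_sets_lebesgue[OF U]
      by (auto simp: is_weak_pderiv_def loc_integrable_on_def intro!: integrable_times_compact_support[where K = K])
    moreover have "(LINT x|lebesgue_on U. \<phi> x *\<^sub>R g x) = (LINT x|lebesgue_on U. \<phi> x *\<^sub>R h x)"
    proof -
      have "(LINT x|lebesgue_on U. pderiv_at i \<phi> x *\<^sub>R f x) = - (LINT x|lebesgue_on U. \<phi> x *\<^sub>R g x)"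
        "(LINT x|lebesgue_on U. pderiv_at i \<phi> x *\<^sub>R f x) = - (LINT x|lebesgue_on U. \<phi> x *\<^sub>R h x)"
        using g h t by (auto simp: is_weak_pderiv_def)
      then show ?thesis by simp
    qed
    ultimately show "(LINT x|lebesgue_on U. \<phi> x *\<^sub>R (g x - h x)) = 0"
      by (simp add: scaleR_diff_right)
  qed
  then show ?thesis by simp
qed

lemma is_weak_pderiv_weak_pderiv: "is_weak_pderiv U i f g \<Longrightarrow> is_weak_pderiv U i f (weak_pderiv U i f)"
  unfolding weak_pderiv_def by (rule someI[of "is_weak_pderiv U i f"])

lemma weak_pderiv_AE_eq:
  assumes "open U" "is_weak_pderiv U i f g"
  shows "AE x in lebesgue_on U. weak_pderiv U i f x = g x"
  using weak_pderiv_unique[OF assms(1) is_weak_pderiv_weak_pderiv[OF assms(2)] assms(2)] .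

lemma is_weak_pderiv_times_integrable:
  assumes U: "open U" and w: "is_weak_pderiv U i f g" and t: "test_function U \<phi>"
  shows "integrable (lebesgue_on U) (\<lambda>x. pderiv_at i \<phi> x *\<^sub>R f x)" "integrable (lebesgue_on U) (\<lambda>x. \<phi> x *\<^sub>R g x)"
proof -
  obtain K where K: "compact K" "K \<subseteq> U" "\<And>x. x \<notin> K \<Longrightarrow> \<phi> x = 0" "smooth_on UNIV \<phi>"
    using test_functionE[OF t] by blast
  have d: "(\<phi> has_derivative frechet_derivative \<phi> (at x)) (at x)" for x
    using smooth_on_has_derivative[OF K(4)] by simp
  have "pderiv_at i \<phi> x = 0" if "x \<notin> K" for x
    unfolding pderiv_at_def
    by (rule has_derivative_vanishing_outside[OF d compact_imp_closed[OF K(1)] K(3) that])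
  then show "integrable (lebesgue_on U) (\<lambda>x. pderiv_at i \<phi> x *\<^sub>R f x)" "integrable (lebesgue_on U) (\<lambda>x. \<phi> x *\<^sub>R g x)"
    using K smooth_on_continuous[OF K(4)] smooth_on_continuous[OF smooth_on_pderiv_at[OF _ K(4)], of i] w open_sets_lebesgue[OF U]
    by (auto simp: is_weak_pderiv_def loc_integrable_on_def intro!: integrable_times_compact_support[where K = K])
qed

lemma is_weak_pderiv_add:
  assumes U: "open U" and "is_weak_pderiv U i f f'" "is_weak_pderiv U i g g'"
  shows "is_weak_pderiv U i (\<lambda>x. f x + g x) (\<lambda>x. f' x + g' x)"
  using assms is_weak_pderiv_times_integrable[OF U assms(2)] is_weak_pderiv_times_integrable[OF U assms(3)]
  by (auto simp: is_weak_pderiv_def loc_integrable_on_def scaleR_add_right)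

lemma is_weak_pderiv_diff:
  assumes U: "open U" and "is_weak_pderiv U i f f'" "is_weak_pderiv U i g g'"
  shows "is_weak_pderiv U i (\<lambda>x. f x - g x) (\<lambda>x. f' x - g' x)"
  using assms is_weak_pderiv_times_integrable[OF U assms(2)] is_weak_pderiv_times_integrable[OF U assms(3)]
  by (auto simp: is_weak_pderiv_def loc_integrable_on_def scaleR_diff_right)

lemma is_weak_pderiv_bounded_linear:
  fixes l :: "'b::euclidean_space \<Rightarrow> 'c::euclidean_space"
  assumes U: "open U" and w: "is_weak_pderiv U i f f'" and l: "bounded_linear l"
  shows "is_weak_pderiv U i (\<lambda>x. l (f x)) (\<lambda>x. l (f' x))"
  unfolding is_weak_pderiv_def loc_integrable_on_def
proof (intro conjI allI impI)
  fix \<phi> assume t: "test_function U \<phi>"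
  note int = is_weak_pderiv_times_integrable[OF U w t]
  have "(LINT x|lebesgue_on U. pderiv_at i \<phi> x *\<^sub>R l (f x)) = l (LINT x|lebesgue_on U. pderiv_at i \<phi> x *\<^sub>R f x)"
    using integral_bounded_linear[OF l int(1)] by (simp add: linear_scale[OF bounded_linear.linear[OF l]])
  also have "\<dots> = l (- (LINT x|lebesgue_on U. \<phi> x *\<^sub>R f' x))"
    using w t by (auto simp: is_weak_pderiv_def)
  also have "\<dots> = - (LINT x|lebesgue_on U. \<phi> x *\<^sub>R l (f' x))"
    using integral_bounded_linear[OF l int(2)]
    by (simp add: linear_scale[OF bounded_linear.linear[OF l]] linear_neg[OF bounded_linear.linear[OF l]])
  finally show "(LINT x|lebesgue_on U. pderiv_at i \<phi> x *\<^sub>R l (f x)) = - (LINT x|lebesgue_on U. \<phi> x *\<^sub>R l (f' x))" .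
next
  fix K assume "compact K \<and> K \<subseteq> U"
  then have "integrable (lebesgue_on K) f" "integrable (lebesgue_on K) f'"
    using w by (auto simp: is_weak_pderiv_def loc_integrable_on_def)
  then show "integrable (lebesgue_on K) (\<lambda>x. l (f x))" "integrable (lebesgue_on K) (\<lambda>x. l (f' x))"
    by (auto intro: integrable_bounded_linear[OF l])
qed

section \<open>Sobolev functions and their derivatives\<close>

text \<open>The matrix contains every component of the curl twice, with opposite signs. It serves both dimensions, at the
  price of a factor two in all squared norms.\<close>

definition weak_rot :: "(real^'n) set \<Rightarrow> (real^'n \<Rightarrow> real^'n) \<Rightarrow> real^'n \<Rightarrow> real^'n^'n" where
  "weak_rot \<Omega> w x = (\<chi> i j. weak_pderiv \<Omega> i w x $ j - weak_pderiv \<Omega> j w x $ i)"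

locale bounded_domain =
  fixes \<Omega> :: "(real^'n) set"
  assumes open_domain: "open \<Omega>" and bounded_domain: "bounded \<Omega>"
begin

lemma domain_sets: "\<Omega> \<in> sets lebesgue"
  by (rule open_sets_lebesgue[OF open_domain])

lemma L2_loc_integrable: "L2_on \<Omega> f \<Longrightarrow> loc_integrable_on \<Omega> f"
  by (intro integrable_loc_integrable L2_on_integrable domain_sets bounded_domain)

lemmas L2_AE_cong = L2_on_AE_cong[OF domain_sets]
lemmas L2_continuous = L2_on_continuous[OF bounded_domain domain_sets]
lemmas inner_cong_AE = L2_inner_cong_AE[OF domain_sets]
lemmas norm_cong_AE = L2_norm_cong_AE[OF domain_sets]

lemma H1_L2: "Hk_on 1 \<Omega> f \<Longrightarrow> L2_on \<Omega> f"
  by simp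

lemma H1_weak_pderiv:
  assumes "Hk_on 1 \<Omega> f" shows "is_weak_pderiv \<Omega> i f (weak_pderiv \<Omega> i f)" "L2_on \<Omega> (weak_pderiv \<Omega> i f)"
proof -
  obtain g where g: "is_weak_pderiv \<Omega> i f g" "L2_on \<Omega> g" using assms by auto
  show "is_weak_pderiv \<Omega> i f (weak_pderiv \<Omega> i f)" by (rule is_weak_pderiv_weak_pderiv[OF g(1)])
  show "L2_on \<Omega> (weak_pderiv \<Omega> i f)"
    using weak_pderiv_AE_eq[OF open_domain g(1)] by (intro L2_AE_cong[OF g(2)]) (simp add: eq_commute)
qed

lemma H1_I:
  assumes "L2_on \<Omega> f" "\<And>i. is_weak_pderiv \<Omega> i f (g i)" "\<And>i. L2_on \<Omega> (g i)"
  shows "Hk_on 1 \<Omega> f"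
  using assms by auto

lemmas weak_pderiv_AE = weak_pderiv_AE_eq[OF open_domain]

lemma H1_diff:
  assumes "Hk_on 1 \<Omega> f" "Hk_on 1 \<Omega> g"
  shows "Hk_on 1 \<Omega> (\<lambda>x. f x - g x)"
    and "AE x in lebesgue_on \<Omega>. weak_pderiv \<Omega> i (\<lambda>x. f x - g x) x = weak_pderiv \<Omega> i f x - weak_pderiv \<Omega> i g x"
proof -
  have d: "is_weak_pderiv \<Omega> i (\<lambda>x. f x - g x) (\<lambda>x. weak_pderiv \<Omega> i f x - weak_pderiv \<Omega> i g x)" for i
    by (intro is_weak_pderiv_diff open_domain H1_weak_pderiv assms)
  show "Hk_on 1 \<Omega> (\<lambda>x. f x - g x)"
    by (rule H1_I[OF _ d]) (intro L2_on_diff H1_weak_pderiv H1_L2 assms)+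
  show "AE x in lebesgue_on \<Omega>. weak_pderiv \<Omega> i (\<lambda>x. f x - g x) x = weak_pderiv \<Omega> i f x - weak_pderiv \<Omega> i g x"
    by (rule weak_pderiv_AE[OF d])
qed

lemma H1_C1:
  fixes f :: "real^'n \<Rightarrow> 'b::euclidean_space"
  assumes d: "\<And>x. (f has_derivative f' x) (at x)" and c: "\<And>i. continuous_on UNIV (\<lambda>x. f' x (axis i 1))"
  shows "Hk_on 1 \<Omega> f" "AE x in lebesgue_on \<Omega>. weak_pderiv \<Omega> i f x = f' x (axis i 1)"
proof -
  have "continuous_on UNIV f"
    using d by (auto intro!: continuous_at_imp_continuous_on has_derivative_continuous)
  then show "Hk_on 1 \<Omega> f"
    by (intro H1_I[where g = "\<lambda>i x. f' x (axis i 1)"] L2_continuous is_weak_pderiv_C1 open_domain d c)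
  show "AE x in lebesgue_on \<Omega>. weak_pderiv \<Omega> i f x = f' x (axis i 1)"
    by (rule weak_pderiv_AE[OF is_weak_pderiv_C1[OF open_domain d c]])
qed

lemma H1_smooth:
  fixes f :: "real^'n \<Rightarrow> 'b::euclidean_space"
  assumes "smooth_on UNIV f"
  shows "Hk_on 1 \<Omega> f" "AE x in lebesgue_on \<Omega>. weak_pderiv \<Omega> i f x = pderiv_at i f x"
proof -
  have d: "(f has_derivative frechet_derivative f (at x)) (at x)" for x
    using smooth_on_has_derivative[OF assms] by simp
  have c: "continuous_on UNIV (\<lambda>x. frechet_derivative f (at x) (axis i 1))" for i
    by (intro smooth_on_continuous smooth_on_frechet_derivative assms open_UNIV)
  show "Hk_on 1 \<Omega> f" by (rule H1_C1(1)[OF d c])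
  show "AE x in lebesgue_on \<Omega>. weak_pderiv \<Omega> i f x = pderiv_at i f x"
    using H1_C1(2)[OF d c] by (simp add: pderiv_at_def)
qed

lemma L2_vec_lambda:
  fixes f :: "'m::finite \<Rightarrow> real^'n \<Rightarrow> 'b::euclidean_space"
  assumes "\<And>i. L2_on \<Omega> (f i)" shows "L2_on \<Omega> (\<lambda>x. \<chi> i. f i x)"
proof -
  have "L2_on \<Omega> (\<lambda>x. \<Sum>i\<in>UNIV. (\<chi> j. if j = i then f i x else 0))"
  proof (rule L2_on_sum)
    fix i :: 'm
    have "bounded_linear (\<lambda>v::'b. (\<chi> j. if j = i then v else 0) :: 'b^'m)"
      by (rule linear_conv_bounded_linear[THEN iffD1], rule linearI) (auto simp: vec_eq_iff)
    from L2_on_bounded_linear[OF assms this]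
    show "L2_on \<Omega> (\<lambda>x. (\<chi> j. if j = i then f i x else 0))" .
  qed
  moreover have "(\<Sum>i\<in>UNIV. (\<chi> j. if j = i then f i x else 0)) = (\<chi> i. f i x)" for x
    by (auto simp: vec_eq_iff sum_component)
  ultimately show ?thesis by simp
qed

lemma L2_weak_grad: "Hk_on 1 \<Omega> f \<Longrightarrow> L2_on \<Omega> (weak_grad \<Omega> f)"
  unfolding weak_grad_def[abs_def] by (intro L2_vec_lambda H1_weak_pderiv)

lemma L2_weak_rot: "Hk_on 1 \<Omega> w \<Longrightarrow> L2_on \<Omega> (weak_rot \<Omega> w)"
  unfolding weak_rot_def[abs_def]
  by (intro L2_vec_lambda L2_on_diff L2_on_bounded_linear[OF _ bounded_linear_vec_nth] H1_weak_pderiv)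

lemma weak_rot_diff:
  assumes "Hk_on 1 \<Omega> v" "Hk_on 1 \<Omega> w"
  shows "AE x in lebesgue_on \<Omega>. weak_rot \<Omega> (\<lambda>x. v x - w x) x = weak_rot \<Omega> v x - weak_rot \<Omega> w x"
proof -
  have "AE x in lebesgue_on \<Omega>. \<forall>i\<in>UNIV. weak_pderiv \<Omega> i (\<lambda>x. v x - w x) x = weak_pderiv \<Omega> i v x - weak_pderiv \<Omega> i w x"
    using H1_diff(2)[OF assms] by (intro AE_finite_allI) auto
  then show ?thesis by eventually_elim (simp add: weak_rot_def vec_eq_iff)
qed

lemma weak_div_smooth:
  assumes "smooth_on UNIV w" shows "AE x in lebesgue_on \<Omega>. weak_div \<Omega> w x = (\<Sum>i\<in>UNIV. pderiv_at i w x $ i)"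
proof -
  have "AE x in lebesgue_on \<Omega>. \<forall>i\<in>UNIV. weak_pderiv \<Omega> i w x = pderiv_at i w x"
    using H1_smooth(2)[OF assms] by (intro AE_finite_allI) auto
  then show ?thesis by eventually_elim (simp add: weak_div_def)
qed

lemma weak_rot_smooth:
  assumes "smooth_on UNIV w"
  shows "AE x in lebesgue_on \<Omega>. weak_rot \<Omega> w x = (\<chi> i j. pderiv_at i w x $ j - pderiv_at j w x $ i)"
proof -
  have "AE x in lebesgue_on \<Omega>. \<forall>i\<in>UNIV. weak_pderiv \<Omega> i w x = pderiv_at i w x"
    using H1_smooth(2)[OF assms] by (intro AE_finite_allI) auto
  then show ?thesis by eventually_elim (simp add: weak_rot_def)
qed

lemma H2_weak_div:
  assumes "Hk_on 2 \<Omega> w" shows "Hk_on 1 \<Omega> (weak_div \<Omega> w)"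
proof -
  obtain g where g: "\<And>i. is_weak_pderiv \<Omega> i w (g i)" "\<And>i. Hk_on 1 \<Omega> (g i)"
    using assms by (auto simp: numeral_2_eq_2) metis
  have gi: "is_weak_pderiv \<Omega> k (\<lambda>x. g i x $ i) (\<lambda>x. weak_pderiv \<Omega> k (g i) x $ i)" for i k
    by (rule is_weak_pderiv_bounded_linear[OF open_domain H1_weak_pderiv(1)[OF g(2)] bounded_linear_vec_nth])
  have L2: "L2_on \<Omega> (\<lambda>x. weak_pderiv \<Omega> k (g i) x $ i)" "L2_on \<Omega> (\<lambda>x. g i x $ i)" for i k
    by (intro L2_on_bounded_linear[OF _ bounded_linear_vec_nth] H1_weak_pderiv g H1_L2)+
  have ae: "AE x in lebesgue_on \<Omega>. weak_div \<Omega> w x = (\<Sum>i\<in>UNIV. g i x $ i)"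
  proof -
    have "AE x in lebesgue_on \<Omega>. \<forall>i\<in>UNIV. weak_pderiv \<Omega> i w x = g i x"
      using weak_pderiv_AE[OF g(1)] by (intro AE_finite_allI) auto
    then show ?thesis by eventually_elim (simp add: weak_div_def)
  qed
  have Ldiv: "L2_on \<Omega> (weak_div \<Omega> w)"
    by (rule L2_AE_cong[OF L2_on_sum[of UNIV \<Omega> "\<lambda>i x. g i x $ i"]]) (use L2 ae in \<open>auto simp: eq_commute\<close>)
  have s: "is_weak_pderiv \<Omega> k (\<lambda>x. \<Sum>i\<in>I. g i x $ i) (\<lambda>x. \<Sum>i\<in>I. weak_pderiv \<Omega> k (g i) x $ i)" for I k
    by (induction I rule: infinite_finite_induct)
      (auto intro!: is_weak_pderiv_add open_domain gi simp: is_weak_pderiv_def[of _ _ "\<lambda>x. 0"] loc_integrable_on_def)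
  have "is_weak_pderiv \<Omega> k (weak_div \<Omega> w) (\<lambda>x. \<Sum>i\<in>UNIV. weak_pderiv \<Omega> k (g i) x $ i)" for k
  proof -
    have "(LINT x|lebesgue_on \<Omega>. pderiv_at k \<phi> x *\<^sub>R weak_div \<Omega> w x)
        = (LINT x|lebesgue_on \<Omega>. pderiv_at k \<phi> x *\<^sub>R (\<Sum>i\<in>UNIV. g i x $ i))" for \<phi>
      by (rule integral_cong_AE_lebesgue_on[OF domain_sets]) (use ae in eventually_elim, simp)
    then show ?thesis
      using s[of k UNIV] L2_loc_integrable[OF Ldiv] unfolding is_weak_pderiv_def by auto
  qed
  then show ?thesis
    by (rule H1_I[OF Ldiv]) (intro L2_on_sum L2)
qed

lemma Hk_norm_1_bounds:
  assumes "Hk_on 1 \<Omega> f"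
  shows "L2_norm_on \<Omega> f \<le> Hk_norm 1 \<Omega> f" "L2_norm_on \<Omega> (weak_pderiv \<Omega> i f) \<le> Hk_norm 1 \<Omega> f"
proof -
  have "(L2_norm_on \<Omega> (weak_pderiv \<Omega> i f))\<^sup>2 \<le> (\<Sum>i\<in>UNIV. (L2_norm_on \<Omega> (weak_pderiv \<Omega> i f))\<^sup>2)"
    by (rule member_le_sum) auto
  also have "\<dots> \<le> Hk_norm_sq 1 \<Omega> f" by simp
  finally show "L2_norm_on \<Omega> (weak_pderiv \<Omega> i f) \<le> Hk_norm 1 \<Omega> f"
    unfolding Hk_norm_def by (rule real_le_rsqrt)
  have "(L2_norm_on \<Omega> f)\<^sup>2 \<le> Hk_norm_sq 1 \<Omega> f" by (simp add: sum_nonneg)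
  then show "L2_norm_on \<Omega> f \<le> Hk_norm 1 \<Omega> f"
    unfolding Hk_norm_def by (rule real_le_rsqrt)
qed

lemma norm_weak_rot_le:
  assumes "Hk_on 1 \<Omega> w"
  shows "L2_norm_on \<Omega> (weak_rot \<Omega> w) \<le> 2 * Hk_norm 1 \<Omega> w"
proof -
  have "(L2_norm_on \<Omega> (weak_rot \<Omega> w))\<^sup>2 = (LINT x|lebesgue_on \<Omega>. (norm (weak_rot \<Omega> w x))\<^sup>2)"
    by (simp add: L2_norm_on_def)
  also have "\<dots> \<le> (LINT x|lebesgue_on \<Omega>. 4 * (\<Sum>i\<in>UNIV. (norm (weak_pderiv \<Omega> i w x))\<^sup>2))"
  proof (rule integral_mono)
    show "integrable (lebesgue_on \<Omega>) (\<lambda>x. (norm (weak_rot \<Omega> w x))\<^sup>2)"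
      using L2_weak_rot[OF assms] by (simp add: L2_on_def)
    show "integrable (lebesgue_on \<Omega>) (\<lambda>x. 4 * (\<Sum>i\<in>UNIV. (norm (weak_pderiv \<Omega> i w x))\<^sup>2))"
      using H1_weak_pderiv(2)[OF assms] by (auto simp: L2_on_def)
    fix x
    let ?p = "\<lambda>i j. weak_pderiv \<Omega> i w x $ j"
    have sq: "(norm v)\<^sup>2 = (\<Sum>j\<in>UNIV. (v $ j)\<^sup>2)" for v :: "real^'n"
      unfolding power2_norm_eq_inner inner_vec_def by (simp add: power2_eq_square)
    have "(norm (weak_rot \<Omega> w x))\<^sup>2 = (\<Sum>i\<in>UNIV. \<Sum>j\<in>UNIV. (?p i j - ?p j i)\<^sup>2)"
      unfolding power2_norm_eq_inner inner_vec_def by (simp add: power2_eq_square weak_rot_def)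
    also have "\<dots> \<le> (\<Sum>i\<in>UNIV. \<Sum>j\<in>UNIV. 2 * (?p i j)\<^sup>2 + 2 * (?p j i)\<^sup>2)"
    proof (intro sum_mono)
      fix i j
      have "0 \<le> (?p i j + ?p j i)\<^sup>2" by simp
      then show "(?p i j - ?p j i)\<^sup>2 \<le> 2 * (?p i j)\<^sup>2 + 2 * (?p j i)\<^sup>2"
        by (simp add: power2_eq_square algebra_simps)
    qed
    also have "\<dots> = 2 * (\<Sum>i\<in>UNIV. \<Sum>j\<in>UNIV. (?p i j)\<^sup>2) + 2 * (\<Sum>i\<in>UNIV. \<Sum>j\<in>UNIV. (?p j i)\<^sup>2)"
      by (simp add: sum.distrib sum_distrib_left)
    also have "(\<Sum>i\<in>UNIV. \<Sum>j\<in>UNIV. (?p j i)\<^sup>2) = (\<Sum>i\<in>UNIV. \<Sum>j\<in>UNIV. (?p i j)\<^sup>2)"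
      by (rule sum.swap)
    finally show "(norm (weak_rot \<Omega> w x))\<^sup>2 \<le> 4 * (\<Sum>i\<in>UNIV. (norm (weak_pderiv \<Omega> i w x))\<^sup>2)"
      by (simp add: sq)
  qed
  also have "\<dots> = 4 * (\<Sum>i\<in>UNIV. (L2_norm_on \<Omega> (weak_pderiv \<Omega> i w))\<^sup>2)"
    using H1_weak_pderiv(2)[OF assms] by (simp add: L2_norm_on_def L2_on_def)
  also have "\<dots> \<le> (2 * Hk_norm 1 \<Omega> w)\<^sup>2"
    by (simp add: Hk_norm_def power_mult_distrib sum_nonneg)
  finally show ?thesis
    by (rule power2_le_imp_le) (simp add: Hk_norm_def sum_nonneg)
qed

end

section \<open>Domains with smooth boundary\<close>

lemma has_derivative_eq_gradient:
  fixes f :: "real^'n \<Rightarrow> real"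
  assumes "(f has_derivative f') (at x)" shows "f' v = gradient f x \<bullet> v"
proof -
  have l: "linear f'" using assms by (rule has_derivative_linear)
  have "f' v = f' (\<Sum>i\<in>UNIV. v $ i *\<^sub>R axis i 1)"
    using basis_expansion[of v] by (simp add: scalar_mult_eq_scaleR)
  also have "\<dots> = (\<Sum>i\<in>UNIV. v $ i * f' (axis i 1))"
    by (simp add: linear_sum[OF l] linear_scale[OF l])
  also have "\<dots> = gradient f x \<bullet> v"
    by (simp add: inner_vec_def gradient_def pderiv_at_eq[OF assms] mult.commute)
  finally show ?thesis .
qed

lemma smooth_on_has_gradient:
  fixes f :: "real^'n \<Rightarrow> real"
  assumes "smooth_on U f" "x \<in> U" shows "(f has_derivative (\<lambda>v. gradient f x \<bullet> v)) (at x)"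
  using smooth_on_has_derivative[OF assms] has_derivative_eq_gradient[OF smooth_on_has_derivative[OF assms]]
  by (metis (no_types, lifting) ext)

lemma gradient_eqI:
  fixes f :: "real^'n \<Rightarrow> real"
  assumes "(f has_derivative (\<lambda>v. w \<bullet> v)) (at x)" shows "gradient f x = w"
  using has_derivative_eq_gradient[OF assms] by (metis inner_commute vector_eq_rdot)

lemma smooth_on_gradient:
  fixes f :: "real^'n \<Rightarrow> real"
  assumes "open U" "smooth_on U f" shows "smooth_on U (gradient f)"
proof -
  have "smooth_on U (\<lambda>x. \<Sum>i\<in>UNIV. pderiv_at i f x *\<^sub>R axis i (1::real))"
    by (intro smooth_on_sum smooth_on_scaleR smooth_on_const smooth_on_pderiv_at assms)
  moreover have "(\<Sum>i\<in>UNIV. pderiv_at i f x *\<^sub>R axis i (1::real)) = gradient f x" for x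
    using basis_expansion[of "gradient f x"] by (simp add: scalar_mult_eq_scaleR gradient_def)
  ultimately show ?thesis by simp
qed

text \<open>The sign of the directional derivative of a defining function decides on which side of the boundary a short
  segment lies. This ties the gradient to the domain, up to a positive factor, and makes the normal well defined.\<close>

lemma boundary_defining_directions:
  assumes b: "boundary_defining \<Omega> p U \<rho>" and p: "p \<in> frontier \<Omega>"
  shows "gradient \<rho> p \<bullet> v < 0 \<Longrightarrow> \<exists>d>0. \<forall>t. 0 < t \<and> t < d \<longrightarrow> p + t *\<^sub>R v \<in> \<Omega>"
    and "gradient \<rho> p \<bullet> v > 0 \<Longrightarrow> \<exists>d>0. \<forall>t. 0 < t \<and> t < d \<longrightarrow> p + t *\<^sub>R v \<notin> \<Omega>"
proof -
  have U: "open U" "p \<in> U" "smooth_on U \<rho>" and \<Omega>: "\<And>x. x \<in> U \<Longrightarrow> x \<in> \<Omega> \<longleftrightarrow> \<rho> x < 0" and z: "\<rho> p = 0"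
    using b p by (auto simp: boundary_defining_def set_eq_iff)
  have "((\<lambda>t. \<rho> (p + t *\<^sub>R v)) has_derivative (\<lambda>t. t * (gradient \<rho> p \<bullet> v))) (at 0)"
    by (rule has_derivative_eq_rhs[OF has_derivative_compose[where g = \<rho> and g' = "\<lambda>v. gradient \<rho> p \<bullet> v"]])
      (auto intro!: derivative_eq_intros smooth_on_has_gradient U)
  then have D: "((\<lambda>t. \<rho> (p + t *\<^sub>R v)) has_real_derivative gradient \<rho> p \<bullet> v) (at 0)"
    by (simp add: has_field_derivative_def mult_commute_abs)
  have "((\<lambda>t. p + t *\<^sub>R v) \<longlongrightarrow> p + 0 *\<^sub>R v) (at_right 0)" by (intro tendsto_intros)
  then have "\<forall>\<^sub>F t in at_right 0. p + t *\<^sub>R v \<in> U" using U by (auto intro: topological_tendstoD)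
  then obtain d0 where d0: "d0 > 0" "\<And>t. 0 < t \<Longrightarrow> t < d0 \<Longrightarrow> p + t *\<^sub>R v \<in> U"
    by (auto simp: eventually_at_right_field)
  show "\<exists>d>0. \<forall>t. 0 < t \<and> t < d \<longrightarrow> p + t *\<^sub>R v \<in> \<Omega>" if neg: "gradient \<rho> p \<bullet> v < 0"
  proof -
    obtain d where "d > 0" "\<And>t. 0 < t \<Longrightarrow> t < d \<Longrightarrow> \<rho> (p + t *\<^sub>R v) < 0"
      using DERIV_neg_dec_right[OF D neg] z by auto
    then show ?thesis using d0 \<Omega> by (intro exI[of _ "min d d0"]) auto
  qed
  show "\<exists>d>0. \<forall>t. 0 < t \<and> t < d \<longrightarrow> p + t *\<^sub>R v \<notin> \<Omega>" if pos: "gradient \<rho> p \<bullet> v > 0"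
  proof -
    obtain d where "d > 0" "\<And>t. 0 < t \<Longrightarrow> t < d \<Longrightarrow> 0 < \<rho> (p + t *\<^sub>R v)"
      using DERIV_pos_inc_right[OF D pos] z by auto
    then show ?thesis using d0 \<Omega> by (intro exI[of _ "min d d0"]) (auto simp: not_less less_imp_le)
  qed
qed

lemma boundary_defining_sgn_gradient_unique:
  assumes b1: "boundary_defining \<Omega> p U1 \<rho>1" and b2: "boundary_defining \<Omega> p U2 \<rho>2" and p: "p \<in> frontier \<Omega>"
  shows "sgn (gradient \<rho>1 p) = sgn (gradient \<rho>2 p)"
proof (rule ccontr)
  define a where "a = gradient \<rho>1 p"
  define b where "b = gradient \<rho>2 p"
  assume "sgn (gradient \<rho>1 p) \<noteq> sgn (gradient \<rho>2 p)"
  then have ne: "sgn a \<noteq> sgn b" by (simp add: a_def b_def)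
  have "a \<noteq> 0" "b \<noteq> 0" using b1 b2 by (auto simp: boundary_defining_def a_def b_def)
  then have n: "norm (sgn a) = 1" "norm (sgn b) = 1" by (auto simp: norm_sgn)
  have n2: "sgn a \<bullet> sgn a = 1" "sgn b \<bullet> sgn b = 1"
    using n by (auto simp only: norm_eq_1)
  have "0 < (norm (sgn a - sgn b))\<^sup>2" using ne by simp
  also have "\<dots> = 2 - 2 * (sgn a \<bullet> sgn b)"
    unfolding power2_norm_eq_inner by (simp add: inner_diff_left inner_diff_right n2 inner_commute[of "sgn b" "sgn a"])
  finally have lt: "sgn a \<bullet> sgn b < 1" by simp
  have ab: "a = norm a *\<^sub>R sgn a" "b = norm b *\<^sub>R sgn b" using \<open>a \<noteq> 0\<close> \<open>b \<noteq> 0\<close> by (auto simp: sgn_div_norm)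
  let ?v = "sgn b - sgn a"
  have "a \<bullet> ?v = norm a * (sgn a \<bullet> sgn b - 1)"
    by (subst ab(1)) (simp only: inner_scaleR_left inner_diff_right n2 right_diff_distrib)
  then have "gradient \<rho>1 p \<bullet> ?v < 0" using lt \<open>a \<noteq> 0\<close> by (simp add: a_def[symmetric] mult_pos_neg)
  moreover have "b \<bullet> ?v = norm b * (1 - sgn a \<bullet> sgn b)"
    by (subst ab(2)) (simp only: inner_scaleR_left inner_diff_right n2 inner_commute[of "sgn b" "sgn a"] right_diff_distrib)
  then have "gradient \<rho>2 p \<bullet> ?v > 0" using lt \<open>b \<noteq> 0\<close> by (simp add: b_def[symmetric])
  ultimately obtain d d' where "d > 0" "d' > 0" "\<And>t. 0 < t \<Longrightarrow> t < d \<Longrightarrow> p + t *\<^sub>R ?v \<in> \<Omega>"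
    "\<And>t. 0 < t \<Longrightarrow> t < d' \<Longrightarrow> p + t *\<^sub>R ?v \<notin> \<Omega>"
    using boundary_defining_directions(1)[OF b1 p] boundary_defining_directions(2)[OF b2 p] by metis
  moreover define t where "t = min d d' / 2"
  moreover have "0 < t" "t < d" "t < d'" using \<open>d > 0\<close> \<open>d' > 0\<close> by (auto simp: t_def min_def)
  ultimately show False by blast
qed

lemma outward_normal_eq:
  assumes "boundary_defining \<Omega> p U \<rho>" "p \<in> frontier \<Omega>"
  shows "outward_normal \<Omega> p = sgn (gradient \<rho> p)"
  unfolding outward_normal_def
  using assms boundary_defining_sgn_gradient_unique[OF _ assms(1,2)] by (intro the_equality) blast+

definition bump :: "'a::euclidean_space \<Rightarrow> real \<Rightarrow> 'a \<Rightarrow> real" where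
  "bump p r x = flat (r\<^sup>2 - (x - p) \<bullet> (x - p))"

lemma smooth_bump: "smooth_on UNIV (bump p r)"
  unfolding bump_def[abs_def]
  by (intro smooth_on_flat_compose smooth_on_diff smooth_on_const smooth_on_inner smooth_on_ident) auto

lemma bump_nonneg: "0 \<le> bump p r x"
  by (simp add: bump_def)

lemma bump_pos_iff: "r > 0 \<Longrightarrow> 0 < bump p r x \<longleftrightarrow> x \<in> ball p r"
proof -
  assume r: "r > 0"
  have "(x - p) \<bullet> (x - p) < r\<^sup>2 \<longleftrightarrow> norm (x - p) < r"
    unfolding power2_norm_eq_inner[symmetric]
    using r power_strict_mono[of "norm (x - p)" r 2] power_less_imp_less_base[of "norm (x - p)" 2 r] by auto
  then show ?thesis by (simp add: bump_def dist_norm norm_minus_commute)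
qed

lemma bump_eq_0: "r > 0 \<Longrightarrow> x \<notin> ball p r \<Longrightarrow> bump p r x = 0"
  using bump_pos_iff[of r p x] bump_nonneg[of p r x] by linarith

text \<open>A local contribution to a global defining function: a bump function times a local defining
  function, or minus a bump function in the interior. All inequalities point in the same direction for all
  centres \<open>p\<close>, including the one for the normal derivative, so they are inherited by sums.\<close>

lemma local_defining_function:
  fixes \<Omega> :: "(real^'n) set"
  assumes \<Omega>: "open \<Omega>" "smooth_boundary \<Omega>" and p: "p \<in> closure \<Omega>"
  shows "\<exists>r>0. \<exists>\<sigma>. smooth_on UNIV \<sigma> \<and>
    (\<forall>x\<in>\<Omega>. \<sigma> x \<le> 0 \<and> (x \<in> ball p r \<longrightarrow> \<sigma> x < 0)) \<and>
    (\<forall>x\<in>frontier \<Omega>. \<sigma> x = 0 \<and> gradient \<sigma> x \<bullet> outward_normal \<Omega> x \<ge> 0 \<and>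
       (x \<in> ball p r \<longrightarrow> gradient \<sigma> x \<bullet> outward_normal \<Omega> x > 0)) \<and>
    (\<forall>x. x \<notin> closure \<Omega> \<longrightarrow> \<sigma> x \<ge> 0 \<and> (x \<in> ball p r \<longrightarrow> \<sigma> x > 0))"
proof (cases "p \<in> \<Omega>")
  case True
  then obtain r where r: "r > 0" "cball p r \<subseteq> \<Omega>" using \<Omega>(1) open_contains_cball by blast
  define \<sigma> where "\<sigma> x = - bump p r x" for x
  have z: "\<sigma> x = 0" if "x \<notin> ball p r" for x using bump_eq_0[OF r(1) that] by (simp add: \<sigma>_def)
  have fr: "x \<notin> cball p r" if "x \<in> frontier \<Omega>" for x
    using that r \<Omega>(1) by (auto simp: frontier_def interior_open)
  have "gradient \<sigma> x = 0" if "x \<in> frontier \<Omega>" for x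
  proof (rule gradient_eqI)
    have "((\<lambda>x. 0) has_derivative (\<lambda>v. 0 \<bullet> v)) (at x)" by simp
    then show "(\<sigma> has_derivative (\<lambda>v. 0 \<bullet> v)) (at x)"
      by (rule has_derivative_transform_within_open[of _ _ _ _ "- cball p r"])
        (use fr[OF that] z in auto)
  qed
  moreover have "x \<in> closure \<Omega>" if "x \<in> ball p r" for x
    using that r closure_subset by fastforce
  moreover have "smooth_on UNIV \<sigma>" unfolding \<sigma>_def[abs_def] by (intro smooth_on_minus smooth_bump) auto
  moreover have "x \<in> ball p r \<longrightarrow> \<sigma> x < 0" "\<sigma> x \<le> 0" for x
    using bump_nonneg[of p r x] bump_pos_iff[OF r(1), of p x] by (auto simp: \<sigma>_def)
  moreover have "\<sigma> x = 0" if "x \<in> frontier \<Omega>" for x using z fr[OF that] by auto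
  moreover have "x \<notin> ball p r" if "x \<in> frontier \<Omega>" for x using fr[OF that] by auto
  ultimately show ?thesis
    using r(1) z by (intro exI[of _ r] conjI exI[of _ \<sigma>] ballI allI impI) (metis inner_zero_left order_refl)+
next
  case False
  then have "p \<in> frontier \<Omega>" using p \<Omega>(1) by (simp add: frontier_def interior_open)
  then obtain U \<rho> where b: "boundary_defining \<Omega> p U \<rho>" using \<Omega>(2) by (auto simp: smooth_boundary_def)
  then have U: "open U" "p \<in> U" and s: "smooth_on U \<rho>" and g: "\<And>x. x \<in> U \<Longrightarrow> gradient \<rho> x \<noteq> 0"
    and in_iff: "\<And>x. x \<in> U \<Longrightarrow> x \<in> \<Omega> \<longleftrightarrow> \<rho> x < 0" and fr_iff: "\<And>x. x \<in> U \<Longrightarrow> x \<in> frontier \<Omega> \<longleftrightarrow> \<rho> x = 0"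
    by (auto simp: boundary_defining_def set_eq_iff)
  have b': "boundary_defining \<Omega> x U \<rho>" if "x \<in> U" for x
    using b that by (auto simp: boundary_defining_def)
  obtain r where r: "r > 0" "cball p r \<subseteq> U" using U open_contains_cball by blast
  have bU: "x \<in> U" if "x \<in> ball p r" for x using that r(2) by (auto simp: subset_iff)
  define \<sigma> where "\<sigma> x = bump p r x * \<rho> x" for x
  have z: "\<sigma> x = 0" if "x \<notin> ball p r" for x using bump_eq_0[OF r(1) that] by (simp add: \<sigma>_def)
  have sU: "smooth_on U \<sigma>" unfolding \<sigma>_def[abs_def]
    by (intro smooth_on_mult U(1) s smooth_on_subset[OF smooth_bump]) auto
  have sC: "smooth_on (- cball p r) \<sigma>"
    by (rule smooth_on_cong[OF _ _ smooth_on_const[of _ 0]]) (use z in auto)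
  have "U \<union> - cball p r = UNIV" using r(2) by auto
  then have smooth: "smooth_on UNIV \<sigma>" using smooth_on_Un[OF U(1) _ sU sC] closed_cball[of p r] by (simp add: open_Compl)
  have grad: "gradient \<sigma> x = bump p r x *\<^sub>R gradient \<rho> x" if x: "x \<in> frontier \<Omega>" "x \<in> U" for x
  proof (rule gradient_eqI)
    have "\<rho> x = 0" using x fr_iff by simp
    then show "(\<sigma> has_derivative (\<lambda>v. (bump p r x *\<^sub>R gradient \<rho> x) \<bullet> v)) (at x)"
      unfolding \<sigma>_def[abs_def]
      by (intro has_derivative_eq_rhs[OF has_derivative_mult[OF
              smooth_on_has_gradient[OF smooth_bump UNIV_I] smooth_on_has_gradient[OF s x(2)]]]) simp
  qed
  have grad0: "gradient \<sigma> x = 0" if x: "x \<notin> cball p r" for x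
  proof (rule gradient_eqI)
    have "((\<lambda>x. 0) has_derivative (\<lambda>v. 0 \<bullet> v)) (at x)" by simp
    then show "(\<sigma> has_derivative (\<lambda>v. 0 \<bullet> v)) (at x)"
      by (rule has_derivative_transform_within_open[of _ _ _ _ "- cball p r"]) (use x z in auto)
  qed
  have normal: "gradient \<rho> x \<bullet> outward_normal \<Omega> x > 0" if x: "x \<in> frontier \<Omega>" "x \<in> U" for x
  proof -
    have "gradient \<rho> x \<bullet> sgn (gradient \<rho> x) = norm (gradient \<rho> x)"
      using g[OF x(2)] by (simp add: sgn_div_norm power2_norm_eq_inner[symmetric] power2_eq_square)
    then show ?thesis using g[OF x(2)] by (simp add: outward_normal_eq[OF b'[OF x(2)] x(1)])
  qed
  have nc: "\<rho> x > 0" if "x \<in> U" "x \<notin> closure \<Omega>" for x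
  proof -
    have "x \<notin> \<Omega>" "x \<notin> frontier \<Omega>" using that closure_subset by (auto simp: frontier_def)
    then show ?thesis using in_iff[OF that(1)] fr_iff[OF that(1)] by linarith
  qed
  show ?thesis
  proof (intro exI[of _ r] conjI exI[of _ \<sigma>] ballI allI impI)
    show "\<sigma> x \<le> 0" if "x \<in> \<Omega>" for x
    proof (cases "x \<in> ball p r")
      case True
      have "\<rho> x < 0" using in_iff[OF bU[OF True]] that by simp
      then show ?thesis using bump_nonneg[of p r x] by (simp add: \<sigma>_def mult_nonneg_nonpos)
    qed (simp add: z)
    show "\<sigma> x < 0" if "x \<in> \<Omega>" "x \<in> ball p r" for x
    proof -
      have "\<rho> x < 0" using in_iff[OF bU[OF that(2)]] that by simp
      then show ?thesis using bump_pos_iff[OF r(1), of p x] that by (simp add: \<sigma>_def mult_pos_neg)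
    qed
    show "\<sigma> x = 0" if "x \<in> frontier \<Omega>" for x
      using z[of x] fr_iff[OF bU] that by (cases "x \<in> ball p r") (auto simp: \<sigma>_def)
    show "gradient \<sigma> x \<bullet> outward_normal \<Omega> x \<ge> 0" if "x \<in> frontier \<Omega>" for x
    proof (cases "x \<in> U")
      case True
      then show ?thesis using grad[OF that True] normal[OF that True] bump_nonneg[of p r x] by simp
    next
      case False
      then have "x \<notin> cball p r" using r(2) by blast
      from grad0[OF this] show ?thesis by simp
    qed
    show "gradient \<sigma> x \<bullet> outward_normal \<Omega> x > 0" if "x \<in> frontier \<Omega>" "x \<in> ball p r" for x
      using grad[OF that(1) bU[OF that(2)]] normal[OF that(1) bU[OF that(2)]] bump_pos_iff[OF r(1), of p x] that by simp
    show "\<sigma> x \<ge> 0" if "x \<notin> closure \<Omega>" for x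
    proof (cases "x \<in> ball p r")
      case True
      then show ?thesis using nc[OF bU[OF True] that] bump_nonneg[of p r x] by (simp add: \<sigma>_def)
    qed (simp add: z)
    show "\<sigma> x > 0" if "x \<notin> closure \<Omega>" "x \<in> ball p r" for x
      using nc[OF bU[OF that(2)] that(1)] bump_pos_iff[OF r(1), of p x] that by (simp add: \<sigma>_def)
  qed (use r smooth in auto)
qed

text \<open>Finitely many local contributions cover the closure of the domain by compactness, and their sum has the right
  signs near it. The gradient of the sum does not vanish on the boundary because the normal derivatives cannot
  cancel. Far away from the domain the sum vanishes; the term \<open>flat (t0 - T x)\<close> makes it positive there and vanishes
  with its gradient on the closure, where the total weight \<open>T\<close> of the bump functions is at least \<open>t0\<close>.\<close>

lemma global_defining_function:
  fixes \<Omega> :: "(real^'n) set"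
  assumes \<Omega>: "open \<Omega>" "bounded \<Omega>" "smooth_boundary \<Omega>"
  shows "\<exists>\<rho>. smooth_on UNIV \<rho> \<and> (\<forall>x\<in>\<Omega>. \<rho> x < 0) \<and>
    (\<forall>x\<in>frontier \<Omega>. \<rho> x = 0 \<and> gradient \<rho> x \<noteq> 0) \<and> (\<forall>x. x \<notin> closure \<Omega> \<longrightarrow> \<rho> x > 0)"
proof -
  define Q where "Q p r \<sigma> \<longleftrightarrow> r > 0 \<and> smooth_on UNIV \<sigma> \<and>
    (\<forall>x\<in>\<Omega>. \<sigma> x \<le> 0 \<and> (x \<in> ball p r \<longrightarrow> \<sigma> x < 0)) \<and>
    (\<forall>x\<in>frontier \<Omega>. \<sigma> x = 0 \<and> gradient \<sigma> x \<bullet> outward_normal \<Omega> x \<ge> 0 \<and>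
       (x \<in> ball p r \<longrightarrow> gradient \<sigma> x \<bullet> outward_normal \<Omega> x > 0)) \<and>
    (\<forall>x. x \<notin> closure \<Omega> \<longrightarrow> \<sigma> x \<ge> 0 \<and> (x \<in> ball p r \<longrightarrow> \<sigma> x > 0))" for p r and \<sigma> :: "real^'n \<Rightarrow> real"
  have "\<forall>p\<in>closure \<Omega>. \<exists>h. Q p (fst h) (snd h)"
  proof
    fix p assume "p \<in> closure \<Omega>"
    then obtain r \<sigma> where "Q p r \<sigma>"
      using local_defining_function[OF \<Omega>(1,3)] unfolding Q_def by blast
    then show "\<exists>h. Q p (fst h) (snd h)" by (intro exI[of _ "(r, \<sigma>)"]) simp
  qed
  then obtain h where h: "\<And>p. p \<in> closure \<Omega> \<Longrightarrow> Q p (fst (h p)) (snd (h p))"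
    using bchoice[of "closure \<Omega>" "\<lambda>p h. Q p (fst h) (snd h)"] by blast
  define r where "r p = fst (h p)" for p
  define \<sigma> where "\<sigma> p = snd (h p)" for p
  have Q: "Q p (r p) (\<sigma> p)" if "p \<in> closure \<Omega>" for p using h[OF that] by (simp add: r_def \<sigma>_def)
  have r: "\<And>p. p \<in> closure \<Omega> \<Longrightarrow> r p > 0" and sm: "\<And>p. p \<in> closure \<Omega> \<Longrightarrow> smooth_on UNIV (\<sigma> p)"
    and i: "\<And>p x. p \<in> closure \<Omega> \<Longrightarrow> x \<in> \<Omega> \<Longrightarrow> \<sigma> p x \<le> 0"
      "\<And>p x. p \<in> closure \<Omega> \<Longrightarrow> x \<in> \<Omega> \<Longrightarrow> x \<in> ball p (r p) \<Longrightarrow> \<sigma> p x < 0"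
    and f: "\<And>p x. p \<in> closure \<Omega> \<Longrightarrow> x \<in> frontier \<Omega> \<Longrightarrow> \<sigma> p x = 0"
      "\<And>p x. p \<in> closure \<Omega> \<Longrightarrow> x \<in> frontier \<Omega> \<Longrightarrow> gradient (\<sigma> p) x \<bullet> outward_normal \<Omega> x \<ge> 0"
      "\<And>p x. p \<in> closure \<Omega> \<Longrightarrow> x \<in> frontier \<Omega> \<Longrightarrow> x \<in> ball p (r p) \<Longrightarrow> gradient (\<sigma> p) x \<bullet> outward_normal \<Omega> x > 0"
    and e: "\<And>p x. p \<in> closure \<Omega> \<Longrightarrow> x \<notin> closure \<Omega> \<Longrightarrow> \<sigma> p x \<ge> 0"
      "\<And>p x. p \<in> closure \<Omega> \<Longrightarrow> x \<notin> closure \<Omega> \<Longrightarrow> x \<in> ball p (r p) \<Longrightarrow> \<sigma> p x > 0"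
    using Q unfolding Q_def by simp_all
  have "compact (closure \<Omega>)" using \<Omega>(2) by (simp add: compact_closure)
  moreover have "closure \<Omega> \<subseteq> (\<Union>p\<in>closure \<Omega>. ball p (r p))" using r by force
  ultimately obtain P where P: "P \<subseteq> closure \<Omega>" "finite P" "closure \<Omega> \<subseteq> (\<Union>p\<in>P. ball p (r p))"
    using compactE_image[of "closure \<Omega>" "closure \<Omega>" "\<lambda>p. ball p (r p)"] by (metis open_ball)
  define T where "T x = (\<Sum>p\<in>P. bump p (r p) x)" for x
  have sT: "smooth_on UNIV T" unfolding T_def[abs_def] by (intro smooth_on_sum smooth_bump) auto
  have Tpos: "T x > 0" if "p \<in> P" "x \<in> ball p (r p)" for p x
    unfolding T_def using that P r bump_pos_iff[of "r p" p x] 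
    by (intro sum_pos2[OF P(2) that(1)]) (auto simp: bump_nonneg)
  obtain t0 where t0: "t0 > 0" "\<And>x. x \<in> closure \<Omega> \<Longrightarrow> T x \<ge> t0"
  proof (cases "closure \<Omega> = {}")
    case False
    obtain x0 where "x0 \<in> closure \<Omega>" "\<And>x. x \<in> closure \<Omega> \<Longrightarrow> T x0 \<le> T x"
      using continuous_attains_inf[OF \<open>compact (closure \<Omega>)\<close> False] 
        continuous_on_subset[OF smooth_on_continuous[OF sT]] by (metis subset_UNIV)
    then show ?thesis using that[of "T x0"] Tpos P(3) by blast
  qed (use that[of 1] in simp)
  define \<rho> where "\<rho> x = (\<Sum>p\<in>P. \<sigma> p x) + flat (t0 - T x)" for x
  have smooth: "smooth_on UNIV \<rho>" unfolding \<rho>_def[abs_def]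
    by (intro smooth_on_add smooth_on_sum smooth_on_flat_compose smooth_on_diff smooth_on_const sT) (use sm P in auto)
  have Pc: "p \<in> closure \<Omega>" if "p \<in> P" for p using that P(1) by blast
  have flat0: "flat (t0 - T x) = 0" if "x \<in> closure \<Omega>" for x using t0(2)[OF that] by simp
  have "\<rho> x < 0" if "x \<in> \<Omega>" for x
  proof -
    have xc: "x \<in> closure \<Omega>" using that closure_subset by blast
    then obtain p where p: "p \<in> P" "x \<in> ball p (r p)" using P(3) by blast
    have "(\<Sum>p\<in>P. \<sigma> p x) < (\<Sum>p\<in>P. 0)"
      using i(1)[OF Pc that] i(2)[OF Pc[OF p(1)] that p(2)] p(1) P(2) by (intro sum_strict_mono_ex1) auto
    moreover have "\<rho> x = (\<Sum>p\<in>P. \<sigma> p x)" unfolding \<rho>_def flat0[OF xc] by simp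
    ultimately show ?thesis by simp
  qed
  moreover have "\<rho> x = 0 \<and> gradient \<rho> x \<noteq> 0" if x: "x \<in> frontier \<Omega>" for x
  proof
    have xc: "x \<in> closure \<Omega>" using x by (simp add: frontier_def)
    show "\<rho> x = 0" using f(1) Pc x flat0[OF xc] by (simp add: \<rho>_def)
    obtain p where p: "p \<in> P" "x \<in> ball p (r p)" using P(3) xc by blast
    have "flat_pow 2 (t0 - T x) = 0" using t0(2)[OF xc] by (simp add: flat_pow_def)
    then have F: "((\<lambda>x. flat (t0 - T x)) has_derivative (\<lambda>v. 0)) (at x)"
    proof -
      have "((\<lambda>x. t0 - T x) has_derivative (\<lambda>v. 0 - gradient T x \<bullet> v)) (at x)"
        by (intro has_derivative_diff has_derivative_const smooth_on_has_gradient[OF sT UNIV_I])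
      from has_derivative_compose[OF this flat_has_derivative[unfolded has_field_derivative_def]]
      show ?thesis using \<open>flat_pow 2 (t0 - T x) = 0\<close> by simp
    qed
    have "(\<rho> has_derivative (\<lambda>v. (\<Sum>p\<in>P. gradient (\<sigma> p) x) \<bullet> v)) (at x)"
      unfolding \<rho>_def[abs_def]
      by (rule has_derivative_eq_rhs[OF has_derivative_add[OF has_derivative_sum F]])
        (use sm Pc in \<open>auto intro!: smooth_on_has_gradient simp: inner_sum_left\<close>)
    then have "gradient \<rho> x = (\<Sum>p\<in>P. gradient (\<sigma> p) x)" by (rule gradient_eqI)
    moreover have "0 < (\<Sum>p\<in>P. gradient (\<sigma> p) x \<bullet> outward_normal \<Omega> x)"
      using f Pc x p by (intro sum_pos2[OF P(2) p(1)]) auto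
    ultimately show "gradient \<rho> x \<noteq> 0" by (metis inner_sum_left inner_zero_left less_irrefl)
  qed
  moreover have "\<rho> x > 0" if x: "x \<notin> closure \<Omega>" for x
  proof (cases "\<exists>p\<in>P. x \<in> ball p (r p)")
    case True
    then obtain p where p: "p \<in> P" "x \<in> ball p (r p)" by blast
    have "0 < (\<Sum>p\<in>P. \<sigma> p x)" using e Pc x p by (intro sum_pos2[OF P(2) p(1)]) auto
    then show ?thesis using flat_nonneg[of "t0 - T x"] by (simp add: \<rho>_def add_pos_nonneg)
  next
    case False
    then have "bump p (r p) x = 0" if "p \<in> P" for p
      using bump_eq_0[OF r[OF Pc[OF that]]] that by blast
    then have "T x = 0" unfolding T_def by simp
    moreover have "0 \<le> (\<Sum>p\<in>P. \<sigma> p x)" using e Pc x by (intro sum_nonneg) auto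
    ultimately show ?thesis using t0(1) by (simp add: \<rho>_def add_nonneg_pos)
  qed
  ultimately show ?thesis using smooth by blast
qed

lemma smooth_on_vec_nth:
  fixes W :: "'a::euclidean_space \<Rightarrow> real^'n"
  shows "open U \<Longrightarrow> smooth_on U W \<Longrightarrow> smooth_on U (\<lambda>x. W x $ i)"
  by (rule smooth_on_bounded_linear[OF _ bounded_linear_vec_nth])

lemma pderiv_at_smooth:
  assumes "smooth_on UNIV f" shows "(f has_derivative frechet_derivative f (at x)) (at x)"
    and "continuous_on UNIV (pderiv_at i f)"
  using smooth_on_has_derivative[OF assms] smooth_on_continuous[OF smooth_on_pderiv_at[OF open_UNIV assms]] by auto

lemma pderiv_at_nth:
  fixes W :: "real^'n \<Rightarrow> real^'m"
  assumes "(W has_derivative W') (at x)" shows "pderiv_at i (\<lambda>x. W x $ j) x = pderiv_at i W x $ j"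
  using pderiv_at_eq[OF bounded_linear.has_derivative[OF bounded_linear_vec_nth[of j] assms]] pderiv_at_eq[OF assms] by simp

lemma pderiv_at_diff:
  assumes "(f has_derivative f') (at x)" "(g has_derivative g') (at x)"
  shows "pderiv_at i (\<lambda>x. f x - g x) x = pderiv_at i f x - pderiv_at i g x"
  using pderiv_at_eq[OF has_derivative_diff[OF assms]] pderiv_at_eq[OF assms(1)] pderiv_at_eq[OF assms(2)] by simp

lemma pderiv_at_mult:
  fixes a b :: "real^'n \<Rightarrow> real"
  assumes "(a has_derivative a') (at x)" "(b has_derivative b') (at x)"
  shows "pderiv_at i (\<lambda>x. a x * b x) x = a x * pderiv_at i b x + pderiv_at i a x * b x"
  using pderiv_at_eq[OF has_derivative_mult[OF assms]] pderiv_at_eq[OF assms(1)] pderiv_at_eq[OF assms(2)] by simp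

lemma pderiv_at_gradient_commute:
  fixes c :: "real^'n \<Rightarrow> real"
  assumes "smooth_on UNIV c"
  shows "pderiv_at i (gradient c) x $ j = pderiv_at j (gradient c) x $ i"
proof -
  note gd = pderiv_at_smooth[OF smooth_on_gradient[OF open_UNIV assms]]
  note pd = pderiv_at_smooth[OF smooth_on_pderiv_at[OF open_UNIV assms]]
  have comm: "pderiv_at i (pderiv_at j c) x = pderiv_at j (pderiv_at i c) x"
    using mixed_derivatives_commute[of c "\<lambda>x. frechet_derivative c (at x)" "axis j 1"
        "\<lambda>x. frechet_derivative (pderiv_at j c) (at x)" "axis i 1"
        "\<lambda>x. frechet_derivative (pderiv_at i c) (at x)" x]
      pderiv_at_smooth(1)[OF assms] pd
    by (simp add: pderiv_at_def[abs_def])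
  have "(\<lambda>x. gradient c x $ j) = pderiv_at j c" for j by (simp add: gradient_def)
  then show ?thesis
    using pderiv_at_nth[OF gd(1), where i = i and j = j] pderiv_at_nth[OF gd(1), where i = j and j = i] comm by simp
qed

text \<open>For \<open>s = - m \<rho>\<close> these are the bounds on \<open>\<rho>\<close> times the derivative of the cut-off function \<open>flat (- m \<rho> - 1)\<close>:
  uniform in \<open>m\<close>, and tending to zero as \<open>m\<close> grows.\<close>

lemma flat_pow_2_scaled:
  assumes "s \<ge> 0" shows "s * flat_pow 2 (s - 1) \<le> 2" "0 \<le> s * flat_pow 2 (s - 1)"
    and "s > 2 \<Longrightarrow> s * flat_pow 2 (s - 1) \<le> 2 * inverse (s - 1)"
proof -
  show "0 \<le> s * flat_pow 2 (s - 1)" using assms by (simp add: flat_pow_def)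
  have *: "s * flat_pow 2 (s - 1) = ((inverse (s - 1))\<^sup>2 + inverse (s - 1)) * exp (- inverse (s - 1))" if "s > 1"
  proof -
    have "(s - 1) * inverse (s - 1) = 1" using that by simp
    then have "s * (inverse (s - 1))\<^sup>2 = (inverse (s - 1))\<^sup>2 + inverse (s - 1)"
      by (simp add: power2_eq_square algebra_simps) (metis distrib_left mult.assoc mult_1 mult.commute)
    then show ?thesis using that by (simp add: flat_pow_def mult.assoc[symmetric])
  qed
  show "s * flat_pow 2 (s - 1) \<le> 2"
  proof (cases "s > 1")
    case True
    define y where "y = inverse (s - 1)"
    have y: "y > 0" using True by (simp add: y_def)
    have "1 + y + y\<^sup>2 / 2 \<le> exp y" using exp_lower_Taylor_quadratic[of y] y by simp
    then have "y\<^sup>2 + y \<le> 2 * exp y" using y by linarith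
    then show ?thesis unfolding *[OF True] y_def[symmetric] by (simp add: exp_minus field_simps)
  qed (use assms in \<open>simp add: flat_pow_def\<close>)
  show "s * flat_pow 2 (s - 1) \<le> 2 * inverse (s - 1)" if "s > 2"
  proof -
    define y where "y = inverse (s - 1)"
    have y: "0 < y" "y \<le> 1" using that by (auto simp: y_def field_simps)
    have "(y\<^sup>2 + y) * exp (- y) \<le> (y\<^sup>2 + y) * 1" using y by (intro mult_left_mono) auto
    also have "\<dots> \<le> 2 * y" using y by (simp add: power2_eq_square mult_left_le)
    finally show ?thesis using *[of] that by (simp add: y_def)
  qed
qed

locale smooth_domain = bounded_domain \<Omega> for \<Omega> :: "(real^'n) set" +
  fixes \<rho> :: "real^'n \<Rightarrow> real"
  assumes smooth_rho: "smooth_on UNIV \<rho>" and rho_neg: "x \<in> \<Omega> \<Longrightarrow> \<rho> x < 0"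
    and rho_frontier: "x \<in> frontier \<Omega> \<Longrightarrow> \<rho> x = 0" and grad_rho: "x \<in> frontier \<Omega> \<Longrightarrow> gradient \<rho> x \<noteq> 0"
    and rho_pos: "x \<notin> closure \<Omega> \<Longrightarrow> \<rho> x > 0"
begin

lemma rho_neg_iff: "\<rho> x < 0 \<longleftrightarrow> x \<in> \<Omega>" and rho_zero_iff: "\<rho> x = 0 \<longleftrightarrow> x \<in> frontier \<Omega>"
proof -
  have "x \<in> closure \<Omega> \<longleftrightarrow> x \<in> \<Omega> \<or> x \<in> frontier \<Omega>" "\<not> (x \<in> \<Omega> \<and> x \<in> frontier \<Omega>)"
    using closure_subset open_domain by (auto simp: frontier_def interior_open)
  then show "\<rho> x < 0 \<longleftrightarrow> x \<in> \<Omega>" "\<rho> x = 0 \<longleftrightarrow> x \<in> frontier \<Omega>"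
    using rho_neg[of x] rho_frontier[of x] rho_pos[of x] by (auto; linarith)+
qed

lemma rho_gradient: "(\<rho> has_derivative (\<lambda>v. gradient \<rho> x \<bullet> v)) (at x)"
  by (rule smooth_on_has_gradient[OF smooth_rho UNIV_I])

lemma outward_normal_rho:
  assumes "x \<in> frontier \<Omega>" shows "outward_normal \<Omega> x = sgn (gradient \<rho> x)"
proof (rule outward_normal_eq[OF _ assms])
  let ?U = "{x. gradient \<rho> x \<noteq> 0}"
  have "continuous_on UNIV (gradient \<rho>)"
    by (intro smooth_on_continuous smooth_on_gradient smooth_rho open_UNIV)
  then have "open ?U" using open_Collect_neq[of "gradient \<rho>" "\<lambda>x. 0"] by auto
  then show "boundary_defining \<Omega> x ?U \<rho>"
    using grad_rho[OF assms] smooth_on_subset[OF smooth_rho]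
    by (auto simp: boundary_defining_def rho_neg_iff rho_zero_iff)
qed

lemma tangential_trace_smooth:
  assumes V: "smooth_on UNIV V" and t: "\<And>x. x \<in> frontier \<Omega> \<Longrightarrow> V x \<bullet> gradient \<rho> x = 0"
  shows "tangential_trace \<Omega> V"
  unfolding tangential_trace_def is_trace_def
proof (intro exI[of _ V] conjI)
  have "V \<in> borel_measurable borel" using smooth_on_continuous[OF V] by (rule borel_measurable_continuous_onI)
  then show "V \<in> borel_measurable (surface_measure \<Omega>)"
    unfolding surface_measure_def
    by (intro measurable_restrict_space1) (simp cong: measurable_cong_sets)
  have "L2_norm_on \<Omega> (weak_pderiv \<Omega> i (\<lambda>x. 0::real^'n)) = 0" for i
    using norm_cong_AE[OF H1_C1(2)[of "\<lambda>x. 0::real^'n" "\<lambda>x h. 0"], of i] by (simp add: L2_norm_on_def)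
  then have "Hk_norm 1 \<Omega> (\<lambda>x. V x - V x) = 0"
    by (simp add: Hk_norm_def L2_norm_on_def)
  then show "\<exists>W. (\<forall>k. smooth_on UNIV (W k)) \<and> (\<lambda>k. Hk_norm 1 \<Omega> (\<lambda>x. W k x - V x)) \<longlonglongrightarrow> 0 \<and>
      (\<lambda>k. \<integral>\<^sup>+ x. ennreal ((norm (W k x - V x))\<^sup>2) \<partial>surface_measure \<Omega>) \<longlonglongrightarrow> 0"
    using V by (intro exI[of _ "\<lambda>k. V"]) simp
  have "space (surface_measure \<Omega>) \<subseteq> frontier \<Omega>"
    by (simp add: surface_measure_def space_restrict_space)
  then show "AE x in surface_measure \<Omega>. V x \<bullet> outward_normal \<Omega> x = 0"
    using t by (intro AE_I2) (auto simp: outward_normal_rho sgn_div_norm subset_iff)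
qed

text \<open>Integration by parts for a field that is tangential to the boundary: cutting off with
  \<open>flat (- m \<rho> - 1)\<close> produces the error \<open>f V \<cdot> \<nabla>(flat (- m \<rho> - 1))\<close>, which is bounded uniformly in \<open>m\<close>
  because \<open>V \<cdot> \<nabla>\<rho>\<close> is divisible by \<open>\<rho>\<close>, and which tends to zero pointwise.\<close>

lemma Green_tangential:
  assumes V: "smooth_on UNIV V" and H: "continuous_on UNIV H"
    and t: "\<And>x. V x \<bullet> gradient \<rho> x = \<rho> x * H x" and f: "Hk_on 1 \<Omega> f"
  shows "L2_inner \<Omega> f (weak_div \<Omega> V) = - L2_inner \<Omega> (weak_grad \<Omega> f) V"
proof -
  define divV where "divV x = (\<Sum>i\<in>UNIV. pderiv_at i V x $ i)" for x
  define cut where "cut m x = flat (- real m * \<rho> x - 1)" for m :: nat and x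
  define err where "err m x = - real m * flat_pow 2 (- real m * \<rho> x - 1) * (\<rho> x * H x)" for m :: nat and x
  have cut_smooth: "smooth_on UNIV (cut m)" for m
    unfolding cut_def[abs_def]
    by (intro smooth_on_flat_compose smooth_on_diff smooth_on_mult smooth_on_const smooth_rho) auto
  have cut_z: "cut m x = 0" if "- real m * \<rho> x < 1" for m x using that by (simp add: cut_def)
  have cV: "continuous_on UNIV V" "continuous_on UNIV divV" "continuous_on UNIV \<rho>" "continuous_on UNIV (cut m)" for m
    using smooth_on_continuous[OF V] pderiv_at_smooth(2)[OF V] smooth_on_continuous[OF smooth_rho] smooth_on_continuous[OF cut_smooth]
    by (auto simp: divV_def[abs_def] intro!: continuous_intros)
  have f2: "continuous_on UNIV (flat_pow 2)" using Ck_on_flat_pow[of 0 2] by simp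
  have err_cont: "continuous_on UNIV (err m)" for m
    unfolding err_def[abs_def]
    by (intro continuous_intros continuous_on_compose2[OF f2] cV H) auto
  have cut_grad: "pderiv_at i (cut m) x = - real m * flat_pow 2 (- real m * \<rho> x - 1) * gradient \<rho> x $ i" for i m x
  proof -
    have "((\<lambda>x. - real m * \<rho> x - 1) has_derivative (\<lambda>v. - real m * (gradient \<rho> x \<bullet> v))) (at x)"
      by (auto intro!: derivative_eq_intros rho_gradient)
    from has_derivative_compose[OF this flat_has_derivative[unfolded has_field_derivative_def]]
    show ?thesis unfolding cut_def[abs_def] by (simp add: pderiv_at_eq inner_axis mult.commute mult.left_commute)
  qed
  have test: "test_function \<Omega> (\<lambda>x. cut m x * V x $ i)" for m i
  proof (rule test_functionI[where K = "{x. 1 \<le> - real m * \<rho> x}"])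
    have "closed {x. 1 \<le> - real m * \<rho> x}"
      by (intro closed_Collect_le continuous_intros cV)
    moreover have sub: "{x. 1 \<le> - real m * \<rho> x} \<subseteq> \<Omega>"
    proof
      fix x assume "x \<in> {x. 1 \<le> - real m * \<rho> x}"
      then have "real m * \<rho> x < 0" by simp
      then have "\<rho> x < 0" using mult_nonneg_nonneg[of "real m" "\<rho> x"] by linarith
      then show "x \<in> \<Omega>" by (simp add: rho_neg_iff)
    qed
    ultimately show "compact {x. 1 \<le> - real m * \<rho> x}"
      using bounded_subset[OF bounded_domain] by (simp add: compact_eq_bounded_closed)
    show "{x. 1 \<le> - real m * \<rho> x} \<subseteq> \<Omega>" by (rule sub)
  qed (use cut_z in \<open>auto intro!: smooth_on_mult cut_smooth smooth_on_vec_nth V\<close>)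
  have pd: "pderiv_at i (\<lambda>x. cut m x * V x $ i) x = cut m x * pderiv_at i V x $ i + pderiv_at i (cut m) x * V x $ i" for i m x
    using pderiv_at_mult[OF pderiv_at_smooth(1)[OF cut_smooth] pderiv_at_smooth(1)[OF smooth_on_vec_nth[OF open_UNIV V]]]
      pderiv_at_nth[OF pderiv_at_smooth(1)[OF V]] by simp
  have L2: "L2_on \<Omega> (\<lambda>x. cut m x * divV x)" "L2_on \<Omega> (err m)" "L2_on \<Omega> (\<lambda>x. cut m x *\<^sub>R V x)" "L2_on \<Omega> divV" "L2_on \<Omega> V" for m
    by (auto intro!: L2_continuous continuous_intros cV err_cont)
  have main: "L2_inner \<Omega> (\<lambda>x. cut m x * divV x) f + L2_inner \<Omega> (err m) f = - L2_inner \<Omega> (\<lambda>x. cut m x *\<^sub>R V x) (weak_grad \<Omega> f)" for m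
  proof -
    have int: "integrable (lebesgue_on \<Omega>) (\<lambda>x. pderiv_at i (\<lambda>x. cut m x * V x $ i) x *\<^sub>R f x)"
      "integrable (lebesgue_on \<Omega>) (\<lambda>x. (cut m x * V x $ i) *\<^sub>R weak_pderiv \<Omega> i f x)" for i
      using is_weak_pderiv_times_integrable[OF open_domain H1_weak_pderiv(1)[OF f] test] by auto
    have sum_eq: "(\<Sum>i\<in>UNIV. pderiv_at i (\<lambda>x. cut m x * V x $ i) x *\<^sub>R f x) = cut m x * divV x * f x + err m x * f x" for x
    proof -
      have "(\<Sum>i\<in>UNIV. pderiv_at i (cut m) x * V x $ i) = - real m * flat_pow 2 (- real m * \<rho> x - 1) * (V x \<bullet> gradient \<rho> x)"
        by (simp add: cut_grad inner_vec_def sum_distrib_left sum_negf algebra_simps)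
      then have "(\<Sum>i\<in>UNIV. pderiv_at i (cut m) x * V x $ i) = err m x" by (simp add: t err_def)
      then show ?thesis
        by (simp add: pd divV_def sum_distrib_left sum_distrib_right sum.distrib distrib_right[symmetric])
          (simp add: sum_distrib_right[symmetric] sum.distrib sum_distrib_left[symmetric] distrib_right)
    qed
    have "L2_inner \<Omega> (\<lambda>x. cut m x * divV x) f + L2_inner \<Omega> (err m) f
        = (LINT x|lebesgue_on \<Omega>. cut m x * divV x * f x + err m x * f x)"
      using L2_inner_integrable[OF L2(1) H1_L2[OF f]] L2_inner_integrable[OF L2(2) H1_L2[OF f]]
      by (simp add: L2_inner_def)
    also have "\<dots> = (\<Sum>i\<in>UNIV. LINT x|lebesgue_on \<Omega>. pderiv_at i (\<lambda>x. cut m x * V x $ i) x *\<^sub>R f x)"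
      using int(1) by (simp add: sum_eq[symmetric] del: real_scaleR_def)
    also have "\<dots> = (\<Sum>i\<in>UNIV. - (LINT x|lebesgue_on \<Omega>. (cut m x * V x $ i) *\<^sub>R weak_pderiv \<Omega> i f x))"
      using H1_weak_pderiv(1)[OF f] test by (intro sum.cong refl) (auto simp: is_weak_pderiv_def)
    also have "\<dots> = - (LINT x|lebesgue_on \<Omega>. (\<Sum>i\<in>UNIV. (cut m x * V x $ i) *\<^sub>R weak_pderiv \<Omega> i f x))"
      using int(2) by (simp add: sum_negf del: real_scaleR_def)
    also have "(\<lambda>x. \<Sum>i\<in>UNIV. (cut m x * V x $ i) *\<^sub>R weak_pderiv \<Omega> i f x) = (\<lambda>x. (cut m x *\<^sub>R V x) \<bullet> weak_grad \<Omega> f x)"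
      by (simp add: inner_vec_def weak_grad_def)
    finally show ?thesis by (simp add: L2_inner_def)
  qed
  have arg: "filterlim (\<lambda>m. - real m * \<rho> x - 1) at_top sequentially" if "x \<in> \<Omega>" for x
  proof -
    have "filterlim (\<lambda>m. -1 + (- \<rho> x) * real m) at_top sequentially"
      using rho_neg[OF that]
      by (intro filterlim_tendsto_add_at_top tendsto_const filterlim_tendsto_pos_mult_at_top filterlim_real_sequentially) auto
    moreover have "(\<lambda>m. -1 + (- \<rho> x) * real m) = (\<lambda>m. - real m * \<rho> x - 1)" by (simp add: fun_eq_iff)
    ultimately show ?thesis by metis
  qed
  have cut_lim: "(\<lambda>m. cut m x) \<longlonglongrightarrow> 1" if "x \<in> \<Omega>" for x
    unfolding cut_def by (rule filterlim_compose[OF flat_tendsto_1 arg[OF that]])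
  have cut_b: "\<bar>cut m x - 1\<bar> \<le> 1" for m x
    using flat_nonneg[of "- real m * \<rho> x - 1"] flat_le_1[of "- real m * \<rho> x - 1"] by (simp add: cut_def)
  have err_le: "\<bar>err m x\<bar> \<le> (- real m * \<rho> x * flat_pow 2 (- real m * \<rho> x - 1)) * \<bar>H x\<bar>"
    "\<bar>err m x\<bar> \<le> 2 * \<bar>H x\<bar>" if "x \<in> \<Omega>" for m x
  proof -
    have s: "0 \<le> - real m * \<rho> x" using rho_neg[OF that] by (simp add: mult_nonneg_nonpos)
    have "\<bar>err m x\<bar> = \<bar>(- real m * \<rho> x * flat_pow 2 (- real m * \<rho> x - 1)) * H x\<bar>"
      by (simp add: err_def algebra_simps)
    also have "\<dots> = (- real m * \<rho> x * flat_pow 2 (- real m * \<rho> x - 1)) * \<bar>H x\<bar>"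
      unfolding abs_mult[of _ "H x"] abs_of_nonneg[OF flat_pow_2_scaled(2)[OF s]] ..
    finally have eq: "\<bar>err m x\<bar> = (- real m * \<rho> x * flat_pow 2 (- real m * \<rho> x - 1)) * \<bar>H x\<bar>" .
    then show "\<bar>err m x\<bar> \<le> (- real m * \<rho> x * flat_pow 2 (- real m * \<rho> x - 1)) * \<bar>H x\<bar>" by simp
    show "\<bar>err m x\<bar> \<le> 2 * \<bar>H x\<bar>"
      unfolding eq by (intro mult_right_mono flat_pow_2_scaled(1)[OF s]) simp
  qed
  have err_lim: "(\<lambda>m. err m x) \<longlonglongrightarrow> 0" if x: "x \<in> \<Omega>" for x
  proof -
    have "(\<lambda>m. 2 * inverse (- real m * \<rho> x - 1) * \<bar>H x\<bar>) \<longlonglongrightarrow> 2 * 0 * \<bar>H x\<bar>"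
      by (intro tendsto_intros tendsto_inverse_0_at_top arg[OF x])
    then have lim: "(\<lambda>m. 2 * inverse (- real m * \<rho> x - 1) * \<bar>H x\<bar>) \<longlonglongrightarrow> 0" by simp
    have "\<forall>\<^sub>F m in sequentially. norm (err m x) \<le> 2 * inverse (- real m * \<rho> x - 1) * \<bar>H x\<bar>"
      using filterlim_at_top_dense[THEN iffD1, OF arg[OF x], rule_format, of 1]
    proof eventually_elim
      case (elim m)
      then have "- real m * \<rho> x > 2" by simp
      then have "(- real m * \<rho> x * flat_pow 2 (- real m * \<rho> x - 1)) * \<bar>H x\<bar> \<le> 2 * inverse (- real m * \<rho> x - 1) * \<bar>H x\<bar>"
        by (intro mult_right_mono flat_pow_2_scaled(3)) auto
      then show ?case using err_le(1)[OF x, of m] by simp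
    qed
    then show ?thesis by (rule Lim_null_comparison[OF _ lim])
  qed
  have AEI: "AE x in lebesgue_on \<Omega>. P x" if "\<And>x. x \<in> \<Omega> \<Longrightarrow> P x" for P
    using that by (simp add: AE_lebesgue_on_iff[OF domain_sets])
  have "(\<lambda>m. L2_norm_on \<Omega> (\<lambda>x. cut m x * divV x - divV x)) \<longlonglongrightarrow> 0"
  proof (rule L2_tendsto_dominated[OF _ L2(4)])
    show "AE x in lebesgue_on \<Omega>. norm (cut m x * divV x - divV x) \<le> norm (divV x)" for m
    proof (rule AE_I2)
      fix x
      have "\<bar>(cut m x - 1) * divV x\<bar> \<le> 1 * \<bar>divV x\<bar>"
        unfolding abs_mult by (intro mult_right_mono cut_b) simp
      then show "norm (cut m x * divV x - divV x) \<le> norm (divV x)" by (simp add: algebra_simps)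
    qed
    show "AE x in lebesgue_on \<Omega>. (\<lambda>m. cut m x * divV x - divV x) \<longlonglongrightarrow> 0"
      by (rule AEI) (auto intro!: tendsto_eq_intros cut_lim)
  qed (intro L2_onD L2_on_diff L2)
  then have 1: "(\<lambda>m. L2_inner \<Omega> (\<lambda>x. cut m x * divV x) f) \<longlonglongrightarrow> L2_inner \<Omega> divV f"
    by (intro L2_inner_tendsto L2 H1_L2 f)
  have "(\<lambda>m. L2_norm_on \<Omega> (err m)) \<longlonglongrightarrow> 0"
  proof (rule L2_tendsto_dominated)
    show "L2_on \<Omega> (\<lambda>x. 2 * H x)" by (intro L2_continuous continuous_intros H)
    show "AE x in lebesgue_on \<Omega>. norm (err m x) \<le> norm (2 * H x)" for m
      by (rule AEI) (use err_le(2) in \<open>simp add: abs_mult\<close>)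
    show "AE x in lebesgue_on \<Omega>. (\<lambda>m. err m x) \<longlonglongrightarrow> 0" by (rule AEI) (rule err_lim)
  qed (intro L2_onD L2)
  then have 2: "(\<lambda>m. L2_inner \<Omega> (err m) f) \<longlonglongrightarrow> L2_inner \<Omega> (\<lambda>x. 0) f"
    by (intro L2_inner_tendsto L2 H1_L2 f L2_on_zero) simp
  have "(\<lambda>m. L2_norm_on \<Omega> (\<lambda>x. cut m x *\<^sub>R V x - V x)) \<longlonglongrightarrow> 0"
  proof (rule L2_tendsto_dominated[OF _ L2(5)])
    show "AE x in lebesgue_on \<Omega>. norm (cut m x *\<^sub>R V x - V x) \<le> norm (V x)" for m
    proof (rule AE_I2)
      fix x
      have "norm ((cut m x - 1) *\<^sub>R V x) \<le> 1 * norm (V x)"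
        unfolding norm_scaleR by (intro mult_right_mono cut_b) simp
      then show "norm (cut m x *\<^sub>R V x - V x) \<le> norm (V x)" by (simp add: algebra_simps)
    qed
    show "AE x in lebesgue_on \<Omega>. (\<lambda>m. cut m x *\<^sub>R V x - V x) \<longlonglongrightarrow> 0"
      by (rule AEI) (auto intro!: tendsto_eq_intros cut_lim)
  qed (intro L2_onD L2_on_diff L2)
  then have 3: "(\<lambda>m. - L2_inner \<Omega> (\<lambda>x. cut m x *\<^sub>R V x) (weak_grad \<Omega> f)) \<longlonglongrightarrow> - L2_inner \<Omega> V (weak_grad \<Omega> f)"
    by (intro tendsto_minus L2_inner_tendsto L2 L2_weak_grad f)
  have "L2_inner \<Omega> divV f + L2_inner \<Omega> (\<lambda>x. 0) f = - L2_inner \<Omega> V (weak_grad \<Omega> f)"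
    using LIMSEQ_unique[OF tendsto_add[OF 1 2, unfolded main] 3] .
  moreover have "L2_inner \<Omega> f (weak_div \<Omega> V) = L2_inner \<Omega> f divV"
    using weak_div_smooth[OF V] by (intro inner_cong_AE) (auto simp: divV_def)
  moreover have "L2_inner \<Omega> (\<lambda>x. 0) f = 0" by (simp add: L2_inner_def)
  ultimately show ?thesis by (simp add: L2_inner_commute)
qed

end

lemma has_derivative_imp_gradient_mult:
  fixes a b :: "real^'n \<Rightarrow> real"
  assumes "(a has_derivative (\<lambda>v. a' \<bullet> v)) (at x)" "(b has_derivative (\<lambda>v. b' \<bullet> v)) (at x)"
  shows "gradient (\<lambda>x. a x * b x) x = b x *\<^sub>R a' + a x *\<^sub>R b'"
  by (rule gradient_eqI, rule has_derivative_eq_rhs[OF has_derivative_mult[OF assms]])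
    (auto simp: inner_simps algebra_simps)

context smooth_domain
begin

text \<open>The gradient of \<open>g \<rho> / (1 + k \<rho>\<^sup>2)\<close> equals \<open>g \<nabla>\<rho>\<close> on the boundary, so with \<open>g = W \<cdot> \<nabla>\<rho> / \<bar>\<nabla>\<rho>\<bar>\<^sup>2\<close> there,
  subtracting it removes the normal component of \<open>W\<close>. Being a gradient it does not change the rotation, and it
  tends to zero for large \<open>k\<close> because it concentrates at the boundary.\<close>

lemma tangential_approximation:
  assumes W: "smooth_on UNIV W"
  shows "\<exists>V. (\<forall>k::nat. smooth_on UNIV (V k) \<and> tangential_trace \<Omega> (V k) \<and>
      (AE x in lebesgue_on \<Omega>. weak_rot \<Omega> (V k) x = weak_rot \<Omega> W x) \<and>
      (\<forall>f. Hk_on 1 \<Omega> f \<longrightarrow> L2_inner \<Omega> f (weak_div \<Omega> (V k)) = - L2_inner \<Omega> (weak_grad \<Omega> f) (V k))) \<and>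
    (\<lambda>k. L2_norm_on \<Omega> (\<lambda>x. V k x - W x)) \<longlonglongrightarrow> 0"
proof -
  define N where "N x = gradient \<rho> x \<bullet> gradient \<rho> x" for x
  \<comment> \<open>the summand \<open>\<rho>\<^sup>2\<close> keeps the denominator positive at critical points of \<open>\<rho>\<close> off the boundary\<close>
  define D where "D x = N x + (\<rho> x)\<^sup>2" for x
  define g where "g x = (W x \<bullet> gradient \<rho> x) * inverse (D x)" for x
  define j where "j k x = inverse (1 + real k * (\<rho> x)\<^sup>2)" for k :: nat and x
  define c where "c k x = g x * (\<rho> x * j k x)" for k x
  define V where "V k x = W x - gradient (c k) x" for k x
  have Dpos: "D x > 0" for x
  proof (cases "\<rho> x = 0")
    case True
    then have "gradient \<rho> x \<noteq> 0" using grad_rho by (simp add: rho_zero_iff)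
    then show ?thesis by (simp add: D_def N_def add_pos_nonneg)
  next
    case False
    then show ?thesis by (simp add: D_def N_def add_nonneg_pos)
  qed
  have jpos: "1 + real k * (\<rho> x)\<^sup>2 > 0" for k x by (simp add: add_pos_nonneg)
  have sgr: "smooth_on UNIV (gradient \<rho>)" by (intro smooth_on_gradient smooth_rho open_UNIV)
  have sD: "smooth_on UNIV D" unfolding D_def[abs_def] N_def power2_eq_square
    by (intro smooth_on_add smooth_on_inner smooth_on_mult sgr smooth_rho open_UNIV)
  have sg: "smooth_on UNIV g" unfolding g_def[abs_def]
    by (intro smooth_on_mult smooth_on_inner smooth_on_inverse sD sgr W open_UNIV) (use Dpos in \<open>simp add: less_imp_neq[symmetric]\<close>)
  have sj: "smooth_on UNIV (j k)" for k unfolding j_def[abs_def] power2_eq_square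
    by (intro smooth_on_inverse smooth_on_add smooth_on_mult smooth_on_const smooth_rho open_UNIV)
      (use jpos[of k] in \<open>simp add: less_imp_neq[symmetric] power2_eq_square\<close>)
  have sc: "smooth_on UNIV (c k)" for k unfolding c_def[abs_def]
    by (intro smooth_on_mult sg sj smooth_rho open_UNIV)
  have sV: "smooth_on UNIV (V k)" for k unfolding V_def[abs_def]
    by (intro smooth_on_diff smooth_on_gradient W sc open_UNIV)
  have cont: "continuous_on UNIV W" "continuous_on UNIV g" "continuous_on UNIV \<rho>" "continuous_on UNIV (gradient \<rho>)"
    "continuous_on UNIV (gradient g)" "continuous_on UNIV (j k)" "continuous_on UNIV N" "continuous_on UNIV (gradient (c k))" for k
    unfolding N_def[abs_def]
    by (rule smooth_on_continuous; intro smooth_on_inner smooth_on_gradient open_UNIV sg sgr sj W smooth_rho sc)+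
  have jd: "((\<lambda>x. \<rho> x * j k x) has_derivative (\<lambda>v. (((1 - real k * (\<rho> x)\<^sup>2) * (j k x)\<^sup>2) *\<^sub>R gradient \<rho> x) \<bullet> v)) (at x)" for k x
  proof -
    have ne: "1 + real k * (\<rho> x)\<^sup>2 \<noteq> 0" using jpos[of k x] by simp
    have "((\<lambda>s. s * inverse (1 + real k * s\<^sup>2)) has_real_derivative
        ((1 - real k * (\<rho> x)\<^sup>2) * (inverse (1 + real k * (\<rho> x)\<^sup>2))\<^sup>2)) (at (\<rho> x))"
    proof -
      have 1: "((\<lambda>s. 1 + real k * s\<^sup>2) has_real_derivative 2 * real k * \<rho> x) (at (\<rho> x))"
        by (auto intro!: derivative_eq_intros)
      define B where "B = inverse (1 + real k * (\<rho> x)\<^sup>2)"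
      have "(1 + real k * (\<rho> x)\<^sup>2) * B = 1" using ne by (simp add: B_def)
      then have B: "(1 + real k * (\<rho> x)\<^sup>2) * B\<^sup>2 = B" by (metis mult.assoc mult_1 power2_eq_square)
      have "1 * B + - (B * (2 * real k * \<rho> x) * B) * \<rho> x = (1 - real k * (\<rho> x)\<^sup>2) * B\<^sup>2"
        using B by (simp add: algebra_simps power2_eq_square)
      with DERIV_mult[OF DERIV_ident DERIV_inverse'[OF 1 ne]] show ?thesis
        unfolding B_def by metis
    qed
    from has_derivative_compose[OF rho_gradient this[unfolded has_field_derivative_def]]
    show ?thesis by (simp add: j_def)
  qed
  have grad_c: "gradient (c k) x = (\<rho> x * j k x) *\<^sub>R gradient g x
      + (g x * ((1 - real k * (\<rho> x)\<^sup>2) * (j k x)\<^sup>2)) *\<^sub>R gradient \<rho> x" for k x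
    unfolding c_def[abs_def]
    by (subst has_derivative_imp_gradient_mult[OF smooth_on_has_gradient[OF sg UNIV_I] jd]) simp
  have Wg: "W x \<bullet> gradient \<rho> x = g x * D x" for x using Dpos[of x] by (simp add: g_def)
  \<comment> \<open>the quotient of the normal component by \<open>\<rho>\<close>, obtained by expanding \<open>1 = (1 + k \<rho>\<^sup>2)\<^sup>2 j\<^sup>2\<close>\<close>
  define H where "H k x = g x * \<rho> x + g x * N x * (3 * real k * \<rho> x + (real k)\<^sup>2 * \<rho> x ^ 3) * (j k x)\<^sup>2
      - j k x * (gradient g x \<bullet> gradient \<rho> x)" for k x
  have VH: "V k x \<bullet> gradient \<rho> x = \<rho> x * H k x" for k x
  proof -
    let ?q = "(1 - real k * (\<rho> x)\<^sup>2) * (j k x)\<^sup>2"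
    have one: "(1 + real k * (\<rho> x)\<^sup>2)\<^sup>2 * (j k x)\<^sup>2 = 1"
      using jpos[of k x] by (simp add: j_def power_mult_distrib[symmetric])
    have "1 - ?q = (1 + real k * (\<rho> x)\<^sup>2)\<^sup>2 * (j k x)\<^sup>2 - ?q" using one by simp
    also have "\<dots> = (3 * real k * \<rho> x + (real k)\<^sup>2 * \<rho> x ^ 3) * (j k x)\<^sup>2 * \<rho> x"
      by (simp add: algebra_simps power2_eq_square power3_eq_cube)
    finally have q: "1 - ?q = (3 * real k * \<rho> x + (real k)\<^sup>2 * \<rho> x ^ 3) * (j k x)\<^sup>2 * \<rho> x" .
    have "V k x \<bullet> gradient \<rho> x = g x * D x - (\<rho> x * j k x) * (gradient g x \<bullet> gradient \<rho> x) - g x * ?q * N x"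
      unfolding V_def grad_c inner_diff_left inner_add_left inner_scaleR_left Wg N_def by simp
    also have "\<dots> = g x * (\<rho> x)\<^sup>2 + g x * N x * (1 - ?q) - (\<rho> x * j k x) * (gradient g x \<bullet> gradient \<rho> x)"
      by (simp add: D_def algebra_simps)
    also have "\<dots> = \<rho> x * H k x"
      unfolding q H_def by (simp add: algebra_simps power2_eq_square)
    finally show ?thesis .
  qed
  have cH: "continuous_on UNIV (H k)" for k
    unfolding H_def[abs_def] by (intro continuous_intros cont)
  have rot: "AE x in lebesgue_on \<Omega>. weak_rot \<Omega> (V k) x = weak_rot \<Omega> W x" for k
    using weak_rot_smooth[OF sV[of k]] weak_rot_smooth[OF W]
  proof eventually_elim
    case (elim x)
    have "pderiv_at i (V k) x = pderiv_at i W x - pderiv_at i (gradient (c k)) x" for i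
      unfolding V_def[abs_def]
      by (rule pderiv_at_diff[OF pderiv_at_smooth(1)[OF W] pderiv_at_smooth(1)[OF smooth_on_gradient[OF open_UNIV sc]]])
    then show ?case
      using elim pderiv_at_gradient_commute[OF sc[of k]] by (simp add: vec_eq_iff)
  qed
  have lim0: "(\<lambda>k. L2_norm_on \<Omega> (gradient (c k))) \<longlonglongrightarrow> 0"
  proof (rule L2_tendsto_dominated)
    show "gradient (c k) \<in> borel_measurable (lebesgue_on \<Omega>)" for k
      by (rule continuous_measurable_lebesgue_on[OF cont(8)])
    show "L2_on \<Omega> (\<lambda>x. norm (\<rho> x *\<^sub>R gradient g x) + norm (g x *\<^sub>R gradient \<rho> x))"
      by (intro L2_continuous continuous_intros cont)
    have q1: "\<bar>j k x\<bar> \<le> 1" "\<bar>(1 - real k * (\<rho> x)\<^sup>2) * (j k x)\<^sup>2\<bar> \<le> 1" for k x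
    proof -
      define z where "z = real k * (\<rho> x)\<^sup>2"
      have z: "z \<ge> 0" by (simp add: z_def)
      show "\<bar>j k x\<bar> \<le> 1" using z unfolding j_def z_def[symmetric] by (simp add: inverse_le_1_iff)
      have "\<bar>1 - z\<bar> \<le> (1 + z)\<^sup>2" using z by (simp add: power2_eq_square algebra_simps abs_le_iff)
      then have "\<bar>1 - z\<bar> / (1 + z)\<^sup>2 \<le> 1" using z by (simp add: divide_le_eq_1)
      then show "\<bar>(1 - real k * (\<rho> x)\<^sup>2) * (j k x)\<^sup>2\<bar> \<le> 1"
        unfolding j_def z_def[symmetric] by (simp add: abs_mult divide_inverse power_inverse)
    qed
    show "AE x in lebesgue_on \<Omega>. norm (gradient (c k) x) \<le> norm (norm (\<rho> x *\<^sub>R gradient g x) + norm (g x *\<^sub>R gradient \<rho> x))" for k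
    proof (rule AE_I2)
      fix x
      have "norm (gradient (c k) x) \<le> \<bar>j k x\<bar> * norm (\<rho> x *\<^sub>R gradient g x)
          + \<bar>(1 - real k * (\<rho> x)\<^sup>2) * (j k x)\<^sup>2\<bar> * norm (g x *\<^sub>R gradient \<rho> x)"
        unfolding grad_c by (rule order_trans[OF norm_triangle_ineq]) (simp add: abs_mult mult_ac)
      also have "\<dots> \<le> norm (\<rho> x *\<^sub>R gradient g x) + norm (g x *\<^sub>R gradient \<rho> x)"
        by (intro add_mono mult_left_le_one_le q1) auto
      finally show "norm (gradient (c k) x) \<le> norm (norm (\<rho> x *\<^sub>R gradient g x) + norm (g x *\<^sub>R gradient \<rho> x))"
        by simp
    qed
    show "AE x in lebesgue_on \<Omega>. (\<lambda>k. gradient (c k) x) \<longlonglongrightarrow> 0"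
      unfolding AE_lebesgue_on_iff[OF domain_sets]
    proof (rule AE_I2, rule impI)
      fix x assume "x \<in> \<Omega>"
      then have r: "(\<rho> x)\<^sup>2 > 0" using rho_neg[of x] by simp
      have "filterlim (\<lambda>k. 1 + (\<rho> x)\<^sup>2 * real k) at_top sequentially"
        by (rule filterlim_tendsto_add_at_top[OF tendsto_const
              filterlim_tendsto_pos_mult_at_top[OF tendsto_const r filterlim_real_sequentially]])
      then have j0: "(\<lambda>k. j k x) \<longlonglongrightarrow> 0"
        unfolding j_def by (intro tendsto_inverse_0_at_top) (simp add: mult.commute)
      have "(1 - real k * (\<rho> x)\<^sup>2) * (j k x)\<^sup>2 = (2 * j k x - 1) * j k x" for k
        using jpos[of k x] by (simp add: j_def field_simps power2_eq_square)
      then have "gradient (c k) x = (\<rho> x * j k x) *\<^sub>R gradient g x + (g x * ((2 * j k x - 1) * j k x)) *\<^sub>R gradient \<rho> x" for k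
        by (simp add: grad_c)
      moreover have "(\<lambda>k. (\<rho> x * j k x) *\<^sub>R gradient g x + (g x * ((2 * j k x - 1) * j k x)) *\<^sub>R gradient \<rho> x)
          \<longlonglongrightarrow> (\<rho> x * 0) *\<^sub>R gradient g x + (g x * ((2 * 0 - 1) * 0)) *\<^sub>R gradient \<rho> x"
        by (intro tendsto_intros j0)
      ultimately show "(\<lambda>k. gradient (c k) x) \<longlonglongrightarrow> 0" by simp
    qed
  qed
  have "L2_norm_on \<Omega> (\<lambda>x. V k x - W x) = L2_norm_on \<Omega> (gradient (c k))" for k
    by (simp add: V_def L2_norm_minus)
  then have "(\<lambda>k. L2_norm_on \<Omega> (\<lambda>x. V k x - W x)) \<longlonglongrightarrow> 0" using lim0 by simp
  moreover have "tangential_trace \<Omega> (V k)" for k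
    by (rule tangential_trace_smooth[OF sV]) (simp add: VH rho_frontier)
  moreover have "L2_inner \<Omega> f (weak_div \<Omega> (V k)) = - L2_inner \<Omega> (weak_grad \<Omega> f) (V k)" if "Hk_on 1 \<Omega> f" for f k
    by (rule Green_tangential[OF sV cH VH that])
  ultimately show ?thesis using sV rot by (intro exI[of _ V]) blast
qed

text \<open>The boundary condition on the rotation is encoded in the weak equation: testing with tangential
  approximations of an arbitrary smooth field shows that the equation, with the divergence term
  integrated by parts, holds for smooth fields without any boundary condition.\<close>

lemma momentum_smooth_test:
  assumes a: "L2_on \<Omega> a" and u: "Hk_on 1 \<Omega> u" "Hk_on 1 \<Omega> (weak_div \<Omega> u)" and th: "Hk_on 1 \<Omega> \<theta>"
    and eq: "\<And>\<phi>. Hk_on 1 \<Omega> \<phi> \<Longrightarrow> tangential_trace \<Omega> \<phi> \<Longrightarrow>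
      L2_inner \<Omega> a \<phi> + \<kappa> * L2_inner \<Omega> (weak_div \<Omega> u) (weak_div \<Omega> \<phi>) + m * L2_inner \<Omega> (weak_rot \<Omega> u) (weak_rot \<Omega> \<phi>)
      = - \<nu> * L2_inner \<Omega> (weak_grad \<Omega> \<theta>) \<phi>"
    and W: "smooth_on UNIV W"
  shows "L2_inner \<Omega> (\<lambda>x. a x + \<nu> *\<^sub>R weak_grad \<Omega> \<theta> x - \<kappa> *\<^sub>R weak_grad \<Omega> (weak_div \<Omega> u) x) W
      = - m * L2_inner \<Omega> (weak_rot \<Omega> u) (weak_rot \<Omega> W)"
proof -
  let ?F = "\<lambda>x. a x + \<nu> *\<^sub>R weak_grad \<Omega> \<theta> x - \<kappa> *\<^sub>R weak_grad \<Omega> (weak_div \<Omega> u) x"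
  obtain V where V: "\<And>k::nat. smooth_on UNIV (V k)" "\<And>k. tangential_trace \<Omega> (V k)"
    "\<And>k. AE x in lebesgue_on \<Omega>. weak_rot \<Omega> (V k) x = weak_rot \<Omega> W x"
    "\<And>k f. Hk_on 1 \<Omega> f \<Longrightarrow> L2_inner \<Omega> f (weak_div \<Omega> (V k)) = - L2_inner \<Omega> (weak_grad \<Omega> f) (V k)"
    and lim: "(\<lambda>k. L2_norm_on \<Omega> (\<lambda>x. V k x - W x)) \<longlonglongrightarrow> 0"
    using tangential_approximation[OF W] by blast
  have VL: "L2_on \<Omega> (V k)" "L2_on \<Omega> W" for k
    using H1_L2[OF H1_smooth(1)] V(1) W by blast+
  note L = a L2_weak_grad[OF th] L2_weak_grad[OF u(2)] 
  have FL: "L2_on \<Omega> ?F" by (intro L2_on_add L2_on_diff L2_on_scaleR L)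
  have "L2_inner \<Omega> (V k) ?F = - m * L2_inner \<Omega> (weak_rot \<Omega> u) (weak_rot \<Omega> W)" for k
  proof -
    have "L2_inner \<Omega> (weak_rot \<Omega> u) (weak_rot \<Omega> (V k)) = L2_inner \<Omega> (weak_rot \<Omega> u) (weak_rot \<Omega> W)"
      using V(3)[of k] by (intro inner_cong_AE) auto
    then have "L2_inner \<Omega> a (V k) - \<kappa> * L2_inner \<Omega> (weak_grad \<Omega> (weak_div \<Omega> u)) (V k)
        + m * L2_inner \<Omega> (weak_rot \<Omega> u) (weak_rot \<Omega> W) = - \<nu> * L2_inner \<Omega> (weak_grad \<Omega> \<theta>) (V k)"
      using eq[OF H1_smooth(1)[OF V(1)] V(2), of k] V(4)[OF u(2), of k] by simp
    moreover have "L2_inner \<Omega> ?F (V k) = L2_inner \<Omega> a (V k) + \<nu> * L2_inner \<Omega> (weak_grad \<Omega> \<theta>) (V k)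
        - \<kappa> * L2_inner \<Omega> (weak_grad \<Omega> (weak_div \<Omega> u)) (V k)"
      by (simp add: L2_inner_diff_left L2_inner_add_left L2_inner_scaleR_left L VL L2_on_add L2_on_scaleR)
    ultimately show ?thesis by (simp add: L2_inner_commute[of _ "V k"])
  qed
  moreover have "(\<lambda>k. L2_inner \<Omega> (V k) ?F) \<longlonglongrightarrow> L2_inner \<Omega> W ?F"
    by (rule L2_inner_tendsto[OF VL(1) VL(2) FL lim])
  ultimately show ?thesis by (simp add: LIMSEQ_const_iff L2_inner_commute)
qed

end

section \<open>Approximation of gradients on convex domains\<close>

lemma uniformly_continuous_compact_support:
  fixes f :: "'a::euclidean_space \<Rightarrow> 'b::real_normed_vector"
  assumes c: "continuous_on UNIV f" and z: "\<And>x. R < norm x \<Longrightarrow> f x = 0" and e: "e > 0"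
  shows "\<exists>d>0. \<forall>x y. dist x y < d \<longrightarrow> dist (f x) (f y) < e"
proof -
  have "uniformly_continuous_on (cball 0 (R + 1)) f"
    by (intro compact_uniformly_continuous continuous_on_subset[OF c]) auto
  then obtain d where d: "d > 0"
    "\<And>x y. x \<in> cball 0 (R + 1) \<Longrightarrow> y \<in> cball 0 (R + 1) \<Longrightarrow> dist y x < d \<Longrightarrow> dist (f y) (f x) < e"
    using e unfolding uniformly_continuous_on_def by metis
  have "dist (f x) (f y) < e" if xy: "dist x y < min d 1" for x y
  proof (cases "norm x \<le> R \<or> norm y \<le> R")
    case True
    have "norm x \<le> norm y + dist x y" "norm y \<le> norm x + dist x y"
      using norm_triangle_ineq[of "x - y" y] norm_triangle_ineq[of "y - x" x]
      by (auto simp: dist_norm norm_minus_commute)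
    then have "x \<in> cball 0 (R + 1)" "y \<in> cball 0 (R + 1)" using True xy by auto
    then show ?thesis using d(2)[of y x] xy by simp
  next
    case False
    then show ?thesis using z e by simp
  qed
  then show ?thesis using d(1) by (intro exI[of _ "min d 1"]) auto
qed

text \<open>The measurable map \<open>m\<close> allows for a dilation of the function before it is mollified.\<close>

lemma convolution_has_derivative:
  fixes K :: "real^'n \<Rightarrow> real" and f :: "'b::euclidean_space \<Rightarrow> real" and m :: "'b \<Rightarrow> real^'n"
  assumes K: "smooth_on UNIV K" "\<And>z. R < norm z \<Longrightarrow> K z = 0" and f: "integrable lborel f"
    and m: "m \<in> borel_measurable borel"
  shows "((\<lambda>x. LBINT y. K (x - m y) * f y) has_derivative (\<lambda>v. LBINT y. (gradient K (x - m y) \<bullet> v) * f y)) (at x)"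
proof -
  have cK: "continuous_on UNIV K" "continuous_on UNIV (gradient K)"
    using smooth_on_continuous[OF K(1)] smooth_on_continuous[OF smooth_on_gradient[OF open_UNIV K(1)]] by auto
  have grad0: "gradient K z = 0" if "R < norm z" for z
  proof -
    have "(\<lambda>v. gradient K z \<bullet> v) v = 0" for v
      by (rule has_derivative_vanishing_outside[OF smooth_on_has_gradient[OF K(1) UNIV_I], of "cball 0 R"]) (use that K(2) in auto)
    then show ?thesis by (metis inner_eq_zero_iff)
  qed
  have bounded: "\<exists>C. \<forall>z. norm (h z) \<le> C" if "continuous_on UNIV h" "\<And>z. R < norm z \<Longrightarrow> h z = 0"
    for h :: "real^'n \<Rightarrow> 'c::euclidean_space"
  proof -
    have "bounded (h ` cball 0 R)"
      by (intro compact_imp_bounded compact_continuous_image continuous_on_subset[OF that(1)]) auto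
    then obtain C where "\<forall>y\<in>h ` cball 0 R. norm y \<le> C" unfolding bounded_iff by blast
    then have C: "norm (h z) \<le> C" if "norm z \<le> R" for z using that by simp
    have "norm (h z) \<le> max C 0" for z
      using C[of z] that(2)[of z] by (cases "norm z \<le> R") auto
    then show ?thesis by blast
  qed
  have fm: "f \<in> borel_measurable borel" using borel_measurable_integrable[OF f] by simp
  have int: "integrable lborel (\<lambda>y. h (x - m y) * f y)"
    if h: "continuous_on UNIV h" "\<And>z. R < norm z \<Longrightarrow> h z = 0" for h :: "real^'n \<Rightarrow> real" and x
  proof -
    obtain C where C: "\<And>z. norm (h z) \<le> C" using bounded[OF h] by blast
    have hm: "h \<in> borel_measurable borel" using h(1) by (rule borel_measurable_continuous_onI)
    show ?thesis
    proof (rule Bochner_Integration.integrable_bound[of _ "\<lambda>y. C * f y"])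
      show "(\<lambda>y. h (x - m y) * f y) \<in> borel_measurable lborel"
        using measurable_compose[OF _ hm, of "\<lambda>y. x - m y"] m fm by simp
      show "AE y in lborel. norm (h (x - m y) * f y) \<le> norm (C * f y)"
      proof (rule AE_I2)
        fix y
        have "norm (h (x - m y)) * norm (f y) \<le> \<bar>C\<bar> * norm (f y)"
          using C[of "x - m y"] by (intro mult_right_mono) auto
        then show "norm (h (x - m y) * f y) \<le> norm (C * f y)" by (simp add: abs_mult)
      qed
    qed (use f in simp)
  qed
  have igrad: "integrable lborel (\<lambda>y. (gradient K (x - m y) \<bullet> v) * f y)" for v x
    by (rule int[of "\<lambda>z. gradient K z \<bullet> v"]) (use grad0 in \<open>auto intro: continuous_intros cK\<close>)
  show ?thesis
    unfolding has_derivative_at_alt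
  proof (intro conjI allI impI)
    show "bounded_linear (\<lambda>v. LBINT y. (gradient K (x - m y) \<bullet> v) * f y)"
    proof (rule linear_conv_bounded_linear[THEN iffD1], rule linearI)
      fix v w :: "real^'n" and a :: real
      show "(LBINT y. (gradient K (x - m y) \<bullet> (v + w)) * f y)
          = (LBINT y. (gradient K (x - m y) \<bullet> v) * f y) + (LBINT y. (gradient K (x - m y) \<bullet> w) * f y)"
        using igrad[of x v] igrad[of x w] by (simp add: inner_add_right distrib_right)
      show "(LBINT y. (gradient K (x - m y) \<bullet> (a *\<^sub>R v)) * f y) = a *\<^sub>R (LBINT y. (gradient K (x - m y) \<bullet> v) * f y)"
        by (simp add: mult.assoc)
    qed
    fix e :: real assume e: "e > 0"
    define I where "I = (LBINT y. norm (f y))"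
    have I: "I \<ge> 0" unfolding I_def by (rule integral_nonneg_AE) simp
    define e' where "e' = e / (I + 1)"
    have e': "e' > 0" using e I by (simp add: e'_def)
    obtain d where d: "d > 0" "\<And>z w. dist z w < d \<Longrightarrow> dist (gradient K z) (gradient K w) < e'"
      using uniformly_continuous_compact_support[OF cK(2) grad0 e'] by blast
    have taylor: "norm (K (z + h) - K z - gradient K z \<bullet> h) \<le> norm h * e'" if h: "norm h < d" for z h
    proof -
      have "norm (K (z + h) - K z - gradient K z \<bullet> (z + h - z)) \<le> norm (z + h - z) * e'"
      proof (rule differentiable_bound_linearization[where S = "ball z d" and f' = "\<lambda>y v. gradient K y \<bullet> v"])
        show "z + t *\<^sub>R (z + h - z) \<in> ball z d" if "t \<in> {0..1}" for t
        proof -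
          have "\<bar>t\<bar> * norm h \<le> 1 * norm h" using that by (intro mult_right_mono) auto
          then show ?thesis using h by (simp add: dist_norm)
        qed
        show "(K has_derivative (\<lambda>v. gradient K y \<bullet> v)) (at y within ball z d)" for y
          using smooth_on_has_gradient[OF K(1) UNIV_I] by (rule has_derivative_at_withinI)
        show "onorm ((\<lambda>v. gradient K y \<bullet> v) - (\<lambda>v. gradient K z \<bullet> v)) \<le> e'" if "y \<in> ball z d" for y
        proof (rule onorm_le)
          fix v
          have "norm (gradient K y \<bullet> v - gradient K z \<bullet> v) \<le> norm (gradient K y - gradient K z) * norm v"
            unfolding inner_diff_left[symmetric] by (simp add: Cauchy_Schwarz_ineq2)
          also have "\<dots> \<le> e' * norm v"
            using d(2)[of y z] that by (intro mult_right_mono) (auto simp: dist_norm norm_minus_commute)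
          finally show "norm (((\<lambda>v. gradient K y \<bullet> v) - (\<lambda>v. gradient K z \<bullet> v)) v) \<le> e' * norm v" by simp
        qed
      qed (use d in auto)
      then show ?thesis by simp
    qed
    show "\<exists>d>0. \<forall>y. norm (y - x) < d \<longrightarrow> norm ((LBINT z. K (y - m z) * f z) - (LBINT z. K (x - m z) * f z)
        - (LBINT z. (gradient K (x - m z) \<bullet> (y - x)) * f z)) \<le> e * norm (y - x)"
    proof (intro exI[of _ d] conjI allI impI)
      fix y assume y: "norm (y - x) < d"
      note ints = int[OF cK(1) K(2)] igrad
      have "norm ((LBINT z. K (y - m z) * f z) - (LBINT z. K (x - m z) * f z) - (LBINT z. (gradient K (x - m z) \<bullet> (y - x)) * f z))
          = norm (LBINT z. (K (y - m z) - K (x - m z) - gradient K (x - m z) \<bullet> (y - x)) * f z)"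
        using ints by (simp add: left_diff_distrib)
      also have "\<dots> \<le> (LBINT z. norm (y - x) * e' * norm (f z))"
      proof (rule order_trans[OF integral_norm_bound], rule integral_mono)
        show "integrable lborel (\<lambda>z. norm ((K (y - m z) - K (x - m z) - gradient K (x - m z) \<bullet> (y - x)) * f z))"
          using ints by (intro integrable_norm) (simp add: left_diff_distrib)
        show "integrable lborel (\<lambda>z. norm (y - x) * e' * norm (f z))" using f by simp
        fix z
        have "norm (K (x - m z + (y - x)) - K (x - m z) - gradient K (x - m z) \<bullet> (y - x)) \<le> norm (y - x) * e'"
          by (rule taylor[OF y])
        then show "norm ((K (y - m z) - K (x - m z) - gradient K (x - m z) \<bullet> (y - x)) * f z) \<le> norm (y - x) * e' * norm (f z)"
          unfolding norm_mult by (intro mult_right_mono) (auto simp: algebra_simps)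
      qed
      also have "\<dots> = norm (y - x) * (e' * I)" by (simp add: I_def)
      also have "\<dots> \<le> norm (y - x) * e"
        using e I by (intro mult_left_mono) (auto simp: e'_def field_simps)
      finally show "norm ((LBINT z. K (y - m z) * f z) - (LBINT z. K (x - m z) * f z)
        - (LBINT z. (gradient K (x - m z) \<bullet> (y - x)) * f z)) \<le> e * norm (y - x)" by (simp add: mult.commute)
    qed (use d in auto)
  qed
qed

lemma pderiv_at_convolution:
  fixes K :: "real^'n \<Rightarrow> real" and f :: "'b::euclidean_space \<Rightarrow> real" and m :: "'b \<Rightarrow> real^'n"
  assumes "smooth_on UNIV K" "\<And>z. R < norm z \<Longrightarrow> K z = 0" "integrable lborel f" "m \<in> borel_measurable borel"
  shows "pderiv_at i (\<lambda>x. LBINT y. K (x - m y) * f y) x = (LBINT y. pderiv_at i K (x - m y) * f y)"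
  using pderiv_at_eq[OF convolution_has_derivative[OF assms]] by (simp add: inner_axis gradient_def)

lemma smooth_convolution:
  fixes K :: "real^'n \<Rightarrow> real" and f :: "'b::euclidean_space \<Rightarrow> real" and m :: "'b \<Rightarrow> real^'n"
  assumes K: "smooth_on UNIV K" "\<And>z. R < norm z \<Longrightarrow> K z = 0" and f: "integrable lborel f" and m: "m \<in> borel_measurable borel"
  shows "smooth_on UNIV (\<lambda>x. LBINT y. K (x - m y) * f y)"
proof -
  have "Ck_on k UNIV (\<lambda>x. LBINT y. K (x - m y) * f y)" for k
    using K
  proof (induction k arbitrary: K)
    case 0
    have "isCont (\<lambda>x. LBINT y. K (x - m y) * f y) x" for x
      using convolution_has_derivative[OF 0(1,2) f m] by (rule has_derivative_continuous)
    then show ?case by (auto intro: continuous_at_imp_continuous_on)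
  next
    case (Suc k)
    show ?case
    proof (rule Ck_on_derivI[OF open_UNIV convolution_has_derivative[OF Suc.prems f m]])
      fix b :: "real^'n" assume b: "b \<in> Basis"
      have s: "smooth_on UNIV (\<lambda>z. gradient K z \<bullet> b)"
        by (intro smooth_on_inner smooth_on_gradient smooth_on_const Suc.prems open_UNIV)
      have "gradient K z \<bullet> b = 0" if "R < norm z" for z
        by (rule has_derivative_vanishing_outside[OF smooth_on_has_gradient[OF Suc.prems(1) UNIV_I], of "cball 0 R"])
          (use that Suc.prems(2) in auto)
      from Suc.IH[OF s this] show "Ck_on k UNIV (\<lambda>x. LBINT y. (gradient K (x - m y) \<bullet> b) * f y)" .
    qed
  qed
  then show ?thesis by (simp add: smooth_on_def)
qed

lemma nn_integral_affine:
  fixes f :: "'a::euclidean_space \<Rightarrow> ennreal"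
  assumes [measurable]: "f \<in> borel_measurable borel" and c: "c > 0"
  shows "(\<integral>\<^sup>+x. f x \<partial>lborel) = ennreal (c ^ DIM('a)) * (\<integral>\<^sup>+x. f (t + c *\<^sub>R x) \<partial>lborel)"
  using c by (subst lborel_affine[of c t]) (simp_all add: nn_integral_density nn_integral_distr nn_integral_cmult)

lemma integral_affine:
  fixes f :: "'a::euclidean_space \<Rightarrow> real"
  assumes f: "integrable lborel f" and c: "c > 0"
  shows "integrable lborel (\<lambda>x. f (t + c *\<^sub>R x))" "(LBINT x. f x) = c ^ DIM('a) * (LBINT x. f (t + c *\<^sub>R x))"
proof -
  have [measurable]: "f \<in> borel_measurable borel" using borel_measurable_integrable[OF f] by simp
  have "integrable (density (distr lborel borel (\<lambda>x. t + c *\<^sub>R x)) (\<lambda>_. ennreal (\<bar>c\<bar> ^ DIM('a)))) f"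
    using f lborel_affine[of c t] c by simp
  then have "integrable (distr lborel borel (\<lambda>x. t + c *\<^sub>R x)) (\<lambda>x. \<bar>c\<bar> ^ DIM('a) *\<^sub>R f x)"
    by (subst (asm) integrable_density) auto
  then have "integrable lborel (\<lambda>x. \<bar>c\<bar> ^ DIM('a) *\<^sub>R f (t + c *\<^sub>R x))"
    by (subst (asm) integrable_distr_eq) auto
  then show "integrable lborel (\<lambda>x. f (t + c *\<^sub>R x))" using c by simp
  have "(LBINT x. f x) = integral\<^sup>L (density (distr lborel borel (\<lambda>x. t + c *\<^sub>R x)) (\<lambda>_. ennreal (\<bar>c\<bar> ^ DIM('a)))) f"
    using lborel_affine[of c t] c by simp
  also have "\<dots> = (LBINT x. \<bar>c\<bar> ^ DIM('a) *\<^sub>R f (t + c *\<^sub>R x))"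
    by (subst integral_density) (auto simp: integral_distr)
  finally show "(LBINT x. f x) = c ^ DIM('a) * (LBINT x. f (t + c *\<^sub>R x))" using c by simp
qed

text \<open>A measurable function is an almost everywhere limit of continuous functions. Projecting both onto a large ball
  bounds them, so that the convergence is dominated.\<close>

lemma L2_dense_continuous:
  fixes f :: "'a::euclidean_space \<Rightarrow> 'b::euclidean_space"
  assumes S: "bounded S" "S \<in> sets lebesgue" and f: "L2_on S f" and e: "e > 0"
  shows "\<exists>G. continuous_on UNIV G \<and> L2_norm_on S (\<lambda>x. f x - G x) < e"
proof -
  define P where "P M = closest_point (cball (0::'b) M)" for M :: real
  have P: "continuous_on UNIV (P M)" "norm (P M v) \<le> M" "norm v \<le> M \<Longrightarrow> P M v = v" "norm (P M v - v) \<le> norm v"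
    if "M \<ge> 0" for M v
    using that closest_point_in_set[of "cball 0 M" v] closest_point_self[of v "cball 0 M"] closest_point_le[of "cball 0 M" 0 v]
    by (auto simp: P_def dist_norm norm_minus_commute intro!: continuous_on_closest_point)
  have Pm: "P M \<in> borel_measurable borel" if "M \<ge> 0" for M
    using P(1)[OF that] by (rule borel_measurable_continuous_onI)
  have Pf: "L2_on S (\<lambda>x. P M (f x))" if "M \<ge> 0" for M
  proof (rule L2_on_dominated[OF f, where C = 2])
    show "(\<lambda>x. P M (f x)) \<in> borel_measurable (lebesgue_on S)"
      using measurable_compose[OF L2_onD[OF f] Pm[OF that]] .
    have "norm (P M v) \<le> 2 * norm v" for v
      using P(4)[OF that, of v] norm_triangle_ineq[of "P M v - v" v] by simp
    then show "AE x in lebesgue_on S. norm (P M (f x)) \<le> 2 * norm (f x)" by simp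
  qed
  have "(\<lambda>k. L2_norm_on S (\<lambda>x. P (real k) (f x) - f x)) \<longlonglongrightarrow> 0"
  proof (rule L2_tendsto_dominated[OF _ f])
    show "(\<lambda>x. P (real k) (f x) - f x) \<in> borel_measurable (lebesgue_on S)" for k
      by (intro L2_onD L2_on_diff Pf f) simp
    show "AE x in lebesgue_on S. norm (P (real k) (f x) - f x) \<le> norm (f x)" for k using P(4)[of "real k"] by simp
    show "AE x in lebesgue_on S. (\<lambda>k. P (real k) (f x) - f x) \<longlonglongrightarrow> 0"
    proof (rule AE_I2)
      fix x
      have "\<forall>\<^sub>F k in sequentially. norm (f x) \<le> real k"
        using filterlim_at_top[THEN iffD1, OF filterlim_real_sequentially] by blast
      then have "\<forall>\<^sub>F k in sequentially. P (real k) (f x) - f x = 0"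
        by eventually_elim (simp add: P(3))
      then show "(\<lambda>k. P (real k) (f x) - f x) \<longlonglongrightarrow> 0" by (rule tendsto_eventually)
    qed
  qed
  then have "\<forall>\<^sub>F k in sequentially. L2_norm_on S (\<lambda>x. P (real k) (f x) - f x) < e / 2"
    using e by (auto dest: order_tendstoD(2)[of _ 0 _ "e / 2"])
  then obtain k where k: "L2_norm_on S (\<lambda>x. P (real k) (f x) - f x) < e / 2"
    by (auto simp: eventually_sequentially)
  define M where "M = real k"
  have M: "M \<ge> 0" by (simp add: M_def)
  have "(\<lambda>x. P M (f x)) measurable_on S"
    using L2_onD[OF Pf[OF M]] measurable_on_iff_borel_measurable[OF S(2)] by blast
  then obtain N g where N: "negligible N" and g: "\<And>n. continuous_on UNIV (g n)"
    and lim: "\<And>x. x \<notin> N \<Longrightarrow> (\<lambda>n. g n x) \<longlonglongrightarrow> (if x \<in> S then P M (f x) else 0)"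
    unfolding measurable_on_def by blast
  have gc: "continuous_on UNIV (\<lambda>x. P M (g n x))" for n
    by (rule continuous_on_compose2[OF P(1)[OF M] g]) auto
  have gL: "L2_on S (\<lambda>x. P M (g n x))" for n by (rule L2_on_continuous[OF S gc])
  have "(\<lambda>n. L2_norm_on S (\<lambda>x. P M (g n x) - P M (f x))) \<longlonglongrightarrow> 0"
  proof (rule L2_tendsto_dominated)
    show "L2_on S (\<lambda>x. 2 * M)" by (rule L2_on_continuous[OF S]) auto
    show "(\<lambda>x. P M (g n x) - P M (f x)) \<in> borel_measurable (lebesgue_on S)" for n
      by (intro L2_onD L2_on_diff gL Pf M)
    show "AE x in lebesgue_on S. norm (P M (g n x) - P M (f x)) \<le> norm (2 * M)" for n
    proof (rule AE_I2)
      fix x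
      show "norm (P M (g n x) - P M (f x)) \<le> norm (2 * M)"
        using norm_triangle_ineq4[of "P M (g n x)" "P M (f x)"] P(2)[OF M, of "g n x"] P(2)[OF M, of "f x"] M by simp
    qed
    have "AE x in lebesgue. x \<notin> N" using N by (intro AE_not_in) (simp add: negligible_iff_null_sets)
    then show "AE x in lebesgue_on S. (\<lambda>n. P M (g n x) - P M (f x)) \<longlonglongrightarrow> 0"
      unfolding AE_lebesgue_on_iff[OF S(2)]
    proof (eventually_elim, intro impI)
      fix x assume x: "x \<notin> N" "x \<in> S"
      have "(\<lambda>n. P M (g n x)) \<longlonglongrightarrow> P M (P M (f x))"
        using lim[OF x(1)] x(2) P(1)[OF M] by (intro isCont_tendsto_compose[of _ "P M"]) (auto simp: continuous_on_eq_continuous_at)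
      then show "(\<lambda>n. P M (g n x) - P M (f x)) \<longlonglongrightarrow> 0"
        using P(2,3)[OF M] by (simp add: LIM_zero_iff)
    qed
  qed
  then have "\<forall>\<^sub>F n in sequentially. L2_norm_on S (\<lambda>x. P M (g n x) - P M (f x)) < e / 2"
    using e by (auto dest: order_tendstoD(2)[of _ 0 _ "e / 2"])
  then obtain n where n: "L2_norm_on S (\<lambda>x. P M (g n x) - P M (f x)) < e / 2"
    by (auto simp: eventually_sequentially)
  have "L2_norm_on S (\<lambda>x. (P M (g n x) - P M (f x)) + (P M (f x) - f x))
      \<le> L2_norm_on S (\<lambda>x. P M (g n x) - P M (f x)) + L2_norm_on S (\<lambda>x. P M (f x) - f x)"
    by (intro L2_norm_triangle L2_on_diff gL Pf f M)
  also have "\<dots> < e" using k n by (simp add: M_def)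
  finally have "L2_norm_on S (\<lambda>x. f x - P M (g n x)) < e" by (simp add: L2_norm_diff_commute[of S f])
  then show ?thesis using gc by blast
qed

text \<open>Products of Lebesgue measurable functions with affine maps and Fubini's theorem require Borel measurability, which
  an exceptional null set provides.\<close>

lemma borel_representative:
  fixes f :: "'a::euclidean_space \<Rightarrow> 'b::euclidean_space"
  assumes \<Omega>: "open \<Omega>" and f: "f \<in> borel_measurable (lebesgue_on \<Omega>)"
  shows "\<exists>f0. f0 \<in> borel_measurable borel \<and> (\<forall>x. x \<notin> \<Omega> \<longrightarrow> f0 x = 0) \<and> (AE x in lebesgue_on \<Omega>. f0 x = f x)"
proof -
  note \<Omega>S = open_sets_lebesgue[OF \<Omega>]
  have fm: "(\<lambda>x. if x \<in> \<Omega> then f x else 0) \<in> borel_measurable lebesgue"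
    using f borel_measurable_if[OF \<Omega>S, of f] by simp
  have "\<forall>b. \<exists>g. g \<in> borel_measurable lborel \<and> (AE x in lborel. (if x \<in> \<Omega> then f x else 0) \<bullet> b = g x)"
  proof
    fix b
    have "(\<lambda>x. (if x \<in> \<Omega> then f x else 0) \<bullet> b) \<in> borel_measurable lebesgue"
      using fm by (intro borel_measurable_inner) auto
    from completion_ex_borel_measurable_real[OF this]
    show "\<exists>g. g \<in> borel_measurable lborel \<and> (AE x in lborel. (if x \<in> \<Omega> then f x else 0) \<bullet> b = g x)" by blast
  qed
  then obtain g where g: "\<And>b. g b \<in> borel_measurable lborel"
    "\<And>b. AE x in lborel. (if x \<in> \<Omega> then f x else 0) \<bullet> b = g b x"
    by metis
  define f0 where "f0 x = indicator \<Omega> x *\<^sub>R (\<Sum>b\<in>Basis. g b x *\<^sub>R b)" for x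
  have "f0 \<in> borel_measurable borel"
    unfolding f0_def[abs_def] using g(1) \<Omega>
    by (intro borel_measurable_scaleR borel_measurable_sum borel_measurable_indicator) auto
  moreover have "AE x in lborel. \<forall>b\<in>Basis. (if x \<in> \<Omega> then f x else 0) \<bullet> b = g b x"
    using g(2) by (intro AE_finite_allI) auto
  then have "AE x in lebesgue. \<forall>b\<in>Basis. (if x \<in> \<Omega> then f x else 0) \<bullet> b = g b x"
    by (rule AE_completion)
  then have "AE x in lebesgue_on \<Omega>. f0 x = f x"
    unfolding AE_lebesgue_on_iff[OF \<Omega>S]
  proof (eventually_elim, intro impI)
    fix x assume x: "\<forall>b\<in>Basis. (if x \<in> \<Omega> then f x else 0) \<bullet> b = g b x" "x \<in> \<Omega>"
    then have "f0 x = (\<Sum>b\<in>Basis. (f x \<bullet> b) *\<^sub>R b)" by (simp add: f0_def)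
    then show "f0 x = f x" by (simp add: euclidean_representation)
  qed
  ultimately show ?thesis by (intro exI[of _ f0]) (auto simp: f0_def)
qed

context bounded_domain
begin

lemma integral_domain_eq_lborel:
  fixes h :: "real^'n \<Rightarrow> 'b::euclidean_space"
  assumes "h \<in> borel_measurable borel" "\<And>x. x \<notin> \<Omega> \<Longrightarrow> h x = 0"
  shows "integrable (lebesgue_on \<Omega>) h \<longleftrightarrow> integrable lborel h" "integral\<^sup>L (lebesgue_on \<Omega>) h = integral\<^sup>L lborel h"
proof -
  have "(\<lambda>x. indicator \<Omega> x *\<^sub>R h x) = h" using assms(2) by (auto simp: indicator_def fun_eq_iff)
  then show "integrable (lebesgue_on \<Omega>) h \<longleftrightarrow> integrable lborel h" "integral\<^sup>L (lebesgue_on \<Omega>) h = integral\<^sup>L lborel h"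
    using assms(1) by (simp_all add: integrable_lebesgue_on_iff[OF domain_sets] integral_lebesgue_on_eq[OF domain_sets]
        integrable_completion integral_completion)
qed

text \<open>Continuous functions are dense in \<open>L\<^sup>2\<close> and uniformly continuous on bounded sets, and composition with
  the affine maps considered here does not increase the norm, since their Jacobian is at least one.\<close>

lemma L2_affine_continuity:
  fixes f :: "real^'n \<Rightarrow> real"
  assumes fm: "f \<in> borel_measurable borel" and f0: "\<And>x. x \<notin> \<Omega> \<Longrightarrow> f x = 0" and f: "L2_on \<Omega> f" and e: "e > 0"
  shows "\<exists>d>0. \<forall>\<delta> z. 0 < \<delta> \<and> \<delta> < d \<and> norm z < d \<longrightarrow>
    L2_on \<Omega> (\<lambda>x. f (x0 + (1 + \<delta>) *\<^sub>R (x - x0) + z)) \<and>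
    L2_norm_on \<Omega> (\<lambda>x. f (x0 + (1 + \<delta>) *\<^sub>R (x - x0) + z) - f x) \<le> e"
proof -
  obtain r where r: "\<And>x. x \<in> \<Omega> \<Longrightarrow> norm (x - x0) \<le> r" "r \<ge> 0"
  proof -
    obtain b where "\<forall>y\<in>\<Omega>. dist x0 y \<le> b" using bounded_domain bounded_any_center[of \<Omega> x0] by blast
    then have "norm (x - x0) \<le> max b 0" if "x \<in> \<Omega>" for x
      using that by (force simp: dist_norm norm_minus_commute)
    then show ?thesis by (intro that[of "max b 0"]) auto
  qed
  define S where "S = cball x0 (2 * r + 1)"
  have S: "bounded S" "S \<in> sets lebesgue" "compact S" by (auto simp: S_def)
  have SB: "S \<in> sets borel" by (simp add: S_def)
  have \<Omega>S: "x \<in> S" if "x \<in> \<Omega>" for x using r(1)[OF that] r(2) by (simp add: S_def dist_norm norm_minus_commute)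
  have sq: "integrable lborel (\<lambda>x. (f x)\<^sup>2)"
    using f integral_domain_eq_lborel(1)[of "\<lambda>x. (f x)\<^sup>2"] fm f0 by (simp add: L2_on_def)
  have fS: "L2_on S f"
    unfolding L2_on_def
  proof
    show "f \<in> borel_measurable (lebesgue_on S)"
      using measurable_completion[of f lborel borel] fm by (intro measurable_restrict_space1) simp
    have "integrable lebesgue (\<lambda>x. indicator S x *\<^sub>R (norm (f x))\<^sup>2)"
      using sq integrable_completion[of "\<lambda>x. (f x)\<^sup>2" lborel] fm by (intro integrable_mult_indicator S(2)) simp
    then show "integrable (lebesgue_on S) (\<lambda>x. (norm (f x))\<^sup>2)" by (simp add: integrable_lebesgue_on_iff[OF S(2)])
  qed
  obtain G where G: "continuous_on UNIV G" "L2_norm_on S (\<lambda>x. f x - G x) < e / 3"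
    using L2_dense_continuous[OF S(1,2) fS, of "e / 3"] e by auto
  have Gm: "G \<in> borel_measurable borel" using G(1) by (rule borel_measurable_continuous_onI)
  define A where "A = sqrt (measure lebesgue \<Omega>)"
  have A: "A \<ge> 0" by (simp add: A_def)
  have "uniformly_continuous_on S G" by (intro compact_uniformly_continuous continuous_on_subset[OF G(1)] S) auto
  moreover have e': "e / (3 * (A + 1)) > 0" using e A by simp
  ultimately obtain d where d: "d > 0" "\<And>x y. x \<in> S \<Longrightarrow> y \<in> S \<Longrightarrow> dist y x < d \<Longrightarrow> dist (G y) (G x) < e / (3 * (A + 1))"
    unfolding uniformly_continuous_on_def by metis
  define d' where "d' = min 1 (d / (r + 1))"
  have d': "d' > 0" "d' \<le> 1" using d(1) r(2) by (auto simp: d'_def)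
  show ?thesis
  proof (intro exI[of _ d'] conjI allI impI)
    fix \<delta> z assume dz: "0 < \<delta> \<and> \<delta> < d' \<and> norm (z :: real^'n) < d'"
    define T where "T x = x0 + (1 + \<delta>) *\<^sub>R (x - x0) + z" for x
    have T_eq: "T x = (x0 + z - (1 + \<delta>) *\<^sub>R x0) + (1 + \<delta>) *\<^sub>R x" for x
      by (simp add: T_def algebra_simps)
    have Tm: "T \<in> borel_measurable borel" unfolding T_def[abs_def] by measurable
    have T_close: "dist (T x) x < d" and T_S: "T x \<in> S" if "x \<in> \<Omega>" for x
    proof -
      have eq: "T x - x = \<delta> *\<^sub>R (x - x0) + z" "T x - x0 = (x - x0) + (T x - x)" by (simp_all add: T_def algebra_simps)
      have "norm (T x - x) \<le> \<delta> * norm (x - x0) + norm z"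
        unfolding eq(1) using dz norm_triangle_ineq[of "\<delta> *\<^sub>R (x - x0)" z] by simp
      also have "\<dots> \<le> \<delta> * r + norm z" using dz r(1)[OF that] by simp
      also have "\<dots> < d' * r + d'" using dz r(2) by (intro add_le_less_mono mult_right_mono) auto
      finally have le: "norm (T x - x) < d' * (r + 1)" by (simp add: algebra_simps)
      also have "\<dots> \<le> d" using d(1) r(2) mult_right_mono[of d' "d / (r + 1)" "r + 1"] by (simp add: d'_def)
      finally show "dist (T x) x < d" by (simp add: dist_norm)
      have "d' * (r + 1) \<le> r + 1" using d' r(2) by (simp add: mult_left_le_one_le)
      then have "norm (T x - x0) \<le> 2 * r + 1"
        using le norm_triangle_ineq[of "x - x0" "T x - x"] r(1)[OF that] unfolding eq(2)[symmetric] by linarith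
      then show "T x \<in> S" by (simp add: S_def dist_norm norm_minus_commute)
    qed
    have fTm: "(\<lambda>x. f (T x)) \<in> borel_measurable borel" "(\<lambda>x. G (T x)) \<in> borel_measurable borel"
      using measurable_compose[OF Tm] fm Gm by auto
    have GTc: "continuous_on UNIV (\<lambda>x. G (T x))"
      unfolding T_def by (intro continuous_on_compose2[OF G(1)] continuous_intros) auto
    have leb: "h \<in> borel_measurable (lebesgue_on \<Omega>)" if "h \<in> borel_measurable borel" for h :: "real^'n \<Rightarrow> real"
      using measurable_completion[of h lborel borel] that by (intro measurable_restrict_space1) simp
    have L2fT: "L2_on \<Omega> (\<lambda>x. f (T x))"
      unfolding L2_on_def
    proof
      show "(\<lambda>x. f (T x)) \<in> borel_measurable (lebesgue_on \<Omega>)" by (rule leb[OF fTm(1)])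
      have "integrable lborel (\<lambda>x. (f (T x))\<^sup>2)"
        unfolding T_eq by (rule integral_affine(1)[OF sq]) (use dz in simp)
      then have "integrable lebesgue (\<lambda>x. indicator \<Omega> x *\<^sub>R (norm (f (T x)))\<^sup>2)"
        using integrable_completion[of "\<lambda>x. (f (T x))\<^sup>2" lborel] fTm by (intro integrable_mult_indicator domain_sets) simp
      then show "integrable (lebesgue_on \<Omega>) (\<lambda>x. (norm (f (T x)))\<^sup>2)" by (simp add: integrable_lebesgue_on_iff[OF domain_sets])
    qed
    then show "L2_on \<Omega> (\<lambda>x. f (x0 + (1 + \<delta>) *\<^sub>R (x - x0) + z))" by (simp add: T_def)
    note L2G = L2_continuous[OF G(1)] L2_continuous[OF GTc]
    have 1: "L2_norm_on \<Omega> (\<lambda>x. f (T x) - G (T x)) \<le> e / 3"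
    proof -
      define h where "h x = indicator S x * (f x - G x)\<^sup>2" for x
      have hm: "h \<in> borel_measurable borel" unfolding h_def[abs_def] using SB fm Gm by measurable
      have "L2_on S (\<lambda>x. f x - G x)" by (intro L2_on_diff fS L2_on_continuous[OF S(1,2) G(1)])
      then have hi: "integrable lborel h"
        using hm by (auto simp: L2_on_def integrable_lebesgue_on_iff[OF S(2)] h_def[symmetric] integrable_completion)
      have "(LBINT x. h x) = (LINT x|lebesgue_on S. (norm (f x - G x))\<^sup>2)"
        using hm by (simp add: integral_lebesgue_on_eq[OF S(2)] h_def[symmetric] integral_completion)
      then have h_eq: "(LBINT x. h x) = (L2_norm_on S (\<lambda>x. f x - G x))\<^sup>2"
        by (simp add: L2_norm_on_def)
      have hT: "integrable lborel (\<lambda>x. h (T x))" and hTe: "(LBINT x. h x) = (1 + \<delta>) ^ CARD('n) * (LBINT x. h (T x))"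
        unfolding T_eq using integral_affine[OF hi, of "1 + \<delta>" "x0 + z - (1 + \<delta>) *\<^sub>R x0"] dz by auto
      have "(L2_norm_on \<Omega> (\<lambda>x. f (T x) - G (T x)))\<^sup>2 = (LINT x|lebesgue_on \<Omega>. (f (T x) - G (T x))\<^sup>2)"
        by (simp add: L2_norm_on_def)
      also have "\<dots> = (LINT x|lebesgue. indicator \<Omega> x * (f (T x) - G (T x))\<^sup>2)"
        by (simp add: integral_lebesgue_on_eq[OF domain_sets])
      also have "\<dots> \<le> (LINT x|lebesgue. h (T x))"
      proof (rule integral_mono_AE)
        have "integrable (lebesgue_on \<Omega>) (\<lambda>x. (f (T x) - G (T x))\<^sup>2)"
          using L2_on_diff[OF L2fT L2G(2)] by (simp add: L2_on_def)
        then show "integrable lebesgue (\<lambda>x. indicator \<Omega> x * (f (T x) - G (T x))\<^sup>2)"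
          by (simp add: integrable_lebesgue_on_iff[OF domain_sets])
        show "integrable lebesgue (\<lambda>x. h (T x))"
          using hT measurable_compose[OF Tm hm] by (simp add: integrable_completion)
        show "AE x in lebesgue. indicator \<Omega> x * (f (T x) - G (T x))\<^sup>2 \<le> h (T x)"
          using T_S by (intro AE_I2) (auto simp: h_def indicator_def)
      qed
      also have "\<dots> = (LBINT x. h (T x))"
        using measurable_compose[OF Tm hm] by (simp add: integral_completion)
      also have "\<dots> \<le> (1 + \<delta>) ^ CARD('n) * (LBINT x. h (T x))"
      proof -
        have "0 \<le> (LBINT x. h (T x))" by (intro integral_nonneg_AE AE_I2) (simp add: h_def)
        moreover have "1 \<le> (1 + \<delta>) ^ CARD('n)" using dz by (intro one_le_power) simp
        ultimately show ?thesis using mult_right_mono[of 1 "(1 + \<delta>) ^ CARD('n)" "LBINT x. h (T x)"] by simp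
      qed
      also have "\<dots> = (L2_norm_on S (\<lambda>x. f x - G x))\<^sup>2" using hTe h_eq by simp
      finally have "L2_norm_on \<Omega> (\<lambda>x. f (T x) - G (T x)) \<le> L2_norm_on S (\<lambda>x. f x - G x)"
        by (rule power2_le_imp_le) simp
      then show ?thesis using G(2) by simp
    qed
    have 2: "L2_norm_on \<Omega> (\<lambda>x. G (T x) - G x) \<le> e / 3"
    proof -
      define q where "q = e / (3 * (A + 1))"
      have q: "q > 0" using e' by (simp add: q_def)
      have "(L2_norm_on \<Omega> (\<lambda>x. G (T x) - G x))\<^sup>2 = (LINT x|lebesgue_on \<Omega>. (G (T x) - G x)\<^sup>2)"
        by (simp add: L2_norm_on_def)
      also have "\<dots> \<le> (LINT x|lebesgue_on \<Omega>. q\<^sup>2)"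
      proof (rule integral_mono_AE)
        show "integrable (lebesgue_on \<Omega>) (\<lambda>x. (G (T x) - G x)\<^sup>2)"
          using L2_on_diff[OF L2G(2,1)] by (simp add: L2_on_def)
        show "integrable (lebesgue_on \<Omega>) (\<lambda>x. q\<^sup>2)"
          by (intro integrable_continuous_lebesgue_on bounded_domain domain_sets continuous_intros)
        have "(G (T x) - G x)\<^sup>2 \<le> q\<^sup>2" if "x \<in> \<Omega>" for x
        proof -
          have "\<bar>G (T x) - G x\<bar> \<le> q"
            using d(2)[OF \<Omega>S[OF that] T_S[OF that] T_close[OF that]] by (simp add: q_def dist_real_def)
          then show ?thesis by (metis abs_ge_zero power2_abs power_mono)
        qed
        then show "AE x in lebesgue_on \<Omega>. (G (T x) - G x)\<^sup>2 \<le> q\<^sup>2"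
          by (auto simp: AE_lebesgue_on_iff[OF domain_sets])
      qed
      also have "\<dots> = (q * A)\<^sup>2"
        by (simp add: A_def power_mult_distrib measure_restrict_space domain_sets)
      finally have "L2_norm_on \<Omega> (\<lambda>x. G (T x) - G x) \<le> q * A"
        by (rule power2_le_imp_le) (use q A in simp)
      also have "\<dots> \<le> e / 3" using e A by (simp add: q_def field_simps)
      finally show ?thesis .
    qed
    have 3: "L2_norm_on \<Omega> (\<lambda>x. G x - f x) \<le> e / 3"
    proof -
      have "(L2_norm_on \<Omega> (\<lambda>x. G x - f x))\<^sup>2 = (LINT x|lebesgue. indicator \<Omega> x * (f x - G x)\<^sup>2)"
        by (simp add: L2_norm_on_def integral_lebesgue_on_eq[OF domain_sets] power2_commute)
      also have "\<dots> \<le> (LINT x|lebesgue. indicator S x * (f x - G x)\<^sup>2)"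
      proof (rule integral_mono_AE)
        have "integrable (lebesgue_on \<Omega>) (\<lambda>x. (f x - G x)\<^sup>2)" "integrable (lebesgue_on S) (\<lambda>x. (f x - G x)\<^sup>2)"
          using L2_on_diff[OF f L2G(1)] L2_on_diff[OF fS L2_on_continuous[OF S(1,2) G(1)]] by (auto simp: L2_on_def)
        then show "integrable lebesgue (\<lambda>x. indicator \<Omega> x * (f x - G x)\<^sup>2)" "integrable lebesgue (\<lambda>x. indicator S x * (f x - G x)\<^sup>2)"
          by (auto simp: integrable_lebesgue_on_iff[OF domain_sets] integrable_lebesgue_on_iff[OF S(2)])
        show "AE x in lebesgue. indicator \<Omega> x * (f x - G x)\<^sup>2 \<le> indicator S x * (f x - G x)\<^sup>2"
          using \<Omega>S by (intro AE_I2) (auto simp: indicator_def)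
      qed
      also have "\<dots> = (L2_norm_on S (\<lambda>x. f x - G x))\<^sup>2"
        by (simp add: L2_norm_on_def integral_lebesgue_on_eq[OF S(2)])
      finally have "L2_norm_on \<Omega> (\<lambda>x. G x - f x) \<le> L2_norm_on S (\<lambda>x. f x - G x)"
        by (rule power2_le_imp_le) simp
      then show ?thesis using G(2) by simp
    qed
    have "L2_norm_on \<Omega> (\<lambda>x. f (T x) - f x) = L2_norm_on \<Omega> (\<lambda>x. ((f (T x) - G (T x)) + (G (T x) - G x)) + (G x - f x))"
      by simp
    also have "\<dots> \<le> (L2_norm_on \<Omega> (\<lambda>x. f (T x) - G (T x)) + L2_norm_on \<Omega> (\<lambda>x. G (T x) - G x)) + L2_norm_on \<Omega> (\<lambda>x. G x - f x)"
      by (intro order_trans[OF L2_norm_triangle] add_mono L2_norm_triangle L2_on_add L2_on_diff L2fT L2G f order_refl)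
    also have "\<dots> \<le> e" using 1 2 3 by simp
    finally show "L2_norm_on \<Omega> (\<lambda>x. f (x0 + (1 + \<delta>) *\<^sub>R (x - x0) + z) - f x) \<le> e" by (simp add: T_def)
  qed (rule d')
qed

text \<open>By Fubini's theorem the pairing of an average is the average of the pairings with the dilated and translated
  functions, each of which is close to \<open>f\<close> in \<open>L\<^sup>2\<close>.\<close>

lemma mollification_pairing:
  fixes f g :: "real^'n \<Rightarrow> real" and \<eta> :: "real^'n \<Rightarrow> real"
  assumes fm: "f \<in> borel_measurable borel" and f0: "\<And>x. x \<notin> \<Omega> \<Longrightarrow> f x = 0" and f: "L2_on \<Omega> f" and g: "L2_on \<Omega> g"
    and \<eta>: "continuous_on UNIV \<eta>" "\<And>z. \<eta> z \<ge> 0" "\<And>z. norm z > 1 \<Longrightarrow> \<eta> z = 0" and e: "e > 0"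
  shows "\<exists>d>0. \<forall>\<delta> \<epsilon>. 0 < \<delta> \<and> \<delta> < d \<and> 0 < \<epsilon> \<and> \<epsilon> < d \<and>
      L2_on \<Omega> (\<lambda>x. LBINT z. \<eta> z * f (x0 + (1 + \<delta>) *\<^sub>R (x - x0) + \<epsilon> *\<^sub>R z)) \<longrightarrow>
    \<bar>L2_inner \<Omega> (\<lambda>x. LBINT z. \<eta> z * f (x0 + (1 + \<delta>) *\<^sub>R (x - x0) + \<epsilon> *\<^sub>R z)) g - (LBINT z. \<eta> z) * L2_inner \<Omega> f g\<bar>
      \<le> (LBINT z. \<eta> z) * (e * L2_norm_on \<Omega> g)"
proof -
  obtain d where d: "d > 0" and close: "\<And>\<delta> z. 0 < \<delta> \<Longrightarrow> \<delta> < d \<Longrightarrow> norm z < d \<Longrightarrow>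
      L2_on \<Omega> (\<lambda>x. f (x0 + (1 + \<delta>) *\<^sub>R (x - x0) + z)) \<and>
      L2_norm_on \<Omega> (\<lambda>x. f (x0 + (1 + \<delta>) *\<^sub>R (x - x0) + z) - f x) \<le> e"
    using L2_affine_continuity[OF fm f0 f e, of x0] by blast
  have \<eta>m: "\<eta> \<in> borel_measurable borel" using \<eta>(1) by (rule borel_measurable_continuous_onI)
  have \<eta>i: "integrable lborel \<eta>"
  proof -
    have "\<eta> = (\<lambda>z. indicator (cball 0 1) z *\<^sub>R \<eta> z)" using \<eta>(3) by (auto simp: indicator_def fun_eq_iff)
    then show ?thesis using borel_integrable_compact[of "cball 0 1" \<eta>] continuous_on_subset[OF \<eta>(1)] by simp
  qed
  have fi: "integrable lborel f"
    using L2_on_integrable[OF bounded_domain domain_sets f] integral_domain_eq_lborel(1)[OF fm f0] by simp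
  obtain C where C: "\<And>z. \<bar>\<eta> z\<bar> \<le> C"
  proof -
    have "bounded (\<eta> ` cball 0 1)"
      by (intro compact_imp_bounded compact_continuous_image continuous_on_subset[OF \<eta>(1)]) auto
    then obtain C where "\<forall>y\<in>\<eta> ` cball 0 1. norm y \<le> C" unfolding bounded_iff by blast
    then have "norm (\<eta> z) \<le> C" if "norm z \<le> 1" for z using that by simp
    then have "\<bar>\<eta> z\<bar> \<le> max C 0" for z using \<eta>(3)[of z] by (cases "norm z \<le> 1") (auto simp: le_max_iff_disj)
    then show ?thesis by (rule that)
  qed
  obtain g0 where g0: "g0 \<in> borel_measurable borel" "\<And>x. x \<notin> \<Omega> \<Longrightarrow> g0 x = 0" "AE x in lebesgue_on \<Omega>. g0 x = g x"
    using borel_representative[OF open_domain L2_onD[OF g]] by blast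
  have g0L: "L2_on \<Omega> g0" by (rule L2_AE_cong[OF g]) (use g0(3) in \<open>simp add: eq_commute\<close>)
  have g0n: "L2_norm_on \<Omega> g0 = L2_norm_on \<Omega> g" by (rule norm_cong_AE[OF g0(3)])
  have g0i: "L2_inner \<Omega> h g0 = L2_inner \<Omega> h g" for h by (rule inner_cong_AE) (use g0(3) in auto)
  show ?thesis
  proof (intro exI[of _ d] conjI allI impI)
    fix \<delta> \<epsilon> :: real
    assume *: "0 < \<delta> \<and> \<delta> < d \<and> 0 < \<epsilon> \<and> \<epsilon> < d \<and>
      L2_on \<Omega> (\<lambda>x. LBINT z. \<eta> z * f (x0 + (1 + \<delta>) *\<^sub>R (x - x0) + \<epsilon> *\<^sub>R z))"
    define T where "T x z = x0 + (1 + \<delta>) *\<^sub>R (x - x0) + \<epsilon> *\<^sub>R z" for x z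
    define M where "M x = (LBINT z. \<eta> z * f (T x z))" for x
    have M_L2: "L2_on \<Omega> M" using * by (simp add: M_def[abs_def] T_def)
    define I where "I = (LBINT z. \<eta> z)"
    have fT: "integrable lborel (\<lambda>z. f (T x z))" for x
      unfolding T_def by (rule integral_affine(1)[OF fi]) (use * in simp)
    have fTm: "(\<lambda>z. f (T x z)) \<in> borel_measurable borel" for x using borel_measurable_integrable[OF fT] by simp
    have \<eta>fT: "integrable lborel (\<lambda>z. \<eta> z * f (T x z))" for x
    proof (rule Bochner_Integration.integrable_bound[of _ "\<lambda>z. C * f (T x z)"])
      show "(\<lambda>z. \<eta> z * f (T x z)) \<in> borel_measurable lborel" using \<eta>m fTm[of x] by simp
      show "AE z in lborel. norm (\<eta> z * f (T x z)) \<le> norm (C * f (T x z))"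
      proof (rule AE_I2)
        fix z
        have "\<bar>\<eta> z\<bar> * \<bar>f (T x z)\<bar> \<le> \<bar>C\<bar> * \<bar>f (T x z)\<bar>"
          using C[of z] by (intro mult_right_mono) auto
        then show "norm (\<eta> z * f (T x z)) \<le> norm (C * f (T x z))" by (simp add: abs_mult)
      qed
    qed (use fT in simp)
    have diff: "M x - I * f x = (LBINT z. \<eta> z * (f (T x z) - f x))" for x
      using \<eta>fT[of x] \<eta>i by (simp add: M_def I_def right_diff_distrib)
    have diffi: "integrable lborel (\<lambda>z. \<eta> z * (f (T x z) - f x))" for x
      using \<eta>fT[of x] \<eta>i by (simp add: right_diff_distrib)
    define J where "J = (\<lambda>(x, z). ennreal (\<eta> z * \<bar>f (T x z) - f x\<bar> * \<bar>g0 x\<bar>))"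
    have Jm: "J \<in> borel_measurable (lborel \<Otimes>\<^sub>M lborel)"
    proof -
      have Tm: "(\<lambda>p. T (fst p) (snd p)) \<in> borel_measurable (lborel \<Otimes>\<^sub>M lborel)"
        unfolding T_def by measurable
      have 1: "(\<lambda>p. f (T (fst p) (snd p))) \<in> borel_measurable (lborel \<Otimes>\<^sub>M lborel)"
        using measurable_compose[OF Tm fm] .
      have 2: "(\<lambda>p. f (fst p)) \<in> borel_measurable (lborel \<Otimes>\<^sub>M lborel)" "(\<lambda>p. g0 (fst p)) \<in> borel_measurable (lborel \<Otimes>\<^sub>M lborel)"
        "(\<lambda>p. \<eta> (snd p)) \<in> borel_measurable (lborel \<Otimes>\<^sub>M lborel)"
        using fm g0(1) \<eta>m by (auto intro: measurable_compose[OF measurable_fst] measurable_compose[OF measurable_snd])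
      show ?thesis
        unfolding J_def case_prod_beta' using 1 2 by measurable
    qed
    have inner_z: "(\<integral>\<^sup>+ x. J (x, z) \<partial>lborel) \<le> ennreal (\<eta> z * (e * L2_norm_on \<Omega> g))" for z
    proof (cases "norm z > 1")
      case True
      then show ?thesis using \<eta>(3) by (simp add: J_def)
    next
      case False
      then have le: "\<epsilon> * norm z \<le> \<epsilon> * 1" using * by (intro mult_left_mono) auto
      have "norm (\<epsilon> *\<^sub>R z) = \<epsilon> * norm z" using * by simp
      also have "\<dots> < d" using le * by linarith
      finally have "norm (\<epsilon> *\<^sub>R z) < d" .
      then have c: "L2_on \<Omega> (\<lambda>x. f (T x z))" "L2_norm_on \<Omega> (\<lambda>x. f (T x z) - f x) \<le> e"
        using close[of \<delta> "\<epsilon> *\<^sub>R z"] * by (auto simp: T_def)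
      have dL: "L2_on \<Omega> (\<lambda>x. \<bar>f (T x z) - f x\<bar>)" "L2_on \<Omega> (\<lambda>x. \<bar>g0 x\<bar>)"
        using L2_on_diff[OF c(1) f] g0L L2_onD[OF L2_on_diff[OF c(1) f]] L2_onD[OF g0L]
        by (auto simp: L2_on_def)
      have zm: "(\<lambda>x. f (T x z)) \<in> borel_measurable borel"
      proof -
        have "(\<lambda>x. T x z) \<in> borel_measurable borel" unfolding T_def by measurable
        from measurable_compose[OF this fm] show ?thesis .
      qed
      have h: "(\<lambda>x. \<eta> z * \<bar>f (T x z) - f x\<bar> * \<bar>g0 x\<bar>) \<in> borel_measurable borel"
        using zm fm g0(1) by measurable
      have hi: "integrable (lebesgue_on \<Omega>) (\<lambda>x. \<eta> z * \<bar>f (T x z) - f x\<bar> * \<bar>g0 x\<bar>)"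
        using L2_inner_integrable[OF dL] by (simp add: mult.assoc)
      have "(\<integral>\<^sup>+ x. J (x, z) \<partial>lborel) = ennreal (LBINT x. \<eta> z * \<bar>f (T x z) - f x\<bar> * \<bar>g0 x\<bar>)"
        unfolding J_def prod.case
        using hi integral_domain_eq_lborel(1)[OF h] g0(2) \<eta>(2) by (intro nn_integral_eq_integral) auto
      also have "(LBINT x. \<eta> z * \<bar>f (T x z) - f x\<bar> * \<bar>g0 x\<bar>) = \<eta> z * L2_inner \<Omega> (\<lambda>x. \<bar>f (T x z) - f x\<bar>) (\<lambda>x. \<bar>g0 x\<bar>)"
        using integral_domain_eq_lborel(2)[OF h] g0(2) by (auto simp: L2_inner_def mult.assoc)
      also have "\<dots> \<le> \<eta> z * (L2_norm_on \<Omega> (\<lambda>x. f (T x z) - f x) * L2_norm_on \<Omega> g0)"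
        using L2_Cauchy_Schwarz[OF dL] \<eta>(2) by (intro mult_left_mono) (auto simp: L2_norm_on_def)
      also have "\<dots> \<le> \<eta> z * (e * L2_norm_on \<Omega> g)"
        unfolding g0n by (intro mult_left_mono mult_right_mono c \<eta>(2)) simp
      finally show ?thesis by (simp add: ennreal_leI)
    qed
    have I0: "I \<ge> 0" unfolding I_def using \<eta>(2) by (simp add: integral_nonneg_AE)
    have total: "(\<integral>\<^sup>+ x. \<integral>\<^sup>+ z. J (x, z) \<partial>lborel \<partial>lborel) \<le> ennreal (I * (e * L2_norm_on \<Omega> g))"
    proof -
      have "(\<integral>\<^sup>+ x. \<integral>\<^sup>+ z. J (x, z) \<partial>lborel \<partial>lborel) = (\<integral>\<^sup>+ z. \<integral>\<^sup>+ x. J (x, z) \<partial>lborel \<partial>lborel)"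
        by (rule lborel_pair.Fubini'[symmetric]) (use Jm in simp)
      also have "\<dots> \<le> (\<integral>\<^sup>+ z. ennreal (\<eta> z * (e * L2_norm_on \<Omega> g)) \<partial>lborel)"
        by (intro nn_integral_mono inner_z)
      also have "\<dots> = ennreal (LBINT z. \<eta> z * (e * L2_norm_on \<Omega> g))"
        using \<eta>i \<eta>(2) e by (intro nn_integral_eq_integral) auto
      finally show ?thesis by (simp add: I_def)
    qed
    have MIL: "L2_on \<Omega> (\<lambda>x. M x - I * f x)"
      using L2_on_diff[OF M_L2 L2_on_scaleR[OF f, of I]] by simp
    have "ennreal (norm (L2_inner \<Omega> (\<lambda>x. M x - I * f x) g0)) \<le> (\<integral>\<^sup>+ x. ennreal (norm ((M x - I * f x) * g0 x)) \<partial>lebesgue_on \<Omega>)"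
      unfolding L2_inner_def using integral_norm_bound_ennreal[OF L2_inner_integrable[OF MIL g0L]] by simp
    also have "\<dots> = (\<integral>\<^sup>+ x. ennreal (norm ((M x - I * f x) * g0 x)) * indicator \<Omega> x \<partial>lebesgue)"
      by (rule nn_integral_restrict_space) (simp add: domain_sets)
    also have "\<dots> \<le> (\<integral>\<^sup>+ x. (\<integral>\<^sup>+ z. J (x, z) \<partial>lborel) \<partial>lebesgue)"
    proof (rule nn_integral_mono)
      fix x
      have "ennreal (norm (M x - I * f x)) \<le> (\<integral>\<^sup>+ z. ennreal (norm (\<eta> z * (f (T x z) - f x))) \<partial>lborel)"
        unfolding diff by (rule integral_norm_bound_ennreal[OF diffi])
      then have "ennreal (norm (M x - I * f x)) * ennreal \<bar>g0 x\<bar>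
          \<le> (\<integral>\<^sup>+ z. ennreal (norm (\<eta> z * (f (T x z) - f x))) \<partial>lborel) * ennreal \<bar>g0 x\<bar>"
        by (intro mult_right_mono) auto
      also have "\<dots> = (\<integral>\<^sup>+ z. ennreal (norm (\<eta> z * (f (T x z) - f x))) * ennreal \<bar>g0 x\<bar> \<partial>lborel)"
        using borel_measurable_integrable[OF diffi[of x]] by (intro nn_integral_multc[symmetric]) simp
      also have "\<dots> = (\<integral>\<^sup>+ z. J (x, z) \<partial>lborel)"
        using \<eta>(2) by (intro nn_integral_cong) (simp add: J_def ennreal_mult'[symmetric] abs_mult)
      finally have "ennreal (norm ((M x - I * f x) * g0 x)) \<le> (\<integral>\<^sup>+ z. J (x, z) \<partial>lborel)"
        by (simp add: ennreal_mult'[symmetric] abs_mult)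
      then show "ennreal (norm ((M x - I * f x) * g0 x)) * indicator \<Omega> x \<le> (\<integral>\<^sup>+ z. J (x, z) \<partial>lborel)"
        by (auto simp: indicator_def)
    qed
    also have "\<dots> = (\<integral>\<^sup>+ x. (\<integral>\<^sup>+ z. J (x, z) \<partial>lborel) \<partial>lborel)"
      by (rule nn_integral_completion)
    also note total
    finally have "\<bar>L2_inner \<Omega> (\<lambda>x. M x - I * f x) g0\<bar> \<le> I * (e * L2_norm_on \<Omega> g)"
      using I0 e by (simp add: ennreal_le_iff)
    also have "L2_inner \<Omega> (\<lambda>x. M x - I * f x) g0 = L2_inner \<Omega> M g - I * L2_inner \<Omega> f g"
      using L2_inner_diff_left[OF M_L2 L2_on_scaleR[OF f, of I] g0L] L2_inner_scaleR_left[of \<Omega> I f g0] by (simp add: g0i)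
    finally show "\<bar>L2_inner \<Omega> (\<lambda>x. LBINT z. \<eta> z * f (x0 + (1 + \<delta>) *\<^sub>R (x - x0) + \<epsilon> *\<^sub>R z)) g - (LBINT z. \<eta> z) * L2_inner \<Omega> f g\<bar>
      \<le> (LBINT z. \<eta> z) * (e * L2_norm_on \<Omega> g)"
      by (simp add: M_def[abs_def] T_def I_def)
  qed (rule d)
qed

text \<open>The field, extended by zero, is dilated about a point of the domain and mollified. Convexity makes the
  dilation shrink the support into the domain, so the result is a smooth field with compact support, to which
  the definition of the weak gradient applies. It is divergence free because its divergence at a point is the
  pairing of the given field with the gradient of a smooth function.\<close>

lemma orthogonal_to_weak_grad:
  assumes conv: "convex \<Omega>" and F: "L2_on \<Omega> F" and orth: "\<And>\<psi>. smooth_on UNIV \<psi> \<Longrightarrow> L2_inner \<Omega> F (gradient \<psi>) = 0"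
    and \<phi>: "Hk_on 1 \<Omega> \<phi>"
  shows "L2_inner \<Omega> F (weak_grad \<Omega> \<phi>) = 0"
proof (cases "\<Omega> = {}")
  case True
  then show ?thesis by (simp add: L2_inner_def)
next
  case False
  then obtain x0 where "x0 \<in> \<Omega>" by blast
  then obtain r where r: "r > 0" "cball x0 r \<subseteq> \<Omega>" using open_domain open_contains_cball by blast
  obtain F0 where F0: "F0 \<in> borel_measurable borel" "\<And>x. x \<notin> \<Omega> \<Longrightarrow> F0 x = 0" "AE x in lebesgue_on \<Omega>. F0 x = F x"
    using borel_representative[OF open_domain L2_onD[OF F]] by blast
  have F0L: "L2_on \<Omega> F0" by (rule L2_AE_cong[OF F]) (use F0(3) in \<open>simp add: eq_commute\<close>)
  have F0i: "L2_inner \<Omega> F0 h = L2_inner \<Omega> F h" for h by (rule inner_cong_AE) (use F0(3) in auto)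
  define f where "f i x = F0 x $ i" for i x
  have fm: "f i \<in> borel_measurable borel" for i
    unfolding f_def[abs_def] by (rule measurable_compose[OF F0(1)]) (intro borel_measurable_continuous_onI continuous_intros)
  have f0: "f i x = 0" if "x \<notin> \<Omega>" for i x using F0(2)[OF that] by (simp add: f_def)
  have fL: "L2_on \<Omega> (f i)" for i unfolding f_def[abs_def] by (rule L2_on_bounded_linear[OF F0L bounded_linear_vec_nth])
  have fi: "integrable lborel (f i)" for i
    using L2_on_integrable[OF bounded_domain domain_sets fL] integral_domain_eq_lborel(1)[OF fm f0] by blast
  define \<eta> where "\<eta> z = flat (1 - z \<bullet> z)" for z :: "real^'n"
  have s\<eta>: "smooth_on UNIV \<eta>"
    unfolding \<eta>_def[abs_def] by (intro smooth_on_flat_compose smooth_on_diff smooth_on_const smooth_on_inner smooth_on_ident open_UNIV)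
  have \<eta>0: "\<eta> z = 0" if "norm z > 1" for z
  proof -
    have "1 \<le> (norm z)\<^sup>2" using that by (simp add: one_le_power)
    then show ?thesis by (simp add: \<eta>_def power2_norm_eq_inner)
  qed
  have \<eta>nn: "\<eta> z \<ge> 0" for z by (simp add: \<eta>_def)
  note \<eta>c = smooth_on_continuous[OF s\<eta>]
  define I where "I = (LBINT z. \<eta> z)"
  have \<eta>i: "integrable lborel \<eta>"
  proof -
    have "\<eta> = (\<lambda>z. indicator (cball 0 1) z *\<^sub>R \<eta> z)" using \<eta>0 by (auto simp: indicator_def fun_eq_iff)
    then show ?thesis using borel_integrable_compact[of "cball 0 1" \<eta>] continuous_on_subset[OF \<eta>c] by simp
  qed
  have I: "I > 0"
  proof -
    have "I \<ge> 0" unfolding I_def using \<eta>nn by (simp add: integral_nonneg_AE)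
    moreover have "I \<noteq> 0"
    proof
      assume "I = 0"
      then have "AE z in lborel. \<eta> z = 0"
        using integral_nonneg_eq_0_iff_AE[OF \<eta>i] \<eta>nn by (simp add: I_def)
      then have "AE z in lborel. (z :: real^'n) \<notin> ball 0 1"
      proof eventually_elim
        case (elim z)
        then have "(norm z)\<^sup>2 \<ge> 1" by (simp add: \<eta>_def power2_norm_eq_inner)
        then show ?case using power_less_one_iff[of "norm z" 2] by auto
      qed
      then have "emeasure lborel (ball (0::real^'n) 1) = 0"
        by (subst (asm) AE_iff_measurable[of "ball 0 1"]) auto
      then have "negligible (ball (0::real^'n) 1)"
        by (simp add: negligible_iff_null_sets null_sets_completionI null_setsI)
      then show False using open_not_negligible[of "ball (0::real^'n) 1"] by auto
    qed
    ultimately show ?thesis by simp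
  qed
  \<comment> \<open>the dilation by \<open>1 + \<delta>\<close> leaves room for a kernel of radius proportional to \<open>\<delta>\<close>\<close>
  have key: "(\<Sum>i\<in>UNIV. L2_inner \<Omega> (\<lambda>x. LBINT z. \<eta> z * f i (x0 + (1 + \<delta>) *\<^sub>R (x - x0) + (r * \<delta>) *\<^sub>R z)) (weak_pderiv \<Omega> i \<phi>)) = 0
      \<and> (\<forall>i. L2_on \<Omega> (\<lambda>x. LBINT z. \<eta> z * f i (x0 + (1 + \<delta>) *\<^sub>R (x - x0) + (r * \<delta>) *\<^sub>R z)))" if \<delta>: "\<delta> > 0" for \<delta>
  proof -
    define a where "a = (1 + \<delta>) / (r * \<delta>)"
    have a: "a > 0" using \<delta> r by (simp add: a_def)
    define K where "K v = flat (1 - a\<^sup>2 * (v \<bullet> v))" for v :: "real^'n"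
    define m where "m y = x0 + inverse (1 + \<delta>) *\<^sub>R (y - x0)" for y
    define M where "M i x = (LBINT y. K (x - m y) * f i y)" for i x
    have K_eq: "K v = \<eta> (- a *\<^sub>R v)" for v by (simp add: K_def \<eta>_def power2_eq_square mult.assoc)
    have sK: "smooth_on UNIV K" unfolding K_def[abs_def]
      by (intro smooth_on_flat_compose smooth_on_diff smooth_on_const smooth_on_mult smooth_on_inner smooth_on_ident open_UNIV)
    have K0: "K v = 0" if "inverse a < norm v" for v
    proof -
      have "1 < a * norm v" using that a by (simp add: field_simps)
      then show ?thesis unfolding K_eq using a by (intro \<eta>0) simp
    qed
    have mm: "m \<in> borel_measurable borel" unfolding m_def[abs_def] by measurable
    have sM: "smooth_on UNIV (M i)" for i
      unfolding M_def[abs_def] by (rule smooth_convolution[OF sK K0 fi mm])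
    have M_eq: "M i x = (r * \<delta>) ^ CARD('n) * (LBINT z. \<eta> z * f i (x0 + (1 + \<delta>) *\<^sub>R (x - x0) + (r * \<delta>) *\<^sub>R z))" for i x
    proof -
      have Ki: "integrable lborel (\<lambda>y. K (x - m y) * f i y)"
      proof (rule Bochner_Integration.integrable_bound[of _ "f i"])
        have "K \<in> borel_measurable borel" using smooth_on_continuous[OF sK] by (rule borel_measurable_continuous_onI)
        then have "(\<lambda>y. K (x - m y)) \<in> borel_measurable borel"
          using mm by (intro measurable_compose[of "\<lambda>y. x - m y" borel borel K]) auto
        then show "(\<lambda>y. K (x - m y) * f i y) \<in> borel_measurable lborel" using fm[of i] by simp
        show "AE y in lborel. norm (K (x - m y) * f i y) \<le> norm (f i y)"
          by (intro AE_I2) (auto simp: abs_mult K_def intro!: mult_left_le_one_le)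
      qed (rule fi)
      have mT: "x - m (x0 + (1 + \<delta>) *\<^sub>R (x - x0) + (r * \<delta>) *\<^sub>R z) = - inverse a *\<^sub>R z" for z
      proof -
        have "inverse (1 + \<delta>) *\<^sub>R ((1 + \<delta>) *\<^sub>R (x - x0) + (r * \<delta>) *\<^sub>R z) = (x - x0) + inverse a *\<^sub>R z"
        proof -
          have c: "inverse (1 + \<delta>) * (1 + \<delta>) = 1" "inverse (1 + \<delta>) * (r * \<delta>) = inverse a"
            using \<delta> by (simp_all add: a_def divide_inverse)
          show ?thesis by (simp only: scaleR_add_right scaleR_scaleR c scaleR_one)
        qed
        then show ?thesis by (simp add: m_def add.assoc)
      qed
      have "K (x - m (x0 + (1 + \<delta>) *\<^sub>R (x - x0) + (r * \<delta>) *\<^sub>R z)) = \<eta> z" for z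
        unfolding mT K_eq using a by simp
      then show ?thesis
        unfolding M_def using integral_affine(2)[OF Ki, of "r * \<delta>" "x0 + (1 + \<delta>) *\<^sub>R (x - x0)"] r \<delta> by simp
    qed
    \<comment> \<open>the support: by convexity the shrunk closure has distance at least \<open>r \<delta> / (1 + \<delta>)\<close>, the kernel radius, from the complement of \<open>\<Omega>\<close>\<close>
    define Kc where "Kc = (\<lambda>(y, w). m y + w) ` (closure \<Omega> \<times> cball 0 (inverse a))"
    have Kc: "compact Kc"
      unfolding Kc_def m_def case_prod_beta'
      by (intro compact_continuous_image compact_Times compact_cball continuous_intros)
        (use bounded_domain in \<open>simp add: compact_closure\<close>)
    have "Kc \<subseteq> \<Omega>"
    proof
      fix x assume "x \<in> Kc"
      then obtain y w where yw: "y \<in> closure \<Omega>" "norm w \<le> inverse a" "x = m y + w" by (auto simp: Kc_def)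
      define c where "c = x0 + ((1 + \<delta>) / \<delta>) *\<^sub>R w"
      have "norm (((1 + \<delta>) / \<delta>) *\<^sub>R w) \<le> ((1 + \<delta>) / \<delta>) * inverse a"
      proof -
        have cpos: "0 < (1 + \<delta>) / \<delta>" using \<delta> by simp
        show ?thesis
          by (simp only: norm_scaleR abs_of_pos[OF cpos]) (intro mult_left_mono yw(2) less_imp_le cpos)
      qed
      also have "\<dots> = r"
      proof -
        have "(1 + \<delta>) / \<delta> * (\<delta> / (1 + \<delta>)) = 1" using \<delta> by simp
        moreover have "inverse a = (\<delta> / (1 + \<delta>)) * r" by (simp add: a_def)
        ultimately show ?thesis by (simp only: mult.assoc[symmetric] mult_1_left)
      qed
      finally have "c \<in> \<Omega>" using r(2) by (auto simp: c_def dist_norm subset_iff)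
      then have c: "c \<in> interior \<Omega>" using open_domain by (simp add: interior_open)
      have "y - (\<delta> / (1 + \<delta>)) *\<^sub>R (y - c) \<in> interior \<Omega>"
        by (rule mem_interior_closure_convex_shrink[OF conv c yw(1)]) (use \<delta> in \<open>auto simp: field_simps\<close>)
      moreover have "y - (\<delta> / (1 + \<delta>)) *\<^sub>R (y - c) = x"
      proof -
        have "\<delta> / (1 + \<delta>) * ((1 + \<delta>) / \<delta>) = 1" using \<delta> by simp
        then have "(\<delta> / (1 + \<delta>)) *\<^sub>R (((1 + \<delta>) / \<delta>) *\<^sub>R w) = w" by (simp only: scaleR_scaleR scaleR_one)
        moreover have one: "\<delta> / (1 + \<delta>) = 1 - inverse (1 + \<delta>)" using \<delta> by (simp add: field_simps)
        ultimately
        have "y - (\<delta> / (1 + \<delta>)) *\<^sub>R (y - c) = y - (\<delta> / (1 + \<delta>)) *\<^sub>R (y - x0) + w"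
          by (simp add: c_def scaleR_diff_right scaleR_add_right)
        also have "\<dots> = x" unfolding one yw(3) m_def by (simp add: algebra_simps)
        finally show ?thesis .
      qed
      ultimately show "x \<in> \<Omega>" using interior_subset by auto
    qed
    moreover have "M i x = 0" if "x \<notin> Kc" for i x
    proof -
      have "K (x - m y) * f i y = 0" for y
      proof (cases "y \<in> \<Omega>")
        case True
        then have "x - m y \<notin> cball 0 (inverse a)"
          using that closure_subset unfolding Kc_def by (force simp: image_iff)
        then show ?thesis using K0 by simp
      qed (simp add: f0)
      then have "(\<lambda>y. K (x - m y) * f i y) = (\<lambda>y. 0)" by (rule ext)
      then show ?thesis unfolding M_def by simp
    qed
    ultimately have test: "test_function \<Omega> (M i)" for i
      by (intro test_functionI[OF sM Kc]) auto
    have div0: "(\<Sum>i\<in>UNIV. pderiv_at i (M i) x) = 0" for x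
    proof -
      \<comment> \<open>the divergence at \<open>x\<close> is a pairing of \<open>F\<close> with the gradient of the smooth function \<open>\<psi>\<close>\<close>
      define \<psi> where "\<psi> y = K (x - m y)" for y
      have s\<psi>: "smooth_on UNIV \<psi>"
      proof -
        have lin: "smooth_on UNIV (\<lambda>y. x - m y)"
          unfolding m_def
          by (intro smooth_on_diff smooth_on_add smooth_on_const smooth_on_bounded_linear[OF _ bounded_linear_scaleR_right] smooth_on_ident open_UNIV)
        show ?thesis unfolding \<psi>_def[abs_def] K_def
          by (intro smooth_on_flat_compose smooth_on_diff[of _ "\<lambda>x. 1"] smooth_on_const smooth_on_mult smooth_on_inner lin open_UNIV)
      qed
      have grad: "gradient \<psi> y = - inverse (1 + \<delta>) *\<^sub>R gradient K (x - m y)" for y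
      proof (rule gradient_eqI)
        have d: "((\<lambda>y. x - m y) has_derivative (\<lambda>v. - inverse (1 + \<delta>) *\<^sub>R v)) (at y)"
          unfolding m_def by (auto intro!: derivative_eq_intros)
        show "(\<psi> has_derivative (\<lambda>v. (- inverse (1 + \<delta>) *\<^sub>R gradient K (x - m y)) \<bullet> v)) (at y)"
          unfolding \<psi>_def[abs_def]
          using has_derivative_compose[OF d smooth_on_has_gradient[OF sK UNIV_I]] by simp
      qed
      have gKc: "continuous_on UNIV (gradient K)" by (intro smooth_on_continuous smooth_on_gradient sK open_UNIV)
      have "0 = L2_inner \<Omega> F0 (gradient \<psi>)" using orth[OF s\<psi>] by (simp add: F0i)
      also have "\<dots> = - inverse (1 + \<delta>) * (LINT y|lebesgue_on \<Omega>. F0 y \<bullet> gradient K (x - m y))"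
        by (simp add: L2_inner_def grad)
      finally have "0 = (LINT y|lebesgue_on \<Omega>. F0 y \<bullet> gradient K (x - m y))" using \<delta> by simp
      also have "\<dots> = (LBINT y. F0 y \<bullet> gradient K (x - m y))"
      proof (rule integral_domain_eq_lborel(2))
        have "gradient K \<in> borel_measurable borel" using gKc by (rule borel_measurable_continuous_onI)
        then have "(\<lambda>y. gradient K (x - m y)) \<in> borel_measurable borel"
          using mm by (intro measurable_compose[of "\<lambda>y. x - m y" borel borel "gradient K"]) auto
        then show "(\<lambda>y. F0 y \<bullet> gradient K (x - m y)) \<in> borel_measurable borel" using F0(1) by simp
      qed (simp add: F0(2))
      also have "\<dots> = (LBINT y. \<Sum>i\<in>UNIV. pderiv_at i K (x - m y) * f i y)"
        by (simp add: inner_vec_def gradient_def f_def mult.commute)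
      also have "\<dots> = (\<Sum>i\<in>UNIV. LBINT y. pderiv_at i K (x - m y) * f i y)"
      proof (rule Bochner_Integration.integral_sum)
        fix i
        have gz: "pderiv_at i K v = 0" if "inverse a < norm v" for v
          unfolding pderiv_at_def
          by (rule has_derivative_vanishing_outside[where F = K and x = v and K = "cball 0 (inverse a)"])
            (use K0 that smooth_on_has_derivative[OF sK] in auto)
        have pc: "continuous_on UNIV (pderiv_at i K)" by (rule pderiv_at_smooth(2)[OF sK])
        have "bounded (pderiv_at i K ` cball 0 (inverse a))"
          by (intro compact_imp_bounded compact_continuous_image continuous_on_subset[OF pc]) auto
        then obtain C where C: "\<forall>y\<in>pderiv_at i K ` cball 0 (inverse a). norm y \<le> C" unfolding bounded_iff by blast
        have "norm (pderiv_at i K v) \<le> C" if "norm v \<le> inverse a" for v using C that by simp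
        then have C': "\<bar>pderiv_at i K v\<bar> \<le> \<bar>C\<bar>" for v using gz[of v] by (cases "norm v \<le> inverse a") (force, simp)
        show "integrable lborel (\<lambda>y. pderiv_at i K (x - m y) * f i y)"
        proof (rule Bochner_Integration.integrable_bound[of _ "\<lambda>y. C * f i y"])
          have "pderiv_at i K \<in> borel_measurable borel" using pc by (rule borel_measurable_continuous_onI)
          then have "(\<lambda>y. pderiv_at i K (x - m y)) \<in> borel_measurable borel"
            using mm by (intro measurable_compose[of "\<lambda>y. x - m y" borel borel "pderiv_at i K"]) auto
          then show "(\<lambda>y. pderiv_at i K (x - m y) * f i y) \<in> borel_measurable lborel" using fm[of i] by simp
          show "AE y in lborel. norm (pderiv_at i K (x - m y) * f i y) \<le> norm (C * f i y)"
            using C' by (intro AE_I2) (auto simp: abs_mult intro!: mult_right_mono)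
        qed (use fi in simp)
      qed
      also have "\<dots> = (\<Sum>i\<in>UNIV. pderiv_at i (M i) x)"
        unfolding M_def[abs_def] by (simp add: pderiv_at_convolution[OF sK K0 fi mm])
      finally show ?thesis by simp
    qed
    have M_L2: "L2_on \<Omega> (M i)" for i by (rule L2_continuous[OF smooth_on_continuous[OF sM]])
    have "(\<Sum>i\<in>UNIV. L2_inner \<Omega> (M i) (weak_pderiv \<Omega> i \<phi>)) = (\<Sum>i\<in>UNIV. - (LINT x|lebesgue_on \<Omega>. pderiv_at i (M i) x * \<phi> x))"
      using H1_weak_pderiv(1)[OF \<phi>] test unfolding is_weak_pderiv_def L2_inner_def by (intro sum.cong) auto
    also have "\<dots> = - (LINT x|lebesgue_on \<Omega>. (\<Sum>i\<in>UNIV. pderiv_at i (M i) x * \<phi> x))"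
      using is_weak_pderiv_times_integrable(1)[OF open_domain H1_weak_pderiv(1)[OF \<phi>] test]
      by (subst Bochner_Integration.integral_sum) (auto simp: sum_negf)
    also have "\<dots> = 0" by (simp add: sum_distrib_right[symmetric] div0)
    finally have sum0: "(\<Sum>i\<in>UNIV. L2_inner \<Omega> (M i) (weak_pderiv \<Omega> i \<phi>)) = 0" .
    define p where "p = (r * \<delta>) ^ CARD('n)"
    have p: "p > 0" using r \<delta> by (simp add: p_def)
    let ?A = "\<lambda>i x. LBINT z. \<eta> z * f i (x0 + (1 + \<delta>) *\<^sub>R (x - x0) + (r * \<delta>) *\<^sub>R z)"
    have A_eq: "?A i = (\<lambda>x. inverse p *\<^sub>R M i x)" for i using p by (simp add: fun_eq_iff M_eq[folded p_def])
    have "L2_on \<Omega> (?A i)" for i unfolding A_eq by (rule L2_on_scaleR[OF M_L2])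
    moreover have "(\<Sum>i\<in>UNIV. L2_inner \<Omega> (?A i) (weak_pderiv \<Omega> i \<phi>)) = 0"
      unfolding A_eq L2_inner_scaleR_left sum_distrib_left[symmetric] sum0 by simp
    ultimately show ?thesis by blast
  qed
  let ?g = "\<lambda>i. weak_pderiv \<Omega> i \<phi>"
  define B where "B = (\<Sum>i\<in>UNIV. L2_norm_on \<Omega> (?g i))"
  have B: "B \<ge> 0" by (simp add: B_def sum_nonneg)
  have split: "L2_inner \<Omega> F (weak_grad \<Omega> \<phi>) = (\<Sum>i\<in>UNIV. L2_inner \<Omega> (f i) (?g i))"
  proof -
    have "L2_inner \<Omega> F0 (weak_grad \<Omega> \<phi>) = (LINT x|lebesgue_on \<Omega>. (\<Sum>i\<in>UNIV. f i x \<bullet> ?g i x))"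
      by (simp add: L2_inner_def inner_vec_def weak_grad_def f_def)
    also have "\<dots> = (\<Sum>i\<in>UNIV. L2_inner \<Omega> (f i) (?g i))"
      unfolding L2_inner_def by (intro Bochner_Integration.integral_sum L2_inner_integrable fL H1_weak_pderiv \<phi>)
    finally show ?thesis by (simp add: F0i)
  qed
  have small: "\<bar>L2_inner \<Omega> F (weak_grad \<Omega> \<phi>)\<bar> \<le> e * B" if e: "e > 0" for e
  proof -
    have "\<forall>i. \<exists>d>0. \<forall>\<delta> \<epsilon>. 0 < \<delta> \<and> \<delta> < d \<and> 0 < \<epsilon> \<and> \<epsilon> < d \<and>
        L2_on \<Omega> (\<lambda>x. LBINT z. \<eta> z * f i (x0 + (1 + \<delta>) *\<^sub>R (x - x0) + \<epsilon> *\<^sub>R z)) \<longrightarrow>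
      \<bar>L2_inner \<Omega> (\<lambda>x. LBINT z. \<eta> z * f i (x0 + (1 + \<delta>) *\<^sub>R (x - x0) + \<epsilon> *\<^sub>R z)) (?g i) - I * L2_inner \<Omega> (f i) (?g i)\<bar>
        \<le> I * (e * L2_norm_on \<Omega> (?g i))"
      unfolding I_def using mollification_pairing[OF fm f0 fL H1_weak_pderiv(2)[OF \<phi>] \<eta>c \<eta>nn \<eta>0 e, of _ x0] by blast
    from choice[OF this] obtain d where dd: "\<forall>i. 0 < d i \<and> (\<forall>\<delta> \<epsilon>. 0 < \<delta> \<and> \<delta> < d i \<and> 0 < \<epsilon> \<and> \<epsilon> < d i \<and>
        L2_on \<Omega> (\<lambda>x. LBINT z. \<eta> z * f i (x0 + (1 + \<delta>) *\<^sub>R (x - x0) + \<epsilon> *\<^sub>R z)) \<longrightarrow>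
      \<bar>L2_inner \<Omega> (\<lambda>x. LBINT z. \<eta> z * f i (x0 + (1 + \<delta>) *\<^sub>R (x - x0) + \<epsilon> *\<^sub>R z)) (?g i) - I * L2_inner \<Omega> (f i) (?g i)\<bar>
        \<le> I * (e * L2_norm_on \<Omega> (?g i)))"
      by blast
    then have d: "\<And>i. d i > 0" by blast
    have pair: "\<And>i \<delta> \<epsilon>. 0 < \<delta> \<and> \<delta> < d i \<and> 0 < \<epsilon> \<and> \<epsilon> < d i \<and>
        L2_on \<Omega> (\<lambda>x. LBINT z. \<eta> z * f i (x0 + (1 + \<delta>) *\<^sub>R (x - x0) + \<epsilon> *\<^sub>R z)) \<Longrightarrow>
      \<bar>L2_inner \<Omega> (\<lambda>x. LBINT z. \<eta> z * f i (x0 + (1 + \<delta>) *\<^sub>R (x - x0) + \<epsilon> *\<^sub>R z)) (?g i) - I * L2_inner \<Omega> (f i) (?g i)\<bar>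
        \<le> I * (e * L2_norm_on \<Omega> (?g i))"
      using dd by blast
    define D where "D = Min (range d)"
    have D: "D > 0" "\<And>i. D \<le> d i" using d by (auto simp: D_def)
    define \<delta> where "\<delta> = min D (D / r) / 2"
    have \<delta>: "\<delta> > 0" "\<delta> < D" "r * \<delta> < D" "r * \<delta> > 0"
    proof -
      show "\<delta> > 0" "\<delta> < D" using D r by (auto simp: \<delta>_def min_def)
      have "r * \<delta> \<le> r * (D / r / 2)" using r by (intro mult_left_mono) (auto simp: \<delta>_def)
      also have "\<dots> < D" using D r by simp
      finally show "r * \<delta> < D" .
      show "r * \<delta> > 0" using r \<open>\<delta> > 0\<close> by simp
    qed
    let ?A = "\<lambda>i x. LBINT z. \<eta> z * f i (x0 + (1 + \<delta>) *\<^sub>R (x - x0) + (r * \<delta>) *\<^sub>R z)"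
    have b: "\<bar>L2_inner \<Omega> (?A i) (?g i) - I * L2_inner \<Omega> (f i) (?g i)\<bar> \<le> I * (e * L2_norm_on \<Omega> (?g i))" for i
      using key[OF \<delta>(1)] \<delta> D(2)[of i] by (intro pair) auto
    have "I * \<bar>L2_inner \<Omega> F (weak_grad \<Omega> \<phi>)\<bar> = \<bar>\<Sum>i\<in>UNIV. L2_inner \<Omega> (?A i) (?g i) - I * L2_inner \<Omega> (f i) (?g i)\<bar>"
      using key[OF \<delta>(1)] I by (simp add: split sum_subtractf sum_distrib_left[symmetric] abs_mult)
    also have "\<dots> \<le> (\<Sum>i\<in>UNIV. \<bar>L2_inner \<Omega> (?A i) (?g i) - I * L2_inner \<Omega> (f i) (?g i)\<bar>)" by (rule sum_abs)
    also have "\<dots> \<le> (\<Sum>i\<in>UNIV. I * (e * L2_norm_on \<Omega> (?g i)))" by (intro sum_mono b)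
    also have "\<dots> = I * (e * B)" by (simp add: B_def sum_distrib_left)
    finally show ?thesis using I by simp
  qed
  have "\<bar>L2_inner \<Omega> F (weak_grad \<Omega> \<phi>)\<bar> \<le> 0"
  proof (rule field_le_epsilon)
    fix e :: real assume e: "e > 0"
    have "\<bar>L2_inner \<Omega> F (weak_grad \<Omega> \<phi>)\<bar> \<le> e / (B + 1) * B" using e B by (intro small) auto
    also have "\<dots> \<le> 0 + e" using e B by (simp add: field_simps)
    finally show "\<bar>L2_inner \<Omega> F (weak_grad \<Omega> \<phi>)\<bar> \<le> 0 + e" .
  qed
  then show ?thesis by simp
qed

end

section \<open>A Poincare inequality for divergence-free fields\<close>

context bounded_domain
begin

text \<open>The homotopy formula along the segments \<open>x0 + r\<^sup>2 (x - x0)\<close> writes a field as a gradient plus a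
  remainder that is linear in its rotation. Parametrising by \<open>r\<^sup>2\<close> instead of \<open>r\<close> compensates for the
  factor \<open>r\<^sup>-\<^sup>2\<^sup>n\<close> that the change of variables produces when the remainder is integrated over the
  domain, as long as the dimension is at most three.\<close>

lemma gradient_plus_rotation_remainder:
  fixes W :: "real^'n \<Rightarrow> real^'n"
  assumes conv: "convex \<Omega>" and x0: "x0 \<in> \<Omega>" and d: "\<And>x. x \<in> \<Omega> \<Longrightarrow> norm (x - x0) \<le> d"
    and dim: "CARD('n) \<le> 3" and W: "smooth_on UNIV W"
  shows "\<exists>q. Hk_on 1 \<Omega> q \<and> L2_norm_on \<Omega> (\<lambda>x. W x - weak_grad \<Omega> q x) \<le> 2 * d * L2_norm_on \<Omega> (weak_rot \<Omega> W)"
proof -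
  have d0: "d \<ge> 0" using d[OF x0] by simp
  define p where "p r x = x0 + r\<^sup>2 *\<^sub>R (x - x0)" for r x
  define G where "G j = gradient (\<lambda>x. W x $ j)" for j
  define A where "A x = (\<chi> i j. pderiv_at i W x $ j - pderiv_at j W x $ i)" for x
  \<comment> \<open>the gradient in \<open>x\<close> of the integrand of the potential \<open>q\<close>\<close>
  define V where "V x r = (2 * r) *\<^sub>R (W (p r x) + r\<^sup>2 *\<^sub>R (\<Sum>j\<in>UNIV. (x - x0) $ j *\<^sub>R G j (p r x)))" for x r
  define q where "q x = integral (cbox 0 1) (\<lambda>r. 2 * r * (W (p r x) \<bullet> (x - x0)))" for x
  have sWj: "smooth_on UNIV (\<lambda>x. W x $ j)" for j by (rule smooth_on_vec_nth[OF open_UNIV W])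
  have Wd: "(W has_derivative frechet_derivative W (at x)) (at x)" for x by (rule pderiv_at_smooth(1)[OF W])
  have W_nth: "frechet_derivative W (at x) v $ j = G j x \<bullet> v" for x v j
    using has_derivative_eq_gradient[OF bounded_linear.has_derivative[OF bounded_linear_vec_nth[of j] Wd]]
    by (simp add: G_def)
  have cont: "continuous_on UNIV W" "continuous_on UNIV (G j)" for j
    using smooth_on_continuous[OF W] smooth_on_continuous[OF smooth_on_gradient[OF open_UNIV sWj]] by (auto simp: G_def)
  have cA: "continuous_on UNIV A"
    unfolding A_def[abs_def] using pderiv_at_smooth(2)[OF W] by (intro continuous_intros) auto
  have cp: "continuous_on S (\<lambda>(x, r). p r x)" for S unfolding p_def case_prod_beta' by (intro continuous_intros)
  have cV: "continuous_on S (\<lambda>(x, r). V x r)" for S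
    unfolding V_def case_prod_beta'
    by (intro continuous_intros continuous_on_compose2[OF cont(1)] continuous_on_compose2[OF cont(2)]
        cp[unfolded case_prod_beta']) auto
  have cVr: "continuous_on S (V x)" for x S
  proof -
    have "continuous_on S (\<lambda>r. (x, r))" by (intro continuous_on_Pair continuous_on_const continuous_on_id)
    from continuous_on_compose2[OF cV[of UNIV] this] show ?thesis by simp
  qed
  have Vi: "V x integrable_on cbox 0 1" for x by (intro integrable_continuous cVr)
  have integrand: "((\<lambda>x. 2 * r * (W (p r x) \<bullet> (x - x0))) has_derivative (\<lambda>h. V x r \<bullet> h)) (at x)" for x r
  proof -
    have pd: "((\<lambda>x. p r x) has_derivative (\<lambda>h. r\<^sup>2 *\<^sub>R h)) (at x)"
      unfolding p_def by (auto intro!: derivative_eq_intros)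
    have "((\<lambda>x. W (p r x)) has_derivative (\<lambda>h. frechet_derivative W (at (p r x)) (r\<^sup>2 *\<^sub>R h))) (at x)"
      by (rule has_derivative_compose[OF pd Wd])
    then have "((\<lambda>x. 2 * r * (W (p r x) \<bullet> (x - x0))) has_derivative
        (\<lambda>h. 2 * r * (W (p r x) \<bullet> h + frechet_derivative W (at (p r x)) (r\<^sup>2 *\<^sub>R h) \<bullet> (x - x0)))) (at x)"
      by (auto intro!: derivative_eq_intros)
    moreover have "2 * r * (W (p r x) \<bullet> h + frechet_derivative W (at (p r x)) (r\<^sup>2 *\<^sub>R h) \<bullet> (x - x0)) = V x r \<bullet> h" for h
    proof -
      have "2 * r * (W (p r x) \<bullet> h + (\<Sum>j\<in>UNIV. (G j (p r x) \<bullet> (r\<^sup>2 *\<^sub>R h)) * y $ j))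
          = ((2 * r) *\<^sub>R (W (p r x) + r\<^sup>2 *\<^sub>R (\<Sum>j\<in>UNIV. y $ j *\<^sub>R G j (p r x)))) \<bullet> h" for y :: "real^'n"
        by (simp add: inner_add_left inner_sum_left sum_distrib_left distrib_left mult_ac)
      from this[of "x - x0"] show ?thesis
        by (simp only: V_def inner_vec_def[of "frechet_derivative W _ _" "x - x0"] W_nth inner_real_def)
    qed
    ultimately show ?thesis by simp
  qed
  have qd: "(q has_derivative (\<lambda>h. integral (cbox 0 1) (V x) \<bullet> h)) (at x)" for x
  proof -
    have "((\<lambda>x. integral (cbox 0 1) (\<lambda>r. 2 * r * (W (p r x) \<bullet> (x - x0)))) has_derivative
        integral (cbox 0 1) (\<lambda>r. blinfun_inner_right (V x r))) (at x within UNIV)"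
    proof (rule leibniz_rule)
      show "((\<lambda>x. 2 * r * (W (p r x) \<bullet> (x - x0))) has_derivative blinfun_apply (blinfun_inner_right (V x r))) (at x within UNIV)" for x r
        using integrand[of r x] by simp
      show "(\<lambda>r. 2 * r * (W (p r x) \<bullet> (x - x0))) integrable_on cbox 0 1" for x
        unfolding p_def by (intro integrable_continuous continuous_intros continuous_on_compose2[OF cont(1)]) auto
      show "continuous_on (UNIV \<times> cbox 0 1) (\<lambda>(x, r). blinfun_inner_right (V x r))"
        using bounded_linear.continuous_on[OF bounded_linear_blinfun_inner_right cV] by (simp add: case_prod_beta')
    qed auto
    moreover have "integral (cbox 0 1) (\<lambda>r. blinfun_inner_right (V x r)) = blinfun_inner_right (integral (cbox 0 1) (V x))"
      using integral_linear[OF Vi bounded_linear_blinfun_inner_right] by (simp add: o_def)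
    ultimately show ?thesis by (simp add: q_def[abs_def])
  qed
  have cq: "continuous_on UNIV (\<lambda>x. integral (cbox 0 1) (V x))"
    using integral_continuous_on_param[OF cV[of "UNIV \<times> cbox 0 1"]] .
  have H1q: "Hk_on 1 \<Omega> q" and gq: "AE x in lebesgue_on \<Omega>. weak_pderiv \<Omega> i q x = integral (cbox 0 1) (V x) \<bullet> axis i 1" for i
    using H1_C1(1)[OF qd] H1_C1(2)[OF qd, of i] continuous_on_inner[OF cq continuous_on_const] by blast+
  have wg: "AE x in lebesgue_on \<Omega>. weak_grad \<Omega> q x = integral (cbox 0 1) (V x)"
  proof -
    have "AE x in lebesgue_on \<Omega>. \<forall>i\<in>UNIV. weak_pderiv \<Omega> i q x = integral (cbox 0 1) (V x) \<bullet> axis i 1"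
      using gq by (intro AE_finite_allI) auto
    then show ?thesis by eventually_elim (simp add: weak_grad_def vec_eq_iff inner_axis)
  qed
  \<comment> \<open>what \<open>V x r\<close> misses of the derivative of \<open>r\<^sup>2 W (p r x)\<close> in \<open>r\<close>, an exact derivative with integral \<open>W x\<close>\<close>
  define R where "R x r = - (2 * r ^ 3) *\<^sub>R (\<chi> i. A (p r x) $ i \<bullet> (x - x0))" for x r
  have rem: "(R x has_integral (W x - integral (cbox 0 1) (V x))) (cbox 0 1)" for x
  proof -
    define D where "D r = (2 * r) *\<^sub>R W (p r x) + r\<^sup>2 *\<^sub>R frechet_derivative W (at (p r x)) ((2 * r) *\<^sub>R (x - x0))" for r
    have "((\<lambda>r. r\<^sup>2 *\<^sub>R W (p r x)) has_vector_derivative D r) (at r within {0..1})" for r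
    proof -
      have "((\<lambda>r. p r x) has_derivative (\<lambda>h. h *\<^sub>R ((2 * r) *\<^sub>R (x - x0)))) (at r within {0..1})"
        unfolding p_def by (auto intro!: derivative_eq_intros simp: algebra_simps)
      from has_derivative_compose[OF this Wd]
      have "((\<lambda>r. W (p r x)) has_derivative (\<lambda>h. h *\<^sub>R frechet_derivative W (at (p r x)) ((2 * r) *\<^sub>R (x - x0)))) (at r within {0..1})"
        by (simp add: linear_scale[OF has_derivative_linear[OF Wd]])
      moreover have "((\<lambda>r. r\<^sup>2) has_derivative (\<lambda>h. h * (2 * r))) (at r within {0..1})"
        by (auto intro!: derivative_eq_intros)
      ultimately have "((\<lambda>r. r\<^sup>2 *\<^sub>R W (p r x)) has_derivative
          (\<lambda>h. r\<^sup>2 *\<^sub>R (h *\<^sub>R frechet_derivative W (at (p r x)) ((2 * r) *\<^sub>R (x - x0))) + (h * (2 * r)) *\<^sub>R W (p r x))) (at r within {0..1})"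
        by (rule has_derivative_scaleR[rotated])
      then show ?thesis unfolding has_vector_derivative_def D_def by (simp add: algebra_simps)
    qed
    then have "(D has_integral (1\<^sup>2 *\<^sub>R W (p 1 x) - 0\<^sup>2 *\<^sub>R W (p 0 x))) {0..1}"
      by (intro fundamental_theorem_of_calculus) auto
    then have D: "(D has_integral W x) (cbox 0 1)" by (simp add: p_def)
    have "((\<lambda>r. D r - V x r) has_integral (W x - integral (cbox 0 1) (V x))) (cbox 0 1)"
      by (rule has_integral_diff[OF D integrable_integral[OF Vi]])
    moreover have "D r - V x r = R x r" for r
    proof (rule vec_eq_iff[THEN iffD2], rule allI)
      fix i
      have lin: "frechet_derivative W (at (p r x)) ((2 * r) *\<^sub>R (x - x0)) = (2 * r) *\<^sub>R frechet_derivative W (at (p r x)) (x - x0)"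
        by (rule linear_scale[OF has_derivative_linear[OF Wd]])
      have nth: "pderiv_at i W y $ j = G j y $ i" for i j y
        unfolding pderiv_at_def W_nth by (simp add: inner_axis)
      have A_eq: "A z $ i \<bullet> y = (\<Sum>j\<in>UNIV. y $ j * G j z $ i) - G i z \<bullet> y" for z y
        by (simp add: A_def nth inner_vec_def left_diff_distrib right_diff_distrib sum_subtractf mult.commute)
      have comps: "D r $ i = 2 * r * W (p r x) $ i + r\<^sup>2 * (2 * r * (G i (p r x) \<bullet> (x - x0)))"
        "V x r $ i = 2 * r * (W (p r x) $ i + r\<^sup>2 * (\<Sum>j\<in>UNIV. (x - x0) $ j * G j (p r x) $ i))"
        "R x r $ i = - (2 * r ^ 3) * (A (p r x) $ i \<bullet> (x - x0))"
        by (simp_all only: D_def V_def R_def lin vector_add_component vector_scaleR_component W_nth real_scaleR_def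
            sum_component vec_lambda_beta)
      have alg: "2 * r * w + r\<^sup>2 * (2 * r * g) - 2 * r * (w + r\<^sup>2 * s) = - (2 * r ^ 3) * (s - g)" for w g s :: real
        by (simp add: algebra_simps power2_eq_square power3_eq_cube)
      show "(D r - V x r) $ i = R x r $ i"
        unfolding vector_minus_component comps A_eq by (rule alg)
    qed
    ultimately show ?thesis by simp
  qed
  have matrix_bound: "norm (\<chi> i. B $ i \<bullet> y) \<le> norm B * norm y" for B :: "real^'n^'n" and y
  proof (rule power2_le_imp_le)
    have "(norm (\<chi> i. B $ i \<bullet> y))\<^sup>2 = (\<Sum>i\<in>UNIV. (B $ i \<bullet> y)\<^sup>2)"
      unfolding power2_norm_eq_inner inner_vec_def[of "\<chi> i. _ i"] by (simp add: power2_eq_square)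
    also have "\<dots> \<le> (\<Sum>i\<in>UNIV. (B $ i \<bullet> B $ i) * (y \<bullet> y))"
      by (intro sum_mono Cauchy_Schwarz_ineq)
    also have "\<dots> = (norm B * norm y)\<^sup>2"
      by (simp add: power_mult_distrib power2_norm_eq_inner inner_vec_def[of B B] sum_distrib_right)
    finally show "(norm (\<chi> i. B $ i \<bullet> y))\<^sup>2 \<le> (norm B * norm y)\<^sup>2" .
  qed simp
  define a where "a x r = r ^ 3 * norm (A (p r x))" for x r
  have ca: "continuous_on S (a x)" for S x
    unfolding a_def[abs_def] p_def by (intro continuous_intros continuous_on_compose2[OF cA]) auto
  have ca2: "continuous_on UNIV (\<lambda>p. a (fst p) (snd p))"
    unfolding a_def p_def by (intro continuous_intros continuous_on_compose2[OF cA]) auto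
  have pointwise: "(norm (W x - integral (cbox 0 1) (V x)))\<^sup>2 \<le> 4 * d\<^sup>2 * integral {0..1} (\<lambda>r. (a x r)\<^sup>2)" if x: "x \<in> \<Omega>" for x
  proof -
    define m where "m = integral {0..1} (a x)"
    have ai: "a x integrable_on {0..1}" "(\<lambda>r. (a x r)\<^sup>2) integrable_on {0..1}"
      by (intro integrable_continuous_interval continuous_intros ca)+
    have "norm (W x - integral (cbox 0 1) (V x)) \<le> integral (cbox 0 1) (\<lambda>r. 2 * d * a x r)"
    proof (subst integral_unique[OF rem, symmetric], rule integral_norm_bound_integral)
      show "R x integrable_on cbox 0 1" using rem by (rule has_integral_integrable)
      show "(\<lambda>r. 2 * d * a x r) integrable_on cbox 0 1" using integrable_cmul[OF ai(1), of "2 * d"] by simp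
      fix r :: real assume r: "r \<in> cbox 0 1"
      have "norm (R x r) = 2 * r ^ 3 * norm (\<chi> i. A (p r x) $ i \<bullet> (x - x0))"
        using r by (simp add: R_def abs_mult power_abs)
      also have "\<dots> \<le> 2 * r ^ 3 * (norm (A (p r x)) * d)"
        using r by (intro mult_left_mono order_trans[OF matrix_bound] d x) auto
      finally show "norm (R x r) \<le> 2 * d * a x r" by (simp add: a_def mult_ac)
    qed
    also have "\<dots> = 2 * d * m" by (simp add: m_def)
    finally have le: "norm (W x - integral (cbox 0 1) (V x)) \<le> 2 * d * m" .
    have "0 \<le> integral {0..1} (\<lambda>r. (a x r - m)\<^sup>2)"
      by (intro integral_nonneg integrable_continuous_interval continuous_intros ca) auto
    also have "\<dots> = integral {0..1} (\<lambda>r. (a x r)\<^sup>2 - (2 * m) * a x r + m\<^sup>2)"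
      by (simp add: power2_diff mult_ac algebra_simps)
    also have "\<dots> = integral {0..1} (\<lambda>r. (a x r)\<^sup>2) - (2 * m) * m + m\<^sup>2"
    proof -
      have "((\<lambda>r. (a x r)\<^sup>2 - (2 * m) * a x r + m\<^sup>2) has_integral
          (integral {0..1} (\<lambda>r. (a x r)\<^sup>2) - (2 * m) * integral {0..1} (a x) + (1 - 0) *\<^sub>R m\<^sup>2)) {0..1}"
        by (intro has_integral_add has_integral_diff has_integral_mult_right integrable_integral ai
            has_integral_const_real[of _ 0 1, simplified] | simp)+
      then show ?thesis by (simp add: m_def integral_unique)
    qed
    finally have "m\<^sup>2 \<le> integral {0..1} (\<lambda>r. (a x r)\<^sup>2)" by (simp add: power2_eq_square)
    then have "(2 * d)\<^sup>2 * m\<^sup>2 \<le> (2 * d)\<^sup>2 * integral {0..1} (\<lambda>r. (a x r)\<^sup>2)" by (intro mult_left_mono) auto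
    moreover have "(norm (W x - integral (cbox 0 1) (V x)))\<^sup>2 \<le> (2 * d * m)\<^sup>2" by (rule power_mono[OF le]) simp
    ultimately show ?thesis by (simp add: power_mult_distrib)
  qed
  define S where "S = (LINT x|lebesgue_on \<Omega>. (norm (A x))\<^sup>2)"
  have Ai: "integrable (lebesgue_on \<Omega>) (\<lambda>x. (norm (A x))\<^sup>2)"
    by (intro integrable_continuous_lebesgue_on bounded_domain domain_sets continuous_intros cA)
  have \<Omega>B: "\<Omega> \<in> sets borel" using open_domain by simp
  define J where "J = (\<lambda>(x, r). ennreal (indicator \<Omega> x * indicator {0..1} r * (a x r)\<^sup>2))"
  have Jm: "J \<in> borel_measurable (lborel \<Otimes>\<^sub>M lborel)"
  proof -
    have "(\<lambda>p. a (fst p) (snd p)) \<in> borel_measurable (lborel \<Otimes>\<^sub>M lborel)"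
      using borel_measurable_continuous_onI[OF ca2] by (simp add: lborel_prod)
    moreover have "(\<lambda>p. indicator \<Omega> (fst p) :: real) \<in> borel_measurable (lborel \<Otimes>\<^sub>M lborel)"
      "(\<lambda>p. indicator {0..1::real} (snd p) :: real) \<in> borel_measurable (lborel \<Otimes>\<^sub>M lborel)"
      using \<Omega>B by (auto intro!: measurable_compose[OF measurable_fst] measurable_compose[OF measurable_snd] borel_measurable_indicator)
    ultimately show ?thesis unfolding J_def case_prod_beta' by measurable
  qed
  \<comment> \<open>here \<open>r\<^sup>6 \<le> r\<^sup>2\<^sup>n\<close> is used, where \<open>r\<^sup>2\<^sup>n\<close> is the Jacobian of \<open>p r\<close>\<close>
  have inner_r: "(\<integral>\<^sup>+ x. J (x, r) \<partial>lborel) \<le> ennreal S * indicator {0..1} r" for r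
  proof (cases "r \<in> {0<..1}")
    case True
    define h where "h y = ennreal (indicator \<Omega> y * (norm (A y))\<^sup>2)" for y
    have hm: "h \<in> borel_measurable borel"
      unfolding h_def[abs_def] using \<Omega>B borel_measurable_continuous_onI[OF cA] by measurable
    have pr: "p r x = (x0 - r\<^sup>2 *\<^sub>R x0) + r\<^sup>2 *\<^sub>R x" for x by (simp add: p_def algebra_simps)
    have p\<Omega>: "p r x \<in> \<Omega>" if "x \<in> \<Omega>" for x
    proof -
      have "r\<^sup>2 \<le> 1" using True by (simp add: power_le_one)
      then have "(1 - r\<^sup>2) *\<^sub>R x0 + r\<^sup>2 *\<^sub>R x \<in> \<Omega>"
        using conv x0 that by (intro convexD) auto
      then show ?thesis by (simp add: p_def algebra_simps)
    qed
    have hS: "(\<integral>\<^sup>+ y. h y \<partial>lborel) = ennreal S"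
    proof -
      have "(\<integral>\<^sup>+ y. h y \<partial>lborel) = (\<integral>\<^sup>+ y. h y \<partial>lebesgue)"
        by (rule nn_integral_completion[symmetric])
      also have "\<dots> = ennreal (LINT y|lebesgue. indicator \<Omega> y * (norm (A y))\<^sup>2)"
        unfolding h_def using Ai by (intro nn_integral_eq_integral) (auto simp: integrable_lebesgue_on_iff[OF domain_sets])
      finally show ?thesis by (simp add: S_def integral_lebesgue_on_eq[OF domain_sets])
    qed
    have "(\<integral>\<^sup>+ x. J (x, r) \<partial>lborel) \<le> (\<integral>\<^sup>+ x. ennreal ((r\<^sup>2) ^ CARD('n)) * h (p r x) \<partial>lborel)"
    proof (rule nn_integral_mono)
      fix x
      show "J (x, r) \<le> ennreal ((r\<^sup>2) ^ CARD('n)) * h (p r x)"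
      proof (cases "x \<in> \<Omega>")
        case x: True
        have "(r ^ 3)\<^sup>2 = r ^ 6" "(r\<^sup>2) ^ CARD('n) = r ^ (2 * CARD('n))" by (simp_all add: power_mult[symmetric])
        moreover have "r ^ 6 \<le> r ^ (2 * CARD('n))" using True dim by (intro power_decreasing) auto
        ultimately have "(a x r)\<^sup>2 \<le> (r\<^sup>2) ^ CARD('n) * (norm (A (p r x)))\<^sup>2"
          unfolding a_def power_mult_distrib by (simp add: mult_right_mono)
        then have "ennreal ((a x r)\<^sup>2) \<le> ennreal ((r\<^sup>2) ^ CARD('n)) * ennreal ((norm (A (p r x)))\<^sup>2)"
          by (simp add: ennreal_mult'[symmetric] ennreal_leI)
        then show ?thesis using True x p\<Omega>[OF x] by (simp add: J_def h_def)
      qed (simp add: J_def)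
    qed
    also have "\<dots> = ennreal ((r\<^sup>2) ^ CARD('n)) * (\<integral>\<^sup>+ x. h (p r x) \<partial>lborel)"
      unfolding pr using hm by (intro nn_integral_cmult) (auto intro!: measurable_compose[OF _ hm])
    also have "\<dots> = (\<integral>\<^sup>+ y. h y \<partial>lborel)"
      unfolding pr using nn_integral_affine[OF hm, of "r\<^sup>2" "x0 - r\<^sup>2 *\<^sub>R x0"] True by simp
    finally show ?thesis using hS True by simp
  next
    case False
    then have "J (x, r) = 0" for x by (auto simp: J_def a_def indicator_def)
    then show ?thesis by simp
  qed
  have S0: "S \<ge> 0" by (simp add: S_def)
  have total: "(\<integral>\<^sup>+ x. \<integral>\<^sup>+ r. J (x, r) \<partial>lborel \<partial>lborel) \<le> ennreal S"
  proof -
    have "(\<integral>\<^sup>+ x. \<integral>\<^sup>+ r. J (x, r) \<partial>lborel \<partial>lborel) = (\<integral>\<^sup>+ r. \<integral>\<^sup>+ x. J (x, r) \<partial>lborel \<partial>lborel)"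
      by (rule lborel_pair.Fubini'[symmetric]) (use Jm in simp)
    also have "\<dots> \<le> (\<integral>\<^sup>+ r. ennreal S * indicator {0..1::real} r \<partial>lborel)" by (intro nn_integral_mono inner_r)
    also have "\<dots> = ennreal S" by (simp add: nn_integral_cmult_indicator)
    finally show ?thesis .
  qed
  have WL: "L2_on \<Omega> (\<lambda>x. W x - integral (cbox 0 1) (V x))"
    by (intro L2_continuous continuous_intros cont cq)
  have "ennreal (LINT x|lebesgue_on \<Omega>. (norm (W x - integral (cbox 0 1) (V x)))\<^sup>2)
      = (\<integral>\<^sup>+ x. ennreal ((norm (W x - integral (cbox 0 1) (V x)))\<^sup>2) \<partial>lebesgue_on \<Omega>)"
    using WL by (intro nn_integral_eq_integral[symmetric]) (auto simp: L2_on_def)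
  also have "\<dots> = (\<integral>\<^sup>+ x. ennreal ((norm (W x - integral (cbox 0 1) (V x)))\<^sup>2) * indicator \<Omega> x \<partial>lebesgue)"
    by (rule nn_integral_restrict_space) (simp add: domain_sets)
  also have "\<dots> \<le> (\<integral>\<^sup>+ x. ennreal (4 * d\<^sup>2) * (\<integral>\<^sup>+ r. J (x, r) \<partial>lborel) \<partial>lebesgue)"
  proof (rule nn_integral_mono)
    fix x
    show "ennreal ((norm (W x - integral (cbox 0 1) (V x)))\<^sup>2) * indicator \<Omega> x \<le> ennreal (4 * d\<^sup>2) * (\<integral>\<^sup>+ r. J (x, r) \<partial>lborel)"
    proof (cases "x \<in> \<Omega>")
      case True
      have c2: "continuous_on {0..1} (\<lambda>r. (a x r)\<^sup>2)" by (intro continuous_intros ca)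
      have hi: "((\<lambda>r. (a x r)\<^sup>2) has_integral integral {0..1} (\<lambda>r. (a x r)\<^sup>2)) {0..1}"
        by (intro integrable_integral integrable_continuous_interval c2)
      have "(\<integral>\<^sup>+ r. J (x, r) \<partial>lborel) = (\<integral>\<^sup>+ r. ennreal ((a x r)\<^sup>2) * indicator {0..1} r \<partial>lborel)"
        using True by (intro nn_integral_cong) (auto simp: J_def indicator_def)
      also have "\<dots> = ennreal (integral {0..1} (\<lambda>r. (a x r)\<^sup>2))"
      proof (rule nn_integral_has_integral_lebesgue'[OF _ hi])
      qed simp
      finally show ?thesis
        using True pointwise[OF True] d0 by (simp add: ennreal_mult'[symmetric] ennreal_leI)
    qed simp
  qed
  also have "\<dots> = (\<integral>\<^sup>+ x. ennreal (4 * d\<^sup>2) * (\<integral>\<^sup>+ r. J (x, r) \<partial>lborel) \<partial>lborel)"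
    by (rule nn_integral_completion)
  also have "\<dots> = ennreal (4 * d\<^sup>2) * (\<integral>\<^sup>+ x. \<integral>\<^sup>+ r. J (x, r) \<partial>lborel \<partial>lborel)"
    using lborel.borel_measurable_nn_integral_fst[OF Jm] by (intro nn_integral_cmult) simp
  also have "\<dots> \<le> ennreal (4 * d\<^sup>2) * ennreal S" by (intro mult_left_mono total) simp
  also have "\<dots> = ennreal (4 * d\<^sup>2 * S)" by (simp add: ennreal_mult')
  finally have "(LINT x|lebesgue_on \<Omega>. (norm (W x - integral (cbox 0 1) (V x)))\<^sup>2) \<le> 4 * d\<^sup>2 * S"
    using S0 by (simp add: ennreal_le_iff)
  then have "(L2_norm_on \<Omega> (\<lambda>x. W x - integral (cbox 0 1) (V x)))\<^sup>2 \<le> (2 * d * L2_norm_on \<Omega> A)\<^sup>2"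
    by (simp add: L2_norm_on_def power_mult_distrib S_def)
  then have "L2_norm_on \<Omega> (\<lambda>x. W x - integral (cbox 0 1) (V x)) \<le> 2 * d * L2_norm_on \<Omega> A"
    by (rule power2_le_imp_le) (use d0 in simp)
  moreover have "L2_norm_on \<Omega> (\<lambda>x. W x - weak_grad \<Omega> q x) = L2_norm_on \<Omega> (\<lambda>x. W x - integral (cbox 0 1) (V x))"
    by (rule norm_cong_AE) (use wg in eventually_elim, simp)
  moreover have "L2_norm_on \<Omega> (weak_rot \<Omega> W) = L2_norm_on \<Omega> A"
    by (rule norm_cong_AE) (use weak_rot_smooth[OF W] in \<open>simp add: A_def\<close>)
  ultimately show ?thesis using H1q by auto
qed

text \<open>Convergence of the fields and of their rotations is all that the passages to the limit below require, and it is
  inherited by differences of fields at different times.\<close>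

definition smooth_approximation :: "(real^'n \<Rightarrow> real^'n) \<Rightarrow> (nat \<Rightarrow> real^'n \<Rightarrow> real^'n) \<Rightarrow> bool" where
  "smooth_approximation u W \<longleftrightarrow> (\<forall>k. smooth_on UNIV (W k)) \<and>
    (\<lambda>k. L2_norm_on \<Omega> (\<lambda>x. W k x - u x)) \<longlonglongrightarrow> 0 \<and>
    (\<lambda>k. L2_norm_on \<Omega> (\<lambda>x. weak_rot \<Omega> (W k) x - weak_rot \<Omega> u x)) \<longlonglongrightarrow> 0"

lemma tangential_trace_smooth_approximation:
  assumes u: "Hk_on 1 \<Omega> u" and t: "tangential_trace \<Omega> u"
  shows "\<exists>W. smooth_approximation u W"
proof -
  obtain W where W: "\<And>k. smooth_on UNIV (W k)" and lim: "(\<lambda>k. Hk_norm 1 \<Omega> (\<lambda>x. W k x - u x)) \<longlonglongrightarrow> 0"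
    using t unfolding tangential_trace_def is_trace_def by blast
  note H1W = H1_smooth(1)[OF W]
  note H1d = H1_diff(1)[OF H1W u]
  have "(\<lambda>k. L2_norm_on \<Omega> (\<lambda>x. W k x - u x)) \<longlonglongrightarrow> 0"
    by (rule Lim_null_comparison[OF _ lim]) (use Hk_norm_1_bounds(1)[OF H1d] in simp)
  moreover have "L2_norm_on \<Omega> (\<lambda>x. weak_rot \<Omega> (W k) x - weak_rot \<Omega> u x) \<le> 2 * Hk_norm 1 \<Omega> (\<lambda>x. W k x - u x)" for k
  proof -
    have "L2_norm_on \<Omega> (\<lambda>x. weak_rot \<Omega> (W k) x - weak_rot \<Omega> u x) = L2_norm_on \<Omega> (weak_rot \<Omega> (\<lambda>x. W k x - u x))"
      by (rule norm_cong_AE) (use weak_rot_diff[OF H1W u] in \<open>simp add: eq_commute\<close>)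
    then show ?thesis using norm_weak_rot_le[OF H1d[of k]] by simp
  qed
  then have "(\<lambda>k. L2_norm_on \<Omega> (\<lambda>x. weak_rot \<Omega> (W k) x - weak_rot \<Omega> u x)) \<longlonglongrightarrow> 0"
    by (intro Lim_null_comparison[OF _ tendsto_mult_right_zero[OF lim, of 2]]) simp
  ultimately show ?thesis using W unfolding smooth_approximation_def by blast
qed

lemma smooth_approximation_diff:
  assumes u: "Hk_on 1 \<Omega> u" "smooth_approximation u W" and v: "Hk_on 1 \<Omega> v" "smooth_approximation v Z"
  shows "smooth_approximation (\<lambda>x. u x - v x) (\<lambda>k x. W k x - Z k x)"
proof -
  have W: "\<And>k. smooth_on UNIV (W k)" "(\<lambda>k. L2_norm_on \<Omega> (\<lambda>x. W k x - u x)) \<longlonglongrightarrow> 0"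
      "(\<lambda>k. L2_norm_on \<Omega> (\<lambda>x. weak_rot \<Omega> (W k) x - weak_rot \<Omega> u x)) \<longlonglongrightarrow> 0"
    and Z: "\<And>k. smooth_on UNIV (Z k)" "(\<lambda>k. L2_norm_on \<Omega> (\<lambda>x. Z k x - v x)) \<longlonglongrightarrow> 0"
      "(\<lambda>k. L2_norm_on \<Omega> (\<lambda>x. weak_rot \<Omega> (Z k) x - weak_rot \<Omega> v x)) \<longlonglongrightarrow> 0"
    using u(2) v(2) unfolding smooth_approximation_def by auto
  have L: "L2_on \<Omega> (W k)" "L2_on \<Omega> (Z k)" "L2_on \<Omega> u" "L2_on \<Omega> v"
    "L2_on \<Omega> (weak_rot \<Omega> (W k))" "L2_on \<Omega> (weak_rot \<Omega> (Z k))" "L2_on \<Omega> (weak_rot \<Omega> u)" "L2_on \<Omega> (weak_rot \<Omega> v)" for k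
    using H1_L2 L2_weak_rot H1_smooth(1)[OF W(1)] H1_smooth(1)[OF Z(1)] u(1) v(1) by blast+
  have tri: "L2_norm_on \<Omega> (\<lambda>x. (a x - b x) - (c x - d x)) \<le> L2_norm_on \<Omega> (\<lambda>x. a x - c x) + L2_norm_on \<Omega> (\<lambda>x. b x - d x)"
    if "L2_on \<Omega> a" "L2_on \<Omega> b" "L2_on \<Omega> c" "L2_on \<Omega> d" for a b c d :: "real^'n \<Rightarrow> 'b::euclidean_space"
    using L2_norm_triangle[OF L2_on_diff[OF that(1,3)] L2_on_diff[OF that(4,2)]] L2_norm_diff_commute[of \<Omega> b d]
    by (simp add: algebra_simps)
  have "(\<lambda>k. L2_norm_on \<Omega> (\<lambda>x. (W k x - Z k x) - (u x - v x))) \<longlonglongrightarrow> 0"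
    by (rule Lim_null_comparison[OF _ tendsto_add_zero[OF W(2) Z(2)]]) (use tri[OF L(1,2,3,4)] in simp)
  moreover have "(\<lambda>k. L2_norm_on \<Omega> (\<lambda>x. weak_rot \<Omega> (\<lambda>x. W k x - Z k x) x - weak_rot \<Omega> (\<lambda>x. u x - v x) x)) \<longlonglongrightarrow> 0"
  proof -
    have eq: "L2_norm_on \<Omega> (\<lambda>x. weak_rot \<Omega> (\<lambda>x. W k x - Z k x) x - weak_rot \<Omega> (\<lambda>x. u x - v x) x)
        = L2_norm_on \<Omega> (\<lambda>x. (weak_rot \<Omega> (W k) x - weak_rot \<Omega> (Z k) x) - (weak_rot \<Omega> u x - weak_rot \<Omega> v x))" for k
      by (rule norm_cong_AE)
        (use weak_rot_diff[OF H1_smooth(1)[OF W(1)[of k]] H1_smooth(1)[OF Z(1)[of k]]] weak_rot_diff[OF u(1) v(1)] in eventually_elim, simp)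
    show ?thesis
      unfolding eq by (rule Lim_null_comparison[OF _ tendsto_add_zero[OF W(3) Z(3)]]) (use tri[OF L(5-8)] in simp)
  qed
  ultimately show ?thesis
    using W(1) Z(1) unfolding smooth_approximation_def by (auto intro: smooth_on_diff)
qed

text \<open>A gradient pairs to zero with \<open>\<gamma>\<close>, so only the remainder of the field after splitting off a gradient counts.\<close>

lemma Poincare_rotation:
  assumes conv: "convex \<Omega>" and dim: "CARD('n) \<le> 3"
  shows "\<exists>C\<ge>0. \<forall>u \<gamma> W. Hk_on 1 \<Omega> u \<and> smooth_approximation u W \<and>
      L2_on \<Omega> \<gamma> \<and> (\<forall>\<psi>. Hk_on 1 \<Omega> \<psi> \<longrightarrow> L2_inner \<Omega> \<gamma> (weak_grad \<Omega> \<psi>) = 0) \<longrightarrow>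
    \<bar>L2_inner \<Omega> u \<gamma>\<bar> \<le> C * L2_norm_on \<Omega> (weak_rot \<Omega> u) * L2_norm_on \<Omega> \<gamma>"
proof (cases "\<Omega> = {}")
  case True
  then show ?thesis by (intro exI[of _ 0]) (simp add: L2_inner_def)
next
  case False
  then obtain x0 where x0: "x0 \<in> \<Omega>" by blast
  obtain d where d: "\<And>x. x \<in> \<Omega> \<Longrightarrow> norm (x - x0) \<le> d"
    using bounded_domain bounded_any_center[of \<Omega> x0] by (auto simp: dist_norm norm_minus_commute)
  have d0: "d \<ge> 0" using d[OF x0] by simp
  show ?thesis
  proof (intro exI[of _ "2 * d"] conjI allI impI)
    fix u \<gamma> :: "real^'n \<Rightarrow> real^'n" and W :: "nat \<Rightarrow> real^'n \<Rightarrow> real^'n"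
    assume *: "Hk_on 1 \<Omega> u \<and> smooth_approximation u W \<and>
      L2_on \<Omega> \<gamma> \<and> (\<forall>\<psi>. Hk_on 1 \<Omega> \<psi> \<longrightarrow> L2_inner \<Omega> \<gamma> (weak_grad \<Omega> \<psi>) = 0)"
    then have u: "Hk_on 1 \<Omega> u" and W: "\<And>k. smooth_on UNIV (W k)" and \<gamma>: "L2_on \<Omega> \<gamma>"
      and lims: "(\<lambda>k. L2_norm_on \<Omega> (\<lambda>x. W k x - u x)) \<longlonglongrightarrow> 0"
        "(\<lambda>k. L2_norm_on \<Omega> (\<lambda>x. weak_rot \<Omega> (W k) x - weak_rot \<Omega> u x)) \<longlonglongrightarrow> 0"
      unfolding smooth_approximation_def by auto
    note WL = H1_L2[OF H1_smooth(1)[OF W]] L2_weak_rot[OF H1_smooth(1)[OF W]]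
    have "\<bar>L2_inner \<Omega> (W k) \<gamma>\<bar> \<le> 2 * d * L2_norm_on \<Omega> (weak_rot \<Omega> (W k)) * L2_norm_on \<Omega> \<gamma>" for k
    proof -
      obtain q where q: "Hk_on 1 \<Omega> q" "L2_norm_on \<Omega> (\<lambda>x. W k x - weak_grad \<Omega> q x) \<le> 2 * d * L2_norm_on \<Omega> (weak_rot \<Omega> (W k))"
        using gradient_plus_rotation_remainder[OF conv x0 d dim W] by blast
      have "L2_inner \<Omega> (W k) \<gamma> = L2_inner \<Omega> (\<lambda>x. W k x - weak_grad \<Omega> q x) \<gamma>"
        using L2_inner_diff_left[OF WL(1) L2_weak_grad[OF q(1)] \<gamma>] * q(1) by (simp add: L2_inner_commute[of \<Omega> "weak_grad \<Omega> q"])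
      also have "\<bar>\<dots>\<bar> \<le> L2_norm_on \<Omega> (\<lambda>x. W k x - weak_grad \<Omega> q x) * L2_norm_on \<Omega> \<gamma>"
        by (intro L2_Cauchy_Schwarz L2_on_diff WL L2_weak_grad q \<gamma>)
      also have "\<dots> \<le> 2 * d * L2_norm_on \<Omega> (weak_rot \<Omega> (W k)) * L2_norm_on \<Omega> \<gamma>"
        by (intro mult_right_mono q) simp
      finally show ?thesis .
    qed
    moreover have "(\<lambda>k. \<bar>L2_inner \<Omega> (W k) \<gamma>\<bar>) \<longlonglongrightarrow> \<bar>L2_inner \<Omega> u \<gamma>\<bar>"
      by (intro tendsto_rabs L2_inner_tendsto WL H1_L2 u \<gamma> lims)
    moreover have "(\<lambda>k. 2 * d * L2_norm_on \<Omega> (weak_rot \<Omega> (W k)) * L2_norm_on \<Omega> \<gamma>) \<longlonglongrightarrow> 2 * d * L2_norm_on \<Omega> (weak_rot \<Omega> u) * L2_norm_on \<Omega> \<gamma>"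
      by (intro tendsto_intros L2_norm_tendsto WL L2_weak_rot u lims)
    ultimately show "\<bar>L2_inner \<Omega> u \<gamma>\<bar> \<le> 2 * d * L2_norm_on \<Omega> (weak_rot \<Omega> u) * L2_norm_on \<Omega> \<gamma>"
      by (intro LIMSEQ_le) auto
  qed (use d0 in simp)
qed

end

section \<open>Scalar pairings in time\<close>

text \<open>A smooth approximation of the indicator function of an interval.\<close>

definition ramp :: "real \<Rightarrow> real \<Rightarrow> nat \<Rightarrow> real \<Rightarrow> real" where
  "ramp a b k t = flat (real k * (t - a)) * flat (real k * (b - t))"

lemma test_function_ramp:
  assumes "0 < a"
  shows "test_function {0<..} (ramp a b k)"
proof (rule test_functionI[where K = "{a..b}"])
  show "smooth_on UNIV (ramp a b k)"
    unfolding ramp_def[abs_def]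
    by (intro smooth_on_mult smooth_on_flat_compose smooth_on_diff smooth_on_const smooth_on_ident open_UNIV)
  show "ramp a b k x = 0" if "x \<notin> {a..b}" for x
    using that by (auto simp: ramp_def not_le mult_nonneg_nonpos)
qed (use assms in auto)

lemma deriv_ramp:
  "deriv (ramp a b k) t =
    real k * flat_pow 2 (real k * (t - a)) * flat (real k * (b - t)) - real k * flat_pow 2 (real k * (b - t)) * flat (real k * (t - a))"
proof -
  have 1: "((\<lambda>t. flat (real k * (t - a))) has_real_derivative flat_pow 2 (real k * (t - a)) * real k) (at t)"
    by (rule DERIV_chain2[OF flat_has_derivative]) (auto intro!: derivative_eq_intros)
  have 2: "((\<lambda>t. flat (real k * (b - t))) has_real_derivative flat_pow 2 (real k * (b - t)) * (- real k)) (at t)"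
    by (rule DERIV_chain2[OF flat_has_derivative]) (auto intro!: derivative_eq_intros)
  show ?thesis unfolding ramp_def[abs_def]
    by (rule DERIV_imp_deriv[OF DERIV_cong[OF DERIV_mult[OF 1 2]]]) (simp add: algebra_simps)
qed

lemma continuous_flat_pow: "continuous_on UNIV (flat_pow m)"
  using Ck_on_flat_pow[of 0 m] by simp

lemma flat_pow_2_integral: "integrable lborel (flat_pow 2)" "(LBINT t. flat_pow 2 t) = 1"
proof -
  have nn: "0 \<le> flat_pow 2 t" for t by (simp add: flat_pow_def)
  have m: "flat_pow 2 \<in> borel_measurable borel" by (rule borel_measurable_continuous_onI[OF continuous_flat_pow])
  have "(\<integral>\<^sup>+ t. ennreal (flat_pow 2 t) * indicator {0..} t \<partial>lborel) = ennreal (1 - flat 0)"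
    by (rule nn_integral_FTC_atLeast[OF m flat_has_derivative nn flat_tendsto_1])
  moreover have "(\<integral>\<^sup>+ t. ennreal (flat_pow 2 t) * indicator {0..} t \<partial>lborel) = (\<integral>\<^sup>+ t. ennreal (flat_pow 2 t) \<partial>lborel)"
    by (intro nn_integral_cong) (auto simp: indicator_def flat_pow_def)
  ultimately have *: "(\<integral>\<^sup>+ t. ennreal (flat_pow 2 t) \<partial>lborel) = ennreal 1" by (simp add: flat_def)
  then show "integrable lborel (flat_pow 2)"
    using m nn by (intro integrableI_nonneg) auto
  show "(LBINT t. flat_pow 2 t) = 1"
    using * m nn by (intro integral_eq_nn_integral[THEN trans]) auto
qed

text \<open>After rescaling around an end point of the interval, the derivative of a ramp becomes the fixed probability
  density \<open>flat_pow 2\<close>, up to the second factor that tends to one; the remaining function is evaluated at points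
  that tend to the end point.\<close>

lemma ramp_derivative_concentrates:
  assumes g: "continuous_on UNIV g" "\<And>t. \<bar>g t\<bar> \<le> M" and ab: "a < b"
  shows "(\<lambda>k. LBINT s. flat_pow 2 s * flat (real (Suc k) * (b - a) - s) * g (p + c * s / real (Suc k))) \<longlonglongrightarrow> g p"
proof -
  have M: "M \<ge> 0" using g(2)[of 0] by simp
  have gm: "g \<in> borel_measurable borel" "flat_pow 2 \<in> borel_measurable borel" "flat \<in> borel_measurable borel"
    using g(1) continuous_flat_pow smooth_on_continuous[OF smooth_on_flat] by (auto intro: borel_measurable_continuous_onI)
  have "(\<lambda>k. LBINT s. flat_pow 2 s * flat (real (Suc k) * (b - a) - s) * g (p + c * s / real (Suc k))) \<longlonglongrightarrow> (LBINT s. flat_pow 2 s * g p)"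
  proof (rule integral_dominated_convergence[where w = "\<lambda>s. flat_pow 2 s * M"])
    show "(\<lambda>s. flat_pow 2 s * g p) \<in> borel_measurable lborel" using gm by simp
    show "(\<lambda>s. flat_pow 2 s * flat (real (Suc k) * (b - a) - s) * g (p + c * s / real (Suc k))) \<in> borel_measurable lborel" for k
    proof -
      have "(\<lambda>s. flat (real (Suc k) * (b - a) - s)) \<in> borel_measurable borel"
        "(\<lambda>s. g (p + c * s / real (Suc k))) \<in> borel_measurable borel"
        by (rule measurable_compose[OF _ gm(3)], simp) (rule measurable_compose[OF _ gm(1)], simp)
      then show ?thesis using gm(2) by simp
    qed
    show "integrable lborel (\<lambda>s. flat_pow 2 s * M)" using flat_pow_2_integral(1) by simp
    have nn: "0 \<le> flat_pow 2 t" for t by (simp add: flat_pow_def)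
    show "AE s in lborel. norm (flat_pow 2 s * flat (real (Suc k) * (b - a) - s) * g (p + c * s / real (Suc k))) \<le> flat_pow 2 s * M" for k
    proof (rule AE_I2)
      fix s
      have "flat_pow 2 s * (flat (real (Suc k) * (b - a) - s) * \<bar>g (p + c * s / real (Suc k))\<bar>) \<le> flat_pow 2 s * (1 * M)"
        by (intro mult_left_mono mult_mono g flat_le_1 flat_nonneg nn) auto
      then show "norm (flat_pow 2 s * flat (real (Suc k) * (b - a) - s) * g (p + c * s / real (Suc k))) \<le> flat_pow 2 s * M"
        using nn[of s] flat_nonneg by (simp add: abs_mult mult.assoc)
    qed
    show "AE s in lborel. (\<lambda>k. flat_pow 2 s * flat (real (Suc k) * (b - a) - s) * g (p + c * s / real (Suc k))) \<longlonglongrightarrow> flat_pow 2 s * g p"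
    proof (rule AE_I2)
      fix s :: real
      have kk: "filterlim (\<lambda>k. real (Suc k)) at_top sequentially"
        by (rule filterlim_compose[OF filterlim_real_sequentially filterlim_Suc])
      have "filterlim (\<lambda>k. - s + (b - a) * real (Suc k)) at_top sequentially"
        using ab by (intro filterlim_tendsto_add_at_top[OF tendsto_const] filterlim_tendsto_pos_mult_at_top[OF tendsto_const _ kk]) simp
      then have "filterlim (\<lambda>k. real (Suc k) * (b - a) - s) at_top sequentially"
        by (simp add: algebra_simps)
      then have 1: "(\<lambda>k. flat (real (Suc k) * (b - a) - s)) \<longlonglongrightarrow> 1" by (rule filterlim_compose[OF flat_tendsto_1])
      have "(\<lambda>k. p + c * s * inverse (real (Suc k))) \<longlonglongrightarrow> p + c * s * 0"
        by (intro tendsto_intros tendsto_inverse_0_at_top kk)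
      then have "(\<lambda>k. p + c * s / real (Suc k)) \<longlonglongrightarrow> p" by (simp add: divide_inverse)
      then have 2: "(\<lambda>k. g (p + c * s / real (Suc k))) \<longlonglongrightarrow> g p"
        using g(1) by (intro isCont_tendsto_compose[of _ g]) (auto simp: continuous_on_eq_continuous_at)
      show "(\<lambda>k. flat_pow 2 s * flat (real (Suc k) * (b - a) - s) * g (p + c * s / real (Suc k))) \<longlonglongrightarrow> flat_pow 2 s * g p"
        using tendsto_mult[OF tendsto_mult[OF tendsto_const 1] 2] by simp
    qed
  qed
  then show ?thesis by (simp add: flat_pow_2_integral(2))
qed

lemma integral_affine_neg:
  fixes h :: "real \<Rightarrow> real" assumes "c \<noteq> 0"
  shows "(LBINT x. h x) = \<bar>c\<bar> * (LBINT s. h (t + c * s))"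
  using lborel_integral_real_affine[OF assms, of h t] by simp

text \<open>Testing with ramps, which tend to the indicator function of the interval while their derivatives concentrate at
  the end points.\<close>

lemma weak_derivative_increment:
  fixes A B :: "real \<Rightarrow> real"
  assumes A: "continuous_on {0<..} A" and B: "continuous_on {0<..} B"
    and weak: "\<And>\<phi>. test_function {0<..} \<phi> \<Longrightarrow>
      (LINT t|lebesgue_on {0<..}. deriv \<phi> t * A t) = - (LINT t|lebesgue_on {0<..}. \<phi> t * B t)"
    and ab: "0 < a" "a < b"
  shows "A b - A a = integral {a..b} B"
proof -
  \<comment> \<open>clamping to the interval extends \<open>A\<close> and \<open>B\<close> continuously and boundedly without changing them on the supports of the ramps\<close>
  define cl where "cl t = max a (min b t)" for t :: real
  have cl: "cl t \<in> {a..b}" "t \<in> {a..b} \<Longrightarrow> cl t = t" for t using ab by (auto simp: cl_def)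
  have clc: "continuous_on UNIV cl" unfolding cl_def by (intro continuous_intros)
  have ext: "continuous_on UNIV (\<lambda>t. h (cl t))" "\<exists>M. \<forall>t. \<bar>h (cl t)\<bar> \<le> M" if "continuous_on {0<..} h" for h :: "real \<Rightarrow> real"
  proof -
    have c: "continuous_on {a..b} h" using that ab by (intro continuous_on_subset[OF that]) auto
    then show "continuous_on UNIV (\<lambda>t. h (cl t))" by (intro continuous_on_compose2[OF c clc]) (use cl in auto)
    have "bounded (h ` {a..b})" by (intro compact_imp_bounded compact_continuous_image c) simp
    then obtain M where "\<forall>y\<in>h ` {a..b}. norm y \<le> M" unfolding bounded_iff by blast
    then show "\<exists>M. \<forall>t. \<bar>h (cl t)\<bar> \<le> M" using cl(1) by (intro exI[of _ M]) auto
  qed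
  obtain MA where MA: "\<And>t. \<bar>A (cl t)\<bar> \<le> MA" using ext(2)[OF A] by blast
  obtain MB where MB: "\<And>t. \<bar>B (cl t)\<bar> \<le> MB" using ext(2)[OF B] by blast
  have restrict: "(LINT t|lebesgue_on {0<..}. h t * H t) = (LBINT t. h t * H (cl t))"
    if h: "continuous_on UNIV h" "\<And>t. t \<notin> {a..b} \<Longrightarrow> h t = 0" and H: "continuous_on {0<..} H" for h H :: "real \<Rightarrow> real"
  proof -
    have eq: "(\<lambda>t. indicator {0<..} t *\<^sub>R (h t * H t)) = (\<lambda>t. h t * H (cl t))"
    proof
      fix t show "indicator {0<..} t *\<^sub>R (h t * H t) = h t * H (cl t)"
        using h(2)[of t] cl(2)[of t] ab by (cases "t \<in> {a..b}") (auto simp: indicator_def)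
    qed
    have "continuous_on UNIV (\<lambda>t. h t * H (cl t))" by (intro continuous_intros h ext H)
    then have "(\<lambda>t. h t * H (cl t)) \<in> borel_measurable borel" by (rule borel_measurable_continuous_onI)
    then show ?thesis
      unfolding integral_lebesgue_on_eq[OF open_sets_lebesgue[OF open_greaterThan]] eq by (simp add: integral_completion)
  qed
  define R where "R k = ramp a b (Suc k)" for k
  have R0: "R k t = 0" "deriv (R k) t = 0" if "t \<notin> {a..b}" for k t
    using that unfolding R_def deriv_ramp by (auto simp: ramp_def not_le mult_nonneg_nonpos flat_pow_def zero_less_mult_iff)
  have fc: "continuous_on UNIV flat" by (rule smooth_on_continuous[OF smooth_on_flat])
  have dR: "deriv (R k) = (\<lambda>t. deriv (ramp a b (Suc k)) t)" for k by (simp add: R_def)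
  have Rc: "continuous_on UNIV (R k)" "continuous_on UNIV (deriv (R k))" for k
    unfolding dR deriv_ramp unfolding R_def ramp_def
    by (intro continuous_intros continuous_on_compose2[OF fc] continuous_on_compose2[OF continuous_flat_pow]; simp)+
  have weakR: "(LBINT t. deriv (R k) t * A (cl t)) = - (LBINT t. R k t * B (cl t))" for k
    using weak[OF test_function_ramp[OF ab(1)], of b "Suc k"] restrict[OF Rc(2) R0(2) A, of k] restrict[OF Rc(1) R0(1) B, of k]
    by (simp add: R_def)
  have compact_int: "integrable lborel h" if "continuous_on UNIV h" "\<And>t. t \<notin> {a..b} \<Longrightarrow> h t = 0" for h :: "real \<Rightarrow> real"
  proof -
    have "h = (\<lambda>t. indicator {a..b} t *\<^sub>R h t)" using that(2) by (auto simp: indicator_def fun_eq_iff)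
    then show ?thesis using borel_integrable_compact[of "{a..b}" h] continuous_on_subset[OF that(1)] by simp
  qed
  have split: "(LBINT t. deriv (R k) t * A (cl t)) =
      (LBINT s. flat_pow 2 s * flat (real (Suc k) * (b - a) - s) * A (cl (a + 1 * s / real (Suc k))))
      - (LBINT s. flat_pow 2 s * flat (real (Suc k) * (b - a) - s) * A (cl (b + (-1) * s / real (Suc k))))" for k
  proof -
    let ?n = "real (Suc k)"
    define f1 where "f1 t = ?n * flat_pow 2 (?n * (t - a)) * flat (?n * (b - t)) * A (cl t)" for t
    define f2 where "f2 t = ?n * flat_pow 2 (?n * (b - t)) * flat (?n * (t - a)) * A (cl t)" for t
    have c12: "continuous_on UNIV f1" "continuous_on UNIV f2"
      unfolding f1_def[abs_def] f2_def[abs_def]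
      by (intro continuous_intros ext A continuous_on_compose2[OF fc] continuous_on_compose2[OF continuous_flat_pow]; simp)+
    have z12: "f1 t = 0" "f2 t = 0" if "t \<notin> {a..b}" for t
      using that by (auto simp: f1_def f2_def flat_pow_def zero_less_mult_iff not_le mult_nonneg_nonpos)
    have "(LBINT t. deriv (R k) t * A (cl t)) = (LBINT t. f1 t - f2 t)"
      unfolding R_def deriv_ramp f1_def f2_def by (simp add: left_diff_distrib)
    also have "\<dots> = (LBINT t. f1 t) - (LBINT t. f2 t)"
      by (intro Bochner_Integration.integral_diff compact_int c12 z12)
    also have "(LBINT t. f1 t) = \<bar>inverse ?n\<bar> * (LBINT s. f1 (a + inverse ?n * s))" by (rule integral_affine_neg) simp
    also have "\<dots> = (LBINT s. inverse ?n * f1 (a + inverse ?n * s))" by simp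
    also have "(\<lambda>s. inverse ?n * f1 (a + inverse ?n * s)) = (\<lambda>s. flat_pow 2 s * flat (?n * (b - a) - s) * A (cl (a + 1 * s / ?n)))"
    proof
      fix s
      have 1: "?n * (a + inverse ?n * s - a) = s" "?n * (b - (a + inverse ?n * s)) = ?n * (b - a) - s"
        by (simp_all add: algebra_simps del: of_nat_Suc)
      have 2: "inverse ?n * (?n * F * G * A') = F * G * A'" for F G A' :: real by (simp del: of_nat_Suc)
      have 3: "a + inverse ?n * s = a + 1 * s / ?n" by (simp add: divide_inverse mult.commute del: of_nat_Suc)
      show "inverse ?n * f1 (a + inverse ?n * s) = flat_pow 2 s * flat (?n * (b - a) - s) * A (cl (a + 1 * s / ?n))"
        unfolding f1_def 1 2 unfolding 3 by (rule refl)
    qed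
    also have "(LBINT t. f2 t) = \<bar>- inverse ?n\<bar> * (LBINT s. f2 (b + - inverse ?n * s))" by (rule integral_affine_neg) simp
    also have "\<dots> = (LBINT s. inverse ?n * f2 (b + - inverse ?n * s))" by simp
    also have "(\<lambda>s. inverse ?n * f2 (b + - inverse ?n * s)) = (\<lambda>s. flat_pow 2 s * flat (?n * (b - a) - s) * A (cl (b + (-1) * s / ?n)))"
    proof
      fix s
      have 1: "?n * (b - (b + - inverse ?n * s)) = s" "?n * (b + - inverse ?n * s - a) = ?n * (b - a) - s"
        by (simp_all add: algebra_simps del: of_nat_Suc)
      have 2: "inverse ?n * (?n * F * G * A') = F * G * A'" for F G A' :: real by (simp del: of_nat_Suc)
      have 3: "b + - inverse ?n * s = b + (-1) * s / ?n" by (simp add: divide_inverse mult.commute del: of_nat_Suc)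
      show "inverse ?n * f2 (b + - inverse ?n * s) = flat_pow 2 s * flat (?n * (b - a) - s) * A (cl (b + (-1) * s / ?n))"
        unfolding f2_def 1 2 unfolding 3 by (rule refl)
    qed
    finally show ?thesis .
  qed
  have lim1: "(\<lambda>k. LBINT t. deriv (R k) t * A (cl t)) \<longlonglongrightarrow> A (cl a) - A (cl b)"
    unfolding split by (intro tendsto_diff ramp_derivative_concentrates[OF ext(1)[OF A] MA ab(2)])
  have BB: "continuous_on {a..b} B" using ab by (intro continuous_on_subset[OF B]) auto
  have lim2: "(\<lambda>k. LBINT t. R k t * B (cl t)) \<longlonglongrightarrow> (LBINT t. indicator {a..b} t * B (cl t))"
  proof (rule integral_dominated_convergence[where w = "\<lambda>t. indicator {a..b} t * MB"])
    have Bm: "(\<lambda>t. B (cl t)) \<in> borel_measurable borel" by (rule borel_measurable_continuous_onI[OF ext(1)[OF B]])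
    show "(\<lambda>t. indicator {a..b} t * B (cl t)) \<in> borel_measurable lborel" using Bm by simp
    show "(\<lambda>t. R k t * B (cl t)) \<in> borel_measurable lborel" for k
      using Bm borel_measurable_continuous_onI[OF Rc(1)] by simp
    show "integrable lborel (\<lambda>t. indicator {a..b} t * MB)"
      using borel_integrable_compact[of "{a..b}" "\<lambda>_. MB"] by simp
    have Rb: "0 \<le> R k t" "R k t \<le> 1" for k t
      by (auto simp: R_def ramp_def intro!: mult_nonneg_nonneg mult_le_one)
    show "AE t in lborel. norm (R k t * B (cl t)) \<le> indicator {a..b} t * MB" for k
    proof (rule AE_I2)
      fix t
      have "R k t * \<bar>B (cl t)\<bar> \<le> 1 * MB" by (intro mult_mono MB Rb) auto
      then show "norm (R k t * B (cl t)) \<le> indicator {a..b} t * MB"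
        using Rb[of k t] R0(1)[of t k] by (cases "t \<in> {a..b}") (auto simp: abs_mult)
    qed
    have "AE t in lborel. t \<noteq> a" "AE t in lborel. t \<noteq> b" by (rule AE_lborel_singleton)+
    then show "AE t in lborel. (\<lambda>k. R k t * B (cl t)) \<longlonglongrightarrow> indicator {a..b} t * B (cl t)"
    proof eventually_elim
      case (elim t)
      show ?case
      proof (cases "t \<in> {a..b}")
        case True
        then have t: "a < t" "t < b" using elim by auto
        have kk: "filterlim (\<lambda>k. real (Suc k)) at_top sequentially"
          by (rule filterlim_compose[OF filterlim_real_sequentially filterlim_Suc])
        have "(\<lambda>k. flat (c * real (Suc k))) \<longlonglongrightarrow> 1" if "c > 0" for c
          by (rule filterlim_compose[OF flat_tendsto_1 filterlim_tendsto_pos_mult_at_top[OF tendsto_const that kk]])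
        then have "(\<lambda>k. R k t) \<longlonglongrightarrow> 1 * 1"
          unfolding R_def ramp_def using t by (intro tendsto_mult) (simp_all add: mult.commute[of "real (Suc _)"] del: of_nat_Suc)
        then show ?thesis using True by (auto intro!: tendsto_eq_intros)
      qed (simp add: R0)
    qed
  qed
  have "A (cl a) - A (cl b) = - (LBINT t. indicator {a..b} t * B (cl t))"
    using LIMSEQ_unique[OF lim1[unfolded weakR] tendsto_minus[OF lim2]] .
  moreover have "(LBINT t. indicator {a..b} t * B (cl t)) = integral {a..b} B"
  proof -
    have "(LBINT t. indicator {a..b} t * B (cl t)) = (LBINT t:{a..b}. B t)"
      unfolding set_lebesgue_integral_def using cl(2) by (intro Bochner_Integration.integral_cong) (auto simp: indicator_def)
    also have "\<dots> = integral {a..b} B"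
      by (rule set_borel_integral_eq_integral(2)[OF borel_integrable_atLeastAtMost']) (rule BB)
    finally show ?thesis .
  qed
  ultimately show ?thesis using cl(2)[of a] cl(2)[of b] ab by simp
qed

lemma weak_derivative_imp_derivative:
  fixes A B :: "real \<Rightarrow> real"
  assumes A: "continuous_on {0<..} A" and B: "continuous_on {0<..} B"
    and weak: "\<And>\<phi>. test_function {0<..} \<phi> \<Longrightarrow>
      (LINT t|lebesgue_on {0<..}. deriv \<phi> t * A t) = - (LINT t|lebesgue_on {0<..}. \<phi> t * B t)"
    and t: "0 < t"
  shows "(A has_real_derivative B t) (at t)"
proof -
  define a where "a = t / 2"
  define b where "b = t + 1"
  have ab: "0 < a" "a < t" "t < b" using t by (auto simp: a_def b_def)
  have Bc: "continuous_on {a..b} B" using ab by (intro continuous_on_subset[OF B]) auto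
  have "((\<lambda>x. integral {a..x} B) has_real_derivative B t) (at t within {a..b})"
    by (rule integral_has_real_derivative[OF Bc]) (use ab in auto)
  then have "((\<lambda>x. A a + integral {a..x} B) has_real_derivative B t) (at t within {a<..<b})"
    using ab by (auto intro!: derivative_eq_intros elim: has_field_derivative_subset)
  then have "((\<lambda>x. A a + integral {a..x} B) has_real_derivative B t) (at t)"
    using ab by (subst (asm) at_within_open) auto
  then show ?thesis
  proof (rule has_field_derivative_transform_within_open[where S = "{a<..<b}"])
    show "A a + integral {a..x} B = A x" if "x \<in> {a<..<b}" for x
      using weak_derivative_increment[OF A B weak ab(1), of x] that by simp
  qed (use ab in auto)
qed

text \<open>For \<open>k t s = \<langle>\<gamma> t, \<gamma> s\<rangle>\<close> the function \<open>\<omega> s t = K t (t + s) - K (t + s) t\<close> is the Wronskian of \<open>\<gamma>\<close> and its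
  translate by \<open>s\<close>. Its derivative vanishes: the terms with \<open>c\<close> cancel by symmetry, and so do those with mixed
  second derivatives of \<open>k\<close>. As \<open>\<omega> s\<close> decays, it is zero. For small \<open>s = h\<close> this turns the increment of
  \<open>K t\<close> in its second argument into \<open>- \<mu> h c t t\<close>, while \<open>h\<close> times the same increment is, up to lower order,
  the second difference of \<open>k\<close> on the diagonal, which is not negative. Differentiability of \<open>K\<close> in its second
  argument is not available, so mixed second differences of \<open>k\<close> take the place of mixed derivatives.\<close>

lemma Wronskian_argument:
  fixes k K c :: "real \<Rightarrow> real \<Rightarrow> real"
  assumes \<mu>: "\<mu> > 0"
    and sym: "\<And>t s. 0 < t \<Longrightarrow> 0 < s \<Longrightarrow> k t s = k s t" "\<And>t s. c t s = c s t"
    and dk: "\<And>t s. 0 < t \<Longrightarrow> 0 < s \<Longrightarrow> ((\<lambda>t. k t s) has_real_derivative K t s) (at t)"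
    and dK: "\<And>t s. 0 < t \<Longrightarrow> 0 < s \<Longrightarrow> ((\<lambda>t. K t s) has_real_derivative - \<mu> * c t s) (at t)"
    and pos: "\<And>t s. 0 < t \<Longrightarrow> 0 < s \<Longrightarrow> 0 \<le> k t t - 2 * k t s + k s s"
    and c: "\<And>t s e. 0 < t \<Longrightarrow> 0 < s \<Longrightarrow> 0 < e \<Longrightarrow> \<exists>d>0. \<forall>x y. \<bar>x - t\<bar> < d \<and> \<bar>y - s\<bar> < d \<longrightarrow> \<bar>c x y - c t s\<bar> \<le> e"
    and K: "\<And>t e. 0 < t \<Longrightarrow> 0 < e \<Longrightarrow> \<exists>d>0. \<forall>x s s'. \<bar>x - t\<bar> < d \<and> 0 < x \<and> 0 < s \<and> 0 < s' \<longrightarrow>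
        \<bar>(K x s - K x s') - (K t s - K t s')\<bar> \<le> e * \<bar>s - s'\<bar>"
    and decay: "\<And>s. 0 < s \<Longrightarrow> ((\<lambda>t. K t (t + s)) \<longlongrightarrow> 0) at_top" "\<And>s. 0 < s \<Longrightarrow> ((\<lambda>t. K (t + s) t) \<longlongrightarrow> 0) at_top"
    and t: "0 < t"
  shows "c t t \<le> 0"
proof -
  have mvt: "\<exists>z. \<bar>z - x\<bar> \<le> \<bar>h\<bar> \<and> 0 < z \<and> f (x + h) - f x = h * f' z"
    if "\<And>z. 0 < z \<Longrightarrow> (f has_real_derivative f' z) (at z)" "0 < x" "0 < x + h" for f f' :: "real \<Rightarrow> real" and x h
  proof -
    consider "h > 0" | "h = 0" | "h < 0" by linarith
    then show ?thesis
    proof cases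
      case 1
      have "\<exists>z. x < z \<and> z < x + h \<and> f (x + h) - f x = (x + h - x) * f' z"
        using 1 that by (intro MVT2) auto
      then obtain z where "x < z" "z < x + h" "f (x + h) - f x = h * f' z" by auto
      then show ?thesis using that(2) 1 by (intro exI[of _ z]) auto
    next
      case 2
      then show ?thesis using that(2) by (intro exI[of _ x]) auto
    next
      case 3
      have "\<exists>z. x + h < z \<and> z < x \<and> f x - f (x + h) = (x - (x + h)) * f' z"
        using 3 that by (intro MVT2) auto
      then obtain z where "x + h < z" "z < x" "f x - f (x + h) = - h * f' z" by auto
      then show ?thesis using that(3) 3 by (intro exI[of _ z]) auto
    qed
  qed
  \<comment> \<open>the mixed second difference is \<open>h\<close> times an increment of \<open>K\<close> in its second argument, up to \<open>e h\<^sup>2\<close>\<close>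
  have second: "\<bar>(k (x + h) (y + h) - k x (y + h) - k (x + h) y + k x y) - h * (K x (y + h) - K x y)\<bar> \<le> e * h\<^sup>2"
    if d: "\<And>z s s'. \<bar>z - x\<bar> < d \<Longrightarrow> 0 < z \<Longrightarrow> 0 < s \<Longrightarrow> 0 < s' \<Longrightarrow> \<bar>(K z s - K z s') - (K x s - K x s')\<bar> \<le> e * \<bar>s - s'\<bar>"
      and xy: "0 < x" "0 < y" "0 < x + h" "0 < y + h" "\<bar>h\<bar> < d" for x y h d e
  proof -
    have "\<exists>z. \<bar>z - x\<bar> \<le> \<bar>h\<bar> \<and> 0 < z \<and> (\<lambda>x. k x (y + h) - k x y) (x + h) - (\<lambda>x. k x (y + h) - k x y) x = h * (K z (y + h) - K z y)"
      by (rule mvt) (use dk xy in \<open>auto intro!: DERIV_diff\<close>)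
    then obtain z where z: "\<bar>z - x\<bar> \<le> \<bar>h\<bar>" "0 < z" "(k (x + h) (y + h) - k (x + h) y) - (k x (y + h) - k x y) = h * (K z (y + h) - K z y)"
      by auto
    have "\<bar>h * (K z (y + h) - K z y) - h * (K x (y + h) - K x y)\<bar> = \<bar>h\<bar> * \<bar>(K z (y + h) - K z y) - (K x (y + h) - K x y)\<bar>"
      by (simp add: right_diff_distrib[symmetric] abs_mult)
    also have "\<dots> \<le> \<bar>h\<bar> * (e * \<bar>(y + h) - y\<bar>)"
      using z xy by (intro mult_left_mono d) auto
    also have "\<dots> = e * h\<^sup>2" by (simp add: power2_eq_square)
    finally show ?thesis using z(3) by (simp add: algebra_simps)
  qed
  define \<omega> where "\<omega> s t = K t (t + s) - K (t + s) t" for s t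
  have d\<omega>: "(\<omega> s has_real_derivative 0) (at x)" if s: "0 < s" and x: "0 < x" for s x
  proof -
    define y where "y = x + s"
    have y: "y > 0" using s x by (simp add: y_def)
    have "\<exists>d>0. \<forall>h. h \<noteq> 0 \<and> \<bar>h\<bar> < d \<longrightarrow> \<bar>\<omega> s (x + h) - \<omega> s x\<bar> \<le> e * \<bar>h\<bar>" if e: "e > 0" for e
    proof -
      define e1 where "e1 = e / (4 * \<mu>)"
      have e1: "e1 > 0" using e \<mu> by (simp add: e1_def)
      obtain d1 where d1: "d1 > 0" "\<And>p q. \<bar>p - x\<bar> < d1 \<Longrightarrow> \<bar>q - y\<bar> < d1 \<Longrightarrow> \<bar>c p q - c x y\<bar> \<le> e1"
        using c[OF x y e1] by blast
      obtain d2 where d2: "d2 > 0" "\<And>p q. \<bar>p - y\<bar> < d2 \<Longrightarrow> \<bar>q - x\<bar> < d2 \<Longrightarrow> \<bar>c p q - c y x\<bar> \<le> e1"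
        using c[OF y x e1] by blast
      obtain d3 where d3: "d3 > 0" "\<And>z s s'. \<bar>z - x\<bar> < d3 \<Longrightarrow> 0 < z \<Longrightarrow> 0 < s \<Longrightarrow> 0 < s' \<Longrightarrow> \<bar>(K z s - K z s') - (K x s - K x s')\<bar> \<le> e / 4 * \<bar>s - s'\<bar>"
        using K[OF x, of "e / 4"] e by auto
      obtain d4 where d4: "d4 > 0" "\<And>z s s'. \<bar>z - y\<bar> < d4 \<Longrightarrow> 0 < z \<Longrightarrow> 0 < s \<Longrightarrow> 0 < s' \<Longrightarrow> \<bar>(K z s - K z s') - (K y s - K y s')\<bar> \<le> e / 4 * \<bar>s - s'\<bar>"
        using K[OF y, of "e / 4"] e by auto
      define d where "d = Min {d1, d2, d3, d4, x, y}"
      have d: "d > 0" "d \<le> d1" "d \<le> d2" "d \<le> d3" "d \<le> d4" "d \<le> x" "d \<le> y"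
        using d1(1) d2(1) d3(1) d4(1) x y unfolding d_def by auto
      show ?thesis
      proof (intro exI[of _ d] conjI allI impI)
        fix h assume h: "h \<noteq> 0 \<and> \<bar>h\<bar> < d"
        have xh: "0 < x + h" "0 < y + h" using h d by auto
        obtain z1 where z1: "\<bar>z1 - x\<bar> \<le> \<bar>h\<bar>" "K (x + h) (y + h) - K x (y + h) = h * (- \<mu> * c z1 (y + h))"
          using mvt[of "\<lambda>z. K z (y + h)" "\<lambda>z. - \<mu> * c z (y + h)" x h] dK xh x by auto
        obtain z2 where z2: "\<bar>z2 - y\<bar> \<le> \<bar>h\<bar>" "K (y + h) (x + h) - K y (x + h) = h * (- \<mu> * c z2 (x + h))"
          using mvt[of "\<lambda>z. K z (x + h)" "\<lambda>z. - \<mu> * c z (x + h)" y h] dK xh y by auto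
        have "\<bar>c z1 (y + h) - c x y\<bar> \<le> e1" "\<bar>c z2 (x + h) - c y x\<bar> \<le> e1"
          using z1(1) z2(1) h d by (auto intro!: d1(2) d2(2))
        then have "\<bar>c z1 (y + h) - c z2 (x + h)\<bar> \<le> 2 * e1" using sym(2)[of x y] by linarith
        then have "\<bar>h\<bar> * (\<mu> * \<bar>c z1 (y + h) - c z2 (x + h)\<bar>) \<le> \<bar>h\<bar> * (\<mu> * (2 * e1))"
          using \<mu> by (intro mult_left_mono) auto
        also have "\<dots> = e / 2 * \<bar>h\<bar>" using \<mu> by (simp add: e1_def)
        finally have I: "\<bar>(K (x + h) (y + h) - K x (y + h)) - (K (y + h) (x + h) - K y (x + h))\<bar> \<le> e / 2 * \<bar>h\<bar>"
        proof -
          assume le: "\<bar>h\<bar> * (\<mu> * \<bar>c z1 (y + h) - c z2 (x + h)\<bar>) \<le> e / 2 * \<bar>h\<bar>"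
          have "(K (x + h) (y + h) - K x (y + h)) - (K (y + h) (x + h) - K y (x + h)) = - (h * (\<mu> * (c z1 (y + h) - c z2 (x + h))))"
            unfolding z1(2) z2(2) by (simp add: algebra_simps)
          then show ?thesis using le \<mu> by (simp add: abs_mult)
        qed
        \<comment> \<open>the same second difference of \<open>k\<close> describes the increments of \<open>K\<close> at \<open>x\<close> and at \<open>y\<close>\<close>
        let ?N = "k (x + h) (y + h) - k x (y + h) - k (x + h) y + k x y"
        have N1: "\<bar>?N - h * (K x (y + h) - K x y)\<bar> \<le> e / 4 * h\<^sup>2"
          by (rule second[OF d3(2)]) (use x y xh h d in auto)
        have "\<bar>(k (y + h) (x + h) - k y (x + h) - k (y + h) x + k y x) - h * (K y (x + h) - K y x)\<bar> \<le> e / 4 * h\<^sup>2"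
          by (rule second[OF d4(2)]) (use x y xh h d in auto)
        then have N2: "\<bar>?N - h * (K y (x + h) - K y x)\<bar> \<le> e / 4 * h\<^sup>2"
          using sym(1)[of "y + h" "x + h"] sym(1)[of y "x + h"] sym(1)[of "y + h" x] sym(1)[of y x] x y xh
          by (simp add: algebra_simps)
        have "\<bar>h * (K x (y + h) - K x y) - h * (K y (x + h) - K y x)\<bar> \<le> e / 2 * h\<^sup>2"
          using N1 N2 by linarith
        moreover have "\<bar>h\<bar> * \<bar>(K x (y + h) - K x y) - (K y (x + h) - K y x)\<bar> = \<bar>h * (K x (y + h) - K x y) - h * (K y (x + h) - K y x)\<bar>"
          by (simp only: abs_mult[symmetric] right_diff_distrib)
        moreover have "h\<^sup>2 = \<bar>h\<bar> * \<bar>h\<bar>" by (simp add: power2_eq_square)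
        then have "e / 2 * h\<^sup>2 = \<bar>h\<bar> * (e / 2 * \<bar>h\<bar>)" by (simp only: mult_ac)
        ultimately have "\<bar>h\<bar> * \<bar>(K x (y + h) - K x y) - (K y (x + h) - K y x)\<bar> \<le> \<bar>h\<bar> * (e / 2 * \<bar>h\<bar>)"
          by (simp only:)
        then have II: "\<bar>(K x (y + h) - K x y) - (K y (x + h) - K y x)\<bar> \<le> e / 2 * \<bar>h\<bar>"
          using h by simp
        have "\<omega> s (x + h) - \<omega> s x = ((K (x + h) (y + h) - K x (y + h)) - (K (y + h) (x + h) - K y (x + h)))
            + ((K x (y + h) - K x y) - (K y (x + h) - K y x))"
          by (simp add: \<omega>_def y_def algebra_simps)
        then show "\<bar>\<omega> s (x + h) - \<omega> s x\<bar> \<le> e * \<bar>h\<bar>" using I II by linarith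
      qed (use d in auto)
    qed
    then have "((\<lambda>h. (\<omega> s (x + h) - \<omega> s x) / h) \<longlongrightarrow> 0) (at 0)"
      unfolding LIM_def
    proof (intro allI impI)
      fix r :: real assume r: "0 < r" and *: "\<And>e. 0 < e \<Longrightarrow> \<exists>d>0. \<forall>h. h \<noteq> 0 \<and> \<bar>h\<bar> < d \<longrightarrow> \<bar>\<omega> s (x + h) - \<omega> s x\<bar> \<le> e * \<bar>h\<bar>"
      obtain d where d: "d > 0" "\<And>h. h \<noteq> 0 \<Longrightarrow> \<bar>h\<bar> < d \<Longrightarrow> \<bar>\<omega> s (x + h) - \<omega> s x\<bar> \<le> r / 2 * \<bar>h\<bar>"
        using *[of "r / 2"] r by auto
      have "\<bar>(\<omega> s (x + h) - \<omega> s x) / h\<bar> < r" if h: "h \<noteq> 0" "\<bar>h\<bar> < d" for h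
      proof -
        have "\<bar>(\<omega> s (x + h) - \<omega> s x) / h\<bar> \<le> r / 2"
          unfolding abs_divide using d(2)[OF h] h(1) by (subst pos_divide_le_eq) auto
        moreover have "r / 2 < r" using r by simp
        ultimately show ?thesis by (rule le_less_trans)
      qed
      then show "\<exists>d>0. \<forall>h. h \<noteq> 0 \<and> dist h 0 < d \<longrightarrow> dist ((\<omega> s (x + h) - \<omega> s x) / h) 0 < r"
        using d(1) by (intro exI[of _ d]) auto
    qed
    then show ?thesis by (simp add: DERIV_def)
  qed
  have \<omega>0: "\<omega> s x = 0" if s: "0 < s" and x: "0 < x" for s x
  proof -
    have const: "\<omega> s y = \<omega> s x" if "x < y" for y
    proof -
      have "\<exists>z. x < z \<and> z < y \<and> \<omega> s y - \<omega> s x = (y - x) * 0"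
        using that d\<omega>[OF s] x by (intro MVT2) auto
      then show ?thesis by auto
    qed
    have "(\<omega> s \<longlongrightarrow> 0 - 0) at_top"
      unfolding \<omega>_def[abs_def] by (intro tendsto_diff decay s)
    moreover have "(\<omega> s \<longlongrightarrow> \<omega> s x) at_top"
      by (rule tendsto_eventually) (use const in \<open>auto simp: eventually_at_top_dense\<close>)
    ultimately show ?thesis using tendsto_unique[OF trivial_limit_at_top_linorder] by fastforce
  qed
  show ?thesis
  proof (rule field_le_epsilon)
    fix e :: real assume e: "e > 0"
    obtain d1 where d1: "d1 > 0" "\<And>p q. \<bar>p - t\<bar> < d1 \<Longrightarrow> \<bar>q - t\<bar> < d1 \<Longrightarrow> \<bar>c p q - c t t\<bar> \<le> e / 2"
      using c[OF t t, of "e / 2"] e by auto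
    define e2 where "e2 = e * \<mu> / 2"
    have e2: "e2 > 0" using e \<mu> by (simp add: e2_def)
    obtain d2 where d2: "d2 > 0" "\<And>z s s'. \<bar>z - t\<bar> < d2 \<Longrightarrow> 0 < z \<Longrightarrow> 0 < s \<Longrightarrow> 0 < s' \<Longrightarrow> \<bar>(K z s - K z s') - (K t s - K t s')\<bar> \<le> e2 * \<bar>s - s'\<bar>"
      using K[OF t e2] by blast
    define h where "h = min d1 d2 / 2"
    have h: "h > 0" "h < d1" "h < d2" using d1 d2 by (auto simp: h_def min_def)
    obtain z where z: "\<bar>z - t\<bar> \<le> \<bar>h\<bar>" "K (t + h) t - K t t = h * (- \<mu> * c z t)"
      using mvt[of "\<lambda>z. K z t" "\<lambda>z. - \<mu> * c z t" t h] dK t h by auto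
    have "K t (t + h) = K (t + h) t" using \<omega>0[OF h(1) t] by (simp add: \<omega>_def)
    then have Q: "K t (t + h) - K t t = h * (- \<mu> * c z t)" using z(2) by simp
    have "\<bar>(k (t + h) (t + h) - k t (t + h) - k (t + h) t + k t t) - h * (K t (t + h) - K t t)\<bar> \<le> e2 * h\<^sup>2"
      by (rule second[where d = d2, OF d2(2)]) (use t h in auto)
    moreover have "0 \<le> k (t + h) (t + h) - k t (t + h) - k (t + h) t + k t t"
      using pos[of "t + h" t] sym(1)[of t "t + h"] t h by simp
    ultimately have "- (e2 * h\<^sup>2) \<le> h * (K t (t + h) - K t t)" by linarith
    then have "h\<^sup>2 * (\<mu> * c z t) \<le> h\<^sup>2 * e2" unfolding Q by (simp add: power2_eq_square algebra_simps)
    then have "\<mu> * c z t \<le> e2" using h(1) by (subst (asm) mult_le_cancel_left_pos) auto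
    then have "\<mu> * c z t \<le> \<mu> * (e / 2)" by (simp add: e2_def mult.commute)
    then have "c z t \<le> e / 2" using \<mu> by simp
    moreover have "\<bar>c z t - c t t\<bar> \<le> e / 2" using z(1) h d1(1) by (intro d1(2)) auto
    ultimately show "c t t \<le> 0 + e" by linarith
  qed
qed

section \<open>Vector-valued functions of time\<close>

lemma simple_function_inner:
  assumes I: "I \<in> sets lebesgue" and w: "L2_on \<Omega> w" and s: "simple_on I (L2_space \<Omega>) s"
  shows "L2_on \<Omega> (simple_val s t)" "L2_on \<Omega> (simple_int s)"
    "integrable (lebesgue_on I) (\<lambda>t. L2_inner \<Omega> (simple_val s t) w)"
    "(LINT t|lebesgue_on I. L2_inner \<Omega> (simple_val s t) w) = L2_inner \<Omega> (simple_int s) w"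
proof -
  have "(\<forall>t. L2_on \<Omega> (simple_val s t)) \<and> L2_on \<Omega> (simple_int s) \<and>
    integrable (lebesgue_on I) (\<lambda>t. L2_inner \<Omega> (simple_val s t) w) \<and>
    (LINT t|lebesgue_on I. L2_inner \<Omega> (simple_val s t) w) = L2_inner \<Omega> (simple_int s) w"
    using s
  proof (induction s)
    case Nil
    show ?case by (simp add: simple_val_def[abs_def] simple_int_def[abs_def] L2_inner_def)
  next
    case (Cons p s)
    obtain E v where p: "p = (E, v)" by (cases p) auto
    have E: "E \<in> lmeasurable" "E \<subseteq> I" "L2_on \<Omega> v" and s: "simple_on I (L2_space \<Omega>) s"
      using Cons.prems by (auto simp: simple_on_def p L2_space_def)
    note IH = Cons.IH[OF s]
    have sv: "simple_val (p # s) t = (\<lambda>x. (indicator E t *\<^sub>R v x) + simple_val s t x)" for t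
      by (simp add: simple_val_def p fun_eq_iff)
    have si: "simple_int (p # s) = (\<lambda>x. (measure lebesgue E *\<^sub>R v x) + simple_int s x)"
      by (simp add: simple_int_def p fun_eq_iff)
    have inner: "L2_inner \<Omega> (simple_val (p # s) t) w = indicator E t * L2_inner \<Omega> v w + L2_inner \<Omega> (simple_val s t) w" for t
      unfolding sv using E(3) w IH by (simp add: L2_inner_add_left L2_on_scaleR L2_inner_scaleR_left)
    have eq: "(\<lambda>t. indicator I t *\<^sub>R indicator E t) = (indicator E :: real \<Rightarrow> real)"
      using E(2) by (auto simp: indicator_def fun_eq_iff)
    have ind: "integrable (lebesgue_on I) (indicator E :: real \<Rightarrow> real)"
      unfolding integrable_lebesgue_on_iff[OF I] eq using E(1) by (simp add: lmeasurable_iff_integrable)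
    have "(LINT t|lebesgue_on I. indicator E t :: real) = measure lebesgue E"
      unfolding integral_lebesgue_on_eq[OF I] eq by simp
    then show ?case
      using IH E(3) w ind unfolding inner unfolding sv si
      by (simp add: L2_on_add L2_on_scaleR L2_inner_add_left L2_inner_scaleR_left)
  qed
  then show "L2_on \<Omega> (simple_val s t)" "L2_on \<Omega> (simple_int s)"
    "integrable (lebesgue_on I) (\<lambda>t. L2_inner \<Omega> (simple_val s t) w)"
    "(LINT t|lebesgue_on I. L2_inner \<Omega> (simple_val s t) w) = L2_inner \<Omega> (simple_int s) w" by auto
qed

text \<open>The norm \<open>t \<mapsto> \<parallel>f t\<parallel>\<close> is not
  known to be measurable here, so the functional is normalised by \<open>c\<close> to compare upper integrals.\<close>

lemma Bochner_integral_inner: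
  assumes I: "I \<in> sets lebesgue" and w: "L2_on \<Omega> w" and B: "has_Bochner_integral_on I (L2_space \<Omega>) f y"
  shows "(LINT t|lebesgue_on I. L2_inner \<Omega> (f t) w) = L2_inner \<Omega> y w"
proof -
  define h where "h t = L2_inner \<Omega> (f t) w" for t
  define c where "c = L2_norm_on \<Omega> w + 1"
  have c: "c > 0" "L2_norm_on \<Omega> w \<le> c" by (auto simp: c_def add_nonneg_pos)
  have fL: "AE t in lebesgue_on I. L2_on \<Omega> (f t)" and y: "L2_on \<Omega> y"
    using B by (auto simp: has_Bochner_integral_on_def strongly_measurable_on_def L2_space_def)
  obtain r where r: "\<And>k. simple_on I (L2_space \<Omega>) (r k)"
    "AE t in lebesgue_on I. (\<lambda>k::nat. L2_norm_on \<Omega> (\<lambda>x. f t x - simple_val (r k) t x)) \<longlonglongrightarrow> 0"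
    using B by (auto simp: has_Bochner_integral_on_def strongly_measurable_on_def L2_space_def)
  obtain s where s: "\<And>k. simple_on I (L2_space \<Omega>) (s k)"
    "(\<lambda>k::nat. \<integral>\<^sup>+ t. ennreal (L2_norm_on \<Omega> (\<lambda>x. f t x - simple_val (s k) t x)) \<partial>lebesgue_on I) \<longlonglongrightarrow> 0"
    "(\<lambda>k. L2_norm_on \<Omega> (\<lambda>x. simple_int (s k) x - y x)) \<longlonglongrightarrow> 0"
    using B by (auto simp: has_Bochner_integral_on_def L2_space_def)
  note simp_r = simple_function_inner[OF I w r(1)] and simp_s = simple_function_inner[OF I w s(1)]
  have "AE t in lebesgue_on I. (\<lambda>k. L2_inner \<Omega> (simple_val (r k) t) w) \<longlonglongrightarrow> h t"
    using r(2) fL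
  proof eventually_elim
    case (elim t)
    then show ?case unfolding h_def
      by (intro L2_inner_tendsto simp_r w) (simp_all add: L2_norm_diff_commute[of \<Omega> "simple_val _ t"])
  qed
  then have lim: "AE t in lebesgue_on I. lim (\<lambda>k. L2_inner \<Omega> (simple_val (r k) t) w) = h t"
    by eventually_elim (simp add: limI)
  have hm: "h \<in> borel_measurable (lebesgue_on I)"
    by (rule AE_measurable_lebesgue_on[OF I _ lim])
      (intro borel_measurable_lim_metric borel_measurable_integrable simp_r(3))
  define h' where "h' k t = L2_inner \<Omega> (simple_val (s k) t) w" for k t
  have h'i: "integrable (lebesgue_on I) (h' k)" for k unfolding h'_def by (rule simp_s(3))
  have bound: "AE t in lebesgue_on I. ennreal (norm (h' k t / c - h t / c))
      \<le> ennreal (L2_norm_on \<Omega> (\<lambda>x. f t x - simple_val (s k) t x))" for k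
    using fL
  proof eventually_elim
    case (elim t)
    have "\<bar>h' k t - h t\<bar> = \<bar>L2_inner \<Omega> (\<lambda>x. f t x - simple_val (s k) t x) w\<bar>"
      unfolding h_def h'_def L2_inner_diff_left[OF elim simp_s(1) w] by simp
    also have "\<dots> \<le> L2_norm_on \<Omega> (\<lambda>x. f t x - simple_val (s k) t x) * L2_norm_on \<Omega> w"
      by (intro L2_Cauchy_Schwarz L2_on_diff elim simp_s(1) w)
    also have "\<dots> \<le> L2_norm_on \<Omega> (\<lambda>x. f t x - simple_val (s k) t x) * c"
      by (intro mult_left_mono c) simp
    finally have "\<bar>h' k t - h t\<bar> / c \<le> L2_norm_on \<Omega> (\<lambda>x. f t x - simple_val (s k) t x)"
      using c(1) by (subst pos_divide_le_eq) auto
    then show ?case using c(1)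
      by (intro ennreal_leI) (simp add: diff_divide_distrib[symmetric] abs_divide)
  qed
  have L1: "(\<lambda>k. \<integral>\<^sup>+ t. ennreal (norm (h' k t / c - h t / c)) \<partial>lebesgue_on I) \<longlonglongrightarrow> 0"
  proof (rule tendsto_sandwich[OF _ _ tendsto_const s(2)])
    show "eventually (\<lambda>k. (\<integral>\<^sup>+ t. ennreal (norm (h' k t / c - h t / c)) \<partial>lebesgue_on I)
        \<le> (\<integral>\<^sup>+ t. ennreal (L2_norm_on \<Omega> (\<lambda>x. f t x - simple_val (s k) t x)) \<partial>lebesgue_on I)) sequentially"
      by (intro always_eventually allI nn_integral_mono_AE bound)
  qed simp
  have hi: "integrable (lebesgue_on I) (\<lambda>t. h t / c)"
  proof -
    have "eventually (\<lambda>k. (\<integral>\<^sup>+ t. ennreal (norm (h' k t / c - h t / c)) \<partial>lebesgue_on I) < 1) sequentially"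
      using order_tendstoD(2)[OF L1, of 1] by simp
    then obtain k where "(\<integral>\<^sup>+ t. ennreal (norm (h' k t / c - h t / c)) \<partial>lebesgue_on I) < 1"
      by (auto simp: eventually_sequentially)
    then have fin: "(\<integral>\<^sup>+ t. ennreal (norm (h' k t / c - h t / c)) \<partial>lebesgue_on I) < \<infinity>"
      by (rule order.strict_trans) simp
    have "integrable (lebesgue_on I) (\<lambda>t. h' k t / c - h t / c)"
      by (rule integrableI_bounded[OF _ fin]) (intro borel_measurable_diff borel_measurable_divide borel_measurable_const hm borel_measurable_integrable h'i)
    from Bochner_Integration.integrable_diff[OF integrable_divide[OF h'i[of k]] this, of c]
    show ?thesis by (simp add: algebra_simps)
  qed
  have "(\<lambda>k. LINT t|lebesgue_on I. h' k t / c) \<longlonglongrightarrow> (LINT t|lebesgue_on I. h t / c)"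
    by (rule tendsto_L1_int[OF _ hi L1]) (intro integrable_divide h'i)
  then have "(\<lambda>k. c * ((LINT t|lebesgue_on I. h' k t) / c)) \<longlonglongrightarrow> c * ((LINT t|lebesgue_on I. h t) / c)"
    by (intro tendsto_mult_left) simp
  then have "(\<lambda>k. LINT t|lebesgue_on I. h' k t) \<longlonglongrightarrow> (LINT t|lebesgue_on I. h t)"
    using c(1) by simp
  moreover have "(\<lambda>k. LINT t|lebesgue_on I. h' k t) \<longlonglongrightarrow> L2_inner \<Omega> y w"
    unfolding h'_def simp_s(4) by (rule L2_inner_tendsto[OF simp_s(2) y w s(3)])
  ultimately show ?thesis unfolding h_def by (rule LIMSEQ_unique)
qed

lemma weak_tderiv_inner:
  assumes I: "I \<in> sets lebesgue" and w: "L2_on \<Omega> w"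
    and d: "is_weak_tderiv I (L2_space \<Omega>) f g" and \<phi>: "test_function I \<phi>"
  shows "(LINT t|lebesgue_on I. deriv \<phi> t * L2_inner \<Omega> (f t) w) = - (LINT t|lebesgue_on I. \<phi> t * L2_inner \<Omega> (g t) w)"
proof -
  obtain y where y: "has_Bochner_integral_on I (L2_space \<Omega>) (\<lambda>t x. deriv \<phi> t *\<^sub>R f t x) y"
    "has_Bochner_integral_on I (L2_space \<Omega>) (\<lambda>t x. \<phi> t *\<^sub>R g t x) (\<lambda>x. - y x)"
    using d \<phi> unfolding is_weak_tderiv_def by blast
  have "L2_inner \<Omega> (\<lambda>x. - y x) w = - L2_inner \<Omega> y w" by (simp add: L2_inner_def)
  then show ?thesis
    using Bochner_integral_inner[OF I w y(1)] Bochner_integral_inner[OF I w y(2)]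
    by (simp add: L2_inner_scaleR_left)
qed

lemma continuous_AE_le_imp_le:
  fixes f :: "real \<Rightarrow> real"
  assumes f: "continuous_on {0<..} f" and ae: "AE t in lebesgue_on {0<..}. f t \<le> C" and t: "0 < t"
  shows "f t \<le> C"
proof (rule ccontr)
  assume "\<not> f t \<le> C"
  let ?N = "{0<..} \<inter> f -` {C<..}"
  have "open ?N" by (rule continuous_open_preimage[OF f]) auto
  moreover have "t \<in> ?N" using t \<open>\<not> f t \<le> C\<close> by simp
  ultimately have "\<not> negligible ?N" using open_not_negligible by blast
  moreover have "?N \<in> null_sets lebesgue"
  proof -
    have "AE t in lebesgue. t \<notin> ?N"
      using ae unfolding AE_lebesgue_on_iff[OF open_sets_lebesgue[OF open_greaterThan]]
      by eventually_elim auto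
    then show ?thesis using AE_iff_null_sets[OF open_sets_lebesgue[OF \<open>open ?N\<close>]] by simp
  qed
  ultimately show False by (simp add: negligible_iff_null_sets)
qed

section \<open>Decaying divergence-free parts vanish\<close>

context smooth_domain
begin

text \<open>The divergence-free part \<open>g\<close> of a test field \<open>v\<close> need not be a test field itself. It differs from \<open>v\<close> by a
  gradient, and the field tested in \<open>momentum_smooth_test\<close> is orthogonal to gradients because they have no
  rotation. The remaining gradients in that field are orthogonal to \<open>g\<close>.\<close>

lemma momentum_divfree_part:
  assumes conv: "convex \<Omega>" and a: "L2_on \<Omega> a" and u: "Hk_on 1 \<Omega> u" "Hk_on 1 \<Omega> (weak_div \<Omega> u)" and th: "Hk_on 1 \<Omega> \<theta>"
    and eq: "\<And>\<phi>. Hk_on 1 \<Omega> \<phi> \<Longrightarrow> tangential_trace \<Omega> \<phi> \<Longrightarrow>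
      L2_inner \<Omega> a \<phi> + \<kappa> * L2_inner \<Omega> (weak_div \<Omega> u) (weak_div \<Omega> \<phi>) + m * L2_inner \<Omega> (weak_rot \<Omega> u) (weak_rot \<Omega> \<phi>)
      = - \<nu> * L2_inner \<Omega> (weak_grad \<Omega> \<theta>) \<phi>"
    and v: "Hk_on 1 \<Omega> v" "smooth_approximation v W"
    and g: "L2_on \<Omega> g" "\<And>\<psi>. Hk_on 1 \<Omega> \<psi> \<Longrightarrow> L2_inner \<Omega> g (weak_grad \<Omega> \<psi>) = 0"
    and \<phi>: "Hk_on 1 \<Omega> \<phi>" "AE x in lebesgue_on \<Omega>. v x = g x + weak_grad \<Omega> \<phi> x"
  shows "L2_inner \<Omega> a g = - m * L2_inner \<Omega> (weak_rot \<Omega> u) (weak_rot \<Omega> v)"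
proof -
  define F where "F x = a x + \<nu> *\<^sub>R weak_grad \<Omega> \<theta> x - \<kappa> *\<^sub>R weak_grad \<Omega> (weak_div \<Omega> u) x" for x
  note L = L2_weak_grad[OF th] L2_weak_grad[OF u(2)]
  have F: "L2_on \<Omega> F" unfolding F_def by (intro L2_on_diff L2_on_add L2_on_scaleR a L)
  have test: "L2_inner \<Omega> F V = - m * L2_inner \<Omega> (weak_rot \<Omega> u) (weak_rot \<Omega> V)" if "smooth_on UNIV V" for V
    unfolding F_def using momentum_smooth_test[OF a u th eq that] .
  have W: "\<And>k. smooth_on UNIV (W k)" "(\<lambda>k. L2_norm_on \<Omega> (\<lambda>x. W k x - v x)) \<longlonglongrightarrow> 0"
      "(\<lambda>k. L2_norm_on \<Omega> (\<lambda>x. weak_rot \<Omega> (W k) x - weak_rot \<Omega> v x)) \<longlonglongrightarrow> 0"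
    using v(2) unfolding smooth_approximation_def by auto
  note H1W = H1_smooth(1)[OF W(1)]
  have "(\<lambda>k. L2_inner \<Omega> (W k) F) \<longlonglongrightarrow> L2_inner \<Omega> v F"
    by (rule L2_inner_tendsto[OF H1_L2[OF H1W] H1_L2[OF v(1)] F W(2)])
  moreover have "(\<lambda>k. - m * L2_inner \<Omega> (weak_rot \<Omega> (W k)) (weak_rot \<Omega> u)) \<longlonglongrightarrow> - m * L2_inner \<Omega> (weak_rot \<Omega> v) (weak_rot \<Omega> u)"
    by (intro tendsto_mult_left L2_inner_tendsto[OF L2_weak_rot[OF H1W] L2_weak_rot[OF v(1)] L2_weak_rot[OF u(1)] W(3)])
  moreover have "L2_inner \<Omega> (W k) F = - m * L2_inner \<Omega> (weak_rot \<Omega> (W k)) (weak_rot \<Omega> u)" for k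
    using test[OF W(1)[of k]] by (simp only: L2_inner_commute[of \<Omega> _ F] L2_inner_commute[of \<Omega> _ "weak_rot \<Omega> u"])
  ultimately have Fv: "L2_inner \<Omega> v F = - m * L2_inner \<Omega> (weak_rot \<Omega> v) (weak_rot \<Omega> u)"
    by (simp add: LIMSEQ_unique)
  have "L2_inner \<Omega> F (gradient \<psi>) = 0" if s: "smooth_on UNIV \<psi>" for \<psi> :: "real^'n \<Rightarrow> real"
  proof -
    have sg: "smooth_on UNIV (gradient \<psi>)" by (intro smooth_on_gradient s open_UNIV)
    have "AE x in lebesgue_on \<Omega>. weak_rot \<Omega> (gradient \<psi>) x = 0"
      using weak_rot_smooth[OF sg] by eventually_elim (simp add: vec_eq_iff pderiv_at_gradient_commute[OF s])
    then have "L2_inner \<Omega> (weak_rot \<Omega> u) (weak_rot \<Omega> (gradient \<psi>)) = L2_inner \<Omega> (weak_rot \<Omega> u) (\<lambda>x. 0)"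
      by (intro inner_cong_AE) auto
    then show ?thesis using test[OF sg] by (simp add: L2_inner_def)
  qed
  note F0 = orthogonal_to_weak_grad[OF conv F this \<phi>(1)]
  have "L2_inner \<Omega> v F = L2_inner \<Omega> (\<lambda>x. g x + weak_grad \<Omega> \<phi> x) F"
    by (intro inner_cong_AE \<phi>(2)) auto
  also have "\<dots> = L2_inner \<Omega> g F"
    using F0 L2_inner_add_left[OF g(1) L2_weak_grad[OF \<phi>(1)] F] L2_inner_commute[of \<Omega> F] by simp
  also have "\<dots> = L2_inner \<Omega> g a + \<nu> * L2_inner \<Omega> g (weak_grad \<Omega> \<theta>) - \<kappa> * L2_inner \<Omega> g (weak_grad \<Omega> (weak_div \<Omega> u))"
    unfolding F_def by (simp add: L2_inner_diff_right L2_inner_add_right L2_inner_scaleR_right L2_on_add L2_on_scaleR g(1) a L)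
  also have "\<dots> = L2_inner \<Omega> a g" using g(2)[OF th] g(2)[OF u(2)] by (simp add: L2_inner_commute)
  finally show ?thesis using Fv by (simp add: L2_inner_commute)
qed

text \<open>Pairing the equation for \<open>\<gamma>\<close> with \<open>\<gamma> s\<close> gives the symmetric kernel \<open>\<langle>\<gamma> t, \<gamma> s\<rangle>\<close> to which the
  Wronskian argument applies. All estimates for \<open>\<gamma>\<close> come from those for \<open>u\<close>: continuity in time by the
  Poincare inequality, Lipschitz continuity by the bound on the velocity.\<close>

lemma decaying_divfree_part_vanishes:
  fixes u v \<gamma> :: "real \<Rightarrow> real^'n \<Rightarrow> real^'n"
  assumes conv: "convex \<Omega>" and dim: "CARD('n) \<le> 3" and m: "m > 0"
    and u: "\<And>t. 0 < t \<Longrightarrow> Hk_on 1 \<Omega> (u t)" "\<And>t. 0 < t \<Longrightarrow> \<exists>W. smooth_approximation (u t) W"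
    and g: "\<And>t. 0 < t \<Longrightarrow> L2_on \<Omega> (\<gamma> t)" "\<And>t \<psi>. 0 < t \<Longrightarrow> Hk_on 1 \<Omega> \<psi> \<Longrightarrow> L2_inner \<Omega> (\<gamma> t) (weak_grad \<Omega> \<psi>) = 0"
      "\<And>t. 0 < t \<Longrightarrow> \<exists>\<phi>. Hk_on 1 \<Omega> \<phi> \<and> (AE x in lebesgue_on \<Omega>. u t x = \<gamma> t x + weak_grad \<Omega> \<phi> x)"
    and rot: "\<And>t. 0 < t \<Longrightarrow> ((\<lambda>s. L2_norm_on \<Omega> (\<lambda>x. weak_rot \<Omega> (u s) x - weak_rot \<Omega> (u t) x)) \<longlongrightarrow> 0) (at t)"
    and v: "\<And>t. 0 < t \<Longrightarrow> L2_on \<Omega> (v t)" "\<And>t. 0 < t \<Longrightarrow> L2_norm_on \<Omega> (v t) \<le> M"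
      "\<And>t. 0 < t \<Longrightarrow> ((\<lambda>s. L2_norm_on \<Omega> (\<lambda>x. v s x - v t x)) \<longlongrightarrow> 0) (at t)"
    and weak1: "\<And>w \<phi>. L2_on \<Omega> w \<Longrightarrow> test_function {0<..} \<phi> \<Longrightarrow>
      (LINT t|lebesgue_on {0<..}. deriv \<phi> t * L2_inner \<Omega> (u t) w) = - (LINT t|lebesgue_on {0<..}. \<phi> t * L2_inner \<Omega> (v t) w)"
    and weak2: "\<And>s \<phi>. 0 < s \<Longrightarrow> test_function {0<..} \<phi> \<Longrightarrow>
      (LINT t|lebesgue_on {0<..}. deriv \<phi> t * L2_inner \<Omega> (v t) (\<gamma> s))
      = - (LINT t|lebesgue_on {0<..}. \<phi> t * (- m * L2_inner \<Omega> (weak_rot \<Omega> (u t)) (weak_rot \<Omega> (u s))))"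
    and decay: "((\<lambda>t. L2_norm_on \<Omega> (\<gamma> t)) \<longlongrightarrow> 0) at_top"
    and t: "0 < t"
  shows "AE x in lebesgue_on \<Omega>. \<gamma> t x = 0"
proof -
  define k where "k t s = L2_inner \<Omega> (\<gamma> t) (\<gamma> s)" for t s
  define K where "K t s = L2_inner \<Omega> (v t) (\<gamma> s)" for t s
  define c where "c t s = L2_inner \<Omega> (weak_rot \<Omega> (u t)) (weak_rot \<Omega> (u s))" for t s
  note R = L2_weak_rot[OF u(1)]
  have uL: "L2_on \<Omega> (u t)" if "0 < t" for t using H1_L2[OF u(1)[OF that]] .
  have M: "0 \<le> M" using v(2)[OF t] L2_norm_on_nonneg[of \<Omega> "v t"] by linarith
  have proj: "L2_inner \<Omega> (u t) h = L2_inner \<Omega> (\<gamma> t) h"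
    if "0 < t" and h: "L2_on \<Omega> h" "\<And>\<psi>. Hk_on 1 \<Omega> \<psi> \<Longrightarrow> L2_inner \<Omega> h (weak_grad \<Omega> \<psi>) = 0" for t h
  proof -
    obtain \<phi> where \<phi>: "Hk_on 1 \<Omega> \<phi>" "AE x in lebesgue_on \<Omega>. u t x = \<gamma> t x + weak_grad \<Omega> \<phi> x"
      using g(3)[OF \<open>0 < t\<close>] by blast
    have "L2_inner \<Omega> (u t) h = L2_inner \<Omega> (\<lambda>x. \<gamma> t x + weak_grad \<Omega> \<phi> x) h"
      by (intro inner_cong_AE \<phi>(2)) auto
    also have "\<dots> = L2_inner \<Omega> (\<gamma> t) h"
      using h(2)[OF \<phi>(1)] L2_inner_add_left[OF g(1)[OF \<open>0 < t\<close>] L2_weak_grad[OF \<phi>(1)] h(1)] L2_inner_commute[of \<Omega> h] by simp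
    finally show ?thesis .
  qed
  have gd: "L2_on \<Omega> (\<lambda>x. \<gamma> s x - \<gamma> t x)"
      "\<And>\<psi>. Hk_on 1 \<Omega> \<psi> \<Longrightarrow> L2_inner \<Omega> (\<lambda>x. \<gamma> s x - \<gamma> t x) (weak_grad \<Omega> \<psi>) = 0" if "0 < s" "0 < t" for s t
    using that by (auto intro!: L2_on_diff g(1) simp: L2_inner_diff_left g L2_weak_grad)
  have ku: "L2_inner \<Omega> (u t) (\<gamma> s) = k t s" if "0 < t" "0 < s" for t s
    unfolding k_def using that by (intro proj g) auto
  obtain C where C: "C \<ge> 0" "\<And>w W h. Hk_on 1 \<Omega> w \<Longrightarrow> smooth_approximation w W \<Longrightarrow> L2_on \<Omega> h \<Longrightarrow>
      (\<And>\<psi>. Hk_on 1 \<Omega> \<psi> \<Longrightarrow> L2_inner \<Omega> h (weak_grad \<Omega> \<psi>) = 0) \<Longrightarrow>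
      \<bar>L2_inner \<Omega> w h\<bar> \<le> C * L2_norm_on \<Omega> (weak_rot \<Omega> w) * L2_norm_on \<Omega> h"
    using Poincare_rotation[OF conv dim] by blast
  have gdiff: "L2_norm_on \<Omega> (\<lambda>x. \<gamma> s x - \<gamma> t x) \<le> C * L2_norm_on \<Omega> (\<lambda>x. weak_rot \<Omega> (u s) x - weak_rot \<Omega> (u t) x)"
    if st: "0 < s" "0 < t" for s t
  proof -
    let ?h = "\<lambda>x. \<gamma> s x - \<gamma> t x" and ?w = "\<lambda>x. u s x - u t x"
    obtain W Z where "smooth_approximation (u s) W" "smooth_approximation (u t) Z" using u(2) st by blast
    then have app: "smooth_approximation ?w (\<lambda>k x. W k x - Z k x)"
      by (intro smooth_approximation_diff u(1) st)
    have "L2_inner \<Omega> (u s) ?h = L2_inner \<Omega> (\<gamma> s) ?h" "L2_inner \<Omega> (u t) ?h = L2_inner \<Omega> (\<gamma> t) ?h"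
      by (intro proj gd st; assumption)+
    then have "(L2_norm_on \<Omega> ?h)\<^sup>2 = L2_inner \<Omega> ?w ?h"
      unfolding L2_norm_on_square L2_inner_diff_left[OF g(1)[OF st(1)] g(1)[OF st(2)] gd(1)[OF st]]
          L2_inner_diff_left[OF uL[OF st(1)] uL[OF st(2)] gd(1)[OF st]] by simp
    also have "\<dots> \<le> C * L2_norm_on \<Omega> (weak_rot \<Omega> ?w) * L2_norm_on \<Omega> ?h"
      using C(2)[OF H1_diff(1)[OF u(1)[OF st(1)] u(1)[OF st(2)]] app gd[OF st]] by linarith
    also have "L2_norm_on \<Omega> (weak_rot \<Omega> ?w) = L2_norm_on \<Omega> (\<lambda>x. weak_rot \<Omega> (u s) x - weak_rot \<Omega> (u t) x)"
      by (rule norm_cong_AE) (rule weak_rot_diff[OF u(1)[OF st(1)] u(1)[OF st(2)]])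
    finally have le: "L2_norm_on \<Omega> ?h * L2_norm_on \<Omega> ?h \<le> C * L2_norm_on \<Omega> (\<lambda>x. weak_rot \<Omega> (u s) x - weak_rot \<Omega> (u t) x) * L2_norm_on \<Omega> ?h"
      by (simp add: power2_eq_square)
    show ?thesis
    proof (cases "L2_norm_on \<Omega> ?h = 0")
      case True
      then show ?thesis using C(1) by simp
    next
      case False
      then have "L2_norm_on \<Omega> ?h > 0" using L2_norm_on_nonneg[of \<Omega> ?h] by linarith
      then show ?thesis using le by (rule mult_right_le_imp_le[rotated])
    qed
  qed
  have near: "eventually (\<lambda>s. 0 < s) (at t)" if "0 < t" for t :: real
    using that by (intro eventually_at_topological[THEN iffD2] exI[of _ "{0<..}"]) auto
  have gcont: "((\<lambda>s. L2_norm_on \<Omega> (\<lambda>x. \<gamma> s x - \<gamma> t x)) \<longlongrightarrow> 0) (at t)" if "0 < t" for t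
  proof (rule Lim_null_comparison)
    show "eventually (\<lambda>s. norm (L2_norm_on \<Omega> (\<lambda>x. \<gamma> s x - \<gamma> t x)) \<le> C * L2_norm_on \<Omega> (\<lambda>x. weak_rot \<Omega> (u s) x - weak_rot \<Omega> (u t) x)) (at t)"
      using near[OF that] by eventually_elim (use gdiff that in simp)
    show "((\<lambda>s. C * L2_norm_on \<Omega> (\<lambda>x. weak_rot \<Omega> (u s) x - weak_rot \<Omega> (u t) x)) \<longlongrightarrow> 0) (at t)"
      using tendsto_mult_left[OF rot[OF that], of C] by simp
  qed
  have cont: "continuous_on {0<..} (\<lambda>s. L2_inner \<Omega> (f s) h)"
    if f: "\<And>t. 0 < t \<Longrightarrow> L2_on \<Omega> (f t)" and h: "L2_on \<Omega> h"
      and lim: "\<And>t. 0 < t \<Longrightarrow> ((\<lambda>s. L2_norm_on \<Omega> (\<lambda>x. f s x - f t x)) \<longlongrightarrow> 0) (at t)"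
    for f :: "real \<Rightarrow> real^'n \<Rightarrow> 'b::euclidean_space" and h
    unfolding continuous_on_eq_continuous_at[OF open_greaterThan] isCont_def
  proof
    fix t :: real assume "t \<in> {0<..}"
    then have t: "0 < t" by simp
    let ?f = "\<lambda>s. if 0 < s then f s else f t"
    have "((\<lambda>s. L2_norm_on \<Omega> (\<lambda>x. ?f s x - f t x)) \<longlongrightarrow> 0) (at t)"
      by (rule Lim_transform_eventually[OF lim[OF t]]) (use near[OF t] in eventually_elim, simp)
    then have "((\<lambda>s. L2_inner \<Omega> (?f s) h) \<longlongrightarrow> L2_inner \<Omega> (f t) h) (at t)"
      by (rule L2_inner_tendsto[rotated 3]) (use f t h in auto)
    then show "((\<lambda>s. L2_inner \<Omega> (f s) h) \<longlongrightarrow> L2_inner \<Omega> (f t) h) (at t)"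
      by (rule Lim_transform_eventually) (use near[OF t] in eventually_elim, simp)
  qed
  have dk: "((\<lambda>t. k t s) has_real_derivative K t s) (at t)" if ts: "0 < t" "0 < s" for t s
  proof (rule weak_derivative_imp_derivative[OF _ _ _ ts(1)])
    show "continuous_on {0<..} (\<lambda>t. k t s)" unfolding k_def by (intro cont g(1) gcont ts)
    show "continuous_on {0<..} (\<lambda>t. K t s)" unfolding K_def by (intro cont v(1,3) g(1) ts)
    fix \<phi> :: "real \<Rightarrow> real" assume \<phi>: "test_function {0<..} \<phi>"
    have "(LINT t|lebesgue_on {0<..}. deriv \<phi> t * k t s) = (LINT t|lebesgue_on {0<..}. deriv \<phi> t * L2_inner \<Omega> (u t) (\<gamma> s))"
      using ku ts(2) by (intro Bochner_Integration.integral_cong) auto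
    then show "(LINT t|lebesgue_on {0<..}. deriv \<phi> t * k t s) = - (LINT t|lebesgue_on {0<..}. \<phi> t * K t s)"
      unfolding K_def using weak1[OF g(1)[OF ts(2)] \<phi>] by simp
  qed
  have dK: "((\<lambda>t. K t s) has_real_derivative - m * c t s) (at t)" if ts: "0 < t" "0 < s" for t s
  proof (rule weak_derivative_imp_derivative[OF _ _ _ ts(1)])
    show "continuous_on {0<..} (\<lambda>t. K t s)" unfolding K_def by (intro cont v(1,3) g(1) ts)
    show "continuous_on {0<..} (\<lambda>t. - m * c t s)" unfolding c_def by (intro continuous_intros cont R rot ts)
    show "(LINT t|lebesgue_on {0<..}. deriv \<phi> t * K t s) = - (LINT t|lebesgue_on {0<..}. \<phi> t * (- m * c t s))"
      if "test_function {0<..} \<phi>" for \<phi>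
      unfolding K_def c_def by (rule weak2[OF ts(2) that])
  qed
  have kk: "k s s - k s t - k t s + k t t = (L2_norm_on \<Omega> (\<lambda>x. \<gamma> s x - \<gamma> t x))\<^sup>2" if st: "0 < s" "0 < t" for s t
    unfolding L2_norm_on_square k_def
    by (simp add: L2_inner_diff_left[OF g(1)[OF st(1)] g(1)[OF st(2)] gd(1)[OF st]] L2_inner_diff_right g(1) st)
  have ksym: "k t s = k s t" for t s unfolding k_def by (rule L2_inner_commute)
  have lip: "L2_norm_on \<Omega> (\<lambda>x. \<gamma> s x - \<gamma> t x) \<le> M * (s - t)" if st: "0 < t" "t < s" for s t
  proof -
    have s: "0 < s" using st by simp
    let ?h = "\<lambda>x. \<gamma> s x - \<gamma> t x"
    have "\<exists>z. t < z \<and> z < s \<and> (k s s - k s t) - (k t s - k t t) = (s - t) * (K z s - K z t)"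
      by (rule MVT2[OF st(2)]) (use st in \<open>auto intro!: DERIV_diff dk\<close>)
    then obtain z where z: "t < z" "z < s" "(k s s - k s t) - (k t s - k t t) = (s - t) * (K z s - K z t)" by blast
    have z0: "0 < z" using z st by simp
    have "L2_norm_on \<Omega> ?h * L2_norm_on \<Omega> ?h = (s - t) * (K z s - K z t)"
      using kk[OF s st(1)] z(3) by (simp add: power2_eq_square)
    also have "K z s - K z t = L2_inner \<Omega> (v z) ?h"
      unfolding K_def by (simp add: L2_inner_diff_right v(1) z0 g(1) s st)
    also have "(s - t) * L2_inner \<Omega> (v z) ?h \<le> (s - t) * (M * L2_norm_on \<Omega> ?h)"
    proof (intro mult_left_mono)
      have "L2_inner \<Omega> (v z) ?h \<le> L2_norm_on \<Omega> (v z) * L2_norm_on \<Omega> ?h"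
        using L2_Cauchy_Schwarz[OF v(1)[OF z0] gd(1)[OF s st(1)]] by linarith
      also have "\<dots> \<le> M * L2_norm_on \<Omega> ?h" by (intro mult_right_mono v(2) z0) simp
      finally show "L2_inner \<Omega> (v z) ?h \<le> M * L2_norm_on \<Omega> ?h" .
    qed (use st in simp)
    finally have le: "L2_norm_on \<Omega> ?h * L2_norm_on \<Omega> ?h \<le> M * (s - t) * L2_norm_on \<Omega> ?h" by (simp add: mult_ac)
    show ?thesis
    proof (cases "L2_norm_on \<Omega> ?h = 0")
      case True
      then show ?thesis using M st by simp
    next
      case False
      then have "L2_norm_on \<Omega> ?h > 0" using L2_norm_on_nonneg[of \<Omega> ?h] by linarith
      then show ?thesis using le by (rule mult_right_le_imp_le[rotated])
    qed
  qed
  have lip': "L2_norm_on \<Omega> (\<lambda>x. \<gamma> s x - \<gamma> t x) \<le> M * \<bar>s - t\<bar>" if "0 < s" "0 < t" for s t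
  proof (cases s t rule: linorder_cases)
    case less
    then show ?thesis using lip[OF that(1) less] by (simp add: L2_norm_diff_commute[of \<Omega> "\<gamma> s"])
  next
    case greater
    then show ?thesis using lip[OF that(2) greater] by simp
  qed (simp add: L2_norm_on_def)
  have "c t t \<le> 0"
  proof (rule Wronskian_argument[where k = k and K = K and c = c, OF m ksym _ dk dK])
    show "c t s = c s t" for t s unfolding c_def by (rule L2_inner_commute)
    show "0 \<le> k t t - 2 * k t s + k s s" if "0 < t" "0 < s" for t s
      using kk[OF that] ksym[of t s] zero_le_power2[of "L2_norm_on \<Omega> (\<lambda>x. \<gamma> t x - \<gamma> s x)"] by linarith
    show "\<exists>d>0. \<forall>x y. \<bar>x - t\<bar> < d \<and> \<bar>y - s\<bar> < d \<longrightarrow> \<bar>c x y - c t s\<bar> \<le> e" if ts: "0 < t" "0 < s" and e: "0 < e" for t s e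
    proof -
      let ?r = "\<lambda>t. L2_norm_on \<Omega> (weak_rot \<Omega> (u t))"
      define \<eta> where "\<eta> = min 1 (e / (?r s + 1 + ?r t))"
      have den: "?r s + 1 + ?r t > 0" using L2_norm_on_nonneg[of \<Omega> "weak_rot \<Omega> (u s)"] L2_norm_on_nonneg[of \<Omega> "weak_rot \<Omega> (u t)"] by linarith
      have \<eta>: "\<eta> > 0" "\<eta> \<le> 1" using e den by (auto simp: \<eta>_def)
      have \<eta>e: "\<eta> * (?r s + 1 + ?r t) \<le> e"
      proof -
        have "\<eta> \<le> e / (?r s + 1 + ?r t)" by (simp add: \<eta>_def)
        then show ?thesis using den by (simp add: pos_le_divide_eq)
      qed
      have rotd: "\<exists>d>0. \<forall>x. \<bar>x - t\<bar> < d \<longrightarrow> 0 < x \<and> L2_norm_on \<Omega> (\<lambda>y. weak_rot \<Omega> (u x) y - weak_rot \<Omega> (u t) y) \<le> \<eta>" if t: "0 < t" for t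
      proof -
        obtain d where d: "d > 0" "\<And>x. x \<noteq> t \<Longrightarrow> \<bar>x - t\<bar> < d \<Longrightarrow> L2_norm_on \<Omega> (\<lambda>y. weak_rot \<Omega> (u x) y - weak_rot \<Omega> (u t) y) < \<eta>"
          using rot[OF t] \<eta>(1) unfolding LIM_def by (auto simp: dist_real_def)
        show ?thesis
        proof (intro exI[of _ "min d t"] conjI allI impI)
          fix x assume x: "\<bar>x - t\<bar> < min d t"
          then show "0 < x" by linarith
          show "L2_norm_on \<Omega> (\<lambda>y. weak_rot \<Omega> (u x) y - weak_rot \<Omega> (u t) y) \<le> \<eta>"
            using d(2)[of x] x \<eta>(1) by (cases "x = t") (auto simp: L2_norm_on_def)
        qed (use d t in auto)
      qed
      obtain d1 where d1: "d1 > 0" "\<And>x. \<bar>x - t\<bar> < d1 \<Longrightarrow> 0 < x \<and> L2_norm_on \<Omega> (\<lambda>y. weak_rot \<Omega> (u x) y - weak_rot \<Omega> (u t) y) \<le> \<eta>"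
        using rotd[OF ts(1)] by blast
      obtain d2 where d2: "d2 > 0" "\<And>x. \<bar>x - s\<bar> < d2 \<Longrightarrow> 0 < x \<and> L2_norm_on \<Omega> (\<lambda>y. weak_rot \<Omega> (u x) y - weak_rot \<Omega> (u s) y) \<le> \<eta>"
        using rotd[OF ts(2)] by blast
      show ?thesis
      proof (intro exI[of _ "min d1 d2"] conjI allI impI)
        fix x y assume xy: "\<bar>x - t\<bar> < min d1 d2 \<and> \<bar>y - s\<bar> < min d1 d2"
        let ?Rx = "weak_rot \<Omega> (u x)" and ?Ry = "weak_rot \<Omega> (u y)" and ?Rt = "weak_rot \<Omega> (u t)" and ?Rs = "weak_rot \<Omega> (u s)"
        have dx: "L2_norm_on \<Omega> (\<lambda>z. ?Rx z - ?Rt z) \<le> \<eta>" "0 < x" using d1(2)[of x] xy by auto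
        have dy: "L2_norm_on \<Omega> (\<lambda>z. ?Ry z - ?Rs z) \<le> \<eta>" "0 < y" using d2(2)[of y] xy by auto
        note LL = R[OF dx(2)] R[OF dy(2)] R[OF ts(1)] R[OF ts(2)]
        have "L2_norm_on \<Omega> ?Ry \<le> L2_norm_on \<Omega> (\<lambda>z. ?Ry z - ?Rs z) + L2_norm_on \<Omega> ?Rs"
          using L2_norm_triangle[OF L2_on_diff[OF LL(2,4)] LL(4)] by simp
        then have Ry: "L2_norm_on \<Omega> ?Ry \<le> ?r s + 1" using dy(1) \<eta>(2) by linarith
        have "\<bar>c x y - c t s\<bar> = \<bar>L2_inner \<Omega> (\<lambda>z. ?Rx z - ?Rt z) ?Ry + L2_inner \<Omega> ?Rt (\<lambda>z. ?Ry z - ?Rs z)\<bar>"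
          unfolding c_def by (simp add: L2_inner_diff_left L2_inner_diff_right LL)
        also have "\<dots> \<le> L2_norm_on \<Omega> (\<lambda>z. ?Rx z - ?Rt z) * L2_norm_on \<Omega> ?Ry + ?r t * L2_norm_on \<Omega> (\<lambda>z. ?Ry z - ?Rs z)"
          by (intro order_trans[OF abs_triangle_ineq] add_mono L2_Cauchy_Schwarz L2_on_diff LL)
        also have "\<dots> \<le> \<eta> * (?r s + 1) + ?r t * \<eta>"
          using \<eta>(1) by (intro add_mono mult_mono dx dy Ry) auto
        also have "\<dots> = \<eta> * (?r s + 1 + ?r t)" by (simp add: algebra_simps)
        finally show "\<bar>c x y - c t s\<bar> \<le> e" using \<eta>e by linarith
      qed (use d1 d2 in auto)
    qed
    show "\<exists>d>0. \<forall>x s s'. \<bar>x - t\<bar> < d \<and> 0 < x \<and> 0 < s \<and> 0 < s' \<longrightarrow>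
        \<bar>(K x s - K x s') - (K t s - K t s')\<bar> \<le> e * \<bar>s - s'\<bar>" if t: "0 < t" and e: "0 < e" for t e
    proof -
      have e': "e / (M + 1) > 0" using e M by simp
      obtain d where d: "d > 0" "\<And>x. x \<noteq> t \<Longrightarrow> \<bar>x - t\<bar> < d \<Longrightarrow> L2_norm_on \<Omega> (\<lambda>y. v x y - v t y) < e / (M + 1)"
        using v(3)[OF t] e' unfolding LIM_def by (auto simp: dist_real_def)
      show ?thesis
      proof (intro exI[of _ d] conjI allI impI)
        fix x s s' :: real assume xs: "\<bar>x - t\<bar> < d \<and> 0 < x \<and> 0 < s \<and> 0 < s'"
        let ?h = "\<lambda>z. \<gamma> s z - \<gamma> s' z"
        have dv: "L2_norm_on \<Omega> (\<lambda>y. v x y - v t y) \<le> e / (M + 1)"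
          using d(2)[of x] xs e' by (cases "x = t") (auto simp: L2_norm_on_def)
        have h: "L2_on \<Omega> ?h" using gd(1)[of s s'] xs by simp
        have "\<bar>(K x s - K x s') - (K t s - K t s')\<bar> = \<bar>L2_inner \<Omega> (\<lambda>y. v x y - v t y) ?h\<bar>"
          unfolding K_def using xs t by (simp add: L2_inner_diff_left[OF _ _ h] L2_inner_diff_right v(1) g(1))
        also have "\<dots> \<le> L2_norm_on \<Omega> (\<lambda>y. v x y - v t y) * L2_norm_on \<Omega> ?h"
          using xs t by (intro L2_Cauchy_Schwarz L2_on_diff v(1) h) auto
        also have "\<dots> \<le> e / (M + 1) * (M * \<bar>s - s'\<bar>)"
          using xs e' by (intro mult_mono dv lip') auto
        also have "\<dots> = e * (M / (M + 1)) * \<bar>s - s'\<bar>" by simp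
        also have "\<dots> \<le> e * 1 * \<bar>s - s'\<bar>"
          using M e by (intro mult_right_mono mult_left_mono) auto
        finally show "\<bar>(K x s - K x s') - (K t s - K t s')\<bar> \<le> e * \<bar>s - s'\<bar>" by simp
      qed (rule d(1))
    qed
    have Kb: "norm (K x y) \<le> M * L2_norm_on \<Omega> (\<gamma> y)" if "0 < x" "0 < y" for x y
    proof -
      have "\<bar>K x y\<bar> \<le> L2_norm_on \<Omega> (v x) * L2_norm_on \<Omega> (\<gamma> y)"
        unfolding K_def using that by (intro L2_Cauchy_Schwarz v(1) g(1))
      also have "\<dots> \<le> M * L2_norm_on \<Omega> (\<gamma> y)" using that by (intro mult_right_mono v(2)) auto
      finally show ?thesis by simp
    qed
    have Md: "((\<lambda>t. M * L2_norm_on \<Omega> (\<gamma> t)) \<longlongrightarrow> 0) at_top"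
      using tendsto_mult_left[OF decay, of M] by simp
    show "((\<lambda>t. K t (t + s)) \<longlongrightarrow> 0) at_top" if "0 < s" for s
    proof (rule Lim_null_comparison)
      show "eventually (\<lambda>t. norm (K t (t + s)) \<le> M * L2_norm_on \<Omega> (\<gamma> (t + s))) at_top"
        using eventually_gt_at_top[of 0] by eventually_elim (use Kb that in auto)
      have "filterlim (\<lambda>t. t + s) at_top at_top" using filterlim_tendsto_add_at_top[OF tendsto_const filterlim_ident, of s] by (simp add: add.commute)
      then show "((\<lambda>t. M * L2_norm_on \<Omega> (\<gamma> (t + s))) \<longlongrightarrow> 0) at_top"
        by (rule filterlim_compose[OF Md])
    qed
    show "((\<lambda>t. K (t + s) t) \<longlongrightarrow> 0) at_top" if "0 < s" for s
    proof (rule Lim_null_comparison[OF _ Md])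
      show "eventually (\<lambda>t. norm (K (t + s) t) \<le> M * L2_norm_on \<Omega> (\<gamma> t)) at_top"
        using eventually_gt_at_top[of 0] by eventually_elim (use Kb that in auto)
    qed
  qed (use t in auto)
  then have "L2_norm_on \<Omega> (weak_rot \<Omega> (u t)) = 0"
    unfolding c_def L2_norm_on_square[symmetric] by simp
  moreover obtain W where "smooth_approximation (u t) W" using u(2)[OF t] by blast
  ultimately have "\<bar>L2_inner \<Omega> (u t) (\<gamma> t)\<bar> \<le> 0"
    using C(2)[OF u(1)[OF t] _ g(1)[OF t] g(2)[OF t], of W] by simp
  then have "(L2_norm_on \<Omega> (\<gamma> t))\<^sup>2 = 0"
    using ku[OF t t] unfolding L2_norm_on_square k_def by simp
  then show ?thesis by (intro L2_norm_eq_0_imp_AE g(1) t) simp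
qed

end

text \<open>The curl enters the definition of a solution only through inner products, which are half of those of the
  rotation. This treats both dimensions at once and explains the coefficient \<open>\<mu> / 2\<close>.\<close>

lemma solution_divfree_part_decay_iff:
  fixes crl :: "('n::finite, 'c::euclidean_space) curl_op" and \<Omega> :: "(real^'n) set"
  assumes dim: "CARD('n) \<le> 3" and \<mu>: "\<mu> > 0"
    and crl: "\<And>w v x. crl \<Omega> w x \<bullet> crl \<Omega> v x = 1 / 2 * (weak_rot \<Omega> w x \<bullet> weak_rot \<Omega> v x)"
    and \<Omega>: "open \<Omega>" "bounded \<Omega>" "convex \<Omega>" "smooth_boundary \<Omega>"
    and sol: "is_solution crl \<Omega> \<nu> \<mu> lam u0 v0 \<theta>0 u \<theta>"
    and div: "\<And>t. 0 \<le> t \<Longrightarrow> divfree_part \<Omega> (u t) (\<gamma> t)"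
  shows "((\<lambda>t. L2_norm_on \<Omega> (\<gamma> t)) \<longlongrightarrow> 0) at_top \<longleftrightarrow> (\<forall>t>0. AE x in lebesgue_on \<Omega>. \<gamma> t x = 0)"
proof -
  obtain \<rho> where \<rho>: "smooth_on UNIV \<rho>" "\<forall>x\<in>\<Omega>. \<rho> x < 0" "\<forall>x\<in>frontier \<Omega>. \<rho> x = 0 \<and> gradient \<rho> x \<noteq> 0"
    "\<forall>x. x \<notin> closure \<Omega> \<longrightarrow> \<rho> x > 0"
    using global_defining_function[OF \<Omega>(1,2,4)] by blast
  interpret smooth_domain \<Omega> \<rho> by unfold_locales (use \<Omega> \<rho> in auto)
  obtain ut utt where Lu: "Linf_time {0<..} (H2_Htan_space crl \<Omega>) u"
    and Lut: "Linf_time {0<..} (L2_space \<Omega>) ut" and Lutt: "Linf_time {0<..} (L2_space \<Omega>) utt"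
    and d1: "is_weak_tderiv {0<..} (L2_space \<Omega>) u ut" and d2: "is_weak_tderiv {0<..} (L2_space \<Omega>) ut utt"
    and mom: "momentum_eq crl \<Omega> \<nu> \<mu> lam u utt \<theta>"
    and C\<theta>: "C_time {0..} (Hk_space 1 \<Omega>) \<theta>" and Cu: "C_time {0..} (Htan_space crl \<Omega>) u" and Cut: "C_time {0..} (L2_space \<Omega>) ut"
    using sol unfolding is_solution_def by blast
  have time: "{0<..} \<in> sets (lebesgue :: real measure)" by (rule open_sets_lebesgue[OF open_greaterThan])
  have at: "at t within {0..} = at t" if "0 < t" for t :: real
    using that by (intro at_within_interior) (simp add: interior_real_atLeast)
  have u: "Hk_on 1 \<Omega> (u t)" "tangential_trace \<Omega> (u t)" if "0 < t" for t
    using Cu that by (auto simp: C_time_def Htan_space_def)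
  have \<theta>: "Hk_on 1 \<Omega> (\<theta> t)" if "0 < t" for t using C\<theta> that by (auto simp: C_time_def Hk_space_def)
  have v: "L2_on \<Omega> (ut t)" if "0 < t" for t using Cut that by (auto simp: C_time_def L2_space_def)
  have app: "\<exists>W. smooth_approximation (u t) W" if "0 < t" for t
    by (rule tangential_trace_smooth_approximation[OF u[OF that]])
  have \<gamma>: "L2_on \<Omega> (\<gamma> t)" "\<And>\<psi>. Hk_on 1 \<Omega> \<psi> \<Longrightarrow> L2_inner \<Omega> (\<gamma> t) (weak_grad \<Omega> \<psi>) = 0"
    "\<exists>\<phi>. Hk_on 1 \<Omega> \<phi> \<and> (AE x in lebesgue_on \<Omega>. u t x = \<gamma> t x + weak_grad \<Omega> \<phi> x)" if "0 < t" for t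
    using div[of t] that by (auto simp: divfree_part_def normal_trace_pairing_def L2_inner_def)
  have crlnorm: "(L2_norm_on \<Omega> (weak_rot \<Omega> w))\<^sup>2 = 2 * (L2_norm_on \<Omega> (crl \<Omega> w))\<^sup>2" for w
    unfolding L2_norm_on_square L2_inner_def crl by simp
  have rot: "((\<lambda>s. L2_norm_on \<Omega> (\<lambda>x. weak_rot \<Omega> (u s) x - weak_rot \<Omega> (u t) x)) \<longlongrightarrow> 0) (at t)" if t: "0 < t" for t
  proof (rule Lim_null_comparison)
    let ?n = "\<lambda>s. fnorm (Htan_space crl \<Omega>) (\<lambda>x. u s x - u t x)"
    show "((\<lambda>s. 2 * ?n s) \<longlongrightarrow> 0) (at t)"
      using Cu t tendsto_mult_left[of ?n 0 "at t" 2] by (auto simp: C_time_def at dest!: bspec[of _ _ t])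
    have "eventually (\<lambda>s. 0 < s) (at t)"
      using t by (intro eventually_at_topological[THEN iffD2] exI[of _ "{0<..}"]) auto
    then show "eventually (\<lambda>s. norm (L2_norm_on \<Omega> (\<lambda>x. weak_rot \<Omega> (u s) x - weak_rot \<Omega> (u t) x)) \<le> 2 * ?n s) (at t)"
    proof eventually_elim
      case (elim s)
      let ?w = "\<lambda>x. u s x - u t x"
      have "L2_norm_on \<Omega> (\<lambda>x. weak_rot \<Omega> (u s) x - weak_rot \<Omega> (u t) x) = L2_norm_on \<Omega> (weak_rot \<Omega> ?w)"
        by (rule norm_cong_AE) (use weak_rot_diff[OF u(1)[OF elim] u(1)[OF t]] in \<open>simp add: eq_commute\<close>)
      also have "\<dots> \<le> 2 * ?n s"
      proof (rule power2_le_imp_le)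
        have "(?n s)\<^sup>2 = (L2_norm_on \<Omega> (weak_div \<Omega> ?w))\<^sup>2 + (L2_norm_on \<Omega> (crl \<Omega> ?w))\<^sup>2"
          by (simp add: Htan_space_def)
        then show "(L2_norm_on \<Omega> (weak_rot \<Omega> ?w))\<^sup>2 \<le> (2 * ?n s)\<^sup>2"
          unfolding crlnorm power_mult_distrib by simp
      qed (simp add: Htan_space_def)
      finally show ?case by simp
    qed
  qed
  have vcont: "((\<lambda>s. L2_norm_on \<Omega> (\<lambda>x. ut s x - ut t x)) \<longlongrightarrow> 0) (at t)" if "0 < t" for t
    using Cut that by (auto simp: C_time_def L2_space_def at dest!: bspec[of _ _ t])
  obtain M where M: "AE t in lebesgue_on {0<..}. L2_norm_on \<Omega> (ut t) \<le> M"
    using Lut by (auto simp: Linf_time_def L2_space_def)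
  have vM: "L2_norm_on \<Omega> (ut t) \<le> M" if "0 < t" for t
  proof (rule continuous_AE_le_imp_le[OF _ M that])
    show "continuous_on {0<..} (\<lambda>t. L2_norm_on \<Omega> (ut t))"
      unfolding continuous_on_def
    proof
      fix t :: real assume "t \<in> {0<..}"
      then have t: "0 < t" by simp
      let ?f = "\<lambda>s. if 0 < s then ut s else ut t"
      have near: "eventually (\<lambda>s. ?f s = ut s) (at t within {0<..})"
        by (simp add: eventually_at_filter)
      have "((\<lambda>s. L2_norm_on \<Omega> (\<lambda>x. ut s x - ut t x)) \<longlongrightarrow> 0) (at t within {0<..})"
        by (rule tendsto_within_subset[OF vcont[OF t]]) simp
      then have "((\<lambda>s. L2_norm_on \<Omega> (\<lambda>x. ?f s x - ut t x)) \<longlongrightarrow> 0) (at t within {0<..})"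
        by (rule Lim_transform_eventually) (use near in eventually_elim, simp)
      then have "((\<lambda>s. L2_norm_on \<Omega> (?f s)) \<longlongrightarrow> L2_norm_on \<Omega> (ut t)) (at t within {0<..})"
        by (rule L2_norm_tendsto[rotated 2]) (use v t in auto)
      then show "((\<lambda>s. L2_norm_on \<Omega> (ut s)) \<longlongrightarrow> L2_norm_on \<Omega> (ut t)) (at t within {0<..})"
        by (rule Lim_transform_eventually) (use near in eventually_elim, simp)
    qed
  qed
  have mom': "AE t in lebesgue_on {0<..}. \<forall>s>0. L2_inner \<Omega> (utt t) (\<gamma> s)
      = - (\<mu> / 2) * L2_inner \<Omega> (weak_rot \<Omega> (u t)) (weak_rot \<Omega> (u s))"
  proof -
    have "AE t in lebesgue_on {0<..}. Hk_on 2 \<Omega> (u t)" "AE t in lebesgue_on {0<..}. L2_on \<Omega> (utt t)"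
      using Lu Lutt by (auto simp: Linf_time_def strongly_measurable_on_def H2_Htan_space_def Hk_space_def L2_space_def elim: eventually_mono)
    moreover have "AE t in lebesgue_on {0<..}. 0 < t" by (rule AE_I2) simp
    ultimately show ?thesis using mom[unfolded momentum_eq_def]
    proof eventually_elim
      case (elim t)
      show ?case
      proof (intro allI impI)
        fix s :: real assume s: "0 < s"
        obtain W where W: "smooth_approximation (u s) W" using app[OF s] by blast
        obtain \<phi> where \<phi>: "Hk_on 1 \<Omega> \<phi>" "AE x in lebesgue_on \<Omega>. u s x = \<gamma> s x + weak_grad \<Omega> \<phi> x" using \<gamma>(3)[OF s] by blast
        show "L2_inner \<Omega> (utt t) (\<gamma> s) = - (\<mu> / 2) * L2_inner \<Omega> (weak_rot \<Omega> (u t)) (weak_rot \<Omega> (u s))"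
        proof (rule momentum_divfree_part[OF \<Omega>(3) elim(2) u(1)[OF elim(3)] H2_weak_div[OF elim(1)] \<theta>[OF elim(3)] _ u(1)[OF s] W \<gamma>(1,2)[OF s] \<phi>])
          fix \<phi> assume "Hk_on 1 \<Omega> \<phi>" "tangential_trace \<Omega> \<phi>"
          then have "\<phi> \<in> fcarrier (Htan_space crl \<Omega>)" by (simp add: Htan_space_def)
          with elim(4) have "(LINT x|lebesgue_on \<Omega>. utt t x \<bullet> \<phi> x)
              + (2 * \<mu> + lam) * (LINT x|lebesgue_on \<Omega>. weak_div \<Omega> (u t) x * weak_div \<Omega> \<phi> x)
              + \<mu> * (LINT x|lebesgue_on \<Omega>. crl \<Omega> (u t) x \<bullet> crl \<Omega> \<phi> x)
              = - \<nu> * (LINT x|lebesgue_on \<Omega>. weak_grad \<Omega> (\<theta> t) x \<bullet> \<phi> x)" by blast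
          then show "L2_inner \<Omega> (utt t) \<phi> + (2 * \<mu> + lam) * L2_inner \<Omega> (weak_div \<Omega> (u t)) (weak_div \<Omega> \<phi>)
              + \<mu> / 2 * L2_inner \<Omega> (weak_rot \<Omega> (u t)) (weak_rot \<Omega> \<phi>) = - \<nu> * L2_inner \<Omega> (weak_grad \<Omega> (\<theta> t)) \<phi>"
            unfolding crl L2_inner_def inner_real_def by simp
        qed
      qed
    qed
  qed
  show ?thesis
  proof (intro iffI allI impI)
    fix t :: real assume decay: "((\<lambda>t. L2_norm_on \<Omega> (\<gamma> t)) \<longlongrightarrow> 0) at_top" and t: "0 < t"
    show "AE x in lebesgue_on \<Omega>. \<gamma> t x = 0"
    proof (rule decaying_divfree_part_vanishes[where m = "\<mu> / 2" and v = ut and u = u and M = M,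
          OF \<Omega>(3) dim _ u(1) app \<gamma> rot v vM vcont _ _ decay t])
      show "(LINT t|lebesgue_on {0<..}. deriv \<phi> t * L2_inner \<Omega> (u t) w) = - (LINT t|lebesgue_on {0<..}. \<phi> t * L2_inner \<Omega> (ut t) w)"
        if "L2_on \<Omega> w" "test_function {0<..} \<phi>" for w \<phi>
        by (rule weak_tderiv_inner[OF time that(1) d1 that(2)])
      show "(LINT t|lebesgue_on {0<..}. deriv \<phi> t * L2_inner \<Omega> (ut t) (\<gamma> s))
        = - (LINT t|lebesgue_on {0<..}. \<phi> t * (- (\<mu> / 2) * L2_inner \<Omega> (weak_rot \<Omega> (u t)) (weak_rot \<Omega> (u s))))"
        if s: "0 < s" and \<phi>: "test_function {0<..} \<phi>" for s \<phi>
      proof -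
        have "(LINT t|lebesgue_on {0<..}. \<phi> t * L2_inner \<Omega> (utt t) (\<gamma> s))
          = (LINT t|lebesgue_on {0<..}. \<phi> t * (- (\<mu> / 2) * L2_inner \<Omega> (weak_rot \<Omega> (u t)) (weak_rot \<Omega> (u s))))"
          by (rule integral_cong_AE_lebesgue_on[OF time]) (use mom' in eventually_elim, use s in simp)
        then show ?thesis using weak_tderiv_inner[OF time \<gamma>(1)[OF s] d2 \<phi>] by simp
      qed
    qed (use \<mu> in auto)
  next
    assume z: "\<forall>t>0. AE x in lebesgue_on \<Omega>. \<gamma> t x = 0"
    have "L2_norm_on \<Omega> (\<gamma> t) = 0" if "0 < t" for t
      using norm_cong_AE[of "\<gamma> t" "\<lambda>x. 0"] z that by (simp add: L2_norm_on_def)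
    then show "((\<lambda>t. L2_norm_on \<Omega> (\<gamma> t)) \<longlongrightarrow> 0) at_top"
      by (intro tendsto_eventually) (auto simp: eventually_at_top_dense)
  qed
qed

lemma inner_weak_curl2:
  "weak_curl2 \<Omega> w x \<bullet> weak_curl2 \<Omega> v x = 1 / 2 * (weak_rot \<Omega> w x \<bullet> weak_rot \<Omega> v x)"
  by (simp add: weak_curl2_def weak_rot_def inner_vec_def sum_2 algebra_simps)

lemma inner_weak_curl3:
  "weak_curl3 \<Omega> w x \<bullet> weak_curl3 \<Omega> v x = 1 / 2 * (weak_rot \<Omega> w x \<bullet> weak_rot \<Omega> v x)"
  by (simp add: weak_curl3_def weak_rot_def inner_vec_def sum_3 vector_3 algebra_simps)

theorem proposition5p3:
  fixes \<nu> \<mu> lam :: real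
  assumes "\<mu> > 0"
  shows
    "(2 * \<mu> + 2 * lam > 0 \<longrightarrow>
      (\<forall>(\<Omega> :: (real^2) set) u0 v0 \<theta>0 u \<theta> \<gamma>.
         open \<Omega> \<and> bounded \<Omega> \<and> convex \<Omega> \<and> smooth_boundary \<Omega> \<and>
         is_solution weak_curl2 \<Omega> \<nu> \<mu> lam u0 v0 \<theta>0 u \<theta> \<and>
         (\<forall>t\<ge>0. divfree_part \<Omega> (u t) (\<gamma> t)) \<longrightarrow>
         (((\<lambda>t. L2_norm_on \<Omega> (\<gamma> t)) \<longlongrightarrow> 0) at_top \<longleftrightarrow>
          (\<forall>t>0. AE x in lebesgue_on \<Omega>. \<gamma> t x = 0)))) \<and>
     (2 * \<mu> + 3 * lam > 0 \<longrightarrow>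
      (\<forall>(\<Omega> :: (real^3) set) u0 v0 \<theta>0 u \<theta> \<gamma>.
         open \<Omega> \<and> bounded \<Omega> \<and> convex \<Omega> \<and> smooth_boundary \<Omega> \<and>
         is_solution weak_curl3 \<Omega> \<nu> \<mu> lam u0 v0 \<theta>0 u \<theta> \<and>
         (\<forall>t\<ge>0. divfree_part \<Omega> (u t) (\<gamma> t)) \<longrightarrow>
         (((\<lambda>t. L2_norm_on \<Omega> (\<gamma> t)) \<longlongrightarrow> 0) at_top \<longleftrightarrow>
          (\<forall>t>0. AE x in lebesgue_on \<Omega>. \<gamma> t x = 0))))"
proof (intro conjI impI allI; elim conjE)
  fix \<Omega> :: "(real^2) set" and u0 v0 \<theta>0 u \<theta> \<gamma>
  assume "open \<Omega>" "bounded \<Omega>" "convex \<Omega>" "smooth_boundary \<Omega>"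
    "is_solution weak_curl2 \<Omega> \<nu> \<mu> lam u0 v0 \<theta>0 u \<theta>" "\<forall>t\<ge>0. divfree_part \<Omega> (u t) (\<gamma> t)"
  then show "((\<lambda>t. L2_norm_on \<Omega> (\<gamma> t)) \<longlongrightarrow> 0) at_top \<longleftrightarrow> (\<forall>t>0. AE x in lebesgue_on \<Omega>. \<gamma> t x = 0)"
    by (intro solution_divfree_part_decay_iff[OF _ assms inner_weak_curl2]) auto
next
  fix \<Omega> :: "(real^3) set" and u0 v0 \<theta>0 u \<theta> \<gamma>
  assume "open \<Omega>" "bounded \<Omega>" "convex \<Omega>" "smooth_boundary \<Omega>"
    "is_solution weak_curl3 \<Omega> \<nu> \<mu> lam u0 v0 \<theta>0 u \<theta>" "\<forall>t\<ge>0. divfree_part \<Omega> (u t) (\<gamma> t)"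
  then show "((\<lambda>t. L2_norm_on \<Omega> (\<gamma> t)) \<longlongrightarrow> 0) at_top \<longleftrightarrow> (\<forall>t>0. AE x in lebesgue_on \<Omega>. \<gamma> t x = 0)"
    by (intro solution_divfree_part_decay_iff[OF _ assms inner_weak_curl3]) auto
qed

end
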